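(* For an extended tame persistence CDGA $F$, consider the following implications: (1) $F$ is $H$-formal $\Rightarrow$ $F$ is $d_{\rm HI}$-formal; (2) $F$ is $d_{\rm HI}$-formal $\Rightarrow$ $F$ is $d_{\rm IHC}$-formal; (3) $F$ is $d_{\rm IHC}$-formal $\Rightarrow$ $F$ is $d_{\rm HC}$-formal; (4) $F$ is $d_{\rm HC}$-formal $\Rightarrow$ $F$ is $d_{\rm IHC}$-formal; (5) $F$ is $d_{\rm IHC}$-formal $\Rightarrow$ $F$ is $H$-formal. (i) The implications (1), (2) and (3) hold in general. (ii) Let $\{\tau_n\}_{n\ge0}$ be a sequence which discretises $F$. Suppose that there exists a positive number $\alpha$ such that $\tau_{n+1}-\tau_n\ge\alpha$ for each $n$. Then the implications (4) and (5) hold.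
   Context: $\mathsf{CDGA}$: commutative differential graded algebras over $\mathbb{Q}$ (non-negative degrees), with quasi-isomorphisms as weak equivalences and surjections as fibrations. $\mathbb{R}_+=[0,\infty)$ as a poset. A finite or divergent sequence $\tau_0<\tau_1<\cdots$ in $[0,\infty)$ discretises a functor $F:\mathbb{R}_+\to\mathsf{CDGA}$ if $F(s\le t)$ may fail to be an isomorphism only if there is $a$ with $s<\tau_a\le t$; $F$ is an extended tame persistence CDGA if such a sequence exists. $\mathsf{et}(\mathsf{CDGA}^{\mathbb{R}_+})$ is the full subcategory of $\mathsf{CDGA}^{\mathbb{R}_+}$ of these, with the model structure with objectwise weak equivalences and fibrations. $H(F)$ is the persistence CDGA $t\mapsto H^*(F(t))$ with trivial differential. $F$ is $H$-formal if there is a zig-zag of weak equivalences between $F$ and $(H(F),0)$ in $\mathsf{et}(\mathsf{CDGA}^{\mathbb{R}_+})$. For $\varepsilon\ge0$ let $F^\varepsilon(t)=F(t+\varepsilon)$. In a category with such shifts, $F$ and $G$ are $\varepsilon$-interleaved if there are morphisms $\varphi:F\to G^\varepsilon$, $\psi:G\to F^\varepsilon$ with $\psi^\varepsilon\varphi:F\to F^{2\varepsilon}$ and $\varphi^\varepsilon\psi:G\to G^{2\varepsilon}$ equal to the morphisms given by the structure maps. Objects $F,G$ of $\mathsf{et}(\mathsf{CDGA}^{\mathbb{R}_+})$ are: $\varepsilon$-homotopy interleaved if there are $F'\simeq F$, $G'\simeq G$ (connected by zigzags of weak equivalences) with $F',G'$ $\varepsilon$-interleaved as functors to $\mathsf{CDGA}$;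 $\varepsilon$-interleaved in the homotopy category if they are $\varepsilon$-interleaved in $\mathrm{Ho}(\mathsf{et}(\mathsf{CDGA}^{\mathbb{R}_+}))$; $\varepsilon$-homotopy commutative interleaved if their images in the functor category $\mathrm{Ho}(\mathsf{CDGA})^{\mathbb{R}_+}$ are $\varepsilon$-interleaved. $d_{\rm HI}$, $d_{\rm IHC}$, $d_{\rm HC}$ are the corresponding infima of such $\varepsilon\ge 0$ ($\infty$ if there is none). For $\ast\in\{{\rm HI},{\rm IHC},{\rm HC}\}$, $F$ is $d_{\ast}$-formal if $d_{\ast}(F,H(F))=0$. *)

theory Defs
  imports
    "HOL-Algebra.Algebraic_Closure_Type"
    "HOL-Algebra.AbelCoset"
    "HOL-Library.Extended_Real"
    "HOL-Library.Extended_Nat"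
    "HOL-Library.FuncSet"
begin

no_notation Polynomials.var (\<open>X\<index>\<close>) (* frees the variable name X *)

section \<open>Categories, localisation, shifts\<close>

text \<open>
  Morphisms are indexed by their source and target: \<open>Comp C X Y Z g f\<close> is the composite
  of \<open>f : X \<rightarrow> Y\<close> followed by \<open>g : Y \<rightarrow> Z\<close>.
\<close>

record ('o, 'm) category =
  Obj :: "'o set"
  Hom :: "'o \<Rightarrow> 'o \<Rightarrow> 'm set"
  Idm :: "'o \<Rightarrow> 'm"
  Comp :: "'o \<Rightarrow> 'o \<Rightarrow> 'o \<Rightarrow> 'm \<Rightarrow> 'm \<Rightarrow> 'm"

definition is_iso :: "('o, 'm, 'z) category_scheme \<Rightarrow> 'o \<Rightarrow> 'o \<Rightarrow> 'm \<Rightarrow> bool" where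
  "is_iso C X Y f \<longleftrightarrow>
     f \<in> Hom C X Y \<and>
     (\<exists>g\<in>Hom C Y X. Comp C X Y X g f = Idm C X \<and> Comp C Y X Y f g = Idm C Y)"

text \<open>
  A category with weak equivalences is given by \<open>C\<close> and the sets \<open>W X Y \<subseteq> Hom C X Y\<close>.
  \<open>X\<close> and \<open>Y\<close> are weakly equivalent if they are connected by a zigzag of weak equivalences.
\<close>

definition weakly_equivalent ::
    "('o, 'm, 'z) category_scheme \<Rightarrow> ('o \<Rightarrow> 'o \<Rightarrow> 'm set) \<Rightarrow> 'o \<Rightarrow> 'o \<Rightarrow> bool" where
  "weakly_equivalent C W X Y \<longleftrightarrow>
     X \<in> Obj C \<and> Y \<in> Obj C \<and>
     equivclp (\<lambda>A B. A \<in> Obj C \<and> B \<in> Obj C \<and> W A B \<noteq> {}) X Y"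

text \<open>
  The homotopy category is the Gabriel--Zisman localisation \<open>C[W\<inverse>]\<close>. A word in arrows of
  \<open>C\<close> and formal inverses of arrows in \<open>W\<close> is read from left to right: \<open>Fwd X f Y\<close> is the
  arrow \<open>f : X \<rightarrow> Y\<close>, and \<open>Bwd Y w X\<close> is the formal inverse \<open>Y \<rightarrow> X\<close> of \<open>w : X \<rightarrow> Y\<close>.
\<close>

datatype ('o, 'm) step = Fwd 'o 'm 'o | Bwd 'o 'm 'o

fun is_step :: "('o, 'm, 'z) category_scheme \<Rightarrow> ('o \<Rightarrow> 'o \<Rightarrow> 'm set) \<Rightarrow> 'o \<Rightarrow> ('o, 'm) step \<Rightarrow> 'o \<Rightarrow> bool" where
  "is_step C W A (Fwd X f Y) B \<longleftrightarrow> A = X \<and> B = Y \<and> X \<in> Obj C \<and> Y \<in> Obj C \<and> f \<in> Hom C X Y"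
| "is_step C W A (Bwd Y w X) B \<longleftrightarrow> A = Y \<and> B = X \<and> X \<in> Obj C \<and> Y \<in> Obj C \<and> w \<in> W X Y"

fun is_word :: "('o, 'm, 'z) category_scheme \<Rightarrow> ('o \<Rightarrow> 'o \<Rightarrow> 'm set) \<Rightarrow> 'o \<Rightarrow> ('o, 'm) step list \<Rightarrow> 'o \<Rightarrow> bool" where
  "is_word C W X [] Z \<longleftrightarrow> X = Z \<and> X \<in> Obj C"
| "is_word C W X (s # p) Z \<longleftrightarrow> (\<exists>Y. is_step C W X s Y \<and> is_word C W Y p Z)"

inductive word_eq ::
    "('o, 'm, 'z) category_scheme \<Rightarrow> ('o \<Rightarrow> 'o \<Rightarrow> 'm set) \<Rightarrow>
     'o \<Rightarrow> 'o \<Rightarrow> ('o, 'm) step list \<Rightarrow> ('o, 'm) step list \<Rightarrow> bool"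
  for C W where
  refl: "is_word C W X p Y \<Longrightarrow> word_eq C W X Y p p"
| sym: "word_eq C W X Y p q \<Longrightarrow> word_eq C W X Y q p"
| trans: "word_eq C W X Y p q \<Longrightarrow> word_eq C W X Y q r \<Longrightarrow> word_eq C W X Y p r"
| cong: "is_word C W X' p X \<Longrightarrow> word_eq C W X Y q q' \<Longrightarrow> is_word C W Y r Y' \<Longrightarrow>
     word_eq C W X' Y' (p @ q @ r) (p @ q' @ r)"
| ident: "X \<in> Obj C \<Longrightarrow> word_eq C W X X [Fwd X (Idm C X) X] []"
| comp: "X \<in> Obj C \<Longrightarrow> Y \<in> Obj C \<Longrightarrow> Z \<in> Obj C \<Longrightarrow> f \<in> Hom C X Y \<Longrightarrow> g \<in> Hom C Y Z \<Longrightarrow>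
     word_eq C W X Z [Fwd X f Y, Fwd Y g Z] [Fwd X (Comp C X Y Z g f) Z]"
| inv_left: "X \<in> Obj C \<Longrightarrow> Y \<in> Obj C \<Longrightarrow> w \<in> W X Y \<Longrightarrow> word_eq C W X X [Fwd X w Y, Bwd Y w X] []"
| inv_right: "X \<in> Obj C \<Longrightarrow> Y \<in> Obj C \<Longrightarrow> w \<in> W X Y \<Longrightarrow> word_eq C W Y Y [Bwd Y w X, Fwd X w Y] []"

definition word_class ::
    "('o, 'm, 'z) category_scheme \<Rightarrow> ('o \<Rightarrow> 'o \<Rightarrow> 'm set) \<Rightarrow>
     'o \<Rightarrow> 'o \<Rightarrow> ('o, 'm) step list \<Rightarrow> ('o, 'm) step list set" where
  "word_class C W X Y p = {q. word_eq C W X Y p q}"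

definition Ho ::
    "('o, 'm, 'z) category_scheme \<Rightarrow> ('o \<Rightarrow> 'o \<Rightarrow> 'm set) \<Rightarrow> ('o, ('o, 'm) step list set) category" where
  "Ho C W = \<lparr>
     Obj = Obj C,
     Hom = (\<lambda>X Y. {word_class C W X Y p | p. is_word C W X p Y}),
     Idm = (\<lambda>X. word_class C W X X []),
     Comp = (\<lambda>X Y Z Q P. \<Union>p\<in>P. \<Union>q\<in>Q. word_class C W X Z (p @ q)) \<rparr>"

text \<open>
  A category with shifts has endofunctors \<open>X \<mapsto> X\<^sup>\<epsilon>\<close> and natural maps
  \<open>shift_unit C \<epsilon> X : X \<rightarrow> X\<^sup>\<epsilon>\<close> for \<open>\<epsilon> \<ge> 0\<close>.
\<close>

record ('o, 'm) shift_category = "('o, 'm) category" +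
  shift_ob :: "real \<Rightarrow> 'o \<Rightarrow> 'o"
  shift_map :: "real \<Rightarrow> 'o \<Rightarrow> 'o \<Rightarrow> 'm \<Rightarrow> 'm"
  shift_unit :: "real \<Rightarrow> 'o \<Rightarrow> 'm"

definition interleaved :: "('o, 'm, 'z) shift_category_scheme \<Rightarrow> real \<Rightarrow> 'o \<Rightarrow> 'o \<Rightarrow> bool" where
  "interleaved C \<epsilon> F G \<longleftrightarrow>
     (\<exists>\<phi> \<in> Hom C F (shift_ob C \<epsilon> G). \<exists>\<psi> \<in> Hom C G (shift_ob C \<epsilon> F).
        Comp C F (shift_ob C \<epsilon> G) (shift_ob C (2 * \<epsilon>) F)
          (shift_map C \<epsilon> G (shift_ob C \<epsilon> F) \<psi>) \<phi> = shift_unit C (2 * \<epsilon>) F \<and>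
        Comp C G (shift_ob C \<epsilon> F) (shift_ob C (2 * \<epsilon>) G)
          (shift_map C \<epsilon> F (shift_ob C \<epsilon> G) \<phi>) \<psi> = shift_unit C (2 * \<epsilon>) G)"

fun shift_step :: "('o, 'm, 'z) shift_category_scheme \<Rightarrow> real \<Rightarrow> ('o, 'm) step \<Rightarrow> ('o, 'm) step" where
  "shift_step C \<epsilon> (Fwd X f Y) = Fwd (shift_ob C \<epsilon> X) (shift_map C \<epsilon> X Y f) (shift_ob C \<epsilon> Y)"
| "shift_step C \<epsilon> (Bwd Y w X) = Bwd (shift_ob C \<epsilon> Y) (shift_map C \<epsilon> X Y w) (shift_ob C \<epsilon> X)"

text \<open>Shifts preserving weak equivalences descend to the localisation.\<close>

definition shift_Ho ::
    "('o, 'm, 'z) shift_category_scheme \<Rightarrow> ('o \<Rightarrow> 'o \<Rightarrow> 'm set) \<Rightarrow>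
     ('o, ('o, 'm) step list set) shift_category" where
  "shift_Ho C W = category.extend (Ho C W) (shift_category.fields
     (shift_ob C)
     (\<lambda>\<epsilon> X Y P. \<Union>p\<in>P. word_class C W (shift_ob C \<epsilon> X) (shift_ob C \<epsilon> Y) (map (shift_step C \<epsilon>) p))
     (\<lambda>\<epsilon> X. word_class C W X (shift_ob C \<epsilon> X) [Fwd X (shift_unit C \<epsilon> X) (shift_ob C \<epsilon> X)]))"


section \<open>Functors on the poset of non-negative reals\<close>

text \<open>
  Values of \<open>ob\<close> at negative reals, and of \<open>str s t\<close> unless \<open>0 \<le> s \<le> t\<close>, are irrelevant.
  Natural transformations are made extensional so that equality of functions is equality
  of morphisms.
\<close>

record ('o, 'm) pers =
  ob :: "real \<Rightarrow> 'o"
  str :: "real \<Rightarrow> real \<Rightarrow> 'm"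

definition is_functor :: "('o, 'm, 'z) category_scheme \<Rightarrow> ('o, 'm) pers \<Rightarrow> bool" where
  "is_functor C F \<longleftrightarrow>
     (\<forall>t\<ge>0. ob F t \<in> Obj C) \<and>
     (\<forall>s t. 0 \<le> s \<and> s \<le> t \<longrightarrow> str F s t \<in> Hom C (ob F s) (ob F t)) \<and>
     (\<forall>t\<ge>0. str F t t = Idm C (ob F t)) \<and>
     (\<forall>r s t. 0 \<le> r \<and> r \<le> s \<and> s \<le> t \<longrightarrow>
        Comp C (ob F r) (ob F s) (ob F t) (str F s t) (str F r s) = str F r t)"

definition nat_transf :: "('o, 'm, 'z) category_scheme \<Rightarrow> ('o, 'm) pers \<Rightarrow> ('o, 'm) pers \<Rightarrow> (real \<Rightarrow> 'm) set" where
  "nat_transf C F G =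
     {\<alpha> \<in> extensional {0..}.
        (\<forall>t\<ge>0. \<alpha> t \<in> Hom C (ob F t) (ob G t)) \<and>
        (\<forall>s t. 0 \<le> s \<and> s \<le> t \<longrightarrow>
           Comp C (ob F s) (ob F t) (ob G t) (\<alpha> t) (str F s t) =
           Comp C (ob F s) (ob G s) (ob G t) (str G s t) (\<alpha> s))}"

definition shift_pers :: "real \<Rightarrow> ('o, 'm) pers \<Rightarrow> ('o, 'm) pers" where
  "shift_pers \<epsilon> F = \<lparr> ob = (\<lambda>t. ob F (t + \<epsilon>)), str = (\<lambda>s t. str F (s + \<epsilon>) (t + \<epsilon>)) \<rparr>"

definition pers_cat :: "('o, 'm, 'z) category_scheme \<Rightarrow> (('o, 'm) pers, real \<Rightarrow> 'm) shift_category" where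
  "pers_cat C = \<lparr>
     Obj = {F. is_functor C F},
     Hom = nat_transf C,
     Idm = (\<lambda>F. \<lambda>t\<in>{0..}. Idm C (ob F t)),
     Comp = (\<lambda>F G H \<beta> \<alpha>. \<lambda>t\<in>{0..}. Comp C (ob F t) (ob G t) (ob H t) (\<beta> t) (\<alpha> t)),
     shift_ob = shift_pers,
     shift_map = (\<lambda>\<epsilon> F G \<alpha>. \<lambda>t\<in>{0..}. \<alpha> (t + \<epsilon>)),
     shift_unit = (\<lambda>\<epsilon> F. \<lambda>t\<in>{0..}. str F t (t + \<epsilon>)) \<rparr>"

text \<open>
  \<open>discretises C \<tau> N F\<close>: the sequence consists of the \<open>\<tau> a\<close> with \<open>a < N\<close>, where
  \<open>N = \<infinity>\<close> for a divergent sequence.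
\<close>

definition discretises ::
    "('o, 'm, 'z) category_scheme \<Rightarrow> (nat \<Rightarrow> real) \<Rightarrow> enat \<Rightarrow> ('o, 'm) pers \<Rightarrow> bool" where
  "discretises C \<tau> N F \<longleftrightarrow>
     (\<forall>a. enat a < N \<longrightarrow> 0 \<le> \<tau> a) \<and>
     (\<forall>a. enat (Suc a) < N \<longrightarrow> \<tau> a < \<tau> (Suc a)) \<and>
     (N = \<infinity> \<longrightarrow> filterlim \<tau> at_top sequentially) \<and>
     (\<forall>s t. 0 \<le> s \<and> s \<le> t \<and> \<not> is_iso C (ob F s) (ob F t) (str F s t) \<longrightarrow>
        (\<exists>a. enat a < N \<and> s < \<tau> a \<and> \<tau> a \<le> t))"

definition et :: "('o, 'm, 'z) category_scheme \<Rightarrow> (('o, 'm) pers, real \<Rightarrow> 'm) shift_category" where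
  "et C = (pers_cat C)\<lparr> Obj := {F. is_functor C F \<and> (\<exists>\<tau> N. discretises C \<tau> N F)} \<rparr>"


section \<open>Commutative differential graded algebras over the rationals\<close>

abbreviation QQ :: "rat ring" where
  "QQ \<equiv> ring_of_type_algebra"

text \<open>
  \<open>gr A n\<close> is the vector space of degree \<open>n\<close>; the fields \<open>mult\<close> and \<open>one\<close> of this module
  record play no role. The product of \<open>x\<close> of degree \<open>p\<close> and \<open>y\<close> of degree \<open>q\<close> is
  \<open>gmult A p q x y\<close>, of degree \<open>p + q\<close>. All CDGAs have their elements in a fixed type \<open>'u\<close>,
  which acts as the universe; as \<open>'u\<close> is a type variable it can be taken arbitrarily large.
\<close>

record 'u cdga =
  gr :: "nat \<Rightarrow> (rat, 'u) module"
  gmult :: "nat \<Rightarrow> nat \<Rightarrow> 'u \<Rightarrow> 'u \<Rightarrow> 'u"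
  gone :: "'u"
  gdiff :: "nat \<Rightarrow> 'u \<Rightarrow> 'u"

abbreviation elts :: "'u cdga \<Rightarrow> nat \<Rightarrow> 'u set" where
  "elts A n \<equiv> carrier (gr A n)"

definition linear_on :: "(rat, 'u) module \<Rightarrow> (rat, 'u) module \<Rightarrow> ('u \<Rightarrow> 'u) \<Rightarrow> bool" where
  "linear_on V W f \<longleftrightarrow>
     f \<in> carrier V \<rightarrow> carrier W \<and>
     (\<forall>x\<in>carrier V. \<forall>y\<in>carrier V. f (x \<oplus>\<^bsub>V\<^esub> y) = f x \<oplus>\<^bsub>W\<^esub> f y) \<and>
     (\<forall>c. \<forall>x\<in>carrier V. f (c \<odot>\<^bsub>V\<^esub> x) = c \<odot>\<^bsub>W\<^esub> f x)"

locale cdga =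
  fixes A :: "'u cdga"
  assumes vector_space: "module QQ (gr A n)"
    and mult_linear_right: "x \<in> elts A p \<Longrightarrow> linear_on (gr A q) (gr A (p + q)) (\<lambda>y. gmult A p q x y)"
    and mult_linear_left: "y \<in> elts A q \<Longrightarrow> linear_on (gr A p) (gr A (p + q)) (\<lambda>x. gmult A p q x y)"
    and mult_assoc: "x \<in> elts A p \<Longrightarrow> y \<in> elts A q \<Longrightarrow> z \<in> elts A r \<Longrightarrow>
      gmult A (p + q) r (gmult A p q x y) z = gmult A p (q + r) x (gmult A q r y z)"
    and one_closed: "gone A \<in> elts A 0"
    and mult_one_left: "x \<in> elts A p \<Longrightarrow> gmult A 0 p (gone A) x = x"
    and mult_one_right: "x \<in> elts A p \<Longrightarrow> gmult A p 0 x (gone A) = x"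
    and graded_comm: "x \<in> elts A p \<Longrightarrow> y \<in> elts A q \<Longrightarrow>
      gmult A p q x y = (- 1) ^ (p * q) \<odot>\<^bsub>gr A (p + q)\<^esub> gmult A q p y x"
    and diff_linear: "linear_on (gr A n) (gr A (Suc n)) (gdiff A n)"
    and diff_diff: "x \<in> elts A n \<Longrightarrow> gdiff A (Suc n) (gdiff A n x) = \<zero>\<^bsub>gr A (Suc (Suc n))\<^esub>"
    and leibniz: "x \<in> elts A p \<Longrightarrow> y \<in> elts A q \<Longrightarrow>
      gdiff A (p + q) (gmult A p q x y) =
        gmult A (Suc p) q (gdiff A p x) y
        \<oplus>\<^bsub>gr A (Suc (p + q))\<^esub> (- 1) ^ p \<odot>\<^bsub>gr A (Suc (p + q))\<^esub> gmult A p (Suc q) x (gdiff A q y)"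

type_synonym 'u cdga_map = "nat \<Rightarrow> 'u \<Rightarrow> 'u"

definition cdga_hom :: "'u cdga \<Rightarrow> 'u cdga \<Rightarrow> 'u cdga_map set" where
  "cdga_hom A B =
     {f. (\<forall>n. f n \<in> extensional (elts A n)) \<and>
         (\<forall>n. linear_on (gr A n) (gr B n) (f n)) \<and>
         f 0 (gone A) = gone B \<and>
         (\<forall>p q. \<forall>x\<in>elts A p. \<forall>y\<in>elts A q. f (p + q) (gmult A p q x y) = gmult B p q (f p x) (f q y)) \<and>
         (\<forall>n. \<forall>x\<in>elts A n. f (Suc n) (gdiff A n x) = gdiff B n (f n x))}"

definition CDGA :: "('u cdga, 'u cdga_map) category" where
  "CDGA = \<lparr>
     Obj = {A. cdga A},
     Hom = cdga_hom,
     Idm = (\<lambda>A n. \<lambda>x\<in>elts A n. x),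
     Comp = (\<lambda>A B C g f n. compose (elts A n) (g n) (f n)) \<rparr>"

text \<open>
  The cohomology algebra \<open>H\<^sup>*(A)\<close>. To stay within the type \<open>'u\<close>, a cohomology class is
  represented by one element of the coset of cocycles, chosen once and for all by
  \<open>coh_rep\<close>; two cocycles have the same representative iff they are cohomologous.
\<close>

definition cocycles :: "'u cdga \<Rightarrow> nat \<Rightarrow> 'u set" where
  "cocycles A n = {x \<in> elts A n. gdiff A n x = \<zero>\<^bsub>gr A (Suc n)\<^esub>}"

fun coboundaries :: "'u cdga \<Rightarrow> nat \<Rightarrow> 'u set" where
  "coboundaries A 0 = {\<zero>\<^bsub>gr A 0\<^esub>}"
| "coboundaries A (Suc n) = gdiff A n ` elts A n"

definition coh_rep :: "'u cdga \<Rightarrow> nat \<Rightarrow> 'u \<Rightarrow> 'u" where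
  "coh_rep A n x = (SOME y. y \<in> coboundaries A n +>\<^bsub>gr A n\<^esub> x)"

definition cohomology :: "'u cdga \<Rightarrow> 'u cdga" where
  "cohomology A = \<lparr>
     gr = (\<lambda>n. (gr A n)\<lparr>
        carrier := coh_rep A n ` cocycles A n,
        zero := coh_rep A n \<zero>\<^bsub>gr A n\<^esub>,
        add := (\<lambda>x y. coh_rep A n (x \<oplus>\<^bsub>gr A n\<^esub> y)),
        smult := (\<lambda>c x. coh_rep A n (c \<odot>\<^bsub>gr A n\<^esub> x)) \<rparr>),
     gmult = (\<lambda>p q x y. coh_rep A (p + q) (gmult A p q x y)),
     gone = coh_rep A 0 (gone A),
     gdiff = (\<lambda>n x. coh_rep A (Suc n) \<zero>\<^bsub>gr A (Suc n)\<^esub>) \<rparr>"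

definition cohomology_map :: "'u cdga \<Rightarrow> 'u cdga \<Rightarrow> 'u cdga_map \<Rightarrow> 'u cdga_map" where
  "cohomology_map A B f = (\<lambda>n. \<lambda>x\<in>elts (cohomology A) n. coh_rep B n (f n x))"

definition quasi_iso :: "'u cdga \<Rightarrow> 'u cdga \<Rightarrow> 'u cdga_map set" where
  "quasi_iso A B =
     {f \<in> cdga_hom A B.
        \<forall>n. bij_betw (cohomology_map A B f n) (elts (cohomology A) n) (elts (cohomology B) n)}"


section \<open>Extended tame persistence CDGAs and formality\<close>

type_synonym 'u pers_cdga = "('u cdga, 'u cdga_map) pers"

text \<open>
  The homotopy category of the model structure on \<open>et CDGA\<close> is the localisation at its weak
  equivalences, so fibrations and cofibrations do not enter.
\<close>

definition weq :: "'u pers_cdga \<Rightarrow> 'u pers_cdga \<Rightarrow> (real \<Rightarrow> 'u cdga_map) set" where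
  "weq F G = {w \<in> Hom (et CDGA) F G. \<forall>t\<ge>0. w t \<in> quasi_iso (ob F t) (ob G t)}"

definition H :: "'u pers_cdga \<Rightarrow> 'u pers_cdga" where
  "H F = \<lparr> ob = (\<lambda>t. cohomology (ob F t)),
           str = (\<lambda>s t. cohomology_map (ob F s) (ob F t) (str F s t)) \<rparr>"

definition H_formal :: "'u pers_cdga \<Rightarrow> bool" where
  "H_formal F \<longleftrightarrow> weakly_equivalent (et CDGA) weq F (H F)"

definition homotopy_interleaved :: "real \<Rightarrow> 'u pers_cdga \<Rightarrow> 'u pers_cdga \<Rightarrow> bool" where
  "homotopy_interleaved \<epsilon> F G \<longleftrightarrow>
     (\<exists>F' G'. weakly_equivalent (et CDGA) weq F' F \<and> weakly_equivalent (et CDGA) weq G' G \<and>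
        interleaved (pers_cat CDGA) \<epsilon> F' G')"

definition Ho_interleaved :: "real \<Rightarrow> 'u pers_cdga \<Rightarrow> 'u pers_cdga \<Rightarrow> bool" where
  "Ho_interleaved \<epsilon> F G \<longleftrightarrow> interleaved (shift_Ho (et CDGA) weq) \<epsilon> F G"

definition Ho_image :: "'u pers_cdga \<Rightarrow> ('u cdga, ('u cdga, 'u cdga_map) step list set) pers" where
  "Ho_image F = \<lparr> ob = ob F,
     str = (\<lambda>s t. word_class CDGA quasi_iso (ob F s) (ob F t) [Fwd (ob F s) (str F s t) (ob F t)]) \<rparr>"

definition homotopy_comm_interleaved :: "real \<Rightarrow> 'u pers_cdga \<Rightarrow> 'u pers_cdga \<Rightarrow> bool" where
  "homotopy_comm_interleaved \<epsilon> F G \<longleftrightarrow>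
     interleaved (pers_cat (Ho CDGA quasi_iso)) \<epsilon> (Ho_image F) (Ho_image G)"

definition d_HI :: "'u pers_cdga \<Rightarrow> 'u pers_cdga \<Rightarrow> ereal" where
  "d_HI F G = Inf (ereal ` {\<epsilon>. 0 \<le> \<epsilon> \<and> homotopy_interleaved \<epsilon> F G})"

definition d_IHC :: "'u pers_cdga \<Rightarrow> 'u pers_cdga \<Rightarrow> ereal" where
  "d_IHC F G = Inf (ereal ` {\<epsilon>. 0 \<le> \<epsilon> \<and> Ho_interleaved \<epsilon> F G})"

definition d_HC :: "'u pers_cdga \<Rightarrow> 'u pers_cdga \<Rightarrow> ereal" where
  "d_HC F G = Inf (ereal ` {\<epsilon>. 0 \<le> \<epsilon> \<and> homotopy_comm_interleaved \<epsilon> F G})"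

definition formal_wrt :: "('u pers_cdga \<Rightarrow> 'u pers_cdga \<Rightarrow> ereal) \<Rightarrow> 'u pers_cdga \<Rightarrow> bool" where
  "formal_wrt d F \<longleftrightarrow> d F (H F) = 0"

end

theory Submission
  imports Defs
begin

text \<open>
  The implications that hold without a gap are formal. A zigzag of weak equivalences becomes an
  isomorphism of the homotopy category, and a natural family of zigzags can be evaluated at every
  point. Thus \<open>H_formal_imp_HI\<close> uses the identity as a \<open>0\<close>-interleaving,
  \<open>homotopy_interleaved_imp_Ho_interleaved\<close> conjugates an interleaving with isomorphisms, and
  \<open>Ho_interleaved_imp_homotopy_comm_interleaved\<close> applies the functor from the homotopy category of
  persistence objects to the persistence objects of the homotopy category.

  If the discretising sequence has gaps, it remains to show that a functor which is \<open>d_HC\<close>-formal is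
  \<open>H\<close>-formal; the remaining implications follow by going round the circle. Let \<open>F\<close> and \<open>G\<close> be
  constant up to isomorphism on the cells \<open>[\<sigma> n, \<sigma> (n + 1))\<close> of a grid of mesh at least \<open>\<beta>\<close>, and
  homotopy commutative \<open>\<epsilon>\<close>-interleaved with \<open>3 \<epsilon> < \<beta>\<close>. The structure maps inside a cell are
  isomorphisms, so by two out of six the interleaving consists of isomorphisms
  \<open>F (\<sigma> n) \<cong> G (\<sigma> n + \<epsilon>)\<close> in the homotopy category of CDGAs, which commute with the structure maps
  there. Such a homotopy commutative isomorphism of sequences can be rectified
  (\<open>sequence_strictification\<close>): \<open>F (\<sigma> 0) \<rightarrow> F (\<sigma> 1) \<rightarrow> \<dots>\<close> is replaced by a sequence \<open>Q\<close> of
  cofibrations between cofibrant algebras, and maps \<open>Q n \<rightarrow> G (\<sigma> n + \<epsilon>)\<close> are chosen one after the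
  other. Each new map extends the previous one up to homotopy, hence strictly after a homotopy, by the
  homotopy extension property. This argument needs a sequence as index, not the half line, and this
  is where the gaps enter. The sequence \<open>Q\<close> spreads out to a functor on the half line that is weakly
  equivalent to \<open>F\<close> and to \<open>G\<close> (\<open>homotopy_comm_interleaved_imp_weakly_equivalent\<close>).

  The homotopy theory is built from three ingredients. Path algebras are the polynomial forms on the line
  with values in an algebra. Cofibrant algebras and cofibrations are those with the lifting property
  against acyclic correspondences, a form of trivial fibration that also covers lifts with prescribed
  end points. Both are produced by a single free extension, an algebra of terms modulo provable
  equality. An infinite type \<open>'u\<close> contains a copy of the terms over \<open>'u\<close>, so free extensions
  of algebras in the universe \<open>'u\<close> stay in this universe; over a finite \<open>'u\<close> all algebras vanish. Since
  the localisation consists of words modulo an inductive equality, a statement about its morphisms is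
  proved by letting words act on homotopy classes of maps out of a cofibrant algebra and on cohomology
  classes (\<open>homotopy_functor\<close>).
\<close>

section \<open>Elementary form of the axioms\<close>

locale rat_space =
  fixes M :: "(rat, 'u) module"
  assumes module: "module QQ M"
begin

lemma
  shows zero_closed [simp, intro]: "\<zero>\<^bsub>M\<^esub> \<in> carrier M"
    and add_closed [simp, intro]: "x \<in> carrier M \<Longrightarrow> y \<in> carrier M \<Longrightarrow> x \<oplus>\<^bsub>M\<^esub> y \<in> carrier M"
    and smult_closed [simp, intro]: "x \<in> carrier M \<Longrightarrow> c \<odot>\<^bsub>M\<^esub> x \<in> carrier M"
    and add_assoc: "x \<in> carrier M \<Longrightarrow> y \<in> carrier M \<Longrightarrow> z \<in> carrier M \<Longrightarrow>
      (x \<oplus>\<^bsub>M\<^esub> y) \<oplus>\<^bsub>M\<^esub> z = x \<oplus>\<^bsub>M\<^esub> (y \<oplus>\<^bsub>M\<^esub> z)"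
    and add_comm: "x \<in> carrier M \<Longrightarrow> y \<in> carrier M \<Longrightarrow> x \<oplus>\<^bsub>M\<^esub> y = y \<oplus>\<^bsub>M\<^esub> x"
    and add_left_comm: "x \<in> carrier M \<Longrightarrow> y \<in> carrier M \<Longrightarrow> z \<in> carrier M \<Longrightarrow>
      x \<oplus>\<^bsub>M\<^esub> (y \<oplus>\<^bsub>M\<^esub> z) = y \<oplus>\<^bsub>M\<^esub> (x \<oplus>\<^bsub>M\<^esub> z)"
    and zero_add [simp]: "x \<in> carrier M \<Longrightarrow> \<zero>\<^bsub>M\<^esub> \<oplus>\<^bsub>M\<^esub> x = x"
    and add_zero [simp]: "x \<in> carrier M \<Longrightarrow> x \<oplus>\<^bsub>M\<^esub> \<zero>\<^bsub>M\<^esub> = x"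
    and smult_add_left: "x \<in> carrier M \<Longrightarrow> (a + b) \<odot>\<^bsub>M\<^esub> x = a \<odot>\<^bsub>M\<^esub> x \<oplus>\<^bsub>M\<^esub> b \<odot>\<^bsub>M\<^esub> x"
    and smult_add_right: "x \<in> carrier M \<Longrightarrow> y \<in> carrier M \<Longrightarrow>
      c \<odot>\<^bsub>M\<^esub> (x \<oplus>\<^bsub>M\<^esub> y) = c \<odot>\<^bsub>M\<^esub> x \<oplus>\<^bsub>M\<^esub> c \<odot>\<^bsub>M\<^esub> y"
    and smult_smult: "x \<in> carrier M \<Longrightarrow> a \<odot>\<^bsub>M\<^esub> (b \<odot>\<^bsub>M\<^esub> x) = (a * b) \<odot>\<^bsub>M\<^esub> x"
    and smult_one [simp]: "x \<in> carrier M \<Longrightarrow> 1 \<odot>\<^bsub>M\<^esub> x = x"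
    and smult_zero_left [simp]: "x \<in> carrier M \<Longrightarrow> 0 \<odot>\<^bsub>M\<^esub> x = \<zero>\<^bsub>M\<^esub>"
    and smult_zero_right [simp]: "c \<odot>\<^bsub>M\<^esub> \<zero>\<^bsub>M\<^esub> = \<zero>\<^bsub>M\<^esub>"
proof -
  interpret module QQ M by (rule module)
  have C: "c \<in> carrier QQ" for c by (simp add: ring_of_type_algebra_def)
  show "\<zero>\<^bsub>M\<^esub> \<in> carrier M" by simp
  show "x \<in> carrier M \<Longrightarrow> y \<in> carrier M \<Longrightarrow> x \<oplus>\<^bsub>M\<^esub> y \<in> carrier M" by simp
  show "x \<in> carrier M \<Longrightarrow> c \<odot>\<^bsub>M\<^esub> x \<in> carrier M" using C by simp
  show "x \<in> carrier M \<Longrightarrow> y \<in> carrier M \<Longrightarrow> z \<in> carrier M \<Longrightarrow>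
      (x \<oplus>\<^bsub>M\<^esub> y) \<oplus>\<^bsub>M\<^esub> z = x \<oplus>\<^bsub>M\<^esub> (y \<oplus>\<^bsub>M\<^esub> z)" by (simp add: M.a_ac)
  show "x \<in> carrier M \<Longrightarrow> y \<in> carrier M \<Longrightarrow> x \<oplus>\<^bsub>M\<^esub> y = y \<oplus>\<^bsub>M\<^esub> x" by (simp add: M.a_ac)
  show "x \<in> carrier M \<Longrightarrow> y \<in> carrier M \<Longrightarrow> z \<in> carrier M \<Longrightarrow>
      x \<oplus>\<^bsub>M\<^esub> (y \<oplus>\<^bsub>M\<^esub> z) = y \<oplus>\<^bsub>M\<^esub> (x \<oplus>\<^bsub>M\<^esub> z)" by (simp add: M.a_ac)
  show "x \<in> carrier M \<Longrightarrow> \<zero>\<^bsub>M\<^esub> \<oplus>\<^bsub>M\<^esub> x = x" by simp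
  show "x \<in> carrier M \<Longrightarrow> x \<oplus>\<^bsub>M\<^esub> \<zero>\<^bsub>M\<^esub> = x" by simp
  show "x \<in> carrier M \<Longrightarrow> (a + b) \<odot>\<^bsub>M\<^esub> x = a \<odot>\<^bsub>M\<^esub> x \<oplus>\<^bsub>M\<^esub> b \<odot>\<^bsub>M\<^esub> x"
    using smult_l_distr[OF C C, of x a b] by (simp add: ring_of_type_algebra_def)
  show "x \<in> carrier M \<Longrightarrow> y \<in> carrier M \<Longrightarrow> c \<odot>\<^bsub>M\<^esub> (x \<oplus>\<^bsub>M\<^esub> y) = c \<odot>\<^bsub>M\<^esub> x \<oplus>\<^bsub>M\<^esub> c \<odot>\<^bsub>M\<^esub> y"
    using smult_r_distr[OF C] .
  show "x \<in> carrier M \<Longrightarrow> a \<odot>\<^bsub>M\<^esub> (b \<odot>\<^bsub>M\<^esub> x) = (a * b) \<odot>\<^bsub>M\<^esub> x"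
    using smult_assoc1[OF C C, of x a b] by (simp add: ring_of_type_algebra_def)
  show "x \<in> carrier M \<Longrightarrow> 1 \<odot>\<^bsub>M\<^esub> x = x"
    using smult_one[of x] by (simp add: ring_of_type_algebra_def)
  show "x \<in> carrier M \<Longrightarrow> 0 \<odot>\<^bsub>M\<^esub> x = \<zero>\<^bsub>M\<^esub>"
    using smult_l_null[of x] by (simp add: ring_of_type_algebra_def)
  show "c \<odot>\<^bsub>M\<^esub> \<zero>\<^bsub>M\<^esub> = \<zero>\<^bsub>M\<^esub>" using smult_r_null[OF C] .
qed

lemmas add_ac = add_assoc add_comm add_left_comm

lemma add_neg [simp]: "x \<in> carrier M \<Longrightarrow> x \<oplus>\<^bsub>M\<^esub> (- 1) \<odot>\<^bsub>M\<^esub> x = \<zero>\<^bsub>M\<^esub>"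
  using smult_add_left[of x 1 "-1"] by simp

lemma neg_add [simp]: "x \<in> carrier M \<Longrightarrow> (- 1) \<odot>\<^bsub>M\<^esub> x \<oplus>\<^bsub>M\<^esub> x = \<zero>\<^bsub>M\<^esub>"
  using add_neg[of x] add_comm[of x "(-1) \<odot>\<^bsub>M\<^esub> x"] by simp

lemma add_neg_assoc [simp]:
  "x \<in> carrier M \<Longrightarrow> y \<in> carrier M \<Longrightarrow> x \<oplus>\<^bsub>M\<^esub> ((- 1) \<odot>\<^bsub>M\<^esub> x \<oplus>\<^bsub>M\<^esub> y) = y"
  "x \<in> carrier M \<Longrightarrow> y \<in> carrier M \<Longrightarrow> (- 1) \<odot>\<^bsub>M\<^esub> x \<oplus>\<^bsub>M\<^esub> (x \<oplus>\<^bsub>M\<^esub> y) = y"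
  by (simp_all add: add_assoc[symmetric])

lemma add_neg_cancel [simp]:
  "x \<in> carrier M \<Longrightarrow> y \<in> carrier M \<Longrightarrow> x \<oplus>\<^bsub>M\<^esub> (y \<oplus>\<^bsub>M\<^esub> (- 1) \<odot>\<^bsub>M\<^esub> x) = y"
  by (simp add: add_left_comm[of x y])

lemma eq_iff_diff: "x \<in> carrier M \<Longrightarrow> y \<in> carrier M \<Longrightarrow> x = y \<longleftrightarrow> x \<oplus>\<^bsub>M\<^esub> (- 1) \<odot>\<^bsub>M\<^esub> y = \<zero>\<^bsub>M\<^esub>"
  by (metis add_assoc add_neg add_zero neg_add smult_closed zero_add)

lemma add_left_cancel:
  "x \<in> carrier M \<Longrightarrow> y \<in> carrier M \<Longrightarrow> z \<in> carrier M \<Longrightarrow> x \<oplus>\<^bsub>M\<^esub> y = x \<oplus>\<^bsub>M\<^esub> z \<longleftrightarrow> y = z"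
  by (metis add_neg_assoc(2))

lemma smult_eq_zero: "x \<in> carrier M \<Longrightarrow> c \<odot>\<^bsub>M\<^esub> x = \<zero>\<^bsub>M\<^esub> \<Longrightarrow> c \<noteq> 0 \<Longrightarrow> x = \<zero>\<^bsub>M\<^esub>"
  by (metis field_class.field_inverse smult_one smult_smult smult_zero_right)

end

lemma rat_spaceI:
  fixes M :: "(rat, 'u) module"
  assumes "\<zero>\<^bsub>M\<^esub> \<in> carrier M"
    and "\<And>x y. x \<in> carrier M \<Longrightarrow> y \<in> carrier M \<Longrightarrow> x \<oplus>\<^bsub>M\<^esub> y \<in> carrier M"
    and smult: "\<And>c x. x \<in> carrier M \<Longrightarrow> c \<odot>\<^bsub>M\<^esub> x \<in> carrier M"
    and "\<And>x y z. x \<in> carrier M \<Longrightarrow> y \<in> carrier M \<Longrightarrow> z \<in> carrier M \<Longrightarrow>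
      (x \<oplus>\<^bsub>M\<^esub> y) \<oplus>\<^bsub>M\<^esub> z = x \<oplus>\<^bsub>M\<^esub> (y \<oplus>\<^bsub>M\<^esub> z)"
    and comm: "\<And>x y. x \<in> carrier M \<Longrightarrow> y \<in> carrier M \<Longrightarrow> x \<oplus>\<^bsub>M\<^esub> y = y \<oplus>\<^bsub>M\<^esub> x"
    and "\<And>x. x \<in> carrier M \<Longrightarrow> \<zero>\<^bsub>M\<^esub> \<oplus>\<^bsub>M\<^esub> x = x"
    and l_distr: "\<And>a b x. x \<in> carrier M \<Longrightarrow> (a + b) \<odot>\<^bsub>M\<^esub> x = a \<odot>\<^bsub>M\<^esub> x \<oplus>\<^bsub>M\<^esub> b \<odot>\<^bsub>M\<^esub> x"
    and "\<And>c x y. x \<in> carrier M \<Longrightarrow> y \<in> carrier M \<Longrightarrow>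
      c \<odot>\<^bsub>M\<^esub> (x \<oplus>\<^bsub>M\<^esub> y) = c \<odot>\<^bsub>M\<^esub> x \<oplus>\<^bsub>M\<^esub> c \<odot>\<^bsub>M\<^esub> y"
    and "\<And>a b x. x \<in> carrier M \<Longrightarrow> (a * b) \<odot>\<^bsub>M\<^esub> x = a \<odot>\<^bsub>M\<^esub> (b \<odot>\<^bsub>M\<^esub> x)"
    and one: "\<And>x. x \<in> carrier M \<Longrightarrow> 1 \<odot>\<^bsub>M\<^esub> x = x"
    and null: "\<And>x. x \<in> carrier M \<Longrightarrow> 0 \<odot>\<^bsub>M\<^esub> x = \<zero>\<^bsub>M\<^esub>"
  shows "rat_space M"
proof (rule rat_space.intro)
  have neg: "\<exists>y\<in>carrier M. y \<oplus>\<^bsub>M\<^esub> x = \<zero>\<^bsub>M\<^esub>" if "x \<in> carrier M" for x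
    using l_distr[OF that, of "-1" 1] one[OF that] null[OF that] smult[OF that, of "-1"] by auto
  have "abelian_group M"
    by (rule abelian_groupI) (use assms neg in auto)
  moreover have "cring QQ" by (rule cring_from_type_algebra)
  ultimately show "module QQ M"
    by (intro moduleI) (simp_all add: assms ring_of_type_algebra_def)
qed

sublocale cdga \<subseteq> rat_space "gr A n" for n
  by (simp add: rat_space_def vector_space)

context cdga
begin

lemma
  shows mult_closed [simp, intro]:
      "x \<in> elts A p \<Longrightarrow> y \<in> elts A q \<Longrightarrow> gmult A p q x y \<in> elts A (p + q)"
    and mult_add_right: "x \<in> elts A p \<Longrightarrow> y \<in> elts A q \<Longrightarrow> z \<in> elts A q \<Longrightarrow>
      gmult A p q x (y \<oplus>\<^bsub>gr A q\<^esub> z) = gmult A p q x y \<oplus>\<^bsub>gr A (p + q)\<^esub> gmult A p q x z"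
    and mult_add_left: "x \<in> elts A p \<Longrightarrow> y \<in> elts A p \<Longrightarrow> z \<in> elts A q \<Longrightarrow>
      gmult A p q (x \<oplus>\<^bsub>gr A p\<^esub> y) z = gmult A p q x z \<oplus>\<^bsub>gr A (p + q)\<^esub> gmult A p q y z"
    and mult_smult_right: "x \<in> elts A p \<Longrightarrow> y \<in> elts A q \<Longrightarrow>
      gmult A p q x (c \<odot>\<^bsub>gr A q\<^esub> y) = c \<odot>\<^bsub>gr A (p + q)\<^esub> gmult A p q x y"
    and mult_smult_left: "x \<in> elts A p \<Longrightarrow> y \<in> elts A q \<Longrightarrow>
      gmult A p q (c \<odot>\<^bsub>gr A p\<^esub> x) y = c \<odot>\<^bsub>gr A (p + q)\<^esub> gmult A p q x y"
    and diff_closed [simp, intro]: "x \<in> elts A n \<Longrightarrow> gdiff A n x \<in> elts A (Suc n)"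
    and diff_add: "x \<in> elts A n \<Longrightarrow> y \<in> elts A n \<Longrightarrow>
      gdiff A n (x \<oplus>\<^bsub>gr A n\<^esub> y) = gdiff A n x \<oplus>\<^bsub>gr A (Suc n)\<^esub> gdiff A n y"
    and diff_smult: "x \<in> elts A n \<Longrightarrow> gdiff A n (c \<odot>\<^bsub>gr A n\<^esub> x) = c \<odot>\<^bsub>gr A (Suc n)\<^esub> gdiff A n x"
  using mult_linear_right[of x p q] mult_linear_left[of z q p] mult_linear_left[of y q p] diff_linear[of n]
  unfolding linear_on_def by (auto simp: Pi_iff)

lemma
  shows mult_zero_right [simp]: "x \<in> elts A p \<Longrightarrow> gmult A p q x \<zero>\<^bsub>gr A q\<^esub> = \<zero>\<^bsub>gr A (p + q)\<^esub>"
    and mult_zero_left [simp]: "y \<in> elts A q \<Longrightarrow> gmult A p q \<zero>\<^bsub>gr A p\<^esub> y = \<zero>\<^bsub>gr A (p + q)\<^esub>"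
    and diff_zero [simp]: "gdiff A n \<zero>\<^bsub>gr A n\<^esub> = \<zero>\<^bsub>gr A (Suc n)\<^esub>"
  using mult_smult_right[of x p "\<zero>\<^bsub>gr A q\<^esub>" q 0] mult_smult_left[of "\<zero>\<^bsub>gr A p\<^esub>" p y q 0]
    diff_smult[of "\<zero>\<^bsub>gr A n\<^esub>" n 0] by simp_all

lemma diff_one: "gdiff A 0 (gone A) = \<zero>\<^bsub>gr A 1\<^esub>"
proof -
  note [simp] = one_closed
  let ?d = "gdiff A 0 (gone A)"
  have "?d = gdiff A (0 + 0) (gmult A 0 0 (gone A) (gone A))" by (simp add: mult_one_left)
  also have "\<dots> = ?d \<oplus>\<^bsub>gr A 1\<^esub> ?d"
    using mult_one_left[of ?d 1] mult_one_right[of ?d 1] diff_closed[of "gone A" 0]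
    by (subst leibniz) simp_all
  finally have "?d \<oplus>\<^bsub>gr A 1\<^esub> \<zero>\<^bsub>gr A 1\<^esub> = ?d \<oplus>\<^bsub>gr A 1\<^esub> ?d"
    using diff_closed[of "gone A" 0] by simp
  thus ?thesis using add_left_cancel[of ?d 1 "\<zero>\<^bsub>gr A 1\<^esub>" ?d] diff_closed[of "gone A" 0] by auto
qed

end

lemma cdgaI:
  fixes A :: "'u cdga"
  assumes "\<And>n. rat_space (gr A n)"
    and "\<And>p q x y. x \<in> elts A p \<Longrightarrow> y \<in> elts A q \<Longrightarrow> gmult A p q x y \<in> elts A (p + q)"
    and "\<And>p q x y z. x \<in> elts A p \<Longrightarrow> y \<in> elts A q \<Longrightarrow> z \<in> elts A q \<Longrightarrow>
      gmult A p q x (y \<oplus>\<^bsub>gr A q\<^esub> z) = gmult A p q x y \<oplus>\<^bsub>gr A (p + q)\<^esub> gmult A p q x z"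
    and "\<And>p q x y z. x \<in> elts A p \<Longrightarrow> y \<in> elts A p \<Longrightarrow> z \<in> elts A q \<Longrightarrow>
      gmult A p q (x \<oplus>\<^bsub>gr A p\<^esub> y) z = gmult A p q x z \<oplus>\<^bsub>gr A (p + q)\<^esub> gmult A p q y z"
    and "\<And>p q c x y. x \<in> elts A p \<Longrightarrow> y \<in> elts A q \<Longrightarrow>
      gmult A p q x (c \<odot>\<^bsub>gr A q\<^esub> y) = c \<odot>\<^bsub>gr A (p + q)\<^esub> gmult A p q x y"
    and "\<And>p q c x y. x \<in> elts A p \<Longrightarrow> y \<in> elts A q \<Longrightarrow>
      gmult A p q (c \<odot>\<^bsub>gr A p\<^esub> x) y = c \<odot>\<^bsub>gr A (p + q)\<^esub> gmult A p q x y"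
    and "\<And>p q r x y z. x \<in> elts A p \<Longrightarrow> y \<in> elts A q \<Longrightarrow> z \<in> elts A r \<Longrightarrow>
      gmult A (p + q) r (gmult A p q x y) z = gmult A p (q + r) x (gmult A q r y z)"
    and "gone A \<in> elts A 0"
    and "\<And>p x. x \<in> elts A p \<Longrightarrow> gmult A 0 p (gone A) x = x"
    and "\<And>p x. x \<in> elts A p \<Longrightarrow> gmult A p 0 x (gone A) = x"
    and "\<And>p q x y. x \<in> elts A p \<Longrightarrow> y \<in> elts A q \<Longrightarrow>
      gmult A p q x y = (- 1) ^ (p * q) \<odot>\<^bsub>gr A (p + q)\<^esub> gmult A q p y x"
    and "\<And>n x. x \<in> elts A n \<Longrightarrow> gdiff A n x \<in> elts A (Suc n)"
    and "\<And>n x y. x \<in> elts A n \<Longrightarrow> y \<in> elts A n \<Longrightarrow>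
      gdiff A n (x \<oplus>\<^bsub>gr A n\<^esub> y) = gdiff A n x \<oplus>\<^bsub>gr A (Suc n)\<^esub> gdiff A n y"
    and "\<And>n c x. x \<in> elts A n \<Longrightarrow> gdiff A n (c \<odot>\<^bsub>gr A n\<^esub> x) = c \<odot>\<^bsub>gr A (Suc n)\<^esub> gdiff A n x"
    and "\<And>n x. x \<in> elts A n \<Longrightarrow> gdiff A (Suc n) (gdiff A n x) = \<zero>\<^bsub>gr A (Suc (Suc n))\<^esub>"
    and "\<And>p q x y. x \<in> elts A p \<Longrightarrow> y \<in> elts A q \<Longrightarrow>
      gdiff A (p + q) (gmult A p q x y) =
        gmult A (Suc p) q (gdiff A p x) y
        \<oplus>\<^bsub>gr A (Suc (p + q))\<^esub> (- 1) ^ p \<odot>\<^bsub>gr A (Suc (p + q))\<^esub> gmult A p (Suc q) x (gdiff A q y)"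
  shows "cdga A"
  by (rule cdga.intro; (rule assms)?;
    (simp add: linear_on_def assms(1)[unfolded rat_space_def] assms(2-6) assms(12-14))?)

section \<open>Maps, cohomology classes and trivial fibrations\<close>

text \<open>
  The algebras that parametrise homotopies do not fit into the universe of the given ones, so maps
  are considered between algebras with elements in different types, and two maps are compared only
  on elements of their source.
\<close>

definition dga_map :: "'a cdga \<Rightarrow> 'b cdga \<Rightarrow> (nat \<Rightarrow> 'a \<Rightarrow> 'b) \<Rightarrow> bool" where
  "dga_map A B f \<longleftrightarrow>
     (\<forall>n. \<forall>x\<in>elts A n. f n x \<in> elts B n) \<and>
     (\<forall>n. \<forall>x\<in>elts A n. \<forall>y\<in>elts A n. f n (x \<oplus>\<^bsub>gr A n\<^esub> y) = f n x \<oplus>\<^bsub>gr B n\<^esub> f n y) \<and>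
     (\<forall>n c. \<forall>x\<in>elts A n. f n (c \<odot>\<^bsub>gr A n\<^esub> x) = c \<odot>\<^bsub>gr B n\<^esub> f n x) \<and>
     f 0 (gone A) = gone B \<and>
     (\<forall>p q. \<forall>x\<in>elts A p. \<forall>y\<in>elts A q. f (p + q) (gmult A p q x y) = gmult B p q (f p x) (f q y)) \<and>
     (\<forall>n. \<forall>x\<in>elts A n. f (Suc n) (gdiff A n x) = gdiff B n (f n x))"

lemma cdga_hom_iff: "f \<in> cdga_hom A B \<longleftrightarrow> dga_map A B f \<and> (\<forall>n. f n \<in> extensional (elts A n))"
  unfolding cdga_hom_def dga_map_def linear_on_def by (auto simp: Pi_iff)

lemma dga_mapD:
  assumes "dga_map A B f"
  shows "x \<in> elts A n \<Longrightarrow> f n x \<in> elts B n"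
    and "x \<in> elts A n \<Longrightarrow> y \<in> elts A n \<Longrightarrow> f n (x \<oplus>\<^bsub>gr A n\<^esub> y) = f n x \<oplus>\<^bsub>gr B n\<^esub> f n y"
    and "x \<in> elts A n \<Longrightarrow> f n (c \<odot>\<^bsub>gr A n\<^esub> x) = c \<odot>\<^bsub>gr B n\<^esub> f n x"
    and "f 0 (gone A) = gone B"
    and "x \<in> elts A p \<Longrightarrow> y \<in> elts A q \<Longrightarrow> f (p + q) (gmult A p q x y) = gmult B p q (f p x) (f q y)"
    and "x \<in> elts A n \<Longrightarrow> f (Suc n) (gdiff A n x) = gdiff B n (f n x)"
  using assms unfolding dga_map_def by auto

lemma dga_map_zero:
  assumes "dga_map A B f" "cdga A" "cdga B" shows "f n \<zero>\<^bsub>gr A n\<^esub> = \<zero>\<^bsub>gr B n\<^esub>"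
proof -
  interpret A: cdga A by fact
  interpret B: cdga B by fact
  show ?thesis using dga_mapD(3)[OF assms(1), of "\<zero>\<^bsub>gr A n\<^esub>" n 0] dga_mapD(1)[OF assms(1), of "\<zero>\<^bsub>gr A n\<^esub>" n] by simp
qed

lemma dga_map_id: "dga_map A A (\<lambda>n x. x)"
  by (simp add: dga_map_def)

lemma dga_map_comp: "dga_map A B f \<Longrightarrow> dga_map B C g \<Longrightarrow> dga_map A C (\<lambda>n x. g n (f n x))"
  unfolding dga_map_def by auto

lemma dga_map_cong:
  assumes "cdga A" "dga_map A B f" "\<And>n x. x \<in> elts A n \<Longrightarrow> f n x = g n x" shows "dga_map A B g"
proof -
  interpret A: cdga A by fact
  show ?thesis using assms(2) unfolding dga_map_def
    by (simp add: assms(3)[symmetric] A.one_closed)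
qed

definition cohomologous :: "'a cdga \<Rightarrow> nat \<Rightarrow> 'a \<Rightarrow> 'a \<Rightarrow> bool" where
  "cohomologous A n x y \<longleftrightarrow> (\<exists>c\<in>coboundaries A n. x = c \<oplus>\<^bsub>gr A n\<^esub> y)"

context cdga
begin

lemma coboundaries_closed: "c \<in> coboundaries A n \<Longrightarrow> c \<in> elts A n"
  by (cases n) auto

lemma coboundaries_cocycles: "c \<in> coboundaries A n \<Longrightarrow> c \<in> cocycles A n"
  by (cases n) (auto simp: cocycles_def diff_diff)

lemma coboundaries_add: "c \<in> coboundaries A n \<Longrightarrow> c' \<in> coboundaries A n \<Longrightarrow> c \<oplus>\<^bsub>gr A n\<^esub> c' \<in> coboundaries A n"
  by (cases n) (auto simp: diff_add[symmetric])

lemma coboundaries_smult: "c \<in> coboundaries A n \<Longrightarrow> a \<odot>\<^bsub>gr A n\<^esub> c \<in> coboundaries A n"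
  by (cases n) (auto simp: diff_smult[symmetric])

lemma coboundaries_zero: "\<zero>\<^bsub>gr A n\<^esub> \<in> coboundaries A n"
  by (cases n) (auto simp: image_iff intro!: bexI[of _ "\<zero>\<^bsub>gr A _\<^esub>"])

lemma cocyclesD: "x \<in> cocycles A n \<Longrightarrow> x \<in> elts A n"
  by (simp add: cocycles_def)

lemma cocycles_add: "x \<in> cocycles A n \<Longrightarrow> y \<in> cocycles A n \<Longrightarrow> x \<oplus>\<^bsub>gr A n\<^esub> y \<in> cocycles A n"
  by (simp add: cocycles_def diff_add)

lemma cocycles_smult: "x \<in> cocycles A n \<Longrightarrow> c \<odot>\<^bsub>gr A n\<^esub> x \<in> cocycles A n"
  by (simp add: cocycles_def diff_smult)

lemma cocycles_zero: "\<zero>\<^bsub>gr A n\<^esub> \<in> cocycles A n"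
  by (simp add: cocycles_def)

lemma cocycles_one: "gone A \<in> cocycles A 0"
  by (simp add: cocycles_def diff_one one_closed)

lemma cocycles_mult: "x \<in> cocycles A p \<Longrightarrow> y \<in> cocycles A q \<Longrightarrow> gmult A p q x y \<in> cocycles A (p + q)"
  using mult_zero_left[of y q "Suc p"] mult_zero_right[of x p "Suc q"]
  by (auto simp: cocycles_def leibniz)

lemma cohomologous_refl: "x \<in> elts A n \<Longrightarrow> cohomologous A n x x"
  unfolding cohomologous_def by (rule bexI[OF _ coboundaries_zero]) simp

lemma cohomologous_sym:
  assumes "cohomologous A n x y" "y \<in> elts A n" shows "cohomologous A n y x"
proof -
  obtain c where c: "c \<in> coboundaries A n" "x = c \<oplus>\<^bsub>gr A n\<^esub> y" using assms by (auto simp: cohomologous_def)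
  have "y = (-1) \<odot>\<^bsub>gr A n\<^esub> c \<oplus>\<^bsub>gr A n\<^esub> x"
    using c assms coboundaries_closed[OF c(1)] by simp
  thus ?thesis using coboundaries_smult[OF c(1)] unfolding cohomologous_def by blast
qed

lemma cohomologous_trans:
  assumes "cohomologous A n x y" "cohomologous A n y z" "z \<in> elts A n" shows "cohomologous A n x z"
proof -
  obtain c where c: "c \<in> coboundaries A n" "x = c \<oplus>\<^bsub>gr A n\<^esub> y" using assms by (auto simp: cohomologous_def)
  obtain c' where c': "c' \<in> coboundaries A n" "y = c' \<oplus>\<^bsub>gr A n\<^esub> z" using assms by (auto simp: cohomologous_def)
  have "x = (c \<oplus>\<^bsub>gr A n\<^esub> c') \<oplus>\<^bsub>gr A n\<^esub> z"
    using c c' assms coboundaries_closed by (simp add: add_assoc)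
  thus ?thesis using coboundaries_add c c' unfolding cohomologous_def by blast
qed

lemma cohomologous_add:
  assumes "cohomologous A n x y" "cohomologous A n x' y'" "y \<in> elts A n" "y' \<in> elts A n"
  shows "cohomologous A n (x \<oplus>\<^bsub>gr A n\<^esub> x') (y \<oplus>\<^bsub>gr A n\<^esub> y')"
proof -
  obtain c where c: "c \<in> coboundaries A n" "x = c \<oplus>\<^bsub>gr A n\<^esub> y" using assms by (auto simp: cohomologous_def)
  obtain c' where c': "c' \<in> coboundaries A n" "x' = c' \<oplus>\<^bsub>gr A n\<^esub> y'" using assms by (auto simp: cohomologous_def)
  have "x \<oplus>\<^bsub>gr A n\<^esub> x' = (c \<oplus>\<^bsub>gr A n\<^esub> c') \<oplus>\<^bsub>gr A n\<^esub> (y \<oplus>\<^bsub>gr A n\<^esub> y')"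
    using c c' assms coboundaries_closed by (simp add: add_ac)
  thus ?thesis using coboundaries_add c c' unfolding cohomologous_def by blast
qed

lemma cohomologous_smult:
  assumes "cohomologous A n x y" "y \<in> elts A n"
  shows "cohomologous A n (a \<odot>\<^bsub>gr A n\<^esub> x) (a \<odot>\<^bsub>gr A n\<^esub> y)"
proof -
  obtain c where c: "c \<in> coboundaries A n" "x = c \<oplus>\<^bsub>gr A n\<^esub> y" using assms by (auto simp: cohomologous_def)
  hence "a \<odot>\<^bsub>gr A n\<^esub> x = a \<odot>\<^bsub>gr A n\<^esub> c \<oplus>\<^bsub>gr A n\<^esub> a \<odot>\<^bsub>gr A n\<^esub> y"
    using assms coboundaries_closed by (simp add: smult_add_right)
  thus ?thesis using coboundaries_smult[OF c(1)] unfolding cohomologous_def by blast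
qed

text \<open>Coboundaries form an ideal in the algebra of cocycles, by the Leibniz rule.\<close>

lemma coboundaries_mult_right:
  assumes "c \<in> coboundaries A p" "y \<in> cocycles A q" shows "gmult A p q c y \<in> coboundaries A (p + q)"
proof (cases p)
  case 0 with assms show ?thesis using coboundaries_zero by (simp add: cocycles_def)
next
  case (Suc p')
  then obtain e where e: "e \<in> elts A p'" "c = gdiff A p' e" using assms by auto
  have "gdiff A (p' + q) (gmult A p' q e y) = gmult A p q c y"
    using e assms(2) Suc mult_closed[of "gdiff A p' e" "Suc p'" y q] mult_zero_right[of e p' "Suc q"]
    by (simp add: leibniz cocycles_def)
  thus ?thesis using Suc e assms(2) by (simp add: image_iff) (metis cocyclesD mult_closed)
qed

lemma coboundaries_mult_left:
  assumes "x \<in> elts A p" "c \<in> coboundaries A q" "x \<in> cocycles A p"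
  shows "gmult A p q x c \<in> coboundaries A (p + q)"
  using coboundaries_smult[OF coboundaries_mult_right[OF assms(2,3)], of "(-1)^(p*q)"]
    graded_comm[of x p c q] assms coboundaries_closed by (simp add: add.commute)

lemma cohomologous_mult:
  assumes "cohomologous A p x x'" "cohomologous A q y y'" "x' \<in> cocycles A p" "y \<in> cocycles A q" "y' \<in> cocycles A q"
  shows "cohomologous A (p + q) (gmult A p q x y) (gmult A p q x' y')"
proof -
  obtain c where c: "c \<in> coboundaries A p" "x = c \<oplus>\<^bsub>gr A p\<^esub> x'" using assms by (auto simp: cohomologous_def)
  obtain e where e: "e \<in> coboundaries A q" "y = e \<oplus>\<^bsub>gr A q\<^esub> y'" using assms by (auto simp: cohomologous_def)
  have x: "x \<in> elts A p" using c assms coboundaries_closed cocyclesD by simp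
  have "gmult A p q x y = gmult A p q c y \<oplus>\<^bsub>gr A (p+q)\<^esub> gmult A p q x' y"
    using c assms coboundaries_closed cocyclesD by (simp add: mult_add_left)
  also have "gmult A p q x' y = gmult A p q x' e \<oplus>\<^bsub>gr A (p+q)\<^esub> gmult A p q x' y'"
    using e assms coboundaries_closed cocyclesD by (simp add: mult_add_right)
  finally have "gmult A p q x y = (gmult A p q c y \<oplus>\<^bsub>gr A (p+q)\<^esub> gmult A p q x' e) \<oplus>\<^bsub>gr A (p+q)\<^esub> gmult A p q x' y'"
    using c e assms coboundaries_closed cocyclesD by (simp add: add_assoc)
  moreover have "gmult A p q c y \<oplus>\<^bsub>gr A (p+q)\<^esub> gmult A p q x' e \<in> coboundaries A (p+q)"
    by (intro coboundaries_add coboundaries_mult_right coboundaries_mult_left c e assms cocyclesD)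
  ultimately show ?thesis unfolding cohomologous_def by blast
qed

lemma cohomologous_zero_iff: "x \<in> elts A n \<Longrightarrow> cohomologous A n x \<zero>\<^bsub>gr A n\<^esub> \<longleftrightarrow> x \<in> coboundaries A n"
  using coboundaries_closed by (auto simp: cohomologous_def)

lemma cohomologous_iff_diff:
  assumes "x \<in> elts A n" "y \<in> elts A n"
  shows "cohomologous A n x y \<longleftrightarrow> x \<oplus>\<^bsub>gr A n\<^esub> (-1) \<odot>\<^bsub>gr A n\<^esub> y \<in> coboundaries A n"
proof
  assume "cohomologous A n x y"
  then obtain c where "c \<in> coboundaries A n" "x = c \<oplus>\<^bsub>gr A n\<^esub> y" by (auto simp: cohomologous_def)
  with assms coboundaries_closed show "x \<oplus>\<^bsub>gr A n\<^esub> (-1) \<odot>\<^bsub>gr A n\<^esub> y \<in> coboundaries A n" by (simp add: add_assoc)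
next
  assume *: "x \<oplus>\<^bsub>gr A n\<^esub> (-1) \<odot>\<^bsub>gr A n\<^esub> y \<in> coboundaries A n"
  have "x = (x \<oplus>\<^bsub>gr A n\<^esub> (-1) \<odot>\<^bsub>gr A n\<^esub> y) \<oplus>\<^bsub>gr A n\<^esub> y" using assms by (simp add: add_assoc)
  with * show "cohomologous A n x y" unfolding cohomologous_def by blast
qed

end

lemma dga_map_coboundaries:
  assumes "dga_map A B f" "cdga A" "cdga B" "c \<in> coboundaries A n" shows "f n c \<in> coboundaries B n"
  using assms(4) dga_mapD(1,6)[OF assms(1)] dga_map_zero[OF assms(1-3)] by (cases n) auto

lemma dga_map_cocycles:
  assumes "dga_map A B f" "cdga A" "cdga B" "c \<in> cocycles A n" shows "f n c \<in> cocycles B n"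
  using assms(4) dga_mapD(1)[OF assms(1)] dga_mapD(6)[OF assms(1),symmetric] dga_map_zero[OF assms(1-3)]
  by (simp add: cocycles_def)

lemma dga_map_cohomologous:
  assumes "dga_map A B f" "cdga A" "cdga B" "cohomologous A n x y" "y \<in> elts A n"
  shows "cohomologous B n (f n x) (f n y)"
  using assms(4,5) dga_map_coboundaries[OF assms(1-3)] dga_mapD(2)[OF assms(1)] cdga.coboundaries_closed[OF assms(2)]
  unfolding cohomologous_def by metis

text \<open>
  Bijectivity on cohomology in terms of cocycles. In contrast to \<open>quasi_iso\<close>, this makes sense for
  algebras with elements in different types.
\<close>

definition weak_equivalence :: "'a cdga \<Rightarrow> 'b cdga \<Rightarrow> (nat \<Rightarrow> 'a \<Rightarrow> 'b) \<Rightarrow> bool" where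
  "weak_equivalence A B f \<longleftrightarrow> dga_map A B f \<and>
     (\<forall>n. \<forall>z\<in>cocycles B n. \<exists>y\<in>cocycles A n. cohomologous B n (f n y) z) \<and>
     (\<forall>n. \<forall>y\<in>cocycles A n. \<forall>y'\<in>cocycles A n.
        cohomologous B n (f n y) (f n y') \<longrightarrow> cohomologous A n y y')"

text \<open>
  Surjective quasi-isomorphisms (see \<open>surjective_weak_equivalence\<close>), in the form in which they are used:
  a solution of \<open>d x = a\<close> in \<open>B\<close> lifts to \<open>A\<close> for every lift of \<open>a\<close> to a cocycle. In degree \<open>0\<close> there
  are no primitives, and injectivity on cohomology is a separate condition.
\<close>

definition trivial_fibration :: "'a cdga \<Rightarrow> 'b cdga \<Rightarrow> (nat \<Rightarrow> 'a \<Rightarrow> 'b) \<Rightarrow> bool" where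
  "trivial_fibration A B p \<longleftrightarrow> dga_map A B p \<and>
     (\<forall>n. \<forall>b\<in>elts B n. \<forall>a\<in>cocycles A (Suc n). p (Suc n) a = gdiff B n b \<longrightarrow>
        (\<exists>x\<in>elts A n. gdiff A n x = a \<and> p n x = b)) \<and>
     (\<forall>z\<in>cocycles A 0. p 0 z = \<zero>\<^bsub>gr B 0\<^esub> \<longrightarrow> z = \<zero>\<^bsub>gr A 0\<^esub>)"

lemma trivial_fibration_dga_map: "trivial_fibration A B p \<Longrightarrow> dga_map A B p"
  by (simp add: trivial_fibration_def)

lemma weak_equivalence_dga_map: "weak_equivalence A B p \<Longrightarrow> dga_map A B p"
  by (simp add: weak_equivalence_def)

lemma trivial_fibration_fill:
  assumes "trivial_fibration A B p" "b \<in> elts B n" "a \<in> cocycles A (Suc n)" "p (Suc n) a = gdiff B n b"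
  obtains x where "x \<in> elts A n" "gdiff A n x = a" "p n x = b"
  using assms unfolding trivial_fibration_def by blast

lemma trivial_fibration_cocycle_lift:
  assumes "trivial_fibration A B p" "cdga A" "cdga B" "z \<in> cocycles B n"
  obtains y where "y \<in> cocycles A n" "p n y = z"
proof -
  interpret A: cdga A by fact
  interpret B: cdga B by fact
  have "\<zero>\<^bsub>gr A (Suc n)\<^esub> \<in> cocycles A (Suc n)" by (rule A.cocycles_zero)
  moreover have "p (Suc n) \<zero>\<^bsub>gr A (Suc n)\<^esub> = gdiff B n z"
    using assms(4) dga_map_zero[OF trivial_fibration_dga_map[OF assms(1)] assms(2,3)] by (simp add: cocycles_def)
  ultimately obtain y where "y \<in> elts A n" "gdiff A n y = \<zero>\<^bsub>gr A (Suc n)\<^esub>" "p n y = z"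
    using trivial_fibration_fill[OF assms(1), of z n] assms(4) B.cocyclesD by blast
  thus ?thesis using that by (auto simp: cocycles_def)
qed

lemma trivial_fibration_surj:
  assumes "trivial_fibration A B p" "cdga A" "cdga B" "b \<in> elts B n"
  obtains x where "x \<in> elts A n" "p n x = b"
proof -
  interpret B: cdga B by fact
  have "gdiff B n b \<in> cocycles B (Suc n)" using assms(4) by (simp add: cocycles_def B.diff_diff)
  then obtain y where "y \<in> cocycles A (Suc n)" "p (Suc n) y = gdiff B n b"
    using trivial_fibration_cocycle_lift[OF assms(1-3)] by blast
  thus ?thesis using trivial_fibration_fill[OF assms(1,4)] that by blast
qed

lemma trivial_fibration_kernel:
  assumes "trivial_fibration A B p" "cdga A" "cdga B" "z \<in> cocycles A n" "p n z \<in> coboundaries B n"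
  shows "z \<in> coboundaries A n"
proof (cases n)
  case 0 thus ?thesis using assms by (auto simp: trivial_fibration_def)
next
  case (Suc m)
  then obtain b where "b \<in> elts B m" "p (Suc m) z = gdiff B m b" using assms(5) by auto
  thus ?thesis using trivial_fibration_fill[OF assms(1), of b m z] assms(4) Suc by auto
qed

lemma dga_map_diff_coboundary:
  assumes "dga_map A B p" "cdga A" "cdga B" "y \<in> cocycles A n" "y' \<in> cocycles A n"
  shows "cohomologous B n (p n y) (p n y') \<longleftrightarrow>
     p n (y \<oplus>\<^bsub>gr A n\<^esub> (-1) \<odot>\<^bsub>gr A n\<^esub> y') \<in> coboundaries B n"
proof -
  interpret A: cdga A by fact
  interpret B: cdga B by fact
  show ?thesis using assms(4,5) A.cocyclesD dga_mapD(1-3)[OF assms(1)]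
    by (subst B.cohomologous_iff_diff) auto
qed

lemma trivial_fibration_weak_equivalence:
  assumes "trivial_fibration A B p" "cdga A" "cdga B" shows "weak_equivalence A B p"
  unfolding weak_equivalence_def
proof (intro conjI allI ballI impI)
  interpret A: cdga A by fact
  interpret B: cdga B by fact
  show m: "dga_map A B p" by (rule trivial_fibration_dga_map) fact
  fix n
  show "\<exists>y\<in>cocycles A n. cohomologous B n (p n y) z" if "z \<in> cocycles B n" for z
    using trivial_fibration_cocycle_lift[OF assms that] B.cohomologous_refl[OF B.cocyclesD[OF that]] by metis
  fix y y' assume y: "y \<in> cocycles A n" "y' \<in> cocycles A n" "cohomologous B n (p n y) (p n y')"
  hence "p n (y \<oplus>\<^bsub>gr A n\<^esub> (-1) \<odot>\<^bsub>gr A n\<^esub> y') \<in> coboundaries B n"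
    using dga_map_diff_coboundary[OF m assms(2,3)] by blast
  hence "y \<oplus>\<^bsub>gr A n\<^esub> (-1) \<odot>\<^bsub>gr A n\<^esub> y' \<in> coboundaries A n"
    using y by (intro trivial_fibration_kernel[OF assms] A.cocycles_add A.cocycles_smult)
  thus "cohomologous A n y y'" using y A.cocyclesD by (simp add: A.cohomologous_iff_diff)
qed

text \<open>
  The class of \<open>a\<close> is mapped to \<open>0\<close> in \<open>B\<close>, so \<open>a\<close> has a primitive. Its image differs from \<open>b\<close> by a
  cocycle, which by surjectivity is the image of a cocycle and not only cohomologous to such an image.
\<close>

lemma surjective_weak_equivalence:
  assumes w: "weak_equivalence A B p" and A: "cdga A" and B: "cdga B"
    and surj: "\<And>n b. b \<in> elts B n \<Longrightarrow> \<exists>a\<in>elts A n. p n a = b"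
  shows "trivial_fibration A B p"
  unfolding trivial_fibration_def
proof (intro conjI allI ballI impI)
  interpret A: cdga A by fact
  interpret B: cdga B by fact
  show m: "dga_map A B p" by (rule weak_equivalence_dga_map) fact
  note pz = dga_map_zero[OF m A B]
  have kill: "z \<in> coboundaries A n" if "z \<in> cocycles A n" "p n z \<in> coboundaries B n" for n z
  proof -
    have "cohomologous B n (p n z) (p n \<zero>\<^bsub>gr A n\<^esub>)"
      using that A.cocyclesD dga_mapD(1)[OF m] by (simp add: pz B.cohomologous_zero_iff)
    hence "cohomologous A n z \<zero>\<^bsub>gr A n\<^esub>"
      using w that(1) A.cocycles_zero unfolding weak_equivalence_def by blast
    thus ?thesis using that(1) A.cocyclesD by (simp add: A.cohomologous_zero_iff)
  qed
  show "z = \<zero>\<^bsub>gr A 0\<^esub>" if "z \<in> cocycles A 0" "p 0 z = \<zero>\<^bsub>gr B 0\<^esub>" for z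
    using kill[OF that(1)] that(2) by simp
  fix n b a assume b: "b \<in> elts B n" and a: "a \<in> cocycles A (Suc n)" and ab: "p (Suc n) a = gdiff B n b"
  obtain x0 where x0: "x0 \<in> elts A n" "a = gdiff A n x0" using kill[OF a] ab b by auto
  have px0: "p n x0 \<in> elts B n" using x0 dga_mapD(1)[OF m] by blast
  define z where "z = p n x0 \<oplus>\<^bsub>gr B n\<^esub> (-1) \<odot>\<^bsub>gr B n\<^esub> b"
  have "gdiff B n (p n x0) = gdiff B n b" using ab x0 dga_mapD(6)[OF m] by simp
  hence z: "z \<in> cocycles B n" using px0 b by (simp add: z_def cocycles_def B.diff_add B.diff_smult)
  then obtain y where y: "y \<in> cocycles A n" "cohomologous B n (p n y) z"
    using w unfolding weak_equivalence_def by blast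
  then obtain c where c: "c \<in> coboundaries B n" "p n y = c \<oplus>\<^bsub>gr B n\<^esub> z" by (auto simp: cohomologous_def)
  have "\<exists>c'\<in>coboundaries A n. p n c' = c"
  proof (cases n)
    case 0 thus ?thesis using c pz by simp
  next
    case (Suc m')
    then obtain e where e: "e \<in> elts B m'" "c = gdiff B m' e" using c by auto
    then obtain e' where "e' \<in> elts A m'" "p m' e' = e" using surj by blast
    thus ?thesis using e Suc dga_mapD(6)[OF m, of e' m'] by auto
  qed
  then obtain c' where c': "c' \<in> coboundaries A n" "p n c' = c" by blast
  define y' where "y' = y \<oplus>\<^bsub>gr A n\<^esub> (-1) \<odot>\<^bsub>gr A n\<^esub> c'"
  have y': "y' \<in> cocycles A n"
    unfolding y'_def using y(1) A.coboundaries_cocycles[OF c'(1)] by (intro A.cocycles_add A.cocycles_smult)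
  have ye: "y \<in> elts A n" "c' \<in> elts A n" "c \<in> elts B n" "z \<in> elts B n"
    using y c c' z A.cocyclesD A.coboundaries_closed B.coboundaries_closed B.cocyclesD by blast+
  have "p n y' = p n y \<oplus>\<^bsub>gr B n\<^esub> (-1) \<odot>\<^bsub>gr B n\<^esub> c"
    using ye c' dga_mapD(2,3)[OF m] by (simp add: y'_def)
  also have "\<dots> = z" using ye c by (simp add: B.add_assoc)
  finally have py': "p n y' = z" .
  define x where "x = x0 \<oplus>\<^bsub>gr A n\<^esub> (-1) \<odot>\<^bsub>gr A n\<^esub> y'"
  have y'e: "y' \<in> elts A n" using y' A.cocyclesD by blast
  have "p n x = p n x0 \<oplus>\<^bsub>gr B n\<^esub> (-1) \<odot>\<^bsub>gr B n\<^esub> z"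
    using x0 y'e py' dga_mapD(2,3)[OF m] by (simp add: x_def)
  also have "\<dots> = b" using px0 b by (simp add: z_def B.smult_add_right B.smult_smult)
  finally have "p n x = b" .
  moreover have "gdiff A n x = a"
    using x0 y' y'e by (simp add: x_def A.diff_add A.diff_smult cocycles_def)
  moreover have "x \<in> elts A n" using x0 y'e by (simp add: x_def)
  ultimately show "\<exists>x\<in>elts A n. gdiff A n x = a \<and> p n x = b" by blast
qed

lemma weak_equivalence_cancel_left:
  assumes A: "cdga A" and B: "cdga B" and C: "cdga C"
    and f: "dga_map A B f" and g: "weak_equivalence B C g"
    and gf: "weak_equivalence A C (\<lambda>n x. g n (f n x))"
  shows "weak_equivalence A B f"
  unfolding weak_equivalence_def
proof (intro conjI allI ballI impI)
  note gm = weak_equivalence_dga_map[OF g]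
  show "dga_map A B f" by fact
  fix n
  show "\<exists>y\<in>cocycles A n. cohomologous B n (f n y) z" if z: "z \<in> cocycles B n" for z
  proof -
    have "g n z \<in> cocycles C n" using dga_map_cocycles[OF gm B C z] .
    then obtain y where y: "y \<in> cocycles A n" "cohomologous C n (g n (f n y)) (g n z)"
      using gf unfolding weak_equivalence_def by meson
    moreover have "f n y \<in> cocycles B n" using dga_map_cocycles[OF f A B y(1)] .
    ultimately show ?thesis using g z unfolding weak_equivalence_def by meson
  qed
  fix y y' assume y: "y \<in> cocycles A n" "y' \<in> cocycles A n" "cohomologous B n (f n y) (f n y')"
  have "f n y' \<in> elts B n" using dga_mapD(1)[OF f] y cdga.cocyclesD[OF A] by blast
  hence "cohomologous C n (g n (f n y)) (g n (f n y'))"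
    using dga_map_cohomologous[OF gm B C y(3)] by blast
  thus "cohomologous A n y y'" using gf y unfolding weak_equivalence_def by meson
qed

lemma weak_equivalence_cancel_right:
  assumes A: "cdga A" and B: "cdga B" and C: "cdga C"
    and f: "weak_equivalence A B f" and g: "dga_map B C g"
    and gf: "weak_equivalence A C (\<lambda>n x. g n (f n x))"
  shows "weak_equivalence B C g"
  unfolding weak_equivalence_def
proof (intro conjI allI ballI impI)
  interpret B: cdga B by fact
  interpret C: cdga C by fact
  note fm = weak_equivalence_dga_map[OF f]
  note fc = dga_map_cocycles[OF fm A B]
  show "dga_map B C g" by fact
  fix n
  show "\<exists>y\<in>cocycles B n. cohomologous C n (g n y) z" if z: "z \<in> cocycles C n" for z
    using gf z fc unfolding weak_equivalence_def by meson
  fix y y' assume y: "y \<in> cocycles B n" "y' \<in> cocycles B n" "cohomologous C n (g n y) (g n y')"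
  obtain x where x: "x \<in> cocycles A n" "cohomologous B n (f n x) y"
    using f y(1) unfolding weak_equivalence_def by meson
  obtain x' where x': "x' \<in> cocycles A n" "cohomologous B n (f n x') y'"
    using f y(2) unfolding weak_equivalence_def by meson
  note el = B.cocyclesD[OF fc[OF x(1)]] B.cocyclesD[OF fc[OF x'(1)]] B.cocyclesD[OF y(1)] B.cocyclesD[OF y(2)]
  have "cohomologous C n (g n (f n x)) (g n y)" "cohomologous C n (g n y') (g n (f n x'))"
    using dga_map_cohomologous[OF g B C x(2)] dga_map_cohomologous[OF g B C x'(2)] el dga_mapD(1)[OF g]
      C.cohomologous_sym by blast+
  hence "cohomologous C n (g n (f n x)) (g n (f n x'))"
    using y(3) el dga_mapD(1)[OF g] C.cohomologous_trans by meson
  hence "cohomologous A n x x'" using gf x x' unfolding weak_equivalence_def by meson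
  hence "cohomologous B n (f n x) (f n x')"
    using dga_map_cohomologous[OF fm A B] x' cdga.cocyclesD[OF A] by blast
  thus "cohomologous B n y y'"
    using x x' el B.cohomologous_sym B.cohomologous_trans by meson
qed

lemma weak_equivalence_comp:
  assumes A: "cdga A" and B: "cdga B" and C: "cdga C"
    and f: "weak_equivalence A B f" and g: "weak_equivalence B C g"
  shows "weak_equivalence A C (\<lambda>n x. g n (f n x))"
  unfolding weak_equivalence_def
proof (intro conjI allI ballI impI)
  interpret C: cdga C by fact
  note fm = weak_equivalence_dga_map[OF f] and gm = weak_equivalence_dga_map[OF g]
  note fc = dga_map_cocycles[OF fm A B] and gc = dga_map_cocycles[OF gm B C]
  show "dga_map A C (\<lambda>n x. g n (f n x))" by (rule dga_map_comp[OF fm gm])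
  fix n
  show "\<exists>y\<in>cocycles A n. cohomologous C n (g n (f n y)) z" if z: "z \<in> cocycles C n" for z
  proof -
    obtain y where y: "y \<in> cocycles B n" "cohomologous C n (g n y) z"
      using g z unfolding weak_equivalence_def by meson
    obtain x where x: "x \<in> cocycles A n" "cohomologous B n (f n x) y"
      using f y unfolding weak_equivalence_def by meson
    have "cohomologous C n (g n (f n x)) (g n y)"
      using dga_map_cohomologous[OF gm B C x(2)] y(1) cdga.cocyclesD[OF B] by blast
    thus ?thesis using x(1) y(2) z C.cocyclesD C.cohomologous_trans by meson
  qed
  fix y y' assume "y \<in> cocycles A n" "y' \<in> cocycles A n" "cohomologous C n (g n (f n y)) (g n (f n y'))"
  thus "cohomologous A n y y'" using f g fc unfolding weak_equivalence_def by meson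
qed

lemma weak_equivalence_cong:
  assumes "cdga A" "weak_equivalence A B f" "\<And>n x. x \<in> elts A n \<Longrightarrow> f n x = g n x"
  shows "weak_equivalence A B g"
proof -
  have eq: "g n x = f n x" if "x \<in> cocycles A n" for n x
    using assms(3) cdga.cocyclesD[OF assms(1) that] by simp
  have "dga_map A B g"
    using dga_map_cong[OF assms(1) weak_equivalence_dga_map[OF assms(2)] assms(3)] .
  thus ?thesis using assms(2) unfolding weak_equivalence_def by (simp add: eq cong: ball_cong bex_cong)
qed

lemma bijective_weak_equivalence:
  assumes "cdga A" "cdga B" "dga_map A B f" "dga_map B A g"
    and gf: "\<And>n x. x \<in> elts A n \<Longrightarrow> g n (f n x) = x" and fg: "\<And>n x. x \<in> elts B n \<Longrightarrow> f n (g n x) = x"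
  shows "weak_equivalence A B f"
  unfolding weak_equivalence_def
proof (intro conjI allI ballI impI)
  interpret A: cdga A by fact
  interpret B: cdga B by fact
  show "dga_map A B f" by fact
  fix n
  show "\<exists>y\<in>cocycles A n. cohomologous B n (f n y) z" if "z \<in> cocycles B n" for z
    using dga_map_cocycles[OF assms(4,2,1) that] fg[OF B.cocyclesD[OF that]]
      B.cohomologous_refl[OF B.cocyclesD[OF that]] by metis
  fix y y' assume y: "y \<in> cocycles A n" "y' \<in> cocycles A n" "cohomologous B n (f n y) (f n y')"
  have "cohomologous A n (g n (f n y)) (g n (f n y'))"
    using dga_map_cohomologous[OF assms(4,2,1) y(3)] dga_mapD(1)[OF assms(3)] y A.cocyclesD by blast
  thus "cohomologous A n y y'" using gf y A.cocyclesD by metis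
qed

section \<open>The cohomology algebra\<close>

context cdga
begin

lemma coh_rep_eq_SOME: "coh_rep A n x = (SOME y. cohomologous A n y x)"
  unfolding coh_rep_def cohomologous_def a_r_coset_def' by (rule arg_cong[of _ _ Eps]) auto

lemma coh_rep_cohomologous:
  assumes "x \<in> cocycles A n" shows "cohomologous A n (coh_rep A n x) x"
  unfolding coh_rep_eq_SOME by (rule someI[of _ x]) (simp add: assms cohomologous_refl cocyclesD)

lemma coh_rep_closed:
  assumes "x \<in> cocycles A n" shows "coh_rep A n x \<in> cocycles A n"
  using coh_rep_cohomologous[OF assms] assms coboundaries_cocycles cocycles_add
  unfolding cohomologous_def by metis

lemma coh_rep_eqI:
  assumes "x \<in> cocycles A n" "y \<in> cocycles A n" "cohomologous A n x y"
  shows "coh_rep A n x = coh_rep A n y"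
proof -
  have "cohomologous A n z x \<longleftrightarrow> cohomologous A n z y" for z
    using assms cohomologous_trans cohomologous_sym cocyclesD by meson
  thus ?thesis by (simp add: coh_rep_eq_SOME)
qed

lemma coh_rep_eq_iff:
  assumes "x \<in> cocycles A n" "y \<in> cocycles A n"
  shows "coh_rep A n x = coh_rep A n y \<longleftrightarrow> cohomologous A n x y"
proof
  assume "coh_rep A n x = coh_rep A n y"
  with coh_rep_cohomologous[OF assms(1)] coh_rep_cohomologous[OF assms(2)]
  show "cohomologous A n x y" using assms cocyclesD cohomologous_sym cohomologous_trans by metis
qed (rule coh_rep_eqI[OF assms])

lemma coh_rep_idem: "x \<in> cocycles A n \<Longrightarrow> coh_rep A n (coh_rep A n x) = coh_rep A n x"
  by (intro coh_rep_eqI coh_rep_closed coh_rep_cohomologous)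

lemma coh_rep_add:
  "x \<in> cocycles A n \<Longrightarrow> y \<in> cocycles A n \<Longrightarrow>
   coh_rep A n (coh_rep A n x \<oplus>\<^bsub>gr A n\<^esub> coh_rep A n y) = coh_rep A n (x \<oplus>\<^bsub>gr A n\<^esub> y)"
  by (intro coh_rep_eqI cocycles_add coh_rep_closed cohomologous_add coh_rep_cohomologous cocyclesD)

lemma coh_rep_smult:
  "x \<in> cocycles A n \<Longrightarrow> coh_rep A n (c \<odot>\<^bsub>gr A n\<^esub> coh_rep A n x) = coh_rep A n (c \<odot>\<^bsub>gr A n\<^esub> x)"
  by (intro coh_rep_eqI cocycles_smult coh_rep_closed cohomologous_smult coh_rep_cohomologous cocyclesD)

lemma coh_rep_mult:
  "x \<in> cocycles A p \<Longrightarrow> y \<in> cocycles A q \<Longrightarrow>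
   coh_rep A (p + q) (gmult A p q (coh_rep A p x) (coh_rep A q y)) = coh_rep A (p + q) (gmult A p q x y)"
  by (intro coh_rep_eqI cocycles_mult coh_rep_closed cohomologous_mult coh_rep_cohomologous)

lemma cohomology_simps:
  "elts (cohomology A) n = coh_rep A n ` cocycles A n"
  "\<zero>\<^bsub>gr (cohomology A) n\<^esub> = coh_rep A n \<zero>\<^bsub>gr A n\<^esub>"
  "x \<oplus>\<^bsub>gr (cohomology A) n\<^esub> y = coh_rep A n (x \<oplus>\<^bsub>gr A n\<^esub> y)"
  "c \<odot>\<^bsub>gr (cohomology A) n\<^esub> x = coh_rep A n (c \<odot>\<^bsub>gr A n\<^esub> x)"
  "gmult (cohomology A) p q x y = coh_rep A (p + q) (gmult A p q x y)"
  "gone (cohomology A) = coh_rep A 0 (gone A)"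
  "gdiff (cohomology A) n x = coh_rep A (Suc n) \<zero>\<^bsub>gr A (Suc n)\<^esub>"
  by (simp_all add: cohomology_def)

lemma cdga_cohomology: "cdga (cohomology A)"
proof -
  note C [simp] = cocyclesD coh_rep_closed cocycles_add cocycles_smult cocycles_zero cocycles_one cocycles_mult
    coh_rep_idem coh_rep_add coh_rep_smult coh_rep_mult
  have mult0: "gmult A p q x \<zero>\<^bsub>gr A q\<^esub> = \<zero>\<^bsub>gr A (p + q)\<^esub>" "gmult A q p \<zero>\<^bsub>gr A q\<^esub> x = \<zero>\<^bsub>gr A (q + p)\<^esub>"
    if "x \<in> cocycles A p" for p q x using that by simp_all
  show ?thesis
  proof (rule cdgaI)
    fix n
    show "rat_space (gr (cohomology A) n)"
    proof (rule rat_spaceI; (unfold cohomology_simps)?; (elim imageE; hypsubst)?)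
      fix u v w assume uvw: "u \<in> cocycles A n" "v \<in> cocycles A n" "w \<in> cocycles A n"
      show "coh_rep A n (coh_rep A n (coh_rep A n u \<oplus>\<^bsub>gr A n\<^esub> coh_rep A n v) \<oplus>\<^bsub>gr A n\<^esub> coh_rep A n w) =
        coh_rep A n (coh_rep A n u \<oplus>\<^bsub>gr A n\<^esub> coh_rep A n (coh_rep A n v \<oplus>\<^bsub>gr A n\<^esub> coh_rep A n w))"
        using uvw by (simp add: add_assoc)
    next
      fix u v assume "u \<in> cocycles A n" "v \<in> cocycles A n"
      thus "coh_rep A n (coh_rep A n u \<oplus>\<^bsub>gr A n\<^esub> coh_rep A n v) = coh_rep A n (coh_rep A n v \<oplus>\<^bsub>gr A n\<^esub> coh_rep A n u)"
        by (simp add: add_comm)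
    next
      fix a b u assume "u \<in> cocycles A n"
      thus "coh_rep A n ((a * b) \<odot>\<^bsub>gr A n\<^esub> coh_rep A n u) = coh_rep A n (a \<odot>\<^bsub>gr A n\<^esub> coh_rep A n (b \<odot>\<^bsub>gr A n\<^esub> coh_rep A n u))"
        by (simp add: smult_smult)
    next
      fix a b u assume "u \<in> cocycles A n"
      thus "coh_rep A n ((a + b) \<odot>\<^bsub>gr A n\<^esub> coh_rep A n u) =
        coh_rep A n (coh_rep A n (a \<odot>\<^bsub>gr A n\<^esub> coh_rep A n u) \<oplus>\<^bsub>gr A n\<^esub> coh_rep A n (b \<odot>\<^bsub>gr A n\<^esub> coh_rep A n u))"
        by (simp add: smult_add_left del: coh_rep_smult)
    qed (simp_all add: smult_add_right)
  next
    fix p q x y assume xy: "x \<in> elts (cohomology A) p" "y \<in> elts (cohomology A) q"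
    then obtain u v where uv: "u \<in> cocycles A p" "v \<in> cocycles A q" "x = coh_rep A p u" "y = coh_rep A q v"
      by (auto simp: cohomology_simps)
    show "gmult (cohomology A) p q x y =
      (- 1) ^ (p * q) \<odot>\<^bsub>gr (cohomology A) (p + q)\<^esub> gmult (cohomology A) q p y x"
      using uv coh_rep_smult[OF cocycles_mult[OF uv(2,1)], of "(-1)^(p*q)"]
        coh_rep_mult[OF uv(1,2)] coh_rep_mult[OF uv(2,1)] graded_comm[OF cocyclesD[OF uv(1)] cocyclesD[OF uv(2)]]
      by (simp add: cohomology_simps add.commute)
    show "gmult (cohomology A) p q x y \<in> elts (cohomology A) (p + q)"
      using uv by (simp add: cohomology_simps)
    have "coh_rep A (Suc (p + q)) (gmult A p (Suc q) u (coh_rep A (Suc q) \<zero>\<^bsub>gr A (Suc q)\<^esub>)) =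
         coh_rep A (Suc (p + q)) \<zero>\<^bsub>gr A (Suc (p + q))\<^esub>"
      "coh_rep A (Suc (p + q)) (gmult A (Suc p) q (coh_rep A (Suc p) \<zero>\<^bsub>gr A (Suc p)\<^esub>) v) =
         coh_rep A (Suc (p + q)) \<zero>\<^bsub>gr A (Suc (p + q))\<^esub>"
      if "u \<in> cocycles A p" "v \<in> cocycles A q" "coh_rep A p u = u" "coh_rep A q v = v" for u v
      using coh_rep_mult[OF that(1) cocycles_zero, of "Suc q"] coh_rep_mult[OF cocycles_zero that(2), of "Suc p"] that
        mult0[of u p "Suc q"] mult0[of v q "Suc p"] by simp_all
    from this[of x y] show "gdiff (cohomology A) (p + q) (gmult (cohomology A) p q x y) =
        gmult (cohomology A) (Suc p) q (gdiff (cohomology A) p x) y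
        \<oplus>\<^bsub>gr (cohomology A) (Suc (p + q))\<^esub> (- 1) ^ p \<odot>\<^bsub>gr (cohomology A) (Suc (p + q))\<^esub>
          gmult (cohomology A) p (Suc q) x (gdiff (cohomology A) q y)"
      using uv by (simp add: cohomology_simps)
  next
    fix p q c x y assume "x \<in> elts (cohomology A) p" "y \<in> elts (cohomology A) q"
    thus "gmult (cohomology A) p q x (c \<odot>\<^bsub>gr (cohomology A) q\<^esub> y) =
        c \<odot>\<^bsub>gr (cohomology A) (p + q)\<^esub> gmult (cohomology A) p q x y"
      "gmult (cohomology A) p q (c \<odot>\<^bsub>gr (cohomology A) p\<^esub> x) y =
        c \<odot>\<^bsub>gr (cohomology A) (p + q)\<^esub> gmult (cohomology A) p q x y"
      by (auto simp: cohomology_simps mult_smult_right mult_smult_left)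
  next
    fix p q x y z assume "x \<in> elts (cohomology A) p" "y \<in> elts (cohomology A) q" "z \<in> elts (cohomology A) q"
    thus "gmult (cohomology A) p q x (y \<oplus>\<^bsub>gr (cohomology A) q\<^esub> z) =
        gmult (cohomology A) p q x y \<oplus>\<^bsub>gr (cohomology A) (p + q)\<^esub> gmult (cohomology A) p q x z"
      by (auto simp: cohomology_simps mult_add_right)
  next
    fix p q x y z assume "x \<in> elts (cohomology A) p" "y \<in> elts (cohomology A) p" "z \<in> elts (cohomology A) q"
    thus "gmult (cohomology A) p q (x \<oplus>\<^bsub>gr (cohomology A) p\<^esub> y) z =
        gmult (cohomology A) p q x z \<oplus>\<^bsub>gr (cohomology A) (p + q)\<^esub> gmult (cohomology A) p q y z"
      by (auto simp: cohomology_simps mult_add_left)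
  next
    fix p q r x y z assume "x \<in> elts (cohomology A) p" "y \<in> elts (cohomology A) q" "z \<in> elts (cohomology A) r"
    then obtain u v w where uvw: "u \<in> cocycles A p" "v \<in> cocycles A q" "w \<in> cocycles A r"
       "x = coh_rep A p u" "y = coh_rep A q v" "z = coh_rep A r w"
      by (auto simp: cohomology_simps)
    show "gmult (cohomology A) (p + q) r (gmult (cohomology A) p q x y) z =
      gmult (cohomology A) p (q + r) x (gmult (cohomology A) q r y z)"
      using uvw coh_rep_mult[OF cocycles_mult[OF uvw(1,2)] uvw(3)] coh_rep_mult[OF uvw(1) cocycles_mult[OF uvw(2,3)]]
        mult_assoc[OF uvw(1,2,3)[THEN cocyclesD]]
      by (simp add: cohomology_simps add.assoc)
  next
    fix p x assume "x \<in> elts (cohomology A) p"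
    then obtain u where u: "u \<in> cocycles A p" "x = coh_rep A p u" by (auto simp: cohomology_simps)
    show "gmult (cohomology A) 0 p (gone (cohomology A)) x = x"
      using coh_rep_mult[OF cocycles_one u(1)] u by (simp add: cohomology_simps mult_one_left)
    show "gmult (cohomology A) p 0 x (gone (cohomology A)) = x"
      using coh_rep_mult[OF u(1) cocycles_one] u by (simp add: cohomology_simps mult_one_right)
  qed (auto simp: cohomology_simps)
qed

end

lemma dga_map_coh_rep:
  assumes "dga_map A B f" "cdga A" "cdga B" "x \<in> cocycles A n"
  shows "coh_rep B n (f n (coh_rep A n x)) = coh_rep B n (f n x)"
proof -
  interpret A: cdga A by fact
  interpret B: cdga B by fact
  show ?thesis using assms(4)
    by (intro B.coh_rep_eqI dga_map_cocycles[OF assms(1-3)] A.coh_rep_closed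
          dga_map_cohomologous[OF assms(1-3)] A.coh_rep_cohomologous A.cocyclesD)
qed

lemma cohomology_map_rep:
  assumes "dga_map A B f" "cdga A" "cdga B" "x \<in> cocycles A n"
  shows "cohomology_map A B f n (coh_rep A n x) = coh_rep B n (f n x)"
  using dga_map_coh_rep[OF assms] assms(4) cdga.cohomology_simps(1)[OF assms(2)]
  by (simp add: cohomology_map_def)

lemma cohomology_map_hom:
  assumes "dga_map A B f" "cdga A" "cdga B"
  shows "cohomology_map A B f \<in> cdga_hom (cohomology A) (cohomology B)"
proof -
  interpret A: cdga A by fact
  interpret B: cdga B by fact
  note [simp] = A.cocyclesD B.cocyclesD A.coh_rep_closed B.coh_rep_closed A.cocycles_add A.cocycles_smult A.cocycles_mult
    A.cocycles_one A.cocycles_zero B.cocycles_add B.cocycles_smult B.cocycles_mult B.cocycles_one B.cocycles_zero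
    A.coh_rep_add A.coh_rep_smult A.coh_rep_mult B.coh_rep_add B.coh_rep_smult B.coh_rep_mult
  note [simp] = cohomology_map_rep[OF assms] dga_map_cocycles[OF assms] dga_map_zero[OF assms]
  have "dga_map (cohomology A) (cohomology B) (cohomology_map A B f)"
    unfolding dga_map_def A.cohomology_simps B.cohomology_simps ball_simps
    using dga_mapD[OF assms(1)] by simp
  thus ?thesis by (simp add: cdga_hom_iff cohomology_map_def)
qed

text \<open>This eliminates the chosen representatives of cohomology classes.\<close>

lemma quasi_iso_iff:
  assumes A: "cdga A" and B: "cdga B"
  shows "f \<in> quasi_iso A B \<longleftrightarrow> f \<in> cdga_hom A B \<and> weak_equivalence A B f"
proof -
  interpret A: cdga A by fact
  interpret B: cdga B by fact
  have "(\<forall>n. bij_betw (cohomology_map A B f n) (elts (cohomology A) n) (elts (cohomology B) n)) \<longleftrightarrow>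
     weak_equivalence A B f" if f: "dga_map A B f"
  proof -
    note map = cohomology_map_rep[OF f A B] and fc = dga_map_cocycles[OF f A B]
    have inj: "inj_on (cohomology_map A B f n) (elts (cohomology A) n) \<longleftrightarrow>
      (\<forall>y\<in>cocycles A n. \<forall>y'\<in>cocycles A n. cohomologous B n (f n y) (f n y') \<longrightarrow> cohomologous A n y y')" for n
      unfolding A.cohomology_simps inj_on_def ball_simps
      by (simp add: map fc A.coh_rep_eq_iff B.coh_rep_eq_iff)
    have "cohomology_map A B f n ` elts (cohomology A) n \<subseteq> elts (cohomology B) n" for n
      by (auto simp: A.cohomology_simps B.cohomology_simps map fc)
    hence "cohomology_map A B f n ` elts (cohomology A) n = elts (cohomology B) n \<longleftrightarrow>
      elts (cohomology B) n \<subseteq> cohomology_map A B f n ` elts (cohomology A) n" for n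
      by blast
    also have "\<dots> n \<longleftrightarrow> (\<forall>z\<in>cocycles B n. \<exists>y\<in>cocycles A n. coh_rep B n z = coh_rep B n (f n y))" for n
      unfolding A.cohomology_simps B.cohomology_simps image_subset_iff by (simp add: map image_iff)
    also have "\<dots> n \<longleftrightarrow> (\<forall>z\<in>cocycles B n. \<exists>y\<in>cocycles A n. cohomologous B n (f n y) z)" for n
    proof -
      have "coh_rep B n z = coh_rep B n (f n y) \<longleftrightarrow> cohomologous B n (f n y) z"
        if "z \<in> cocycles B n" "y \<in> cocycles A n" for z y
        using B.coh_rep_eq_iff[OF fc[OF that(2)] that(1)] by (simp add: eq_commute)
      thus ?thesis by (simp cong: ball_cong bex_cong)
    qed
    finally show ?thesis using f inj unfolding bij_betw_def weak_equivalence_def by auto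
  qed
  thus ?thesis unfolding quasi_iso_def by (auto simp: cdga_hom_iff)
qed

section \<open>Polynomial functions with values in a rational vector space\<close>

text \<open>
  \<open>poly_deriv M p p'\<close>: \<open>p\<close> is a polynomial function with coefficients in \<open>M\<close> and \<open>p'\<close> is its
  derivative. Functions are used rather than formal polynomials because products are then
  computed pointwise.
\<close>

inductive poly_deriv :: "(rat, 'a) module \<Rightarrow> (rat \<Rightarrow> 'a) \<Rightarrow> (rat \<Rightarrow> 'a) \<Rightarrow> bool" for M where
  monom: "b \<in> carrier M \<Longrightarrow>
     poly_deriv M (\<lambda>t. t ^ k \<odot>\<^bsub>M\<^esub> b) (\<lambda>t. (of_nat k * t ^ (k - 1)) \<odot>\<^bsub>M\<^esub> b)"
| add: "poly_deriv M p p' \<Longrightarrow> poly_deriv M q q' \<Longrightarrow>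
     poly_deriv M (\<lambda>t. p t \<oplus>\<^bsub>M\<^esub> q t) (\<lambda>t. p' t \<oplus>\<^bsub>M\<^esub> q' t)"

definition poly_fun :: "(rat, 'a) module \<Rightarrow> (rat \<Rightarrow> 'a) \<Rightarrow> bool" where
  "poly_fun M p \<longleftrightarrow> (\<exists>p'. poly_deriv M p p')"

primrec poly_sum :: "(rat, 'a) module \<Rightarrow> (nat \<Rightarrow> 'a) \<Rightarrow> nat \<Rightarrow> rat \<Rightarrow> 'a" where
  "poly_sum M b 0 t = \<zero>\<^bsub>M\<^esub>"
| "poly_sum M b (Suc m) t = poly_sum M b m t \<oplus>\<^bsub>M\<^esub> t ^ m \<odot>\<^bsub>M\<^esub> b m"

context rat_space
begin

lemma poly_deriv_closed: "poly_deriv M p p' \<Longrightarrow> p t \<in> carrier M \<and> p' t \<in> carrier M"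
  by (induction rule: poly_deriv.induct) auto

lemma poly_fun_closed: "poly_fun M p \<Longrightarrow> p t \<in> carrier M"
  using poly_deriv_closed unfolding poly_fun_def by blast

lemma poly_deriv_const: "b \<in> carrier M \<Longrightarrow> poly_deriv M (\<lambda>t. b) (\<lambda>t. \<zero>\<^bsub>M\<^esub>)"
  using poly_deriv.monom[of b M 0] by simp

lemma poly_deriv_smult: "poly_deriv M p p' \<Longrightarrow> poly_deriv M (\<lambda>t. c \<odot>\<^bsub>M\<^esub> p t) (\<lambda>t. c \<odot>\<^bsub>M\<^esub> p' t)"
proof (induction rule: poly_deriv.induct)
  case (monom b k)
  have "poly_deriv M (\<lambda>t. t ^ k \<odot>\<^bsub>M\<^esub> (c \<odot>\<^bsub>M\<^esub> b)) (\<lambda>t. (of_nat k * t ^ (k - 1)) \<odot>\<^bsub>M\<^esub> (c \<odot>\<^bsub>M\<^esub> b))"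
    by (rule poly_deriv.monom) (simp add: monom)
  thus ?case using monom by (simp add: smult_smult mult.commute)
next
  case (add p p' q q')
  from poly_deriv.add[OF add.IH] show ?case
    using add.hyps poly_deriv_closed by (simp add: smult_add_right)
qed

lemma poly_fun_add: "poly_fun M p \<Longrightarrow> poly_fun M q \<Longrightarrow> poly_fun M (\<lambda>t. p t \<oplus>\<^bsub>M\<^esub> q t)"
  unfolding poly_fun_def using poly_deriv.add by blast

lemma poly_fun_smult: "poly_fun M p \<Longrightarrow> poly_fun M (\<lambda>t. c \<odot>\<^bsub>M\<^esub> p t)"
  unfolding poly_fun_def using poly_deriv_smult by blast

lemma poly_fun_zero: "poly_fun M (\<lambda>t. \<zero>\<^bsub>M\<^esub>)"
  unfolding poly_fun_def using poly_deriv_const by blast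

lemma poly_fun_deriv: "poly_deriv M p p' \<Longrightarrow> poly_fun M p'"
proof (induction rule: poly_deriv.induct)
  case (monom b k)
  have "poly_deriv M (\<lambda>t. t ^ (k - 1) \<odot>\<^bsub>M\<^esub> (of_nat k \<odot>\<^bsub>M\<^esub> b))
     (\<lambda>t. (of_nat (k - 1) * t ^ (k - 1 - 1)) \<odot>\<^bsub>M\<^esub> (of_nat k \<odot>\<^bsub>M\<^esub> b))"
    by (rule poly_deriv.monom) (simp add: monom)
  hence "poly_fun M (\<lambda>t. t ^ (k - 1) \<odot>\<^bsub>M\<^esub> (of_nat k \<odot>\<^bsub>M\<^esub> b))" unfolding poly_fun_def by blast
  thus ?case using monom by (simp add: smult_smult mult.commute)
qed (rule poly_fun_add)

text \<open>
  Characteristic \<open>0\<close> enters through the division by \<open>k + 1\<close>. Antiderivatives and the constancy of functions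
  with vanishing derivative are what makes evaluation of polynomial forms at a point acyclic.
\<close>

lemma antiderivative:
  assumes "poly_fun M q" "b \<in> carrier M"
  shows "\<exists>r. poly_deriv M r q \<and> r s = b"
proof -
  obtain q' where "poly_deriv M q q'" using assms(1) by (auto simp: poly_fun_def)
  hence "\<exists>r. poly_deriv M r q"
  proof (induction rule: poly_deriv.induct)
    case (monom c k)
    have r: "poly_deriv M (\<lambda>t. t ^ Suc k \<odot>\<^bsub>M\<^esub> (inverse (of_nat (Suc k)) \<odot>\<^bsub>M\<^esub> c))
       (\<lambda>t. (of_nat (Suc k) * t ^ (Suc k - 1)) \<odot>\<^bsub>M\<^esub> (inverse (of_nat (Suc k)) \<odot>\<^bsub>M\<^esub> c))"
      by (rule poly_deriv.monom) (simp add: monom)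
    have eq: "(of_nat (Suc k) * t ^ (Suc k - 1)) \<odot>\<^bsub>M\<^esub> (inverse (of_nat (Suc k)) \<odot>\<^bsub>M\<^esub> c) = t ^ k \<odot>\<^bsub>M\<^esub> c" for t :: rat
      using monom by (simp add: smult_smult field_simps del: of_nat_Suc)
    show ?case by (rule exI) (rule r[unfolded eq])
  next
    case (add p p' q q')
    thus ?case using poly_deriv.add by blast
  qed
  then obtain r where r: "poly_deriv M r q" by blast
  have rs: "r s \<in> carrier M" using poly_deriv_closed[OF r] by blast
  have "poly_deriv M (\<lambda>t. r t \<oplus>\<^bsub>M\<^esub> (b \<oplus>\<^bsub>M\<^esub> (-1) \<odot>\<^bsub>M\<^esub> r s)) (\<lambda>t. q t \<oplus>\<^bsub>M\<^esub> \<zero>\<^bsub>M\<^esub>)"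
    using r rs assms(2) by (intro poly_deriv.add poly_deriv_const) auto
  thus ?thesis using rs assms(2) poly_deriv_closed[OF r]
    by (intro exI[of _ "\<lambda>t. r t \<oplus>\<^bsub>M\<^esub> (b \<oplus>\<^bsub>M\<^esub> (-1) \<odot>\<^bsub>M\<^esub> r s)"]) simp
qed

lemma poly_sum_closed: "(\<And>j. b j \<in> carrier M) \<Longrightarrow> poly_sum M b m t \<in> carrier M"
  by (induction m) auto

lemma poly_sum_add:
  assumes "\<And>j. b j \<in> carrier M" "\<And>j. c j \<in> carrier M"
  shows "poly_sum M (\<lambda>j. b j \<oplus>\<^bsub>M\<^esub> c j) m t = poly_sum M b m t \<oplus>\<^bsub>M\<^esub> poly_sum M c m t"
  by (induction m) (use assms in \<open>auto simp: smult_add_right add_ac poly_sum_closed\<close>)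

lemma poly_sum_pad:
  assumes "\<And>j. b j \<in> carrier M" "\<And>j. j \<ge> m \<Longrightarrow> b j = \<zero>\<^bsub>M\<^esub>" "m \<le> n"
  shows "poly_sum M b n t = poly_sum M b m t"
  using assms(3) by (induction n rule: dec_induct) (use assms in \<open>auto simp: poly_sum_closed\<close>)

text \<open>
  A polynomial function that vanishes everywhere has vanishing coefficients: if \<open>p\<close> has \<open>m + 1\<close>
  coefficients, then \<open>p (2 t) - 2 ^ m * p t\<close> has only \<open>m\<close>, namely the old ones up to non-zero factors.
\<close>

lemma poly_sum_identity:
  assumes "\<And>j. b j \<in> carrier M" "\<And>t. poly_sum M b m t = \<zero>\<^bsub>M\<^esub>" "j < m"
  shows "b j = \<zero>\<^bsub>M\<^esub>"
  using assms
proof (induction m arbitrary: b j)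
  case (Suc m)
  note b = Suc.prems(1)
  have scale: "poly_sum M b k (2 * t) \<oplus>\<^bsub>M\<^esub> (- c) \<odot>\<^bsub>M\<^esub> poly_sum M b k t = poly_sum M (\<lambda>j. (2 ^ j - c) \<odot>\<^bsub>M\<^esub> b j) k t" for k c t
  proof (induction k)
    case (Suc k)
    have "((2 * t) ^ k) \<odot>\<^bsub>M\<^esub> b k \<oplus>\<^bsub>M\<^esub> (- c) \<odot>\<^bsub>M\<^esub> (t ^ k \<odot>\<^bsub>M\<^esub> b k) = t ^ k \<odot>\<^bsub>M\<^esub> ((2 ^ k - c) \<odot>\<^bsub>M\<^esub> b k)"
      using b by (simp add: smult_smult smult_add_left[symmetric] algebra_simps power_mult_distrib)
    thus ?case using b Suc.IH[symmetric] by (simp add: poly_sum_closed smult_add_right add_ac)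
  qed simp
  have "poly_sum M (\<lambda>j. (2 ^ j - 2 ^ m) \<odot>\<^bsub>M\<^esub> b j) m t = \<zero>\<^bsub>M\<^esub>"
    for t
  proof -
    have "poly_sum M (\<lambda>j. (2 ^ j - 2 ^ m) \<odot>\<^bsub>M\<^esub> b j) (Suc m) t = \<zero>\<^bsub>M\<^esub>"
      unfolding scale[symmetric] Suc.prems(2) by simp
    thus ?thesis using b by (simp add: poly_sum_closed)
  qed
  hence "(2 ^ i - 2 ^ m) \<odot>\<^bsub>M\<^esub> b i = \<zero>\<^bsub>M\<^esub>" if "i < m" for i
    using Suc.IH[of "\<lambda>j. (2 ^ j - 2 ^ m) \<odot>\<^bsub>M\<^esub> b j" i] b that by simp
  moreover have "(2::rat) ^ i - 2 ^ m \<noteq> 0" if "i < m" for i using that by simp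
  ultimately have low: "b i = \<zero>\<^bsub>M\<^esub>" if "i < m" for i
    using smult_eq_zero[OF b] that by blast
  hence "poly_sum M b k 1 = \<zero>\<^bsub>M\<^esub>" if "k \<le> m" for k using that by (induction k) auto
  hence "b m = \<zero>\<^bsub>M\<^esub>" using Suc.prems(2)[of 1] b by simp
  thus ?case using low Suc.prems(3) less_Suc_eq by auto
qed simp

lemma poly_deriv_poly_sum:
  assumes "poly_deriv M p p'"
  obtains b m where "\<And>j. b j \<in> carrier M" "\<And>j. j \<ge> m \<Longrightarrow> b j = \<zero>\<^bsub>M\<^esub>" "\<And>t. p t = poly_sum M b m t"
    "\<And>t. p' t = poly_sum M (\<lambda>k. of_nat (Suc k) \<odot>\<^bsub>M\<^esub> b (Suc k)) m t"
  using assms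
proof (induction arbitrary: thesis rule: poly_deriv.induct)
  case (monom c k)
  define b where "b j = (if j = k then c else \<zero>\<^bsub>M\<^esub>)" for j
  have b: "b j \<in> carrier M" for j using monom by (simp add: b_def)
  have 1: "poly_sum M b (Suc j) t = (if k \<le> j then t ^ k \<odot>\<^bsub>M\<^esub> c else \<zero>\<^bsub>M\<^esub>)" for j t
    by (induction j) (use monom in \<open>auto simp: b_def le_Suc_eq\<close>)
  have 2: "poly_sum M (\<lambda>i. of_nat (Suc i) \<odot>\<^bsub>M\<^esub> b (Suc i)) j t =
      (if 0 < k \<and> k \<le> j then (of_nat k * t ^ (k - 1)) \<odot>\<^bsub>M\<^esub> c else \<zero>\<^bsub>M\<^esub>)" for j t
    by (induction j) (use monom in \<open>auto simp: b_def le_Suc_eq smult_smult mult.commute\<close>)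
  show ?case
  proof (rule monom.prems[OF b, of "Suc k"])
    show "b j = \<zero>\<^bsub>M\<^esub>" if "j \<ge> Suc k" for j using that by (simp add: b_def)
    show "t ^ k \<odot>\<^bsub>M\<^esub> c = poly_sum M b (Suc k) t" for t unfolding 1 by simp
    show "(of_nat k * t ^ (k - 1)) \<odot>\<^bsub>M\<^esub> c = poly_sum M (\<lambda>k. of_nat (Suc k) \<odot>\<^bsub>M\<^esub> b (Suc k)) (Suc k) t" for t
      unfolding 2 using monom.hyps by simp
  qed
next
  case (add p p' q q')
  obtain b m where b: "\<And>j. b j \<in> carrier M" "\<And>j. j \<ge> m \<Longrightarrow> b j = \<zero>\<^bsub>M\<^esub>" "\<And>t. p t = poly_sum M b m t"
    "\<And>t. p' t = poly_sum M (\<lambda>k. of_nat (Suc k) \<odot>\<^bsub>M\<^esub> b (Suc k)) m t" using add.IH(1) by blast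
  obtain c n where c: "\<And>j. c j \<in> carrier M" "\<And>j. j \<ge> n \<Longrightarrow> c j = \<zero>\<^bsub>M\<^esub>" "\<And>t. q t = poly_sum M c n t"
    "\<And>t. q' t = poly_sum M (\<lambda>k. of_nat (Suc k) \<odot>\<^bsub>M\<^esub> c (Suc k)) n t" using add.IH(2) by blast
  let ?k = "max m n"
  have p: "p t = poly_sum M b ?k t" "q t = poly_sum M c ?k t" for t
    using b c poly_sum_pad[of b m ?k t] poly_sum_pad[of c n ?k t] by auto
  have p': "p' t = poly_sum M (\<lambda>k. of_nat (Suc k) \<odot>\<^bsub>M\<^esub> b (Suc k)) ?k t"
    "q' t = poly_sum M (\<lambda>k. of_nat (Suc k) \<odot>\<^bsub>M\<^esub> c (Suc k)) ?k t" for t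
    using b(1,2,4) c(1,2,4) poly_sum_pad[of "\<lambda>k. of_nat (Suc k) \<odot>\<^bsub>M\<^esub> b (Suc k)" m ?k t]
      poly_sum_pad[of "\<lambda>k. of_nat (Suc k) \<odot>\<^bsub>M\<^esub> c (Suc k)" n ?k t] by auto
  show ?case
  proof (rule add.prems[of "\<lambda>j. b j \<oplus>\<^bsub>M\<^esub> c j" ?k])
    show "p' t \<oplus>\<^bsub>M\<^esub> q' t = poly_sum M (\<lambda>k. of_nat (Suc k) \<odot>\<^bsub>M\<^esub> (b (Suc k) \<oplus>\<^bsub>M\<^esub> c (Suc k))) ?k t" for t
      using b c unfolding p' by (simp add: smult_add_right poly_sum_add del: of_nat_Suc)
  qed (use b c in \<open>auto simp: p poly_sum_add\<close>)
qed

lemma zero_derivative_const: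
  assumes "poly_deriv M p p'" "\<And>t. p' t = \<zero>\<^bsub>M\<^esub>" shows "p t = p s"
proof -
  obtain b m where b: "\<And>j. b j \<in> carrier M" "\<And>j. j \<ge> m \<Longrightarrow> b j = \<zero>\<^bsub>M\<^esub>" "\<And>t. p t = poly_sum M b m t"
    "\<And>t. p' t = poly_sum M (\<lambda>k. of_nat (Suc k) \<odot>\<^bsub>M\<^esub> b (Suc k)) m t"
    using poly_deriv_poly_sum[OF assms(1)] by blast
  have 0: "of_nat (Suc j) \<odot>\<^bsub>M\<^esub> b (Suc j) = \<zero>\<^bsub>M\<^esub>" if "j < m" for j
  proof (rule poly_sum_identity[of "\<lambda>k. of_nat (Suc k) \<odot>\<^bsub>M\<^esub> b (Suc k)" m])
    show "poly_sum M (\<lambda>k. of_nat (Suc k) \<odot>\<^bsub>M\<^esub> b (Suc k)) m t = \<zero>\<^bsub>M\<^esub>" for t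
      using b(4)[of t] assms(2)[of t] by metis
  qed (use b that in auto)
  have "b (Suc j) = \<zero>\<^bsub>M\<^esub>" for j
  proof (cases "j < m")
    case True thus ?thesis using smult_eq_zero[OF b(1) 0[OF True]] by (simp del: of_nat_Suc)
  qed (simp add: b(2))
  hence "poly_sum M b k t = (if k = 0 then \<zero>\<^bsub>M\<^esub> else b 0)" for k t
    by (induction k) (auto simp: b gr0_conv_Suc power_0_left)
  thus ?thesis by (simp add: b)
qed

lemma poly_deriv_unique:
  assumes "poly_deriv M p r" "poly_deriv M q r" "p s = q s" shows "p t = q t"
proof -
  note cl = poly_deriv_closed[OF assms(1)] poly_deriv_closed[OF assms(2)]
  have "poly_deriv M (\<lambda>t. p t \<oplus>\<^bsub>M\<^esub> (-1) \<odot>\<^bsub>M\<^esub> q t) (\<lambda>t. r t \<oplus>\<^bsub>M\<^esub> (-1) \<odot>\<^bsub>M\<^esub> r t)"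
    by (intro poly_deriv.add poly_deriv_smult assms)
  from zero_derivative_const[OF this, of t s]
  have "p t \<oplus>\<^bsub>M\<^esub> (-1) \<odot>\<^bsub>M\<^esub> q t = \<zero>\<^bsub>M\<^esub>" using cl assms(3) by simp
  thus ?thesis using cl eq_iff_diff by blast
qed

end

lemma poly_deriv_linear:
  assumes "poly_deriv M p p'" "rat_space M"
    and f: "\<And>x. x \<in> carrier M \<Longrightarrow> f x \<in> carrier N"
      "\<And>x y. x \<in> carrier M \<Longrightarrow> y \<in> carrier M \<Longrightarrow> f (x \<oplus>\<^bsub>M\<^esub> y) = f x \<oplus>\<^bsub>N\<^esub> f y"
      "\<And>c x. x \<in> carrier M \<Longrightarrow> f (c \<odot>\<^bsub>M\<^esub> x) = c \<odot>\<^bsub>N\<^esub> f x"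
  shows "poly_deriv N (\<lambda>t. f (p t)) (\<lambda>t. f (p' t))"
  using assms(1)
proof (induction rule: poly_deriv.induct)
  case (monom b k)
  thus ?case using poly_deriv.monom[OF f(1)[OF monom], of k] f(3) by simp
next
  case (add p p' q q')
  thus ?case using poly_deriv.add[OF add.IH] f(2) rat_space.poly_deriv_closed[OF assms(2)] by simp
qed

text \<open>Lift the coefficients.\<close>

lemma poly_deriv_lift:
  assumes "poly_deriv N p p'" "rat_space M"
    and f: "\<And>y. y \<in> carrier N \<Longrightarrow> \<exists>x\<in>carrier M. f x = y"
      "\<And>x y. x \<in> carrier M \<Longrightarrow> y \<in> carrier M \<Longrightarrow> f (x \<oplus>\<^bsub>M\<^esub> y) = f x \<oplus>\<^bsub>N\<^esub> f y"
      "\<And>c x. x \<in> carrier M \<Longrightarrow> f (c \<odot>\<^bsub>M\<^esub> x) = c \<odot>\<^bsub>N\<^esub> f x"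
  shows "\<exists>q q'. poly_deriv M q q' \<and> p = (\<lambda>t. f (q t)) \<and> p' = (\<lambda>t. f (q' t))"
  using assms(1)
proof (induction rule: poly_deriv.induct)
  case (monom b k)
  then obtain x where "x \<in> carrier M" "f x = b" using f(1) by blast
  thus ?case using poly_deriv.monom[of x M k] f(3)[of x]
    by (intro exI[of _ "\<lambda>t. t ^ k \<odot>\<^bsub>M\<^esub> x"] exI[of _ "\<lambda>t. (of_nat k * t ^ (k - 1)) \<odot>\<^bsub>M\<^esub> x"]) simp
next
  case (add p p' q q')
  then obtain u u' v v' where *: "poly_deriv M u u'" "p = (\<lambda>t. f (u t))" "p' = (\<lambda>t. f (u' t))"
    "poly_deriv M v v'" "q = (\<lambda>t. f (v t))" "q' = (\<lambda>t. f (v' t))" by blast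
  show ?case
    using poly_deriv.add[OF *(1,4)] * rat_space.poly_deriv_closed[OF assms(2) *(1)]
      rat_space.poly_deriv_closed[OF assms(2) *(4)] f(2)
    by (intro exI[of _ "\<lambda>t. u t \<oplus>\<^bsub>M\<^esub> v t"] exI[of _ "\<lambda>t. u' t \<oplus>\<^bsub>M\<^esub> v' t"]) simp
qed

text \<open>The product rule. By bilinearity it is enough to multiply two monomials.\<close>

lemma poly_deriv_bilinear:
  assumes p: "poly_deriv M p p'" and q: "poly_deriv N q q'"
    and M: "rat_space M" and N: "rat_space N" and L: "rat_space L"
    and f: "\<And>x y. x \<in> carrier M \<Longrightarrow> y \<in> carrier N \<Longrightarrow> f x y \<in> carrier L"
      "\<And>x y z. x \<in> carrier M \<Longrightarrow> y \<in> carrier M \<Longrightarrow> z \<in> carrier N \<Longrightarrow> f (x \<oplus>\<^bsub>M\<^esub> y) z = f x z \<oplus>\<^bsub>L\<^esub> f y z"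
      "\<And>x y z. x \<in> carrier M \<Longrightarrow> y \<in> carrier N \<Longrightarrow> z \<in> carrier N \<Longrightarrow> f x (y \<oplus>\<^bsub>N\<^esub> z) = f x y \<oplus>\<^bsub>L\<^esub> f x z"
      "\<And>c x y. x \<in> carrier M \<Longrightarrow> y \<in> carrier N \<Longrightarrow> f (c \<odot>\<^bsub>M\<^esub> x) y = c \<odot>\<^bsub>L\<^esub> f x y"
      "\<And>c x y. x \<in> carrier M \<Longrightarrow> y \<in> carrier N \<Longrightarrow> f x (c \<odot>\<^bsub>N\<^esub> y) = c \<odot>\<^bsub>L\<^esub> f x y"
  shows "poly_deriv L (\<lambda>t. f (p t) (q t)) (\<lambda>t. f (p' t) (q t) \<oplus>\<^bsub>L\<^esub> f (p t) (q' t))"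
proof -
  interpret M: rat_space M by fact
  interpret N: rat_space N by fact
  interpret L: rat_space L by fact
  show ?thesis using p
  proof (induction rule: poly_deriv.induct)
    case (monom b k)
    show ?case using q
    proof (induction rule: poly_deriv.induct)
      case (monom c l)
      note bc = \<open>b \<in> carrier M\<close> \<open>c \<in> carrier N\<close>
      have 1: "t ^ k * t ^ l = t ^ (k + l)" for t :: rat by (simp add: power_add)
      have 2: "of_nat k * t ^ (k - 1) * t ^ l + t ^ k * (of_nat l * t ^ (l - 1)) = of_nat (k + l) * t ^ (k + l - 1)" for t :: rat
        by (cases k; cases l) (simp_all add: algebra_simps power_add)
      have "(\<lambda>t. f (t ^ k \<odot>\<^bsub>M\<^esub> b) (t ^ l \<odot>\<^bsub>N\<^esub> c)) = (\<lambda>t. t ^ (k + l) \<odot>\<^bsub>L\<^esub> f b c)"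
        using bc f(1) by (simp add: f(4,5) L.smult_smult 1[symmetric] mult.commute)
      moreover have "(\<lambda>t. f ((of_nat k * t ^ (k - 1)) \<odot>\<^bsub>M\<^esub> b) (t ^ l \<odot>\<^bsub>N\<^esub> c) \<oplus>\<^bsub>L\<^esub>
          f (t ^ k \<odot>\<^bsub>M\<^esub> b) ((of_nat l * t ^ (l - 1)) \<odot>\<^bsub>N\<^esub> c)) =
        (\<lambda>t. (of_nat (k + l) * t ^ (k + l - 1)) \<odot>\<^bsub>L\<^esub> f b c)"
        unfolding 2[symmetric]
        using bc f(1) by (simp add: f(4,5) L.smult_smult L.smult_add_left mult.commute mult.left_commute)
      ultimately show ?case using poly_deriv.monom[OF f(1)[OF bc], of "k + l"] by simp
    next
      case (add q q' r r')
      note cl = N.poly_deriv_closed[OF add.hyps(1)] N.poly_deriv_closed[OF add.hyps(2)]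
      from poly_deriv.add[OF add.IH] show ?case
        using cl \<open>b \<in> carrier M\<close> f(1) by (simp add: f(3) L.add_ac)
    qed
  next
    case (add r r' s s')
    note cl = M.poly_deriv_closed[OF add.hyps(1)] M.poly_deriv_closed[OF add.hyps(2)] N.poly_deriv_closed[OF q]
    from poly_deriv.add[OF add.IH] show ?case
      using cl f(1) by (simp add: f(2) L.add_ac)
  qed
qed

section \<open>The path algebra\<close>

text \<open>
  \<open>lower B n\<close> is the space of elements of degree \<open>n - 1\<close>, which is trivial for \<open>n = 0\<close>. It is the
  space of coefficients \<open>c\<close> of the forms \<open>dt \<cdot> c\<close> of degree \<open>n\<close>; the following operations are the
  products \<open>(dt \<cdot> c) \<cdot> y\<close> and \<open>x \<cdot> (dt \<cdot> c)\<close> and the differential of \<open>dt \<cdot> c\<close>, with the signs that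
  come from moving \<open>dt\<close> to the left.
\<close>

definition lower :: "'a cdga \<Rightarrow> nat \<Rightarrow> (rat, 'a) module" where
  "lower B n = (case n of
     0 \<Rightarrow> \<lparr> carrier = {undefined}, monoid.mult = undefined, one = undefined, ring.zero = undefined,
            add = (\<lambda>x y. undefined), module.smult = (\<lambda>c x. undefined) \<rparr>
   | Suc m \<Rightarrow> gr B m)"

definition lmult :: "'a cdga \<Rightarrow> nat \<Rightarrow> nat \<Rightarrow> 'a \<Rightarrow> 'a \<Rightarrow> 'a" where
  "lmult B p q c y = (case p of 0 \<Rightarrow> \<zero>\<^bsub>lower B q\<^esub> | Suc p' \<Rightarrow> gmult B p' q c y)"

definition rmult :: "'a cdga \<Rightarrow> nat \<Rightarrow> nat \<Rightarrow> 'a \<Rightarrow> 'a \<Rightarrow> 'a" where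
  "rmult B p q x c = (case q of 0 \<Rightarrow> \<zero>\<^bsub>lower B p\<^esub>
     | Suc q' \<Rightarrow> (- 1) ^ p \<odot>\<^bsub>gr B (p + q')\<^esub> gmult B p q' x c)"

definition ldiff :: "'a cdga \<Rightarrow> nat \<Rightarrow> 'a \<Rightarrow> 'a" where
  "ldiff B n c = (case n of 0 \<Rightarrow> \<zero>\<^bsub>gr B 0\<^esub> | Suc m \<Rightarrow> (- 1) \<odot>\<^bsub>gr B (Suc m)\<^esub> gdiff B m c)"

lemma lower_Suc [simp]: "lower B (Suc m) = gr B m"
  by (simp add: lower_def)

lemma lower_0_iff [simp]: "x \<in> carrier (lower B 0) \<longleftrightarrow> x = undefined"
  by (simp add: lower_def)

lemma lower_0_simps [simp]: "\<zero>\<^bsub>lower B 0\<^esub> = undefined" "x \<oplus>\<^bsub>lower B 0\<^esub> y = undefined" "c \<odot>\<^bsub>lower B 0\<^esub> x = undefined"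
  by (simp_all add: lower_def)

lemma mult_simps [simp]:
  "lmult B 0 q c y = \<zero>\<^bsub>lower B q\<^esub>" "lmult B (Suc p) q c y = gmult B p q c y"
  "rmult B p 0 x c = \<zero>\<^bsub>lower B p\<^esub>"
  "rmult B p (Suc q) x c = (- 1) ^ p \<odot>\<^bsub>gr B (p + q)\<^esub> gmult B p q x c"
  "ldiff B 0 c = \<zero>\<^bsub>gr B 0\<^esub>" "ldiff B (Suc m) c = (- 1) \<odot>\<^bsub>gr B (Suc m)\<^esub> gdiff B m c"
  by (simp_all add: lmult_def rmult_def ldiff_def)

context cdga
begin

lemma rat_space_lower: "rat_space (lower A n)"
proof (cases n)
  case 0 show ?thesis unfolding 0 by (rule rat_spaceI) simp_all
next
  case (Suc m) thus ?thesis by (simp add: rat_space_axioms)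
qed

sublocale lower: rat_space "lower A n" for n by (rule rat_space_lower)

lemma sign_sq: "(-1::rat) ^ p * ((-1) ^ p * a) = a"
  by (simp_all add: power_mult_distrib[symmetric] mult.assoc[symmetric])

lemma lmult_closed [simp]: "c \<in> carrier (lower A p) \<Longrightarrow> y \<in> elts A q \<Longrightarrow> lmult A p q c y \<in> carrier (lower A (p + q))"
  by (cases p) auto

lemma rmult_closed [simp]: "x \<in> elts A p \<Longrightarrow> c \<in> carrier (lower A q) \<Longrightarrow> rmult A p q x c \<in> carrier (lower A (p + q))"
  by (cases q) auto

lemma ldiff_closed [simp]: "c \<in> carrier (lower A n) \<Longrightarrow> ldiff A n c \<in> elts A n"
  by (cases n) auto

lemma lmult_bilinear:
  "c \<in> carrier (lower A p) \<Longrightarrow> e \<in> carrier (lower A p) \<Longrightarrow> y \<in> elts A q \<Longrightarrow>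
     lmult A p q (c \<oplus>\<^bsub>lower A p\<^esub> e) y = lmult A p q c y \<oplus>\<^bsub>lower A (p + q)\<^esub> lmult A p q e y"
  "c \<in> carrier (lower A p) \<Longrightarrow> y \<in> elts A q \<Longrightarrow> z \<in> elts A q \<Longrightarrow>
     lmult A p q c (y \<oplus>\<^bsub>gr A q\<^esub> z) = lmult A p q c y \<oplus>\<^bsub>lower A (p + q)\<^esub> lmult A p q c z"
  "c \<in> carrier (lower A p) \<Longrightarrow> y \<in> elts A q \<Longrightarrow>
     lmult A p q (a \<odot>\<^bsub>lower A p\<^esub> c) y = a \<odot>\<^bsub>lower A (p + q)\<^esub> lmult A p q c y"
  "c \<in> carrier (lower A p) \<Longrightarrow> y \<in> elts A q \<Longrightarrow>
     lmult A p q c (a \<odot>\<^bsub>gr A q\<^esub> y) = a \<odot>\<^bsub>lower A (p + q)\<^esub> lmult A p q c y"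
  by (cases p; simp add: mult_add_left mult_add_right mult_smult_left mult_smult_right)+

lemma rmult_bilinear:
  "x \<in> elts A p \<Longrightarrow> y \<in> elts A p \<Longrightarrow> c \<in> carrier (lower A q) \<Longrightarrow>
     rmult A p q (x \<oplus>\<^bsub>gr A p\<^esub> y) c = rmult A p q x c \<oplus>\<^bsub>lower A (p + q)\<^esub> rmult A p q y c"
  "x \<in> elts A p \<Longrightarrow> c \<in> carrier (lower A q) \<Longrightarrow> e \<in> carrier (lower A q) \<Longrightarrow>
     rmult A p q x (c \<oplus>\<^bsub>lower A q\<^esub> e) = rmult A p q x c \<oplus>\<^bsub>lower A (p + q)\<^esub> rmult A p q x e"
  "x \<in> elts A p \<Longrightarrow> c \<in> carrier (lower A q) \<Longrightarrow>
     rmult A p q (a \<odot>\<^bsub>gr A p\<^esub> x) c = a \<odot>\<^bsub>lower A (p + q)\<^esub> rmult A p q x c"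
  "x \<in> elts A p \<Longrightarrow> c \<in> carrier (lower A q) \<Longrightarrow>
     rmult A p q x (a \<odot>\<^bsub>lower A q\<^esub> c) = a \<odot>\<^bsub>lower A (p + q)\<^esub> rmult A p q x c"
  by (cases q; simp add: mult_add_left mult_add_right mult_smult_left mult_smult_right
        smult_add_right smult_smult mult.commute)+

lemma ldiff_linear:
  "c \<in> carrier (lower A n) \<Longrightarrow> e \<in> carrier (lower A n) \<Longrightarrow>
     ldiff A n (c \<oplus>\<^bsub>lower A n\<^esub> e) = ldiff A n c \<oplus>\<^bsub>gr A n\<^esub> ldiff A n e"
  "c \<in> carrier (lower A n) \<Longrightarrow> ldiff A n (a \<odot>\<^bsub>lower A n\<^esub> c) = a \<odot>\<^bsub>gr A n\<^esub> ldiff A n c"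
  by (cases n; simp add: diff_add diff_smult smult_add_right smult_smult)+

text \<open>
  The forms \<open>dt \<cdot> c\<close> are a differential bimodule. Its laws are those of \<open>A\<close> with the signs
  that come from passing \<open>dt\<close>.
\<close>

lemma bimodule_assoc:
  "c \<in> carrier (lower A p) \<Longrightarrow> y \<in> elts A q \<Longrightarrow> z \<in> elts A r \<Longrightarrow>
     lmult A (p + q) r (lmult A p q c y) z = lmult A p (q + r) c (gmult A q r y z)"
  "x \<in> elts A p \<Longrightarrow> c \<in> carrier (lower A q) \<Longrightarrow> z \<in> elts A r \<Longrightarrow>
     lmult A (p + q) r (rmult A p q x c) z = rmult A p (q + r) x (lmult A q r c z)"
  "x \<in> elts A p \<Longrightarrow> y \<in> elts A q \<Longrightarrow> c \<in> carrier (lower A r) \<Longrightarrow>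
     rmult A (p + q) r (gmult A p q x y) c = rmult A p (q + r) x (rmult A q r y c)"
proof -
  show "c \<in> carrier (lower A p) \<Longrightarrow> y \<in> elts A q \<Longrightarrow> z \<in> elts A r \<Longrightarrow>
     lmult A (p + q) r (lmult A p q c y) z = lmult A p (q + r) c (gmult A q r y z)"
    using mult_assoc[of c _ y q z r] by (cases p; cases q) auto
  show "x \<in> elts A p \<Longrightarrow> c \<in> carrier (lower A q) \<Longrightarrow> z \<in> elts A r \<Longrightarrow>
     lmult A (p + q) r (rmult A p q x c) z = rmult A p (q + r) x (lmult A q r c z)"
  proof (cases q)
    case 0 thus "x \<in> elts A p \<Longrightarrow> z \<in> elts A r \<Longrightarrow> ?thesis" by (cases p; cases r) auto
  next
    case (Suc q')
    thus "x \<in> elts A p \<Longrightarrow> c \<in> carrier (lower A q) \<Longrightarrow> z \<in> elts A r \<Longrightarrow> ?thesis"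
      using mult_assoc[of x p c q' z r] mult_smult_left[of "gmult A p q' x c" "p + q'" z r]
      by (simp add: add.assoc)
  qed
  show "x \<in> elts A p \<Longrightarrow> y \<in> elts A q \<Longrightarrow> c \<in> carrier (lower A r) \<Longrightarrow>
     rmult A (p + q) r (gmult A p q x y) c = rmult A p (q + r) x (rmult A q r y c)"
  proof (cases r)
    case 0 thus "x \<in> elts A p \<Longrightarrow> y \<in> elts A q \<Longrightarrow> ?thesis" by (cases p; cases q) auto
  next
    case (Suc r')
    thus "x \<in> elts A p \<Longrightarrow> y \<in> elts A q \<Longrightarrow> c \<in> carrier (lower A r) \<Longrightarrow> ?thesis"
      using mult_assoc[of x p y q c r'] mult_smult_right[of x p "gmult A q r' y c" "q + r'"]
      by (simp add: add.assoc smult_smult power_add)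
  qed
qed

lemma bimodule_comm:
  assumes "x \<in> elts A p" "c \<in> carrier (lower A q)"
  shows "rmult A p q x c = (-1) ^ (p * q) \<odot>\<^bsub>lower A (p + q)\<^esub> lmult A q p c x"
    "lmult A q p c x = (-1) ^ (q * p) \<odot>\<^bsub>lower A (q + p)\<^esub> rmult A p q x c"
proof -
  show 1: "rmult A p q x c = (-1) ^ (p * q) \<odot>\<^bsub>lower A (p + q)\<^esub> lmult A q p c x"
  proof (cases q)
    case (Suc q')
    thus ?thesis using assms graded_comm[of x p c q'] mult_closed[of c q' x p]
      by (simp add: smult_smult power_add[symmetric] add.commute)
  qed (use assms lower.smult_zero_right in simp)
  have "lmult A q p c x \<in> carrier (lower A (p + q))" using assms lmult_closed[of c q x p] by (simp add: add.commute)
  thus "lmult A q p c x = (-1) ^ (q * p) \<odot>\<^bsub>lower A (q + p)\<^esub> rmult A p q x c"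
    unfolding 1 by (simp add: lower.smult_smult sign_sq mult.commute[of q p] add.commute[of q p])
qed

lemma lmult_one: "c \<in> carrier (lower A p) \<Longrightarrow> lmult A p 0 c (gone A) = c"
  by (cases p) (auto simp: mult_one_right)

lemma rmult_one: "c \<in> carrier (lower A p) \<Longrightarrow> rmult A 0 p (gone A) c = c"
  by (cases p) (auto simp: mult_one_left)

lemma ldiff_lmult:
  assumes "c \<in> carrier (lower A p)" "y \<in> elts A q"
  shows "ldiff A (p + q) (lmult A p q c y) =
    gmult A p q (ldiff A p c) y \<oplus>\<^bsub>gr A (p + q)\<^esub> (-1) ^ p \<odot>\<^bsub>gr A (p + q)\<^esub> lmult A p (Suc q) c (gdiff A q y)"
proof (cases p)
  case 0
  thus ?thesis using assms by (cases q) (auto simp: ldiff_def)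
next
  case (Suc p')
  moreover have "gmult A p' (Suc q) c (gdiff A q y) \<in> elts A (Suc (p' + q))"
    using assms Suc mult_closed[of c p' "gdiff A q y" "Suc q"] by simp
  moreover have "gmult A (Suc p') q (gdiff A p' c) y \<in> elts A (Suc (p' + q))"
    using assms Suc mult_closed[of "gdiff A p' c" "Suc p'" y q] by simp
  ultimately show ?thesis using assms mult_smult_left[of "gdiff A p' c" "Suc p'" y q]
    by (simp add: leibniz smult_add_right smult_smult)
qed

lemma ldiff_rmult:
  assumes "x \<in> elts A p" "c \<in> carrier (lower A q)"
  shows "ldiff A (p + q) (rmult A p q x c) =
    rmult A (Suc p) q (gdiff A p x) c \<oplus>\<^bsub>gr A (p + q)\<^esub> gmult A p q x (ldiff A q c)"
proof (cases q)
  case 0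
  thus ?thesis using assms by (cases p) (auto simp: ldiff_def)
next
  case (Suc q')
  moreover have "gmult A p (Suc q') x (gdiff A q' c) \<in> elts A (Suc (p + q'))"
    using assms Suc mult_closed[of x p "gdiff A q' c" "Suc q'"] by simp
  moreover have "gmult A (Suc p) q' (gdiff A p x) c \<in> elts A (Suc (p + q'))"
    using assms Suc mult_closed[of "gdiff A p x" "Suc p" c q'] by simp
  ultimately show ?thesis using assms mult_smult_right[of x p "gdiff A q' c" "Suc q'"]
    by (simp add: leibniz smult_add_right smult_smult diff_smult sign_sq)
qed

end

text \<open>
  A triple \<open>(x, x', c)\<close> is the value of a form \<open>p + dt \<cdot> q\<close> at a point, together with the value of
  the derivative of \<open>p\<close>, which is needed in \<open>d (p + dt \<cdot> q) = d p + dt \<cdot> (p' - d q)\<close>.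
\<close>

definition jets :: "'a cdga \<Rightarrow> ('a \<times> 'a \<times> 'a) cdga" where
  "jets B = \<lparr>
     gr = (\<lambda>n. \<lparr> carrier = elts B n \<times> elts B n \<times> carrier (lower B n), monoid.mult = undefined, one = undefined,
        ring.zero = (\<zero>\<^bsub>gr B n\<^esub>, \<zero>\<^bsub>gr B n\<^esub>, \<zero>\<^bsub>lower B n\<^esub>),
        add = (\<lambda>(x, x', c) (y, y', e). (x \<oplus>\<^bsub>gr B n\<^esub> y, x' \<oplus>\<^bsub>gr B n\<^esub> y', c \<oplus>\<^bsub>lower B n\<^esub> e)),
        module.smult = (\<lambda>a (x, x', c). (a \<odot>\<^bsub>gr B n\<^esub> x, a \<odot>\<^bsub>gr B n\<^esub> x', a \<odot>\<^bsub>lower B n\<^esub> c)) \<rparr>),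
     gmult = (\<lambda>p q (x, x', c) (y, y', e). (gmult B p q x y,
        gmult B p q x' y \<oplus>\<^bsub>gr B (p + q)\<^esub> gmult B p q x y',
        lmult B p q c y \<oplus>\<^bsub>lower B (p + q)\<^esub> rmult B p q x e)),
     gone = (gone B, \<zero>\<^bsub>gr B 0\<^esub>, \<zero>\<^bsub>lower B 0\<^esub>),
     gdiff = (\<lambda>n (x, x', c). (gdiff B n x, gdiff B n x', x' \<oplus>\<^bsub>gr B n\<^esub> ldiff B n c)) \<rparr>"

lemma jets_simps [simp]:
  "elts (jets B) n = elts B n \<times> elts B n \<times> carrier (lower B n)"
  "\<zero>\<^bsub>gr (jets B) n\<^esub> = (\<zero>\<^bsub>gr B n\<^esub>, \<zero>\<^bsub>gr B n\<^esub>, \<zero>\<^bsub>lower B n\<^esub>)"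
  "(x, x', c) \<oplus>\<^bsub>gr (jets B) n\<^esub> (y, y', e) = (x \<oplus>\<^bsub>gr B n\<^esub> y, x' \<oplus>\<^bsub>gr B n\<^esub> y', c \<oplus>\<^bsub>lower B n\<^esub> e)"
  "a \<odot>\<^bsub>gr (jets B) n\<^esub> (x, x', c) = (a \<odot>\<^bsub>gr B n\<^esub> x, a \<odot>\<^bsub>gr B n\<^esub> x', a \<odot>\<^bsub>lower B n\<^esub> c)"
  "gmult (jets B) p q (x, x', c) (y, y', e) = (gmult B p q x y,
        gmult B p q x' y \<oplus>\<^bsub>gr B (p + q)\<^esub> gmult B p q x y',
        lmult B p q c y \<oplus>\<^bsub>lower B (p + q)\<^esub> rmult B p q x e)"
  "gone (jets B) = (gone B, \<zero>\<^bsub>gr B 0\<^esub>, \<zero>\<^bsub>lower B 0\<^esub>)"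
  "gdiff (jets B) n (x, x', c) = (gdiff B n x, gdiff B n x', x' \<oplus>\<^bsub>gr B n\<^esub> ldiff B n c)"
  by (simp_all add: jets_def)

lemma (in cdga) cdga_jets: "cdga (jets A)"
proof (rule cdgaI)
  fix n
  show "rat_space (gr (jets A) n)"
    by (rule rat_spaceI)
      (auto simp: add_ac lower.add_ac smult_add_left lower.smult_add_left smult_add_right lower.smult_add_right
        smult_smult lower.smult_smult)
next
  fix p q u v assume uv: "u \<in> elts (jets A) p" "v \<in> elts (jets A) q"
  then obtain x x' c y y' e where e: "u = (x, x', c)" "v = (y, y', e)" "x \<in> elts A p" "x' \<in> elts A p"
    "c \<in> carrier (lower A p)" "y \<in> elts A q" "y' \<in> elts A q" "e \<in> carrier (lower A q)" by auto
  show "gmult (jets A) p q u v \<in> elts (jets A) (p + q)" using e by simp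
  show "gmult (jets A) p q u (a \<odot>\<^bsub>gr (jets A) q\<^esub> v) = a \<odot>\<^bsub>gr (jets A) (p + q)\<^esub> gmult (jets A) p q u v" for a
    using e by (simp add: mult_smult_right smult_add_right lmult_bilinear rmult_bilinear lower.smult_add_right)
  show "gmult (jets A) p q (a \<odot>\<^bsub>gr (jets A) p\<^esub> u) v = a \<odot>\<^bsub>gr (jets A) (p + q)\<^esub> gmult (jets A) p q u v" for a
    using e by (simp add: mult_smult_left smult_add_right lmult_bilinear rmult_bilinear lower.smult_add_right)
  have cl: "gmult A q p y x' \<in> elts A (p + q)" "gmult A q p y' x \<in> elts A (p + q)"
    "lmult A q p e x \<in> carrier (lower A (p + q))" "rmult A q p y c \<in> carrier (lower A (p + q))"
    using e mult_closed[of y q x' p] mult_closed[of y' q x p] lmult_closed[of e q x p] rmult_closed[of y q c p]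
    by (simp_all add: add.commute)
  show "gmult (jets A) p q u v = (- 1) ^ (p * q) \<odot>\<^bsub>gr (jets A) (p + q)\<^esub> gmult (jets A) q p v u"
    using e cl graded_comm[of x p y q] graded_comm[of x' p y q] graded_comm[of x p y' q]
      bimodule_comm(1)[of x p e q] bimodule_comm(2)[of y q c p]
    by (simp add: add.commute[of q p] smult_add_right lower.smult_add_right add_comm lower.add_comm)
  have cl: "gmult A p (Suc q) x (gdiff A q y) \<in> elts A (Suc (p + q))"
    "gmult A p (Suc q) x' (gdiff A q y) \<in> elts A (Suc (p + q))"
    "gmult A p (Suc q) x (gdiff A q y') \<in> elts A (Suc (p + q))"
    "gmult A (Suc p) q (gdiff A p x) y \<in> elts A (Suc (p + q))"
    "gmult A (Suc p) q (gdiff A p x') y \<in> elts A (Suc (p + q))"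
    "gmult A (Suc p) q (gdiff A p x) y' \<in> elts A (Suc (p + q))"
    "lmult A p (Suc q) c (gdiff A q y) \<in> elts A (p + q)"
    "rmult A (Suc p) q (gdiff A p x) e \<in> elts A (p + q)"
    "gmult A p q x (ldiff A q e) \<in> elts A (p + q)"
    "gmult A p q (ldiff A p c) y \<in> elts A (p + q)"
    using e mult_closed[of _ p "gdiff A q _" "Suc q"] mult_closed[of "gdiff A p _" "Suc p" _ q]
      lmult_closed[of c p "gdiff A q y" "Suc q"] rmult_closed[of "gdiff A p x" "Suc p" e q] by simp_all
  show "gdiff (jets A) (p + q) (gmult (jets A) p q u v) =
        gmult (jets A) (Suc p) q (gdiff (jets A) p u) v
        \<oplus>\<^bsub>gr (jets A) (Suc (p + q))\<^esub> (- 1) ^ p \<odot>\<^bsub>gr (jets A) (Suc (p + q))\<^esub>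
          gmult (jets A) p (Suc q) u (gdiff (jets A) q v)"
    using e cl
    by (simp add: leibniz diff_add smult_add_right ldiff_linear ldiff_lmult ldiff_rmult mult_add_left mult_add_right
        smult_smult sign_sq add_ac)
next
  fix p q u v w assume "u \<in> elts (jets A) p" "v \<in> elts (jets A) q" "w \<in> elts (jets A) q"
  thus "gmult (jets A) p q u (v \<oplus>\<^bsub>gr (jets A) q\<^esub> w) =
    gmult (jets A) p q u v \<oplus>\<^bsub>gr (jets A) (p + q)\<^esub> gmult (jets A) p q u w"
    by (auto simp: mult_add_right lmult_bilinear rmult_bilinear add_ac lower.add_ac)
next
  fix p q u v w assume "u \<in> elts (jets A) p" "v \<in> elts (jets A) p" "w \<in> elts (jets A) q"
  thus "gmult (jets A) p q (u \<oplus>\<^bsub>gr (jets A) p\<^esub> v) w =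
    gmult (jets A) p q u w \<oplus>\<^bsub>gr (jets A) (p + q)\<^esub> gmult (jets A) p q v w"
    by (auto simp: mult_add_left lmult_bilinear rmult_bilinear add_ac lower.add_ac)
next
  fix p q r u v w assume "u \<in> elts (jets A) p" "v \<in> elts (jets A) q" "w \<in> elts (jets A) r"
  then obtain x x' c y y' e z z' f where e: "u = (x, x', c)" "v = (y, y', e)" "w = (z, z', f)"
    "x \<in> elts A p" "x' \<in> elts A p" "c \<in> carrier (lower A p)" "y \<in> elts A q" "y' \<in> elts A q" "e \<in> carrier (lower A q)"
    "z \<in> elts A r" "z' \<in> elts A r" "f \<in> carrier (lower A r)" by auto
  have cl: "gmult A p (q + r) x' (gmult A q r y z) \<in> elts A (p + (q + r))"
    "gmult A p (q + r) x (gmult A q r y' z) \<in> elts A (p + (q + r))"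
    "gmult A p (q + r) x (gmult A q r y z') \<in> elts A (p + (q + r))"
    "lmult A p (q + r) c (gmult A q r y z) \<in> carrier (lower A (p + (q + r)))"
    "rmult A p (q + r) x (lmult A q r e z) \<in> carrier (lower A (p + (q + r)))"
    "rmult A p (q + r) x (rmult A q r y f) \<in> carrier (lower A (p + (q + r)))"
    using e by simp_all
  show "gmult (jets A) (p + q) r (gmult (jets A) p q u v) w = gmult (jets A) p (q + r) u (gmult (jets A) q r v w)"
    using e cl by (simp add: mult_assoc mult_add_left mult_add_right lmult_bilinear rmult_bilinear bimodule_assoc
        add.assoc[of p q r] add_assoc lower.add_assoc)
next
  fix n u assume "u \<in> elts (jets A) n"
  thus "gdiff (jets A) (Suc n) (gdiff (jets A) n u) = \<zero>\<^bsub>gr (jets A) (Suc (Suc n))\<^esub>"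
  proof -
    obtain x x' c where u: "u = (x, x', c)" "x \<in> elts A n" "x' \<in> elts A n" "c \<in> carrier (lower A n)"
      using \<open>u \<in> elts (jets A) n\<close> by auto
    have "gdiff A n (ldiff A n c) = \<zero>\<^bsub>gr A (Suc n)\<^esub>"
      using u by (cases n) (auto simp: diff_smult diff_diff)
    thus ?thesis using u by (simp add: diff_diff diff_add)
  qed
qed (auto simp: diff_add diff_smult ldiff_linear smult_add_right add_ac mult_one_left mult_one_right one_closed
      lmult_one rmult_one lower.add_zero)


text \<open>
  The algebra of polynomial forms \<open>p + dt \<cdot> q\<close> on the line with values in \<open>B\<close>. A form is stored by its jets
  at all points, so that the operations are pointwise and the laws follow from those of \<open>jets B\<close>.
\<close>

definition path :: "'a cdga \<Rightarrow> (rat \<Rightarrow> 'a \<times> 'a \<times> 'a) cdga" where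
  "path B = \<lparr>
     gr = (\<lambda>n. \<lparr>
        carrier = {\<alpha>. poly_deriv (gr B n) (\<lambda>t. fst (\<alpha> t)) (\<lambda>t. fst (snd (\<alpha> t))) \<and>
           poly_fun (lower B n) (\<lambda>t. snd (snd (\<alpha> t)))},
        monoid.mult = undefined, one = undefined,
        ring.zero = (\<lambda>t. \<zero>\<^bsub>gr (jets B) n\<^esub>),
        add = (\<lambda>\<alpha> \<beta> t. \<alpha> t \<oplus>\<^bsub>gr (jets B) n\<^esub> \<beta> t),
        module.smult = (\<lambda>c \<alpha> t. c \<odot>\<^bsub>gr (jets B) n\<^esub> \<alpha> t) \<rparr>),
     gmult = (\<lambda>p q \<alpha> \<beta> t. gmult (jets B) p q (\<alpha> t) (\<beta> t)),
     gone = (\<lambda>t. gone (jets B)),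
     gdiff = (\<lambda>n \<alpha> t. gdiff (jets B) n (\<alpha> t)) \<rparr>"

lemma path_simps:
  "\<zero>\<^bsub>gr (path B) n\<^esub> = (\<lambda>t. \<zero>\<^bsub>gr (jets B) n\<^esub>)"
  "\<alpha> \<oplus>\<^bsub>gr (path B) n\<^esub> \<beta> = (\<lambda>t. \<alpha> t \<oplus>\<^bsub>gr (jets B) n\<^esub> \<beta> t)"
  "c \<odot>\<^bsub>gr (path B) n\<^esub> \<alpha> = (\<lambda>t. c \<odot>\<^bsub>gr (jets B) n\<^esub> \<alpha> t)"
  "gmult (path B) p q \<alpha> \<beta> = (\<lambda>t. gmult (jets B) p q (\<alpha> t) (\<beta> t))"
  "gone (path B) = (\<lambda>t. gone (jets B))"
  "gdiff (path B) n \<alpha> = (\<lambda>t. gdiff (jets B) n (\<alpha> t))"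
  by (simp_all add: path_def)

lemma path_elts_iff:
  "(\<lambda>t. (p t, p' t, q t)) \<in> elts (path B) n \<longleftrightarrow> poly_deriv (gr B n) p p' \<and> poly_fun (lower B n) q"
  by (simp add: path_def)

lemma path_eltsE:
  assumes "\<alpha> \<in> elts (path B) n"
  obtains p p' q where "\<alpha> = (\<lambda>t. (p t, p' t, q t))" "poly_deriv (gr B n) p p'" "poly_fun (lower B n) q"
proof -
  have "\<alpha> = (\<lambda>t. (fst (\<alpha> t), fst (snd (\<alpha> t)), snd (snd (\<alpha> t))))" by simp
  thus ?thesis using assms that[of "\<lambda>t. fst (\<alpha> t)" "\<lambda>t. fst (snd (\<alpha> t))" "\<lambda>t. snd (snd (\<alpha> t))"]
    by (simp add: path_def)
qed

lemma poly_fun_linear: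
  assumes "poly_fun M p" "rat_space M"
    and "\<And>x. x \<in> carrier M \<Longrightarrow> f x \<in> carrier N"
      "\<And>x y. x \<in> carrier M \<Longrightarrow> y \<in> carrier M \<Longrightarrow> f (x \<oplus>\<^bsub>M\<^esub> y) = f x \<oplus>\<^bsub>N\<^esub> f y"
      "\<And>c x. x \<in> carrier M \<Longrightarrow> f (c \<odot>\<^bsub>M\<^esub> x) = c \<odot>\<^bsub>N\<^esub> f x"
  shows "poly_fun N (\<lambda>t. f (p t))"
  using poly_deriv_linear[OF _ assms(2-5)] assms(1) unfolding poly_fun_def by blast

context cdga
begin

lemma path_jets: "\<alpha> \<in> elts (path A) n \<Longrightarrow> \<alpha> t \<in> elts (jets A) n"
  by (auto elim!: path_eltsE dest: poly_deriv_closed lower.poly_fun_closed)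

lemma path_closed:
  shows "\<zero>\<^bsub>gr (path A) n\<^esub> \<in> elts (path A) n"
    and "\<alpha> \<in> elts (path A) n \<Longrightarrow> \<beta> \<in> elts (path A) n \<Longrightarrow> \<alpha> \<oplus>\<^bsub>gr (path A) n\<^esub> \<beta> \<in> elts (path A) n"
    and "\<alpha> \<in> elts (path A) n \<Longrightarrow> c \<odot>\<^bsub>gr (path A) n\<^esub> \<alpha> \<in> elts (path A) n"
    and "\<alpha> \<in> elts (path A) p \<Longrightarrow> \<beta> \<in> elts (path A) q \<Longrightarrow> gmult (path A) p q \<alpha> \<beta> \<in> elts (path A) (p + q)"
    and "gone (path A) \<in> elts (path A) 0"
    and "\<alpha> \<in> elts (path A) n \<Longrightarrow> gdiff (path A) n \<alpha> \<in> elts (path A) (Suc n)"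
proof -
  show "\<zero>\<^bsub>gr (path A) n\<^esub> \<in> elts (path A) n"
    by (simp add: path_simps path_elts_iff poly_deriv_const lower.poly_fun_zero)
  show "\<alpha> \<in> elts (path A) n \<Longrightarrow> \<beta> \<in> elts (path A) n \<Longrightarrow> \<alpha> \<oplus>\<^bsub>gr (path A) n\<^esub> \<beta> \<in> elts (path A) n"
    by (elim path_eltsE) (simp add: path_simps path_elts_iff poly_deriv.add lower.poly_fun_add)
  show "\<alpha> \<in> elts (path A) n \<Longrightarrow> c \<odot>\<^bsub>gr (path A) n\<^esub> \<alpha> \<in> elts (path A) n"
    by (elim path_eltsE) (simp add: path_simps path_elts_iff poly_deriv_smult lower.poly_fun_smult)
  show "gone (path A) \<in> elts (path A) 0"
    using lower.poly_fun_zero[of 0] by (simp add: path_simps path_elts_iff poly_deriv_const one_closed)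
  show "gdiff (path A) n \<alpha> \<in> elts (path A) (Suc n)" if "\<alpha> \<in> elts (path A) n"
  proof -
    from that obtain p p' q
      where \<alpha>: "\<alpha> = (\<lambda>t. (p t, p' t, q t))" "poly_deriv (gr A n) p p'" "poly_fun (lower A n) q"
      by (rule path_eltsE)
    have "poly_deriv (gr A (Suc n)) (\<lambda>t. gdiff A n (p t)) (\<lambda>t. gdiff A n (p' t))"
      using poly_deriv_linear[OF \<alpha>(2) rat_space_axioms] diff_closed diff_add diff_smult by blast
    moreover have "poly_fun (gr A n) (\<lambda>t. ldiff A n (q t))"
      using poly_fun_linear[OF \<alpha>(3) rat_space_lower] ldiff_closed ldiff_linear by blast
    ultimately show ?thesis using \<alpha> poly_fun_deriv poly_fun_add by (simp add: path_simps path_elts_iff)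
  qed
  show "gmult (path A) p q \<alpha> \<beta> \<in> elts (path A) (p + q)" if "\<alpha> \<in> elts (path A) p" "\<beta> \<in> elts (path A) q"
  proof -
    from that(1) obtain x x' c
      where \<alpha>: "\<alpha> = (\<lambda>t. (x t, x' t, c t))" "poly_deriv (gr A p) x x'" "poly_fun (lower A p) c"
      by (rule path_eltsE)
    from that(2) obtain y y' e
      where \<beta>: "\<beta> = (\<lambda>t. (y t, y' t, e t))" "poly_deriv (gr A q) y y'" "poly_fun (lower A q) e"
      by (rule path_eltsE)
    obtain c' e' where c': "poly_deriv (lower A p) c c'" and e': "poly_deriv (lower A q) e e'"
      using \<alpha>(3) \<beta>(3) by (auto simp: poly_fun_def)
    have "poly_deriv (gr A (p + q)) (\<lambda>t. gmult A p q (x t) (y t))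
        (\<lambda>t. gmult A p q (x' t) (y t) \<oplus>\<^bsub>gr A (p + q)\<^esub> gmult A p q (x t) (y' t))"
      by (rule poly_deriv_bilinear[OF \<alpha>(2) \<beta>(2) rat_space_axioms rat_space_axioms rat_space_axioms])
        (simp_all add: mult_add_left mult_add_right mult_smult_left mult_smult_right)
    moreover have "poly_fun (lower A (p + q)) (\<lambda>t. lmult A p q (c t) (y t))" unfolding poly_fun_def
      by (rule exI) (rule poly_deriv_bilinear[OF c' \<beta>(2) rat_space_lower rat_space_axioms rat_space_lower],
        simp_all add: lmult_bilinear)
    moreover have "poly_fun (lower A (p + q)) (\<lambda>t. rmult A p q (x t) (e t))" unfolding poly_fun_def
      by (rule exI) (rule poly_deriv_bilinear[OF \<alpha>(2) e' rat_space_axioms rat_space_lower rat_space_lower],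
        simp_all add: rmult_bilinear)
    ultimately show ?thesis using \<alpha> \<beta> lower.poly_fun_add by (simp add: path_simps path_elts_iff)
  qed
qed

lemma cdga_path: "cdga (path A)"
proof -
  interpret J: cdga "jets A" by (rule cdga_jets)
  note [simp del] = jets_simps
  have space: "rat_space (gr (path A) n)" for n
  proof (rule rat_spaceI)
    fix \<alpha> \<beta> \<gamma> assume *: "\<alpha> \<in> elts (path A) n" "\<beta> \<in> elts (path A) n" "\<gamma> \<in> elts (path A) n"
    note j = *[THEN path_jets]
    show "\<alpha> \<oplus>\<^bsub>gr (path A) n\<^esub> \<beta> \<oplus>\<^bsub>gr (path A) n\<^esub> \<gamma> = \<alpha> \<oplus>\<^bsub>gr (path A) n\<^esub> (\<beta> \<oplus>\<^bsub>gr (path A) n\<^esub> \<gamma>)"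
      using j by (simp add: path_simps J.add_assoc)
  next
    fix \<alpha> \<beta> assume *: "\<alpha> \<in> elts (path A) n" "\<beta> \<in> elts (path A) n"
    note j = *[THEN path_jets]
    show "\<alpha> \<oplus>\<^bsub>gr (path A) n\<^esub> \<beta> = \<beta> \<oplus>\<^bsub>gr (path A) n\<^esub> \<alpha>"
      using j by (auto simp: path_simps intro: J.add_comm)
    show "c \<odot>\<^bsub>gr (path A) n\<^esub> (\<alpha> \<oplus>\<^bsub>gr (path A) n\<^esub> \<beta>) = c \<odot>\<^bsub>gr (path A) n\<^esub> \<alpha> \<oplus>\<^bsub>gr (path A) n\<^esub> c \<odot>\<^bsub>gr (path A) n\<^esub> \<beta>" for c
      using j by (simp add: path_simps J.smult_add_right)
  next
    fix \<alpha> assume "\<alpha> \<in> elts (path A) n"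
    note j = path_jets[OF this]
    show "\<zero>\<^bsub>gr (path A) n\<^esub> \<oplus>\<^bsub>gr (path A) n\<^esub> \<alpha> = \<alpha>" "1 \<odot>\<^bsub>gr (path A) n\<^esub> \<alpha> = \<alpha>" "0 \<odot>\<^bsub>gr (path A) n\<^esub> \<alpha> = \<zero>\<^bsub>gr (path A) n\<^esub>"
      using j by (simp_all add: path_simps)
    show "(a + b) \<odot>\<^bsub>gr (path A) n\<^esub> \<alpha> = a \<odot>\<^bsub>gr (path A) n\<^esub> \<alpha> \<oplus>\<^bsub>gr (path A) n\<^esub> b \<odot>\<^bsub>gr (path A) n\<^esub> \<alpha>" for a b
      using j by (simp add: path_simps J.smult_add_left)
    show "(a * b) \<odot>\<^bsub>gr (path A) n\<^esub> \<alpha> = a \<odot>\<^bsub>gr (path A) n\<^esub> (b \<odot>\<^bsub>gr (path A) n\<^esub> \<alpha>)" for a b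
      using j by (simp add: path_simps J.smult_smult)
  qed (rule path_closed; assumption)+
  show ?thesis
  proof (rule cdgaI)
    fix p q \<alpha> \<beta> assume *: "\<alpha> \<in> elts (path A) p" "\<beta> \<in> elts (path A) q"
    note j = path_jets[OF *(1)] path_jets[OF *(2)]
    show "gmult (path A) p q \<alpha> \<beta> = (- 1) ^ (p * q) \<odot>\<^bsub>gr (path A) (p + q)\<^esub> gmult (path A) q p \<beta> \<alpha>"
      unfolding path_simps by (rule ext) (rule J.graded_comm[OF j])
    show "gdiff (path A) (p + q) (gmult (path A) p q \<alpha> \<beta>) =
        gmult (path A) (Suc p) q (gdiff (path A) p \<alpha>) \<beta>
        \<oplus>\<^bsub>gr (path A) (Suc (p + q))\<^esub> (- 1) ^ p \<odot>\<^bsub>gr (path A) (Suc (p + q))\<^esub> gmult (path A) p (Suc q) \<alpha> (gdiff (path A) q \<beta>)"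
      using j by (simp add: path_simps J.leibniz)
    show "gmult (path A) p q \<alpha> (c \<odot>\<^bsub>gr (path A) q\<^esub> \<beta>) = c \<odot>\<^bsub>gr (path A) (p + q)\<^esub> gmult (path A) p q \<alpha> \<beta>"
      "gmult (path A) p q (c \<odot>\<^bsub>gr (path A) p\<^esub> \<alpha>) \<beta> = c \<odot>\<^bsub>gr (path A) (p + q)\<^esub> gmult (path A) p q \<alpha> \<beta>" for c
      using j by (simp_all add: path_simps J.mult_smult_left J.mult_smult_right)
  next
    fix p q \<alpha> \<beta> \<gamma> assume *: "\<alpha> \<in> elts (path A) p" "\<beta> \<in> elts (path A) q" "\<gamma> \<in> elts (path A) q"
    note j = path_jets[OF *(1)] path_jets[OF *(2)] path_jets[OF *(3)]
    show "gmult (path A) p q \<alpha> (\<beta> \<oplus>\<^bsub>gr (path A) q\<^esub> \<gamma>) = gmult (path A) p q \<alpha> \<beta> \<oplus>\<^bsub>gr (path A) (p + q)\<^esub> gmult (path A) p q \<alpha> \<gamma>"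
      using j by (simp add: path_simps J.mult_add_right)
  next
    fix p q \<alpha> \<beta> \<gamma> assume *: "\<alpha> \<in> elts (path A) p" "\<beta> \<in> elts (path A) p" "\<gamma> \<in> elts (path A) q"
    note j = path_jets[OF *(1)] path_jets[OF *(2)] path_jets[OF *(3)]
    show "gmult (path A) p q (\<alpha> \<oplus>\<^bsub>gr (path A) p\<^esub> \<beta>) \<gamma> = gmult (path A) p q \<alpha> \<gamma> \<oplus>\<^bsub>gr (path A) (p + q)\<^esub> gmult (path A) p q \<beta> \<gamma>"
      using j by (simp add: path_simps J.mult_add_left)
  next
    fix p q r \<alpha> \<beta> \<gamma> assume *: "\<alpha> \<in> elts (path A) p" "\<beta> \<in> elts (path A) q" "\<gamma> \<in> elts (path A) r"
    note j = path_jets[OF *(1)] path_jets[OF *(2)] path_jets[OF *(3)]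
    show "gmult (path A) (p + q) r (gmult (path A) p q \<alpha> \<beta>) \<gamma> = gmult (path A) p (q + r) \<alpha> (gmult (path A) q r \<beta> \<gamma>)"
      using j by (simp add: path_simps J.mult_assoc)
  next
    fix p \<alpha> assume "\<alpha> \<in> elts (path A) p"
    note j = path_jets[OF this]
    show "gmult (path A) 0 p (gone (path A)) \<alpha> = \<alpha>" "gmult (path A) p 0 \<alpha> (gone (path A)) = \<alpha>"
      "gdiff (path A) (Suc p) (gdiff (path A) p \<alpha>) = \<zero>\<^bsub>gr (path A) (Suc (Suc p))\<^esub>"
      "gdiff (path A) p (c \<odot>\<^bsub>gr (path A) p\<^esub> \<alpha>) = c \<odot>\<^bsub>gr (path A) (Suc p)\<^esub> gdiff (path A) p \<alpha>" for c
      using j by (simp_all add: path_simps J.mult_one_left J.mult_one_right J.diff_diff J.diff_smult)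
  next
    fix p \<alpha> \<beta> assume *: "\<alpha> \<in> elts (path A) p" "\<beta> \<in> elts (path A) p"
    note j = path_jets[OF *(1)] path_jets[OF *(2)]
    show "gdiff (path A) p (\<alpha> \<oplus>\<^bsub>gr (path A) p\<^esub> \<beta>) = gdiff (path A) p \<alpha> \<oplus>\<^bsub>gr (path A) (Suc p)\<^esub> gdiff (path A) p \<beta>"
      using j by (simp add: path_simps J.diff_add)
  qed (rule space path_closed; assumption?)+
qed

end

definition path_eval :: "rat \<Rightarrow> nat \<Rightarrow> (rat \<Rightarrow> 'a \<times> 'a \<times> 'a) \<Rightarrow> 'a" where
  "path_eval s n \<alpha> = fst (\<alpha> s)"

definition path_const :: "'a cdga \<Rightarrow> nat \<Rightarrow> 'a \<Rightarrow> (rat \<Rightarrow> 'a \<times> 'a \<times> 'a)" where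
  "path_const B n b = (\<lambda>t. (b, \<zero>\<^bsub>gr B n\<^esub>, \<zero>\<^bsub>lower B n\<^esub>))"

definition lower_map :: "(nat \<Rightarrow> 'a \<Rightarrow> 'b) \<Rightarrow> nat \<Rightarrow> 'a \<Rightarrow> 'b" where
  "lower_map f n c = (case n of 0 \<Rightarrow> undefined | Suc m \<Rightarrow> f m c)"

definition path_map :: "(nat \<Rightarrow> 'a \<Rightarrow> 'b) \<Rightarrow> nat \<Rightarrow> (rat \<Rightarrow> 'a \<times> 'a \<times> 'a) \<Rightarrow> (rat \<Rightarrow> 'b \<times> 'b \<times> 'b)" where
  "path_map f n \<alpha> = (\<lambda>t. case \<alpha> t of (x, x', c) \<Rightarrow> (f n x, f n x', lower_map f n c))"

lemma path_eval_const [simp]: "path_eval s n (path_const B n b) = b"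
  by (simp add: path_eval_def path_const_def)

lemma path_eval_map [simp]: "path_eval s n (path_map f n \<alpha>) = f n (path_eval s n \<alpha>)"
  by (simp add: path_eval_def path_map_def split: prod.splits)

lemma path_eval_dga_map:
  assumes "cdga B" shows "dga_map (path B) B (path_eval s)"
proof -
  interpret B: cdga B by fact
  show ?thesis unfolding dga_map_def
    by (auto simp: path_simps path_eval_def dest: B.poly_deriv_closed elim!: path_eltsE)
qed

lemma path_const_dga_map:
  assumes "cdga B" shows "dga_map B (path B) (path_const B)"
proof -
  interpret B: cdga B by fact
  have d: "\<zero>\<^bsub>gr B n\<^esub> \<oplus>\<^bsub>gr B n\<^esub> ldiff B n \<zero>\<^bsub>lower B n\<^esub> = \<zero>\<^bsub>gr B n\<^esub>" for n
    by (cases n) auto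
  have l: "lmult B p q \<zero>\<^bsub>lower B p\<^esub> y \<oplus>\<^bsub>lower B (p + q)\<^esub> rmult B p q x \<zero>\<^bsub>lower B q\<^esub> = \<zero>\<^bsub>lower B (p + q)\<^esub>"
    if "x \<in> elts B p" "y \<in> elts B q" for p q x y
    using that B.lmult_bilinear(3)[of "\<zero>\<^bsub>lower B p\<^esub>" p y q 0] B.rmult_bilinear(4)[of x p "\<zero>\<^bsub>lower B q\<^esub>" q 0] by simp
  show ?thesis unfolding dga_map_def
    by (simp add: path_simps path_const_def path_elts_iff B.poly_deriv_const B.lower.poly_fun_zero d l)
qed

lemma path_map_dga_map:
  assumes "cdga A" "cdga B" "dga_map A B f" shows "dga_map (path A) (path B) (path_map f)"
proof -
  interpret A: cdga A by fact
  interpret B: cdga B by fact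
  note f = dga_mapD[OF assms(3)] and f0 = dga_map_zero[OF assms(3,1,2)]
  have lin: "lower_map f n c \<in> carrier (lower B n)"
    "lower_map f n (a \<odot>\<^bsub>lower A n\<^esub> c) = a \<odot>\<^bsub>lower B n\<^esub> lower_map f n c" if "c \<in> carrier (lower A n)" for n a c
    using that f by (cases n; auto simp: lower_map_def)+
  have add: "lower_map f n (c \<oplus>\<^bsub>lower A n\<^esub> e) = lower_map f n c \<oplus>\<^bsub>lower B n\<^esub> lower_map f n e"
    if "c \<in> carrier (lower A n)" "e \<in> carrier (lower A n)" for n c e
    using that f by (cases n) (auto simp: lower_map_def)
  have zero: "lower_map f n \<zero>\<^bsub>lower A n\<^esub> = \<zero>\<^bsub>lower B n\<^esub>" for n
    using f0 by (cases n) (auto simp: lower_map_def)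
  have l: "lower_map f (p + q) (lmult A p q c y) = lmult B p q (lower_map f p c) (f q y)"
    if "c \<in> carrier (lower A p)" "y \<in> elts A q" for p q c y
    using that f zero[of q] by (cases p) (auto simp: lower_map_def)
  have r: "lower_map f (p + q) (rmult A p q x c) = rmult B p q (f p x) (lower_map f q c)"
    if "c \<in> carrier (lower A q)" "x \<in> elts A p" for p q c x
    using that f zero[of p] by (cases q) (auto simp: lower_map_def)
  have d: "f n (ldiff A n c) = ldiff B n (lower_map f n c)" if "c \<in> carrier (lower A n)" for n c
    using that f f0 by (cases n) (auto simp: lower_map_def)
  have ds: "lower_map f (Suc n) c = f n c" for n c by (simp add: lower_map_def)
  have mem: "path_map f n \<alpha> \<in> elts (path B) n" if "\<alpha> \<in> elts (path A) n" for n \<alpha>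
  proof -
    from that obtain p p' q
      where \<alpha>: "\<alpha> = (\<lambda>t. (p t, p' t, q t))" "poly_deriv (gr A n) p p'" "poly_fun (lower A n) q"
      by (rule path_eltsE)
    have "poly_deriv (gr B n) (\<lambda>t. f n (p t)) (\<lambda>t. f n (p' t))"
      by (rule poly_deriv_linear[OF \<alpha>(2) A.rat_space_axioms]) (simp_all add: f)
    moreover have "poly_fun (lower B n) (\<lambda>t. lower_map f n (q t))"
      by (rule poly_fun_linear[OF \<alpha>(3) A.rat_space_lower]) (simp_all add: lin add)
    ultimately show ?thesis unfolding \<alpha>(1) by (simp add: path_map_def path_elts_iff)
  qed
  have pw: "\<exists>x x' c. \<alpha> t = (x, x', c) \<and> x \<in> elts A n \<and> x' \<in> elts A n \<and> c \<in> carrier (lower A n)"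
    if "\<alpha> \<in> elts (path A) n" for \<alpha> n t
    using A.path_jets[OF that, of t] by auto
  show ?thesis unfolding dga_map_def
  proof (intro conjI allI ballI)
    fix n \<alpha> assume \<alpha>: "\<alpha> \<in> elts (path A) n"
    show "path_map f n \<alpha> \<in> elts (path B) n" by (rule mem[OF \<alpha>])
    show "path_map f (Suc n) (gdiff (path A) n \<alpha>) = gdiff (path B) n (path_map f n \<alpha>)"
    proof
      fix t from pw[OF \<alpha>, of t] show "path_map f (Suc n) (gdiff (path A) n \<alpha>) t = gdiff (path B) n (path_map f n \<alpha>) t"
        by (auto simp: path_map_def path_simps f d ds)
    qed
    show "path_map f n (c \<odot>\<^bsub>gr (path A) n\<^esub> \<alpha>) = c \<odot>\<^bsub>gr (path B) n\<^esub> path_map f n \<alpha>" for c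
    proof
      fix t from pw[OF \<alpha>, of t] show "path_map f n (c \<odot>\<^bsub>gr (path A) n\<^esub> \<alpha>) t = (c \<odot>\<^bsub>gr (path B) n\<^esub> path_map f n \<alpha>) t"
        by (auto simp: path_map_def path_simps f lin)
    qed
  next
    fix n \<alpha> \<beta> assume \<alpha>: "\<alpha> \<in> elts (path A) n" and \<beta>: "\<beta> \<in> elts (path A) n"
    show "path_map f n (\<alpha> \<oplus>\<^bsub>gr (path A) n\<^esub> \<beta>) = path_map f n \<alpha> \<oplus>\<^bsub>gr (path B) n\<^esub> path_map f n \<beta>"
    proof
      fix t from pw[OF \<alpha>, of t] pw[OF \<beta>, of t]
      show "path_map f n (\<alpha> \<oplus>\<^bsub>gr (path A) n\<^esub> \<beta>) t = (path_map f n \<alpha> \<oplus>\<^bsub>gr (path B) n\<^esub> path_map f n \<beta>) t"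
        by (auto simp: path_map_def path_simps f add)
    qed
  next
    fix p q \<alpha> \<beta> assume \<alpha>: "\<alpha> \<in> elts (path A) p" and \<beta>: "\<beta> \<in> elts (path A) q"
    show "path_map f (p + q) (gmult (path A) p q \<alpha> \<beta>) = gmult (path B) p q (path_map f p \<alpha>) (path_map f q \<beta>)"
    proof
      fix t from pw[OF \<alpha>, of t] pw[OF \<beta>, of t]
      show "path_map f (p + q) (gmult (path A) p q \<alpha> \<beta>) t = gmult (path B) p q (path_map f p \<alpha>) (path_map f q \<beta>) t"
        by (auto simp: path_map_def path_simps f add l r)
    qed
  next
    show "path_map f 0 (gone (path A)) = gone (path B)"
      using zero[of 0] by (simp add: path_map_def path_simps f f0)
  qed
qed

text \<open>
  A closed form \<open>p + dt \<cdot> q\<close> satisfies \<open>p' = d q\<close>, hence it is the differential of an antiderivative of \<open>q\<close> with suitable initial value.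
\<close>

lemma path_eval_trivial_fibration:
  assumes "cdga B" shows "trivial_fibration (path B) B (path_eval s)"
  unfolding trivial_fibration_def
proof (intro conjI allI ballI impI)
  interpret B: cdga B by fact
  show "dga_map (path B) B (path_eval s)" by (rule path_eval_dga_map) fact
  show "\<alpha> = \<zero>\<^bsub>gr (path B) 0\<^esub>" if \<alpha>: "\<alpha> \<in> cocycles (path B) 0" "path_eval s 0 \<alpha> = \<zero>\<^bsub>gr B 0\<^esub>" for \<alpha>
  proof -
    obtain p p' q where e: "\<alpha> = (\<lambda>t. (p t, p' t, q t))" "poly_deriv (gr B 0) p p'" "poly_fun (lower B 0) q"
      using path_eltsE \<alpha>(1) unfolding cocycles_def by blast
    have "\<And>t. p' t = \<zero>\<^bsub>gr B 0\<^esub>"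
      using \<alpha>(1) B.poly_deriv_closed[OF e(2)] unfolding e(1) by (auto simp: cocycles_def path_simps fun_eq_iff)
    moreover from this have "\<And>t. p t = \<zero>\<^bsub>gr B 0\<^esub>"
      using B.zero_derivative_const[OF e(2), of _ s] \<alpha>(2) e(1) by (simp add: path_eval_def)
    ultimately show ?thesis using e(1) B.lower.poly_fun_closed[OF e(3)] by (simp add: path_simps)
  qed
  fix n b \<alpha> assume b: "b \<in> elts B n" and \<alpha>: "\<alpha> \<in> cocycles (path B) (Suc n)" "path_eval s (Suc n) \<alpha> = gdiff B n b"
  obtain p p' q where e: "\<alpha> = (\<lambda>t. (p t, p' t, q t))" "poly_deriv (gr B (Suc n)) p p'" "poly_fun (gr B n) q"
    using path_eltsE[of \<alpha> B "Suc n"] \<alpha>(1) unfolding cocycles_def by auto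
  note cl = B.poly_deriv_closed[OF e(2)] B.poly_fun_closed[OF e(3)]
  have "p' t \<oplus>\<^bsub>gr B (Suc n)\<^esub> (- 1) \<odot>\<^bsub>gr B (Suc n)\<^esub> gdiff B n (q t) = \<zero>\<^bsub>gr B (Suc n)\<^esub>" for t
    using \<alpha>(1) unfolding e(1) by (auto simp: cocycles_def path_simps fun_eq_iff)
  hence p': "p' t = gdiff B n (q t)" for t using cl B.eq_iff_diff by blast
  obtain r where r: "poly_deriv (gr B n) r q" "r s = b" using B.antiderivative[OF e(3) b] by blast
  define \<beta> where "\<beta> = (\<lambda>t. (r t, q t, \<zero>\<^bsub>lower B n\<^esub>))"
  have "poly_deriv (gr B (Suc n)) (\<lambda>t. gdiff B n (r t)) (\<lambda>t. gdiff B n (q t))"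
    using poly_deriv_linear[OF r(1) B.rat_space_axioms] B.diff_closed B.diff_add B.diff_smult by blast
  hence "poly_deriv (gr B (Suc n)) (\<lambda>t. gdiff B n (r t)) p'" using p' by presburger
  moreover have "gdiff B n (r s) = p s" using \<alpha>(2) r(2) e(1) by (simp add: path_eval_def)
  ultimately have "gdiff B n (r t) = p t" for t using B.poly_deriv_unique[OF _ e(2)] by blast
  moreover have "ldiff B n \<zero>\<^bsub>lower B n\<^esub> = \<zero>\<^bsub>gr B n\<^esub>" by (cases n) auto
  ultimately have "gdiff (path B) n \<beta> = \<alpha>"
    unfolding e(1) \<beta>_def using p' cl by (simp add: path_simps)
  moreover have "\<beta> \<in> elts (path B) n" unfolding \<beta>_def path_elts_iff using r B.lower.poly_fun_zero by blast
  moreover have "path_eval s n \<beta> = b" by (simp add: path_eval_def \<beta>_def r)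
  ultimately show "\<exists>\<beta>\<in>elts (path B) n. gdiff (path B) n \<beta> = \<alpha> \<and> path_eval s n \<beta> = b" by blast
qed

text \<open>
  It is a weak equivalence because evaluation at \<open>0\<close> is one for both algebras, and surjective because
  coefficients can be lifted.
\<close>

lemma path_map_trivial_fibration:
  assumes A: "cdga A" and B: "cdga B" and f: "trivial_fibration A B f"
  shows "trivial_fibration (path A) (path B) (path_map f)"
proof (rule surjective_weak_equivalence)
  interpret A: cdga A by fact
  interpret B: cdga B by fact
  note fm = trivial_fibration_dga_map[OF f] and PA = A.cdga_path and PB = B.cdga_path
  note evA = trivial_fibration_weak_equivalence[OF path_eval_trivial_fibration[OF A] PA A, of 0]
  note evB = trivial_fibration_weak_equivalence[OF path_eval_trivial_fibration[OF B] PB B, of 0]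
  have "weak_equivalence (path A) B (\<lambda>n \<alpha>. path_eval 0 n (path_map f n \<alpha>))"
    using weak_equivalence_comp[OF PA A B evA trivial_fibration_weak_equivalence[OF f A B]] by simp
  thus "weak_equivalence (path A) (path B) (path_map f)"
    using weak_equivalence_cancel_left[OF PA PB B path_map_dga_map[OF A B fm] evB] by blast
  show "cdga (path A)" "cdga (path B)" by (rule PA PB)+
  fix n \<beta> assume "\<beta> \<in> elts (path B) n"
  then obtain p p' q where e: "\<beta> = (\<lambda>t. (p t, p' t, q t))" "poly_deriv (gr B n) p p'" "poly_fun (lower B n) q"
    by (rule path_eltsE)
  note fD = dga_mapD[OF fm]
  have surj: "\<exists>x\<in>elts A n. f n x = y" if "y \<in> elts B n" for n y
    using trivial_fibration_surj[OF f A B that] by metis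
  obtain r r' where r: "poly_deriv (gr A n) r r'" "p = (\<lambda>t. f n (r t))" "p' = (\<lambda>t. f n (r' t))"
    using poly_deriv_lift[OF e(2), of "gr A n" "f n", OF A.rat_space_axioms] surj fD(2,3) by blast
  have "\<exists>c. poly_fun (lower A n) c \<and> q = (\<lambda>t. lower_map f n (c t))"
  proof (cases n)
    case 0
    thus ?thesis using A.lower.poly_fun_zero[of 0] B.lower.poly_fun_closed[OF e(3)]
      by (auto simp: lower_map_def)
  next
    case (Suc m)
    then obtain q' where "poly_deriv (gr B m) q q'" using e(3) by (auto simp: poly_fun_def)
    then obtain c c' where "poly_deriv (gr A m) c c'" "q = (\<lambda>t. f m (c t))"
      using poly_deriv_lift[of "gr B m" q q' "gr A m" "f m", OF _ A.rat_space_axioms] surj fD(2,3) by blast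
    thus ?thesis using Suc by (auto simp: poly_fun_def lower_map_def)
  qed
  then obtain c where c: "poly_fun (lower A n) c" "q = (\<lambda>t. lower_map f n (c t))" by blast
  show "\<exists>\<alpha>\<in>elts (path A) n. path_map f n \<alpha> = \<beta>"
    using r c e by (intro bexI[of _ "\<lambda>t. (r t, r' t, c t)"]) (simp_all add: path_map_def path_elts_iff)
qed

section \<open>Acyclic correspondences and cofibrations\<close>

text \<open>
  A correspondence is a subalgebra of the product \<open>Q \<times> X\<close>. It is acyclic if its projection to \<open>Q\<close> is
  a trivial fibration, and a section of this projection is a map \<open>L : Q \<rightarrow> X\<close> with graph in \<open>T\<close>. Lifting
  problems with several simultaneous conditions are of this form.
\<close>

locale correspondence =
  fixes Q :: "'u cdga" and X :: "'v cdga" and T :: "nat \<Rightarrow> 'u \<Rightarrow> 'v \<Rightarrow> bool"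
  assumes source: "T n q x \<Longrightarrow> q \<in> elts Q n"
    and target: "T n q x \<Longrightarrow> x \<in> elts X n"
    and zero: "T n \<zero>\<^bsub>gr Q n\<^esub> \<zero>\<^bsub>gr X n\<^esub>"
    and add: "T n q x \<Longrightarrow> T n q' x' \<Longrightarrow> T n (q \<oplus>\<^bsub>gr Q n\<^esub> q') (x \<oplus>\<^bsub>gr X n\<^esub> x')"
    and smult: "T n q x \<Longrightarrow> T n (c \<odot>\<^bsub>gr Q n\<^esub> q) (c \<odot>\<^bsub>gr X n\<^esub> x)"
    and one: "T 0 (gone Q) (gone X)"
    and mult: "T p q x \<Longrightarrow> T r q' x' \<Longrightarrow> T (p + r) (gmult Q p r q q') (gmult X p r x x')"
    and diff: "T n q x \<Longrightarrow> T (Suc n) (gdiff Q n q) (gdiff X n x)"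

definition acyclic_correspondence :: "'u cdga \<Rightarrow> 'v cdga \<Rightarrow> (nat \<Rightarrow> 'u \<Rightarrow> 'v \<Rightarrow> bool) \<Rightarrow> bool" where
  "acyclic_correspondence Q X T \<longleftrightarrow> correspondence Q X T \<and>
     (\<forall>n q a. q \<in> elts Q n \<longrightarrow> T (Suc n) (gdiff Q n q) a \<longrightarrow> a \<in> cocycles X (Suc n) \<longrightarrow>
        (\<exists>x. T n q x \<and> gdiff X n x = a)) \<and>
     (\<forall>z. T 0 \<zero>\<^bsub>gr Q 0\<^esub> z \<longrightarrow> z \<in> cocycles X 0 \<longrightarrow> z = \<zero>\<^bsub>gr X 0\<^esub>)"

text \<open>
  A formula cannot quantify over the type of elements of \<open>X\<close>, so this type is a parameter.
\<close>

definition cofibrant :: "'v itself \<Rightarrow> 'u cdga \<Rightarrow> bool" where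
  "cofibrant (_ :: 'v itself) Q \<longleftrightarrow> (\<forall>(X :: 'v cdga) T. cdga X \<longrightarrow> acyclic_correspondence Q X T \<longrightarrow>
     (\<exists>L. dga_map Q X L \<and> (\<forall>n. \<forall>q\<in>elts Q n. T n q (L n q))))"

text \<open>The relative form: the lift is prescribed on the source of the map.\<close>

definition cofibration :: "'v itself \<Rightarrow> 'u cdga \<Rightarrow> 'u cdga \<Rightarrow> (nat \<Rightarrow> 'u \<Rightarrow> 'u) \<Rightarrow> bool" where
  "cofibration (_ :: 'v itself) P Q i \<longleftrightarrow> (\<forall>(X :: 'v cdga) T u. cdga X \<longrightarrow> acyclic_correspondence Q X T \<longrightarrow>
     dga_map P X u \<longrightarrow> (\<forall>n. \<forall>a\<in>elts P n. T n (i n a) (u n a)) \<longrightarrow>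
     (\<exists>L. dga_map Q X L \<and> (\<forall>n. \<forall>q\<in>elts Q n. T n q (L n q)) \<and> (\<forall>n. \<forall>a\<in>elts P n. L n (i n a) = u n a)))"

lemma acyclic_correspondence_pullback:
  assumes "cdga P" "cdga Q" "dga_map P Q i" "acyclic_correspondence Q X T"
  shows "acyclic_correspondence P X (\<lambda>n a x. a \<in> elts P n \<and> T n (i n a) x)"
proof -
  interpret P: cdga P by fact
  note i = dga_mapD[OF assms(3)] dga_map_zero[OF assms(3,1,2)]
  have T: "correspondence Q X T" using assms(4) by (simp add: acyclic_correspondence_def)
  have "correspondence P X (\<lambda>n a x. a \<in> elts P n \<and> T n (i n a) x)"
    by (rule correspondence.intro)
      (auto simp: i P.one_closed intro: correspondence.zero[OF T] correspondence.add[OF T] correspondence.smult[OF T]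
        correspondence.one[OF T] correspondence.mult[OF T] correspondence.diff[OF T] correspondence.target[OF T])
  moreover have "\<exists>x. (q \<in> elts P n \<and> T n (i n q) x) \<and> gdiff X n x = a"
    if "q \<in> elts P n" "gdiff P n q \<in> elts P (Suc n) \<and> T (Suc n) (i (Suc n) (gdiff P n q)) a" "a \<in> cocycles X (Suc n)" for n q a
  proof -
    have "i n q \<in> elts Q n" "T (Suc n) (gdiff Q n (i n q)) a" using that by (simp_all add: i)
    thus ?thesis using assms(4) that(1,3) unfolding acyclic_correspondence_def by blast
  qed
  moreover have "z = \<zero>\<^bsub>gr X 0\<^esub>" if "T 0 (i 0 \<zero>\<^bsub>gr P 0\<^esub>) z" "z \<in> cocycles X 0" for z
    using that assms(4) unfolding acyclic_correspondence_def by (simp add: i)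
  ultimately show ?thesis unfolding acyclic_correspondence_def by blast
qed

lemma cofibrant_comp:
  assumes "cdga P" "cdga Q" "dga_map P Q i"
    and P: "cofibrant TYPE('v) P" and i: "cofibration TYPE('v) P Q i"
  shows "cofibrant TYPE('v) Q"
  unfolding cofibrant_def
proof (intro allI impI)
  fix X :: "'v cdga" and T assume X: "cdga X" and T: "acyclic_correspondence Q X T"
  obtain u where "dga_map P X u" "\<forall>n. \<forall>a\<in>elts P n. T n (i n a) (u n a)"
    using P X acyclic_correspondence_pullback[OF assms(1-3) T] unfolding cofibrant_def by blast
  thus "\<exists>L. dga_map Q X L \<and> (\<forall>n. \<forall>q\<in>elts Q n. T n q (L n q))"
    using i X T unfolding cofibration_def by blast
qed

section \<open>Factorisation by free extensions\<close>

text \<open>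
  A map \<open>v : P \<rightarrow> B\<close> is factored through an algebra of terms modulo provable equality. The terms are
  built from the elements of \<open>P\<close> and from generators \<open>Gen n b a\<close>, a solution \<open>x\<close> of
  \<open>d x = a\<close> over \<open>b\<close>. As \<open>a\<close> may itself contain generators, one application suffices to obtain
  a trivial fibration, and no iteration is needed.
\<close>

datatype 'a tm =
    Emb nat 'a
  | Gen nat 'a "'a tm"
  | Zero nat
  | One
  | Add nat "'a tm" "'a tm"
  | Scal nat rat "'a tm"
  | Mul nat nat "'a tm" "'a tm"
  | Diff nat "'a tm"

primrec interp :: "'v cdga \<Rightarrow> (nat \<Rightarrow> 'a \<Rightarrow> 'v) \<Rightarrow> (nat \<Rightarrow> 'a \<Rightarrow> 'a tm \<Rightarrow> 'v \<Rightarrow> 'v) \<Rightarrow> 'a tm \<Rightarrow> 'v" where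
  "interp X u \<gamma> (Emb n a) = u n a"
| "interp X u \<gamma> (Gen n b a) = \<gamma> n b a (interp X u \<gamma> a)"
| "interp X u \<gamma> (Zero n) = \<zero>\<^bsub>gr X n\<^esub>"
| "interp X u \<gamma> One = gone X"
| "interp X u \<gamma> (Add n s t) = interp X u \<gamma> s \<oplus>\<^bsub>gr X n\<^esub> interp X u \<gamma> t"
| "interp X u \<gamma> (Scal n c t) = c \<odot>\<^bsub>gr X n\<^esub> interp X u \<gamma> t"
| "interp X u \<gamma> (Mul p q s t) = gmult X p q (interp X u \<gamma> s) (interp X u \<gamma> t)"
| "interp X u \<gamma> (Diff n t) = gdiff X n (interp X u \<gamma> t)"

text \<open>
  If \<open>based\<close> is true, the projection to \<open>B\<close> extends \<open>v\<close> along a cofibration from \<open>P\<close>. Otherwise the terms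
  are built from generators only, and the extension is a cofibrant replacement of \<open>B\<close>. The injection \<open>enc\<close>
  keeps the classes of terms in the universe \<open>'u\<close>.
\<close>

locale free_extension =
  fixes based :: bool and P B :: "'u cdga" and v :: "nat \<Rightarrow> 'u \<Rightarrow> 'u" and enc :: "'u tm \<Rightarrow> 'u"
  assumes P: "cdga P" and B: "cdga B" and v: "dga_map P B v" and inj_enc: "inj enc"
begin

sublocale P: cdga P by (rule P)
sublocale B: cdga B by (rule B)

definition eval_tm :: "'u tm \<Rightarrow> 'u" where
  "eval_tm = interp B v (\<lambda>n b a x. b)"

text \<open>
  \<open>teq n s t\<close>: the terms \<open>s\<close> and \<open>t\<close> are well-formed of degree \<open>n\<close> and provably equal. The last rule
  makes the projection to \<open>B\<close> injective on cocycles of degree \<open>0\<close>; there are no generators of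
  degree \<open>- 1\<close> that could achieve this.
\<close>

inductive teq :: "nat \<Rightarrow> 'u tm \<Rightarrow> 'u tm \<Rightarrow> bool" where
  t_sym: "teq n s t \<Longrightarrow> teq n t s"
| t_trans: "teq n r s \<Longrightarrow> teq n s t \<Longrightarrow> teq n r t"
| t_emb: "based \<Longrightarrow> a \<in> elts P n \<Longrightarrow> teq n (Emb n a) (Emb n a)"
| t_gen: "b \<in> elts B n \<Longrightarrow> teq (Suc n) a a \<Longrightarrow> teq (Suc (Suc n)) (Diff (Suc n) a) (Zero (Suc (Suc n))) \<Longrightarrow>
    eval_tm a = gdiff B n b \<Longrightarrow> teq n (Gen n b a) (Gen n b a)"
| t_zero: "teq n (Zero n) (Zero n)"
| t_one: "teq 0 One One"
| t_add: "teq n s s' \<Longrightarrow> teq n t t' \<Longrightarrow> teq n (Add n s t) (Add n s' t')"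
| t_scal: "teq n s s' \<Longrightarrow> teq n (Scal n c s) (Scal n c s')"
| t_mul: "teq p s s' \<Longrightarrow> teq q t t' \<Longrightarrow> teq (p + q) (Mul p q s t) (Mul p q s' t')"
| t_diff: "teq n s s' \<Longrightarrow> teq (Suc n) (Diff n s) (Diff n s')"
| a_assoc: "teq n r r \<Longrightarrow> teq n s s \<Longrightarrow> teq n t t \<Longrightarrow> teq n (Add n (Add n r s) t) (Add n r (Add n s t))"
| a_comm: "teq n s s \<Longrightarrow> teq n t t \<Longrightarrow> teq n (Add n s t) (Add n t s)"
| a_zero: "teq n t t \<Longrightarrow> teq n (Add n (Zero n) t) t"
| s_add_left: "teq n t t \<Longrightarrow> teq n (Scal n (a + b) t) (Add n (Scal n a t) (Scal n b t))"
| s_add_right: "teq n s s \<Longrightarrow> teq n t t \<Longrightarrow> teq n (Scal n c (Add n s t)) (Add n (Scal n c s) (Scal n c t))"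
| s_mult: "teq n t t \<Longrightarrow> teq n (Scal n (a * b) t) (Scal n a (Scal n b t))"
| s_one: "teq n t t \<Longrightarrow> teq n (Scal n 1 t) t"
| s_zero: "teq n t t \<Longrightarrow> teq n (Scal n 0 t) (Zero n)"
| m_add_right: "teq p r r \<Longrightarrow> teq q s s \<Longrightarrow> teq q t t \<Longrightarrow>
    teq (p + q) (Mul p q r (Add q s t)) (Add (p + q) (Mul p q r s) (Mul p q r t))"
| m_add_left: "teq p r r \<Longrightarrow> teq p s s \<Longrightarrow> teq q t t \<Longrightarrow>
    teq (p + q) (Mul p q (Add p r s) t) (Add (p + q) (Mul p q r t) (Mul p q s t))"
| m_scal_right: "teq p s s \<Longrightarrow> teq q t t \<Longrightarrow> teq (p + q) (Mul p q s (Scal q c t)) (Scal (p + q) c (Mul p q s t))"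
| m_scal_left: "teq p s s \<Longrightarrow> teq q t t \<Longrightarrow> teq (p + q) (Mul p q (Scal p c s) t) (Scal (p + q) c (Mul p q s t))"
| m_assoc: "teq p r r \<Longrightarrow> teq q s s \<Longrightarrow> teq k t t \<Longrightarrow>
    teq (p + q + k) (Mul (p + q) k (Mul p q r s) t) (Mul p (q + k) r (Mul q k s t))"
| m_one_left: "teq p t t \<Longrightarrow> teq p (Mul 0 p One t) t"
| m_one_right: "teq p t t \<Longrightarrow> teq p (Mul p 0 t One) t"
| m_comm: "teq p s s \<Longrightarrow> teq q t t \<Longrightarrow> teq (p + q) (Mul p q s t) (Scal (p + q) ((- 1) ^ (p * q)) (Mul q p t s))"
| d_add: "teq n s s \<Longrightarrow> teq n t t \<Longrightarrow> teq (Suc n) (Diff n (Add n s t)) (Add (Suc n) (Diff n s) (Diff n t))"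
| d_scal: "teq n t t \<Longrightarrow> teq (Suc n) (Diff n (Scal n c t)) (Scal (Suc n) c (Diff n t))"
| d_d: "teq n t t \<Longrightarrow> teq (Suc (Suc n)) (Diff (Suc n) (Diff n t)) (Zero (Suc (Suc n)))"
| d_mul: "teq p s s \<Longrightarrow> teq q t t \<Longrightarrow> teq (Suc (p + q)) (Diff (p + q) (Mul p q s t))
    (Add (Suc (p + q)) (Mul (Suc p) q (Diff p s) t) (Scal (Suc (p + q)) ((- 1) ^ p) (Mul p (Suc q) s (Diff q t))))"
| e_add: "based \<Longrightarrow> x \<in> elts P n \<Longrightarrow> y \<in> elts P n \<Longrightarrow> teq n (Emb n (x \<oplus>\<^bsub>gr P n\<^esub> y)) (Add n (Emb n x) (Emb n y))"
| e_scal: "based \<Longrightarrow> x \<in> elts P n \<Longrightarrow> teq n (Emb n (c \<odot>\<^bsub>gr P n\<^esub> x)) (Scal n c (Emb n x))"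
| e_one: "based \<Longrightarrow> teq 0 (Emb 0 (gone P)) One"
| e_mul: "based \<Longrightarrow> x \<in> elts P p \<Longrightarrow> y \<in> elts P q \<Longrightarrow>
    teq (p + q) (Emb (p + q) (gmult P p q x y)) (Mul p q (Emb p x) (Emb q y))"
| e_diff: "based \<Longrightarrow> x \<in> elts P n \<Longrightarrow> teq (Suc n) (Emb (Suc n) (gdiff P n x)) (Diff n (Emb n x))"
| g_diff: "b \<in> elts B n \<Longrightarrow> teq (Suc n) a a \<Longrightarrow> teq (Suc (Suc n)) (Diff (Suc n) a) (Zero (Suc (Suc n))) \<Longrightarrow>
    eval_tm a = gdiff B n b \<Longrightarrow> teq (Suc n) (Diff n (Gen n b a)) a"
| g_zero: "teq 0 t t \<Longrightarrow> teq (Suc 0) (Diff 0 t) (Zero (Suc 0)) \<Longrightarrow> eval_tm t = \<zero>\<^bsub>gr B 0\<^esub> \<Longrightarrow> teq 0 t (Zero 0)"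

lemma teq_refl: "teq n s t \<Longrightarrow> teq n s s" "teq n s t \<Longrightarrow> teq n t t"
  using t_sym t_trans by blast+

definition cls :: "nat \<Rightarrow> 'u tm \<Rightarrow> 'u" where
  "cls n t = enc (SOME s. teq n s t)"

definition rep :: "nat \<Rightarrow> 'u \<Rightarrow> 'u tm" where
  "rep n x = (SOME t. teq n t t \<and> cls n t = x)"

lemma cls_eq_iff:
  assumes "teq n s s" "teq n t t" shows "cls n s = cls n t \<longleftrightarrow> teq n s t"
proof
  assume "cls n s = cls n t"
  hence "(SOME r. teq n r s) = (SOME r. teq n r t)" using inj_enc by (simp add: cls_def inj_eq)
  thus "teq n s t"
    using someI[of "\<lambda>r. teq n r s", OF assms(1)] someI[of "\<lambda>r. teq n r t", OF assms(2)] t_sym t_trans by metis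
next
  assume "teq n s t"
  hence "teq n r s \<longleftrightarrow> teq n r t" for r using t_sym t_trans by blast
  thus "cls n s = cls n t" by (simp add: cls_def)
qed

lemma cls_eqI: "teq n s t \<Longrightarrow> cls n s = cls n t"
  using cls_eq_iff teq_refl by blast

lemma rep: "teq n t t \<Longrightarrow> teq n (rep n (cls n t)) t"
  using someI[of "\<lambda>s. teq n s s \<and> cls n s = cls n t" t] cls_eq_iff by (auto simp: rep_def)

definition Ext :: "'u cdga" where
  "Ext = \<lparr>
     gr = (\<lambda>n. \<lparr> carrier = cls n ` {t. teq n t t}, monoid.mult = undefined, one = undefined,
        ring.zero = cls n (Zero n),
        add = (\<lambda>x y. cls n (Add n (rep n x) (rep n y))),
        module.smult = (\<lambda>c x. cls n (Scal n c (rep n x))) \<rparr>),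
     gmult = (\<lambda>p q x y. cls (p + q) (Mul p q (rep p x) (rep q y))),
     gone = cls 0 One,
     gdiff = (\<lambda>n x. cls (Suc n) (Diff n (rep n x))) \<rparr>"

lemma Ext_elts: "elts Ext n = cls n ` {t. teq n t t}"
  by (simp add: Ext_def)

lemma Ext_eltsE:
  assumes "x \<in> elts Ext n" obtains t where "x = cls n t" "teq n t t"
  using assms by (auto simp: Ext_elts)

lemma Ext_simps:
  "teq n t t \<Longrightarrow> cls n t \<in> elts Ext n"
  "\<zero>\<^bsub>gr Ext n\<^esub> = cls n (Zero n)"
  "teq n s s \<Longrightarrow> teq n t t \<Longrightarrow> cls n s \<oplus>\<^bsub>gr Ext n\<^esub> cls n t = cls n (Add n s t)"
  "teq n t t \<Longrightarrow> c \<odot>\<^bsub>gr Ext n\<^esub> cls n t = cls n (Scal n c t)"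
  "teq p s s \<Longrightarrow> teq q t t \<Longrightarrow> gmult Ext p q (cls p s) (cls q t) = cls (p + q) (Mul p q s t)"
  "gone Ext = cls 0 One"
  "teq n t t \<Longrightarrow> gdiff Ext n (cls n t) = cls (Suc n) (Diff n t)"
  by (auto simp: Ext_def intro!: cls_eqI t_add t_scal t_mul t_diff rep)

lemma teq_mul:
  "teq 0 s s \<Longrightarrow> teq q t t \<Longrightarrow> teq q (Mul 0 q s t) (Mul 0 q s t)"
  "teq p s s \<Longrightarrow> teq 0 t t \<Longrightarrow> teq p (Mul p 0 s t) (Mul p 0 s t)"
  "teq (Suc p) s s \<Longrightarrow> teq q t t \<Longrightarrow> teq (Suc (p + q)) (Mul (Suc p) q s t) (Mul (Suc p) q s t)"
  "teq p s s \<Longrightarrow> teq (Suc q) t t \<Longrightarrow> teq (Suc (p + q)) (Mul p (Suc q) s t) (Mul p (Suc q) s t)"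
  using t_mul[of 0 s s q t t] t_mul[of p s s 0 t t] t_mul[of "Suc p" s s q t t] t_mul[of p s s "Suc q" t t]
  by simp_all

lemmas wf_rules = t_zero t_one t_add t_scal t_mul t_diff teq_mul

lemma cdga_Ext: "cdga Ext"
proof (rule cdgaI)
  fix n show "rat_space (gr Ext n)"
    by (rule rat_spaceI; (elim Ext_eltsE)?; hypsubst?; simp add: Ext_simps wf_rules; rule cls_eqI;
      (rule a_assoc a_comm a_zero s_add_left s_add_right s_mult s_one s_zero; assumption))
next
  fix p q r x y z assume "x \<in> elts Ext p" "y \<in> elts Ext q" "z \<in> elts Ext r"
  then obtain s t w where e: "x = cls p s" "y = cls q t" "z = cls r w" "teq p s s" "teq q t t" "teq r w w"
    by (elim Ext_eltsE)
  have "cls (p + q + r) (Mul (p + q) r (Mul p q s t) w) = cls (p + q + r) (Mul p (q + r) s (Mul q r t w))"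
    using e by (intro cls_eqI m_assoc)
  thus "gmult Ext (p + q) r (gmult Ext p q x y) z = gmult Ext p (q + r) x (gmult Ext q r y z)"
    using e by (simp add: Ext_simps wf_rules add.assoc)
next
  fix p q x y assume "x \<in> elts Ext p" "y \<in> elts Ext q"
  then obtain s t where e: "x = cls p s" "y = cls q t" "teq p s s" "teq q t t"
    by (elim Ext_eltsE)
  have "teq (p + q) (Mul q p t s) (Mul q p t s)" using t_mul[OF e(4,3)] by (simp add: add.commute)
  hence "(- 1) ^ (p * q) \<odot>\<^bsub>gr Ext (p + q)\<^esub> gmult Ext q p y x = cls (p + q) (Scal (p + q) ((-1) ^ (p * q)) (Mul q p t s))"
    using e by (simp add: Ext_simps add.commute[of q p])
  also have "\<dots> = cls (p + q) (Mul p q s t)"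
    using e cls_eqI[OF m_comm] by simp
  finally show "gmult Ext p q x y = (- 1) ^ (p * q) \<odot>\<^bsub>gr Ext (p + q)\<^esub> gmult Ext q p y x"
    using e by (simp add: Ext_simps)
  show "gdiff Ext (p + q) (gmult Ext p q x y) =
        gmult Ext (Suc p) q (gdiff Ext p x) y
        \<oplus>\<^bsub>gr Ext (Suc (p + q))\<^esub> (- 1) ^ p \<odot>\<^bsub>gr Ext (Suc (p + q))\<^esub> gmult Ext p (Suc q) x (gdiff Ext q y)"
    using e Ext_simps(5)[of "Suc p" "Diff p s" q t] Ext_simps(5)[of p s "Suc q" "Diff q t"]
      cls_eqI[OF d_mul[OF e(3,4)]]
    by (simp add: Ext_simps wf_rules)
qed ((elim Ext_eltsE)?; hypsubst?; simp add: Ext_simps wf_rules; rule cls_eqI;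
  (rule m_add_right m_add_left m_scal_right m_scal_left m_one_left m_one_right d_add d_scal d_d; assumption))+

definition incl :: "nat \<Rightarrow> 'u \<Rightarrow> 'u" where
  "incl n a = cls n (Emb n a)"

definition proj :: "nat \<Rightarrow> 'u \<Rightarrow> 'u" where
  "proj n x = eval_tm (rep n x)"

lemma incl_dga_map:
  assumes based shows "dga_map P Ext incl"
proof -
  have wf: "teq n (Emb n a) (Emb n a)" if "a \<in> elts P n" for n a using assms that by (rule t_emb)
  show ?thesis unfolding dga_map_def incl_def
    by (auto simp: Ext_simps(2-7) wf intro!: Ext_simps(1) wf cls_eqI e_add[OF assms] e_scal[OF assms] e_one[OF assms]
        e_mul[OF assms] e_diff[OF assms])
qed

text \<open>
  Provable equality is sound for every interpretation in \<open>X\<close> that solves the equations of the generators.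
  Membership of the values in a correspondence \<open>T\<close> is carried along in the induction, because the values of
  the generators are only under control inside \<open>T\<close>.
\<close>

lemma teq_sound:
  fixes X :: "'v cdga" and u \<gamma>
  defines "I \<equiv> interp X u \<gamma>"
  assumes X: "cdga X" and T: "correspondence Ext X T"
    and u: "based \<Longrightarrow> dga_map P X u"
    and base: "\<And>n a. based \<Longrightarrow> a \<in> elts P n \<Longrightarrow> T n (incl n a) (u n a)"
    and gen: "\<And>n b a. b \<in> elts B n \<Longrightarrow> teq n (Gen n b a) (Gen n b a) \<Longrightarrow> teq (Suc n) (Diff n (Gen n b a)) a \<Longrightarrow>
      eval_tm a = gdiff B n b \<Longrightarrow> T (Suc n) (cls (Suc n) a) (I a) \<Longrightarrow> I a \<in> cocycles X (Suc n) \<Longrightarrow>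
      T n (cls n (Gen n b a)) (\<gamma> n b a (I a)) \<and> gdiff X n (\<gamma> n b a (I a)) = I a"
    and kill: "\<And>t. eval_tm t = \<zero>\<^bsub>gr B 0\<^esub> \<Longrightarrow>
      T 0 \<zero>\<^bsub>gr Ext 0\<^esub> (I t) \<Longrightarrow> I t \<in> cocycles X 0 \<Longrightarrow> I t = \<zero>\<^bsub>gr X 0\<^esub>"
    and "teq n s t"
  shows "I s = I t \<and> T n (cls n s) (I s) \<and> I s \<in> elts X n"
proof -
  interpret X: cdga X by fact
  interpret T: correspondence Ext X T by fact
  have tadd: "T n (cls n (Add n s t)) (x \<oplus>\<^bsub>gr X n\<^esub> y)"
    if "teq n s s" "teq n t t" "T n (cls n s) x" "T n (cls n t) y" for n s t x y
    using T.add[OF that(3,4)] that by (simp add: Ext_simps)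
  have tscal: "T n (cls n (Scal n c t)) (c \<odot>\<^bsub>gr X n\<^esub> x)"
    if "teq n t t" "T n (cls n t) x" for n t x c
    using T.smult[OF that(2)] that by (simp add: Ext_simps)
  have tmul: "T (p + q) (cls (p + q) (Mul p q s t)) (gmult X p q x y)"
    if "teq p s s" "teq q t t" "T p (cls p s) x" "T q (cls q t) y" for p q s t x y
    using T.mult[OF that(3,4)] that by (simp add: Ext_simps)
  have tdiff: "T (Suc n) (cls (Suc n) (Diff n t)) (gdiff X n x)"
    if "teq n t t" "T n (cls n t) x" for n t x
    using T.diff[OF that(2)] that by (simp add: Ext_simps)
  have tzero: "T n (cls n (Zero n)) \<zero>\<^bsub>gr X n\<^esub>" for n using T.zero by (simp add: Ext_simps)
  have tone: "T 0 (cls 0 One) (gone X)" using T.one by (simp add: Ext_simps)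
  have temb: "T n (cls n (Emb n a)) (u n a)" if based "a \<in> elts P n" for n a using base[OF that] by (simp add: incl_def)
  note T_rules = tadd tscal tmul tdiff tzero tone temb
    tmul[where p = 0, simplified] tmul[where q = 0, simplified]
  note X_rules = X.add_assoc X.smult_add_left X.smult_add_right X.smult_smult X.mult_add_left X.mult_add_right
    X.mult_smult_left X.mult_smult_right X.mult_one_left X.mult_one_right X.one_closed
    X.diff_add X.diff_smult X.diff_diff X.leibniz
  note u_rules = dga_mapD[OF u]
  have IT_rules:
    "teq n s s \<Longrightarrow> teq n t t \<Longrightarrow> T n (cls n s) (I s) \<Longrightarrow> T n (cls n t) (I t) \<Longrightarrow> T n (cls n (Add n s t)) (I (Add n s t))"
    "teq n t t \<Longrightarrow> T n (cls n t) (I t) \<Longrightarrow> T n (cls n (Scal n c t)) (I (Scal n c t))"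
    "teq p s s \<Longrightarrow> teq q t t \<Longrightarrow> T p (cls p s) (I s) \<Longrightarrow> T q (cls q t) (I t) \<Longrightarrow>
      T (p + q) (cls (p + q) (Mul p q s t)) (I (Mul p q s t))"
    "teq 0 s s \<Longrightarrow> teq q t t \<Longrightarrow> T 0 (cls 0 s) (I s) \<Longrightarrow> T q (cls q t) (I t) \<Longrightarrow> T q (cls q (Mul 0 q s t)) (I (Mul 0 q s t))"
    "teq p s s \<Longrightarrow> teq 0 t t \<Longrightarrow> T p (cls p s) (I s) \<Longrightarrow> T 0 (cls 0 t) (I t) \<Longrightarrow> T p (cls p (Mul p 0 s t)) (I (Mul p 0 s t))"
    "teq n t t \<Longrightarrow> T n (cls n t) (I t) \<Longrightarrow> T (Suc n) (cls (Suc n) (Diff n t)) (I (Diff n t))"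
    "T n (cls n (Zero n)) (I (Zero n))" "T 0 (cls 0 One) (I One)"
    for n p q s t c
    unfolding I_def interp.simps by (rule T_rules; assumption)+
  have ok: "I s = I t \<and> T n (cls n s) (I s) \<and> I s \<in> elts X n" if "I s = I t" "T n (cls n s) (I s)" for n s t
    using that T.target by blast
  show ?thesis using \<open>teq n s t\<close>
  proof (induction rule: teq.induct)
    case (t_sym n s t) thus ?case using cls_eqI by metis
  next
    case (t_trans n r s t) thus ?case by metis
  next
    case (t_gen b n a)
    have "I a \<in> cocycles X (Suc n)" using t_gen.IH by (auto simp: cocycles_def I_def)
    moreover have "teq n (Gen n b a) (Gen n b a)" "teq (Suc n) (Diff n (Gen n b a)) a"
      by (rule teq.t_gen[OF t_gen.hyps] teq.g_diff[OF t_gen.hyps])+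
    ultimately show ?case using gen t_gen T.target unfolding I_def interp.simps by blast
  next
    case (g_diff b n a)
    have "I a \<in> cocycles X (Suc n)" using g_diff.IH by (auto simp: cocycles_def I_def)
    moreover have wf: "teq n (Gen n b a) (Gen n b a)" "teq (Suc n) (Diff n (Gen n b a)) a"
      by (rule teq.t_gen[OF g_diff.hyps] teq.g_diff[OF g_diff.hyps])+
    ultimately have *: "T n (cls n (Gen n b a)) (I (Gen n b a))" "gdiff X n (I (Gen n b a)) = I a"
      using gen g_diff unfolding I_def interp.simps by blast+
    moreover have "I (Diff n (Gen n b a)) = gdiff X n (I (Gen n b a))" by (simp add: I_def)
    ultimately show ?case using tdiff[OF wf(1) *(1)] g_diff.IH by simp
  next
    case (g_zero t)
    have "teq 0 t (Zero 0)" using g_zero.hyps by (intro teq.g_zero)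
    hence c: "cls 0 t = cls 0 (Zero 0)" by (rule cls_eqI)
    have z: "I t \<in> cocycles X 0" using g_zero.IH by (auto simp: cocycles_def I_def)
    have "T 0 \<zero>\<^bsub>gr Ext 0\<^esub> (I t)" using g_zero.IH(1) c by (simp add: Ext_simps)
    thus ?case using kill[OF g_zero.hyps(3) _ z] c tzero by (simp add: I_def)
  next
    case (a_comm n s t)
    thus ?case by (simp add: I_def T_rules X.add_comm)
  next
    case (m_comm p s q t)
    have "I (Mul p q s t) = I (Scal (p + q) ((- 1) ^ (p * q)) (Mul q p t s))"
      unfolding I_def interp.simps using m_comm.IH by (intro X.graded_comm) (simp_all add: I_def)
    moreover have "T (p + q) (cls (p + q) (Mul p q s t)) (I (Mul p q s t)) \<and> I (Mul p q s t) \<in> elts X (p + q)"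
      using m_comm by (simp add: I_def T_rules)
    ultimately show ?case by blast
  next
    case (m_assoc p r q s k t)
    have "I (Mul (p + q) k (Mul p q r s) t) = I (Mul p (q + k) r (Mul q k s t))"
      unfolding I_def interp.simps using m_assoc.IH by (intro X.mult_assoc) (simp_all add: I_def)
    moreover have "T (p + q + k) (cls (p + q + k) (Mul (p + q) k (Mul p q r s) t)) (I (Mul (p + q) k (Mul p q r s) t)) \<and>
        I (Mul (p + q) k (Mul p q r s) t) \<in> elts X (p + q + k)"
      using m_assoc by (simp add: I_def T_rules t_mul)
    ultimately show ?case by blast
  next
    case (t_emb a n)
    show ?case unfolding I_def interp.simps
      using temb[OF t_emb] u_rules(1)[OF t_emb] by blast
  next
    case (e_add x n y)
    note a = P.add_closed[OF e_add(2,3)]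
    show ?case unfolding I_def interp.simps
      by (intro conjI u_rules(2)[OF e_add] temb[OF e_add(1) a] u_rules(1)[OF e_add(1) a])
  next
    case (e_scal x n c)
    note a = P.smult_closed[OF e_scal(2), of c]
    show ?case unfolding I_def interp.simps
      by (intro conjI u_rules(3)[OF e_scal] temb[OF e_scal(1) a] u_rules(1)[OF e_scal(1) a])
  next
    case e_one
    show ?case unfolding I_def interp.simps
      by (intro conjI u_rules(4)[OF e_one] temb[OF e_one P.one_closed] u_rules(1)[OF e_one P.one_closed])
  next
    case (e_mul x p y q)
    note a = P.mult_closed[OF e_mul(2,3)]
    show ?case unfolding I_def interp.simps
      by (intro conjI u_rules(5)[OF e_mul] temb[OF e_mul(1) a] u_rules(1)[OF e_mul(1) a])
  next
    case (e_diff x n)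
    note a = P.diff_closed[OF e_diff(2)]
    show ?case unfolding I_def interp.simps
      by (intro conjI u_rules(6)[OF e_diff] temb[OF e_diff(1) a] u_rules(1)[OF e_diff(1) a])
  next
    case (t_add n s s' t t')
    show ?case unfolding I_def interp.simps
      using t_add.IH tadd[OF teq_refl(1)[OF t_add.hyps(1)] teq_refl(1)[OF t_add.hyps(2)], of "I s" "I t"]
      unfolding I_def by auto
  next
    case (t_scal n s s' c)
    show ?case unfolding I_def interp.simps
      using t_scal.IH tscal[OF teq_refl(1)[OF t_scal.hyps(1)], of "I s"] unfolding I_def by auto
  next
    case (t_mul p s s' q t t')
    show ?case unfolding I_def interp.simps
      using t_mul.IH tmul[OF teq_refl(1)[OF t_mul.hyps(1)] teq_refl(1)[OF t_mul.hyps(2)], of "I s" "I t"]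
      unfolding I_def by auto
  next
    case (t_diff n s s')
    show ?case unfolding I_def interp.simps
      using t_diff.IH tdiff[OF teq_refl(1)[OF t_diff.hyps(1)], of "I s"] unfolding I_def by auto
  qed (rule ok, (simp add: I_def X_rules; fail), (elim conjE)?, (intro IT_rules wf_rules; assumption))+
qed

lemma eval_sound: "teq n s t \<Longrightarrow> eval_tm s = eval_tm t" "teq n s t \<Longrightarrow> eval_tm s \<in> elts B n"
proof -
  interpret E: cdga Ext by (rule cdga_Ext)
  assume t: "teq n s t"
  have "eval_tm s = eval_tm t \<and> (cls n s \<in> elts Ext n \<and> eval_tm s \<in> elts B n) \<and> eval_tm s \<in> elts B n"
    unfolding eval_tm_def
  proof (rule teq_sound[where T = "\<lambda>n q x. q \<in> elts Ext n \<and> x \<in> elts B n", OF B])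
    show "correspondence Ext B (\<lambda>n q x. q \<in> elts Ext n \<and> x \<in> elts B n)"
      by (rule correspondence.intro) (auto simp: E.one_closed B.one_closed)
    show "incl n a \<in> elts Ext n \<and> v n a \<in> elts B n" if based "a \<in> elts P n" for n a
      using dga_mapD(1)[OF incl_dga_map] dga_mapD(1)[OF v] that by blast
  qed (use v t in \<open>auto simp: Ext_simps eval_tm_def\<close>)
  thus "eval_tm s = eval_tm t" "eval_tm s \<in> elts B n" by blast+
qed

lemma proj_cls: "teq n t t \<Longrightarrow> proj n (cls n t) = eval_tm t"
  unfolding proj_def using rep eval_sound(1) by blast

lemma proj_incl:
  assumes based "a \<in> elts P n" shows "proj n (incl n a) = v n a"
  unfolding incl_def proj_cls[OF t_emb[OF assms]] by (simp add: eval_tm_def)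

lemma proj_dga_map: "dga_map Ext B proj"
  unfolding dga_map_def
  by (safe elim!: Ext_eltsE; simp add: Ext_simps proj_cls wf_rules eval_sound(2); simp add: eval_tm_def)

text \<open>
  A lifting problem \<open>(b, x)\<close> is solved by the generator whose label is \<open>b\<close> together with a term that represents \<open>x\<close>.
\<close>

lemma proj_trivial_fibration: "trivial_fibration Ext B proj"
  unfolding trivial_fibration_def
proof (intro conjI allI ballI impI)
  show "dga_map Ext B proj" by (rule proj_dga_map)
  show "z = \<zero>\<^bsub>gr Ext 0\<^esub>" if z: "z \<in> cocycles Ext 0" "proj 0 z = \<zero>\<^bsub>gr B 0\<^esub>" for z
  proof -
    obtain t where t: "z = cls 0 t" "teq 0 t t" using z(1) Ext_eltsE by (auto simp: cocycles_def)
    hence "cls (Suc 0) (Diff 0 t) = cls (Suc 0) (Zero (Suc 0))"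
      using z(1) by (simp add: cocycles_def Ext_simps)
    hence "teq (Suc 0) (Diff 0 t) (Zero (Suc 0))" using t cls_eq_iff t_diff t_zero by blast
    hence "teq 0 t (Zero 0)" using t z(2) by (intro g_zero) (simp_all add: proj_cls)
    from cls_eqI[OF this] show ?thesis using t by (simp add: Ext_simps)
  qed
  fix n b x assume b: "b \<in> elts B n" and x: "x \<in> cocycles Ext (Suc n)" "proj (Suc n) x = gdiff B n b"
  obtain a where a: "x = cls (Suc n) a" "teq (Suc n) a a" using x(1) Ext_eltsE by (auto simp: cocycles_def)
  hence "cls (Suc (Suc n)) (Diff (Suc n) a) = cls (Suc (Suc n)) (Zero (Suc (Suc n)))"
    using x(1) by (simp add: cocycles_def Ext_simps)
  hence d: "teq (Suc (Suc n)) (Diff (Suc n) a) (Zero (Suc (Suc n)))" using a cls_eq_iff t_diff t_zero by blast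
  have e: "eval_tm a = gdiff B n b" using x(2) a by (simp add: proj_cls)
  have g: "teq n (Gen n b a) (Gen n b a)" "teq (Suc n) (Diff n (Gen n b a)) a"
    using t_gen[OF b a(2) d e] g_diff[OF b a(2) d e] .
  have "gdiff Ext n (cls n (Gen n b a)) = x" using g a cls_eqI[OF g(2)] by (simp add: Ext_simps)
  moreover have "proj n (cls n (Gen n b a)) = b" using g by (simp add: proj_cls eval_tm_def)
  ultimately show "\<exists>y\<in>elts Ext n. gdiff Ext n y = x \<and> proj n y = b" using g Ext_simps(1) by blast
qed

text \<open>The map to \<open>X\<close> is defined by recursion on terms, choosing the values of the generators in \<open>T\<close>.\<close>

lemma lifting:
  fixes X :: "'v cdga"
  assumes X: "cdga X" and T: "acyclic_correspondence Ext X T"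
    and u: "based \<Longrightarrow> dga_map P X u"
    and base: "\<And>n a. based \<Longrightarrow> a \<in> elts P n \<Longrightarrow> T n (incl n a) (u n a)"
  shows "\<exists>L. dga_map Ext X L \<and> (\<forall>n. \<forall>q\<in>elts Ext n. T n q (L n q)) \<and>
    (based \<longrightarrow> (\<forall>n. \<forall>a\<in>elts P n. L n (incl n a) = u n a))"
proof -
  have C: "correspondence Ext X T" using T by (simp add: acyclic_correspondence_def)
  define \<gamma> where "\<gamma> n b a x = (SOME y. T n (cls n (Gen n b a)) y \<and> gdiff X n y = x)" for n b a x
  define I where "I = interp X u \<gamma>"
  have sound: "I s = I t \<and> T n (cls n s) (I s) \<and> I s \<in> elts X n" if "teq n s t" for n s t
    unfolding I_def
  proof (rule teq_sound[OF X C u base _ _ that])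
    fix n b a
    assume b: "b \<in> elts B n" and g: "teq n (Gen n b a) (Gen n b a)" and d: "teq (Suc n) (Diff n (Gen n b a)) a"
      and Ta: "T (Suc n) (cls (Suc n) a) (interp X u \<gamma> a)"
      and z: "interp X u \<gamma> a \<in> cocycles X (Suc n)"
    have "T (Suc n) (gdiff Ext n (cls n (Gen n b a))) (interp X u \<gamma> a)"
      using Ta g cls_eqI[OF d] by (simp add: Ext_simps)
    hence "\<exists>y. T n (cls n (Gen n b a)) y \<and> gdiff X n y = interp X u \<gamma> a"
      using T z Ext_simps(1)[OF g] unfolding acyclic_correspondence_def by blast
    from someI_ex[OF this]
    show "T n (cls n (Gen n b a)) (\<gamma> n b a (interp X u \<gamma> a)) \<and> gdiff X n (\<gamma> n b a (interp X u \<gamma> a)) = interp X u \<gamma> a"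
      unfolding \<gamma>_def .
  next
    fix t assume "T 0 \<zero>\<^bsub>gr Ext 0\<^esub> (interp X u \<gamma> t)" "interp X u \<gamma> t \<in> cocycles X 0"
    thus "interp X u \<gamma> t = \<zero>\<^bsub>gr X 0\<^esub>" using T unfolding acyclic_correspondence_def by blast
  qed
  define L where "L n q = I (rep n q)" for n q
  have L: "L n (cls n t) = I t" if "teq n t t" for n t
    unfolding L_def using sound[OF rep[OF that]] by simp
  have mem: "I t \<in> elts X n" if "teq n t t" for n t using sound[OF that] by blast
  have "dga_map Ext X L" unfolding dga_map_def
    by (safe elim!: Ext_eltsE; simp add: Ext_simps L wf_rules mem; simp add: I_def)
  moreover have "T n q (L n q)" if "q \<in> elts Ext n" for n q
  proof -
    from that obtain t where "q = cls n t" "teq n t t" by (rule Ext_eltsE)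
    thus ?thesis using sound[of n t t] L by simp
  qed
  moreover have "L n (incl n a) = u n a" if based "a \<in> elts P n" for n a
    using L[OF t_emb[OF that]] by (simp add: incl_def I_def)
  ultimately show ?thesis by blast
qed

end

text \<open>
  For infinite \<open>'u\<close> there is an injection \<open>'u \<times> 'u \<rightarrow> 'u\<close>; iterated pairs encode trees with
  leaves in \<open>'u\<close>.
\<close>

lemma inj_tm_encoding:
  assumes "infinite (UNIV :: 'u set)" shows "\<exists>enc :: 'u tm \<Rightarrow> 'u. inj enc"
proof -
  obtain pr0 :: "'u \<times> 'u \<Rightarrow> 'u" where pr0: "inj pr0"
  proof -
    obtain f where "bij_betw f (UNIV \<times> UNIV :: ('u \<times> 'u) set) (UNIV :: 'u set)"
      using card_of_ordIso[THEN iffD2, OF card_of_Times_same_infinite[OF assms]] by blast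
    hence "inj f" by (simp add: bij_betw_def)
    thus ?thesis by (rule that)
  qed
  obtain nt :: "nat \<Rightarrow> 'u" where nt: "inj nt" using infinite_countable_subset[OF assms] by blast
  define pr where "pr x y = pr0 (x, y)" for x y
  have pr [simp]: "pr x y = pr x' y' \<longleftrightarrow> x = x' \<and> y = y'" for x y x' y'
    by (simp add: pr_def inj_eq[OF pr0])
  have nt [simp]: "nt x = nt y \<longleftrightarrow> x = y" for x y by (rule inj_eq[OF nt])
  define enc :: "'u tm \<Rightarrow> 'u" where "enc = rec_tm
    (\<lambda>n a. pr (nt 0) (pr (nt n) a))
    (\<lambda>n b a ea. pr (nt 1) (pr (nt n) (pr b ea)))
    (\<lambda>n. pr (nt 2) (nt n))
    (pr (nt 3) (nt 0))
    (\<lambda>n s t es et. pr (nt 4) (pr (nt n) (pr es et)))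
    (\<lambda>n c t et. pr (nt 5) (pr (nt n) (pr (nt (to_nat c)) et)))
    (\<lambda>p q s t es et. pr (nt 6) (pr (nt p) (pr (nt q) (pr es et))))
    (\<lambda>n t et. pr (nt 7) (pr (nt n) et))"
  have "enc s = enc t \<Longrightarrow> s = t" for s t
    by (induction s arbitrary: t; case_tac t) (auto simp: enc_def)
  hence "inj enc" by (rule injI)
  thus ?thesis by blast
qed

section \<open>Correspondences as algebras\<close>

definition corr_cdga :: "'a cdga \<Rightarrow> 'b cdga \<Rightarrow> (nat \<Rightarrow> 'a \<Rightarrow> 'b \<Rightarrow> bool) \<Rightarrow> ('a \<times> 'b) cdga" where
  "corr_cdga Q X T = \<lparr>
     gr = (\<lambda>n. \<lparr> carrier = {(q, x). T n q x}, monoid.mult = undefined, one = undefined,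
        ring.zero = (\<zero>\<^bsub>gr Q n\<^esub>, \<zero>\<^bsub>gr X n\<^esub>),
        add = (\<lambda>(q, x) (q', x'). (q \<oplus>\<^bsub>gr Q n\<^esub> q', x \<oplus>\<^bsub>gr X n\<^esub> x')),
        module.smult = (\<lambda>c (q, x). (c \<odot>\<^bsub>gr Q n\<^esub> q, c \<odot>\<^bsub>gr X n\<^esub> x)) \<rparr>),
     gmult = (\<lambda>p r (q, x) (q', x'). (gmult Q p r q q', gmult X p r x x')),
     gone = (gone Q, gone X),
     gdiff = (\<lambda>n (q, x). (gdiff Q n q, gdiff X n x)) \<rparr>"

lemma corr_cdga_simps [simp]:
  "(q, x) \<in> elts (corr_cdga Q X T) n \<longleftrightarrow> T n q x"
  "\<zero>\<^bsub>gr (corr_cdga Q X T) n\<^esub> = (\<zero>\<^bsub>gr Q n\<^esub>, \<zero>\<^bsub>gr X n\<^esub>)"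
  "(q, x) \<oplus>\<^bsub>gr (corr_cdga Q X T) n\<^esub> (q', x') = (q \<oplus>\<^bsub>gr Q n\<^esub> q', x \<oplus>\<^bsub>gr X n\<^esub> x')"
  "c \<odot>\<^bsub>gr (corr_cdga Q X T) n\<^esub> (q, x) = (c \<odot>\<^bsub>gr Q n\<^esub> q, c \<odot>\<^bsub>gr X n\<^esub> x)"
  "gmult (corr_cdga Q X T) p r (q, x) (q', x') = (gmult Q p r q q', gmult X p r x x')"
  "gone (corr_cdga Q X T) = (gone Q, gone X)"
  "gdiff (corr_cdga Q X T) n (q, x) = (gdiff Q n q, gdiff X n x)"
  by (simp_all add: corr_cdga_def)

lemma cdga_corr_cdga:
  assumes "cdga Q" "cdga X" "correspondence Q X T" shows "cdga (corr_cdga Q X T)"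
proof -
  interpret Q: cdga Q by fact
  interpret X: cdga X by fact
  interpret T: correspondence Q X T by fact
  have mem: "q \<in> elts Q n" "x \<in> elts X n" if "T n q x" for n q x using that T.source T.target by blast+
  have sp: "rat_space (gr (corr_cdga Q X T) n)" for n
  proof (rule rat_spaceI; (simp only: split_paired_all)?; (unfold corr_cdga_simps)?)
    fix q x q' x' q'' x'' assume "T n q x" "T n q' x'" "T n q'' x''"
    thus "(q \<oplus>\<^bsub>gr Q n\<^esub> q' \<oplus>\<^bsub>gr Q n\<^esub> q'', x \<oplus>\<^bsub>gr X n\<^esub> x' \<oplus>\<^bsub>gr X n\<^esub> x'') =
      (q \<oplus>\<^bsub>gr Q n\<^esub> (q' \<oplus>\<^bsub>gr Q n\<^esub> q''), x \<oplus>\<^bsub>gr X n\<^esub> (x' \<oplus>\<^bsub>gr X n\<^esub> x''))"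
      by (simp add: mem Q.add_assoc X.add_assoc)
  next
    fix q x q' x' assume "T n q x" "T n q' x'"
    thus "(q \<oplus>\<^bsub>gr Q n\<^esub> q', x \<oplus>\<^bsub>gr X n\<^esub> x') = (q' \<oplus>\<^bsub>gr Q n\<^esub> q, x' \<oplus>\<^bsub>gr X n\<^esub> x)"
      by (simp add: mem Q.add_comm[of q] X.add_comm[of x])
  qed (auto simp: mem T.zero T.add T.smult Q.smult_add_left X.smult_add_left Q.smult_add_right X.smult_add_right
      Q.smult_smult X.smult_smult)
  show ?thesis
  proof (rule cdgaI; (simp only: split_paired_all)?; (unfold corr_cdga_simps)?)
    fix p r q x q' x' assume "T p q x" "T r q' x'"
    thus "(gmult Q p r q q', gmult X p r x x') =
       ((-1) ^ (p * r) \<odot>\<^bsub>gr Q (p + r)\<^esub> gmult Q r p q' q, (-1) ^ (p * r) \<odot>\<^bsub>gr X (p + r)\<^esub> gmult X r p x' x)"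
      by (metis mem Q.graded_comm X.graded_comm)
  qed (auto simp: mem sp T.one T.mult T.diff Q.mult_add_left X.mult_add_left Q.mult_add_right X.mult_add_right
      Q.mult_smult_left X.mult_smult_left Q.mult_smult_right X.mult_smult_right Q.mult_assoc X.mult_assoc
      Q.mult_one_left X.mult_one_left Q.mult_one_right X.mult_one_right Q.diff_add X.diff_add Q.diff_smult X.diff_smult
      Q.diff_diff X.diff_diff Q.leibniz X.leibniz)
qed

lemma corr_cdga_projections:
  assumes "correspondence Q X T"
  shows "dga_map (corr_cdga Q X T) Q (\<lambda>n. fst)" "dga_map (corr_cdga Q X T) X (\<lambda>n. snd)"
proof -
  interpret T: correspondence Q X T by fact
  show "dga_map (corr_cdga Q X T) Q (\<lambda>n. fst)" "dga_map (corr_cdga Q X T) X (\<lambda>n. snd)"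
    unfolding dga_map_def by (auto intro: T.source T.target)
qed

lemma acyclic_correspondence_fst:
  assumes "acyclic_correspondence Q X T" "cdga Q" "cdga X"
  shows "trivial_fibration (corr_cdga Q X T) Q (\<lambda>n. fst)"
proof -
  have T: "correspondence Q X T" using assms(1) by (simp add: acyclic_correspondence_def)
  show ?thesis unfolding trivial_fibration_def
  proof (intro conjI allI ballI impI)
    show "dga_map (corr_cdga Q X T) Q (\<lambda>n. fst)" by (rule corr_cdga_projections[OF T])
    show "z = \<zero>\<^bsub>gr (corr_cdga Q X T) 0\<^esub>" if "z \<in> cocycles (corr_cdga Q X T) 0" "fst z = \<zero>\<^bsub>gr Q 0\<^esub>" for z
      using that assms(1) correspondence.target[OF T] unfolding acyclic_correspondence_def
      by (cases z) (auto simp: cocycles_def)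
    fix n b a assume "b \<in> elts Q n" "a \<in> cocycles (corr_cdga Q X T) (Suc n)" "fst a = gdiff Q n b"
    moreover from this obtain x where "a = (gdiff Q n b, x)" by (cases a) auto
    ultimately have "T (Suc n) (gdiff Q n b) x" "x \<in> cocycles X (Suc n)" "a = (gdiff Q n b, x)"
      using correspondence.target[OF T] by (auto simp: cocycles_def)
    then obtain y where "T n b y" "gdiff X n y = x"
      using assms(1) \<open>b \<in> elts Q n\<close> unfolding acyclic_correspondence_def by blast
    thus "\<exists>x\<in>elts (corr_cdga Q X T) n. gdiff (corr_cdga Q X T) n x = a \<and> fst x = b"
      using \<open>a = (gdiff Q n b, x)\<close> by (intro bexI[of _ "(b, y)"]) auto
  qed
qed

text \<open>
  The pullback of a trivial fibration along \<open>h\<close>, as a subalgebra of the product. Its sections are the lifts of \<open>h\<close>.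
\<close>

lemma trivial_fibration_correspondence:
  assumes p: "trivial_fibration X Y p" and h: "dga_map Q Y h" and "cdga Q" "cdga X" "cdga Y"
  shows "acyclic_correspondence Q X (\<lambda>n q x. q \<in> elts Q n \<and> x \<in> elts X n \<and> p n x = h n q)"
proof -
  interpret Q: cdga Q by fact
  interpret X: cdga X by fact
  interpret Y: cdga Y by fact
  note pm = trivial_fibration_dga_map[OF p]
  note pr = dga_mapD[OF pm] dga_map_zero[OF pm \<open>cdga X\<close> \<open>cdga Y\<close>]
    and hr = dga_mapD[OF h] dga_map_zero[OF h \<open>cdga Q\<close> \<open>cdga Y\<close>]
  have "correspondence Q X (\<lambda>n q x. q \<in> elts Q n \<and> x \<in> elts X n \<and> p n x = h n q)"
    by (rule correspondence.intro) (auto simp: pr hr Q.one_closed X.one_closed)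
  moreover have "\<exists>x. (q \<in> elts Q n \<and> x \<in> elts X n \<and> p n x = h n q) \<and> gdiff X n x = a"
    if "q \<in> elts Q n" "a \<in> cocycles X (Suc n)" "p (Suc n) a = h (Suc n) (gdiff Q n q)" for n q a
  proof -
    have "h n q \<in> elts Y n" "p (Suc n) a = gdiff Y n (h n q)" using that hr by simp_all
    from trivial_fibration_fill[OF p this(1) that(2) this(2)] that(1) show ?thesis by blast
  qed
  moreover have "z = \<zero>\<^bsub>gr X 0\<^esub>" if "z \<in> cocycles X 0" "p 0 z = h 0 \<zero>\<^bsub>gr Q 0\<^esub>" for z
    using p that hr unfolding trivial_fibration_def by simp
  ultimately show ?thesis unfolding acyclic_correspondence_def by blast
qed

section \<open>Homotopies of maps from a cofibrant algebra\<close>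

type_synonym 'a forms = "rat \<Rightarrow> 'a \<times> 'a \<times> 'a"

definition homotopy_step :: "'u cdga \<Rightarrow> 'b cdga \<Rightarrow> (nat \<Rightarrow> 'u \<Rightarrow> 'b) \<Rightarrow> (nat \<Rightarrow> 'u \<Rightarrow> 'b) \<Rightarrow> bool" where
  "homotopy_step Q B f g \<longleftrightarrow> (\<exists>K. dga_map Q (path B) K \<and>
     (\<forall>n. \<forall>q\<in>elts Q n. path_eval 0 n (K n q) = f n q \<and> path_eval 1 n (K n q) = g n q))"

text \<open>Taking the generated equivalence relation replaces the composition of homotopies.\<close>

abbreviation homotopic :: "'u cdga \<Rightarrow> 'b cdga \<Rightarrow> (nat \<Rightarrow> 'u \<Rightarrow> 'b) \<Rightarrow> (nat \<Rightarrow> 'u \<Rightarrow> 'b) \<Rightarrow> bool" where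
  "homotopic Q B \<equiv> equivclp (homotopy_step Q B)"

lemma homotopy_step_dga_map:
  assumes "cdga Q" "cdga B" "homotopy_step Q B f g" shows "dga_map Q B f" "dga_map Q B g"
proof -
  obtain K where K: "dga_map Q (path B) K"
    "\<And>n q. q \<in> elts Q n \<Longrightarrow> path_eval 0 n (K n q) = f n q" "\<And>n q. q \<in> elts Q n \<Longrightarrow> path_eval 1 n (K n q) = g n q"
    using assms(3) unfolding homotopy_step_def by blast
  show "dga_map Q B f" "dga_map Q B g"
    using dga_map_cong[OF assms(1) dga_map_comp[OF K(1) path_eval_dga_map[OF assms(2)]]] K(2,3) by blast+
qed

lemma homotopic_dga_map:
  assumes "cdga Q" "cdga B" "homotopic Q B f g" "dga_map Q B f" shows "dga_map Q B g"
  using assms(3,4) homotopy_step_dga_map[OF assms(1,2)] by (induction rule: equivclp_induct) blast+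

lemma homotopic_cong:
  assumes "cdga B" "dga_map Q B f" "\<And>n q. q \<in> elts Q n \<Longrightarrow> f n q = g n q" shows "homotopic Q B f g"
proof -
  have "homotopy_step Q B f g" unfolding homotopy_step_def
    using assms(3) dga_map_comp[OF assms(2) path_const_dga_map[OF assms(1)]]
    by (intro exI[of _ "\<lambda>n q. path_const B n (f n q)"]) simp
  thus ?thesis by blast
qed

lemma homotopic_trans: "homotopic Q B f g \<Longrightarrow> homotopic Q B g h \<Longrightarrow> homotopic Q B f h"
  by (rule equivclp_trans)

lemma homotopic_sym: "homotopic Q B f g \<Longrightarrow> homotopic Q B g f"
  by (rule equivclp_sym)

lemma homotopic_map:
  assumes step: "\<And>f g. homotopy_step Q B f g \<Longrightarrow> homotopy_step Q' B' (\<Theta> f) (\<Theta> g)" and "homotopic Q B f g"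
  shows "homotopic Q' B' (\<Theta> f) (\<Theta> g)"
  using assms(2)
proof (induction rule: equivclp_induct)
  case (step g h)
  hence "homotopic Q' B' (\<Theta> g) (\<Theta> h)" using assms(1) by (meson converse_r_into_equivclp r_into_equivclp)
  with step.IH show ?case by (rule homotopic_trans)
qed simp

lemma homotopic_post:
  assumes "cdga B" "cdga C" "dga_map B C u" "homotopic Q B f g"
  shows "homotopic Q C (\<lambda>n q. u n (f n q)) (\<lambda>n q. u n (g n q))"
proof (rule homotopic_map[OF _ assms(4)])
  fix f g assume "homotopy_step Q B f g"
  then obtain K where K: "dga_map Q (path B) K"
    "\<forall>n. \<forall>q\<in>elts Q n. path_eval 0 n (K n q) = f n q \<and> path_eval 1 n (K n q) = g n q"
    unfolding homotopy_step_def by blast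
  thus "homotopy_step Q C (\<lambda>n q. u n (f n q)) (\<lambda>n q. u n (g n q))"
    using dga_map_comp[OF K(1) path_map_dga_map[OF assms(1-3)]] unfolding homotopy_step_def
    by (intro exI[of _ "\<lambda>n q. path_map u n (K n q)"]) simp
qed

lemma homotopic_pre:
  assumes "dga_map P Q i" "homotopic Q B f g"
  shows "homotopic P B (\<lambda>n a. f n (i n a)) (\<lambda>n a. g n (i n a))"
proof (rule homotopic_map[OF _ assms(2)])
  fix f g assume "homotopy_step Q B f g"
  then obtain K where K: "dga_map Q (path B) K"
    "\<forall>n. \<forall>q\<in>elts Q n. path_eval 0 n (K n q) = f n q \<and> path_eval 1 n (K n q) = g n q"
    unfolding homotopy_step_def by blast
  thus "homotopy_step P B (\<lambda>n a. f n (i n a)) (\<lambda>n a. g n (i n a))"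
    using dga_map_comp[OF assms(1) K(1)] dga_mapD(1)[OF assms(1)] unfolding homotopy_step_def
    by (intro exI[of _ "\<lambda>n a. K n (i n a)"]) simp
qed

text \<open>
  The evaluations at \<open>0\<close> and \<open>1\<close> agree on cohomology, because both are inverse to the inclusion of the constant paths.
\<close>

lemma homotopic_cohomologous:
  assumes Q: "cdga Q" and B: "cdga B" and "homotopic Q B f g" and f: "dga_map Q B f" and z: "z \<in> cocycles Q n"
  shows "cohomologous B n (f n z) (g n z)"
proof -
  interpret Q: cdga Q by fact
  interpret B: cdga B by fact
  have one: "cohomologous B n (f n z) (g n z)" if fg: "homotopy_step Q B f g" for f g
  proof -
    obtain K where K: "dga_map Q (path B) K"
      "path_eval 0 n (K n z) = f n z" "path_eval 1 n (K n z) = g n z"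
      using fg Q.cocyclesD[OF z] unfolding homotopy_step_def by blast
    note PB = B.cdga_path and c = path_const_dga_map[OF B]
    have fz: "f n z \<in> cocycles B n" using dga_map_cocycles[OF homotopy_step_dga_map(1)[OF Q B fg] Q B z] .
    have Kz: "K n z \<in> cocycles (path B) n" "path_const B n (f n z) \<in> cocycles (path B) n"
      using dga_map_cocycles[OF K(1) Q PB z] dga_map_cocycles[OF c B PB fz] .
    have "cohomologous B n (path_eval 0 n (path_const B n (f n z))) (path_eval 0 n (K n z))"
      using fz K(2) B.cohomologous_refl B.cocyclesD by simp
    hence "cohomologous (path B) n (path_const B n (f n z)) (K n z)"
      using Kz trivial_fibration_weak_equivalence[OF path_eval_trivial_fibration[OF B] PB B, of 0]
      unfolding weak_equivalence_def by blast
    from dga_map_cohomologous[OF path_eval_dga_map[OF B] PB B this, of 1] show ?thesis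
      using K(3) cdga.cocyclesD[OF PB Kz(1)] by simp
  qed
  from assms(3) show ?thesis
  proof (induction rule: equivclp_induct)
    case base
    show ?case using dga_mapD(1)[OF f Q.cocyclesD[OF z]] by (rule B.cohomologous_refl)
  next
    case (step g h)
    have m: "dga_map Q B g" "dga_map Q B h"
      using step(2) homotopy_step_dga_map[OF Q B] by blast+
    note e = dga_mapD(1)[OF m(1) Q.cocyclesD[OF z]] dga_mapD(1)[OF m(2) Q.cocyclesD[OF z]]
    have "cohomologous B n (g n z) (h n z)" using step(2) one B.cohomologous_sym e by blast
    thus ?case using step.IH e B.cohomologous_trans by blast
  qed
qed

lemma cofibrant_lift:
  assumes "cofibrant TYPE('x) Q" "cdga Q" "cdga (X :: 'x cdga)" "cdga Y" "trivial_fibration X Y p" "dga_map Q Y h"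
  obtains L where "dga_map Q X L" "\<And>n q. q \<in> elts Q n \<Longrightarrow> p n (L n q) = h n q"
  using assms(1,3) trivial_fibration_correspondence[OF assms(5,6,2,3,4)] unfolding cofibrant_def by blast

lemma homotopy_extension_step:
  assumes i: "cofibration TYPE('b forms) P Q i" and im: "dga_map P Q i" and Q: "cdga Q" and B: "cdga (B :: 'b cdga)"
    and h: "dga_map Q B h" and K: "dga_map P (path B) K"
    and Kh: "\<And>n a. a \<in> elts P n \<Longrightarrow> path_eval s n (K n a) = h n (i n a)"
  obtains L where "dga_map Q (path B) L" "\<And>n q. q \<in> elts Q n \<Longrightarrow> path_eval s n (L n q) = h n q"
    "\<And>n a. a \<in> elts P n \<Longrightarrow> L n (i n a) = K n a"
proof -
  interpret B: cdga B by fact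
  note T = trivial_fibration_correspondence[OF path_eval_trivial_fibration[OF B] h Q B.cdga_path B, of s]
  have "\<forall>n. \<forall>a\<in>elts P n. i n a \<in> elts Q n \<and> K n a \<in> elts (path B) n \<and> path_eval s n (K n a) = h n (i n a)"
    using Kh dga_mapD(1)[OF im] dga_mapD(1)[OF K] by blast
  from i[unfolded cofibration_def, rule_format, OF B.cdga_path T K] this
  obtain L where "dga_map Q (path B) L" "\<And>n q. q \<in> elts Q n \<Longrightarrow> path_eval s n (L n q) = h n q"
    "\<And>n a. a \<in> elts P n \<Longrightarrow> L n (i n a) = K n a" by blast
  thus ?thesis by (rule that)
qed

text \<open>
  An elementary homotopy is extended by lifting \<open>h\<close> along the evaluation at its starting point, with
  prescribed values on \<open>P\<close>; homotopies of either direction occur.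
\<close>

lemma homotopy_extension:
  assumes i: "cofibration TYPE('b forms) P Q i" and im: "dga_map P Q i"
    and P: "cdga P" and Q: "cdga Q" and B: "cdga (B :: 'b cdga)" and h: "dga_map Q B h"
    and hg: "homotopic P B (\<lambda>n a. h n (i n a)) g"
  shows "\<exists>h'. homotopic Q B h h' \<and> dga_map Q B h' \<and> (\<forall>n. \<forall>a\<in>elts P n. h' n (i n a) = g n a)"
  using hg
proof (induction rule: equivclp_induct)
  case base
  show ?case using h by (intro exI[of _ h]) simp
next
  case (step g k)
  then obtain h' where h': "homotopic Q B h h'" "dga_map Q B h'" "\<And>n a. a \<in> elts P n \<Longrightarrow> h' n (i n a) = g n a" by blast
  have "\<exists>K s s'. dga_map P (path B) K \<and> (\<forall>n. \<forall>a\<in>elts P n. path_eval s n (K n a) = g n a \<and> path_eval s' n (K n a) = k n a) \<and>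
     (s = 0 \<and> s' = 1 \<or> s = 1 \<and> s' = 0)"
    using step(2) unfolding homotopy_step_def by blast
  then obtain K s s' where K: "dga_map P (path B) K" "\<And>n a. a \<in> elts P n \<Longrightarrow> path_eval s n (K n a) = g n a"
    "\<And>n a. a \<in> elts P n \<Longrightarrow> path_eval s' n (K n a) = k n a" "s = 0 \<and> s' = 1 \<or> s = 1 \<and> s' = 0" by blast
  obtain L where L: "dga_map Q (path B) L" "\<And>n q. q \<in> elts Q n \<Longrightarrow> path_eval s n (L n q) = h' n q"
    "\<And>n a. a \<in> elts P n \<Longrightarrow> L n (i n a) = K n a"
    using homotopy_extension_step[OF i im Q B h'(2) K(1), of s] K(2) h'(3) by metis
  define h'' where "h'' n q = path_eval s' n (L n q)" for n q
  have "homotopy_step Q B h' h'' \<or> homotopy_step Q B h'' h'"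
    unfolding homotopy_step_def h''_def using L(1,2) K(4) by blast
  hence "homotopic Q B h' h''" by (meson converse_r_into_equivclp r_into_equivclp)
  moreover have "dga_map Q B h''" unfolding h''_def using L(1) path_eval_dga_map[OF B] by (rule dga_map_comp)
  moreover have "\<forall>n. \<forall>a\<in>elts P n. h'' n (i n a) = k n a" using L(3) K(3) by (simp add: h''_def)
  ultimately show ?case using h'(1) homotopic_trans by blast
qed

section \<open>Weak equivalences are invertible up to homotopy\<close>

text \<open>The straight path. Its image vanishes if the images of both end points do.\<close>

lemma path_interpolation:
  assumes "cdga A" "x \<in> elts A m" "y \<in> elts A m"
  obtains \<gamma> where "\<gamma> \<in> elts (path A) m" "path_eval 0 m \<gamma> = x" "path_eval 1 m \<gamma> = y"
    "\<And>B p. cdga B \<Longrightarrow> dga_map A B p \<Longrightarrow> p m x = \<zero>\<^bsub>gr B m\<^esub> \<Longrightarrow> p m y = \<zero>\<^bsub>gr B m\<^esub> \<Longrightarrow>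
      path_map p m \<gamma> = \<zero>\<^bsub>gr (path B) m\<^esub>"
proof -
  interpret A: cdga A by fact
  let ?D = "y \<oplus>\<^bsub>gr A m\<^esub> (-1) \<odot>\<^bsub>gr A m\<^esub> x"
  define \<gamma> where "\<gamma> = (\<lambda>t. (x \<oplus>\<^bsub>gr A m\<^esub> t \<odot>\<^bsub>gr A m\<^esub> ?D, ?D, \<zero>\<^bsub>lower A m\<^esub>))"
  have D: "?D \<in> elts A m" using assms by simp
  have "poly_deriv (gr A m) (\<lambda>t. x \<oplus>\<^bsub>gr A m\<^esub> t ^ 1 \<odot>\<^bsub>gr A m\<^esub> ?D) (\<lambda>t. \<zero>\<^bsub>gr A m\<^esub> \<oplus>\<^bsub>gr A m\<^esub> (of_nat 1 * t ^ (1 - 1)) \<odot>\<^bsub>gr A m\<^esub> ?D)"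
    using D assms(2) by (intro poly_deriv.add poly_deriv.monom A.poly_deriv_const)
  hence "\<gamma> \<in> elts (path A) m" unfolding \<gamma>_def path_elts_iff using D A.lower.poly_fun_zero by simp
  moreover have "path_eval 0 m \<gamma> = x" "path_eval 1 m \<gamma> = y" using assms D by (simp_all add: path_eval_def \<gamma>_def)
  moreover have "path_map p m \<gamma> = \<zero>\<^bsub>gr (path B) m\<^esub>"
    if B: "cdga B" and p: "dga_map A B p" and 0: "p m x = \<zero>\<^bsub>gr B m\<^esub>" "p m y = \<zero>\<^bsub>gr B m\<^esub>" for B :: "'b cdga" and p
  proof -
    interpret B: cdga B by fact
    have pD: "p m ?D = \<zero>\<^bsub>gr B m\<^esub>" using assms(2,3) 0 by (simp add: dga_mapD[OF p])
    have "lower_map p m \<zero>\<^bsub>lower A m\<^esub> = \<zero>\<^bsub>lower B m\<^esub>"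
      using dga_map_zero[OF p assms(1) B] by (cases m) (simp_all add: lower_map_def)
    thus ?thesis using assms(2) D pD 0 by (simp add: path_map_def \<gamma>_def path_simps dga_mapD[OF p])
  qed
  ultimately show ?thesis by (rule that)
qed

text \<open>
  Lifts of \<open>K\<close> to \<open>path A\<close> with end points \<open>g\<close> and \<open>g'\<close> are sections of the correspondence \<open>T\<close> below. It is
  acyclic: a lift that ignores the end points misses them by cocycles \<open>c\<close> with \<open>p c = 0\<close>. These are
  differentials of elements that \<open>p\<close> annihilates, and the straight path between two such
  elements has a differential that corrects both end points.
\<close>

lemma lift_homotopy_step:
  assumes cof: "cofibrant TYPE('a forms) Q" and Q: "cdga Q" and A: "cdga (A :: 'a cdga)" and B: "cdga B"
    and p: "trivial_fibration A B p" and g: "dga_map Q A g" and g': "dga_map Q A g'"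
    and K: "dga_map Q (path B) K"
    and K0: "\<And>n q. q \<in> elts Q n \<Longrightarrow> path_eval 0 n (K n q) = p n (g n q)"
    and K1: "\<And>n q. q \<in> elts Q n \<Longrightarrow> path_eval 1 n (K n q) = p n (g' n q)"
  shows "homotopy_step Q A g g'"
proof -
  interpret Q: cdga Q by fact
  interpret A: cdga A by fact
  interpret B: cdga B by fact
  interpret PA: cdga "path A" by (rule A.cdga_path)
  interpret PB: cdga "path B" by (rule B.cdga_path)
  define T where "T n q \<alpha> \<longleftrightarrow> q \<in> elts Q n \<and> \<alpha> \<in> elts (path A) n \<and> path_eval 0 n \<alpha> = g n q \<and>
    path_eval 1 n \<alpha> = g' n q \<and> path_map p n \<alpha> = K n q" for n q \<alpha>
  note pm = trivial_fibration_dga_map[OF p]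
  note em = path_eval_dga_map[OF A] and mm = path_map_dga_map[OF A B pm]
  note pT = path_map_trivial_fibration[OF A B p]
  note r = dga_mapD[OF em] dga_map_zero[OF em A.cdga_path A] dga_mapD[OF mm] dga_map_zero[OF mm A.cdga_path B.cdga_path]
    dga_mapD[OF g] dga_map_zero[OF g Q A] dga_mapD[OF g'] dga_map_zero[OF g' Q A]
    dga_mapD[OF K] dga_map_zero[OF K Q B.cdga_path]
  have "correspondence Q (path A) T"
    unfolding T_def by (rule correspondence.intro) (auto simp: r Q.one_closed PA.one_closed)
  moreover have "\<exists>\<alpha>. T n q \<alpha> \<and> gdiff (path A) n \<alpha> = \<beta>"
    if q: "q \<in> elts Q n" and T: "T (Suc n) (gdiff Q n q) \<beta>" and \<beta>: "\<beta> \<in> cocycles (path A) (Suc n)" for n q \<beta>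
  proof -
    have "path_map p (Suc n) \<beta> = gdiff (path B) n (K n q)" using T q r by (simp add: T_def)
    then obtain \<alpha>0 where \<alpha>0: "\<alpha>0 \<in> elts (path A) n" "gdiff (path A) n \<alpha>0 = \<beta>" "path_map p n \<alpha>0 = K n q"
      by (rule trivial_fibration_fill[OF pT dga_mapD(1)[OF K q] \<beta>])
    \<comment> \<open>The end points of \<open>\<alpha>0\<close> are off by cocycles in the acyclic kernel of \<open>p\<close>.\<close>
    have ker: "f n q \<oplus>\<^bsub>gr A n\<^esub> (-1) \<odot>\<^bsub>gr A n\<^esub> path_eval s n \<alpha>0 \<in> cocycles A n \<and>
        p n (f n q \<oplus>\<^bsub>gr A n\<^esub> (-1) \<odot>\<^bsub>gr A n\<^esub> path_eval s n \<alpha>0) = \<zero>\<^bsub>gr B n\<^esub>"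
      if f: "dga_map Q A f" and fb: "path_eval s (Suc n) \<beta> = f (Suc n) (gdiff Q n q)"
        and pf: "path_eval s n (K n q) = p n (f n q)" for f s
    proof -
      have e: "f n q \<in> elts A n" "path_eval s n \<alpha>0 \<in> elts A n" 
        using dga_mapD(1)[OF f q] dga_mapD(1)[OF em \<alpha>0(1)] .
      have "gdiff A n (path_eval s n \<alpha>0) = gdiff A n (f n q)"
        using fb \<alpha>0 q dga_mapD(6)[OF f] dga_mapD(6)[OF em, of \<alpha>0 n s] by simp
      moreover have "p n (path_eval s n \<alpha>0) = p n (f n q)"
        using pf \<alpha>0(3) path_eval_map[of s n p \<alpha>0] by simp
      ultimately show ?thesis using e dga_mapD[OF pm]
        by (simp add: cocycles_def A.diff_add A.diff_smult)
    qed
    define k where "k f s = f n q \<oplus>\<^bsub>gr A n\<^esub> (-1) \<odot>\<^bsub>gr A n\<^esub> path_eval s n \<alpha>0" for f :: "nat \<Rightarrow> _ \<Rightarrow> 'a" and s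
    have k0: "k g 0 \<in> cocycles A n" "p n (k g 0) = \<zero>\<^bsub>gr B n\<^esub>"
      using ker[OF g, of 0] T K0[OF q] by (simp_all add: T_def k_def)
    have k1: "k g' 1 \<in> cocycles A n" "p n (k g' 1) = \<zero>\<^bsub>gr B n\<^esub>"
      using ker[OF g', of 1] T K1[OF q] by (simp_all add: T_def k_def)
    have "\<exists>\<delta>\<in>cocycles (path A) n. path_eval 0 n \<delta> = k g 0 \<and> path_eval 1 n \<delta> = k g' 1 \<and>
      path_map p n \<delta> = \<zero>\<^bsub>gr (path B) n\<^esub>"
    proof (cases n)
      case 0
      hence "k g 0 = \<zero>\<^bsub>gr A n\<^esub>" "k g' 1 = \<zero>\<^bsub>gr A n\<^esub>"
        using k0 k1 p unfolding trivial_fibration_def by blast+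
      thus ?thesis using dga_map_zero[OF em A.cdga_path A] dga_map_zero[OF mm A.cdga_path B.cdga_path]
        by (intro bexI[OF _ PA.cocycles_zero]) simp
    next
      case (Suc m)
      have "\<exists>l\<in>elts A m. gdiff A m l = c \<and> p m l = \<zero>\<^bsub>gr B m\<^esub>"
        if "c \<in> cocycles A n" "p n c = \<zero>\<^bsub>gr B n\<^esub>" for c
      proof -
        have "c \<in> cocycles A (Suc m)" "p (Suc m) c = gdiff B m \<zero>\<^bsub>gr B m\<^esub>" using that Suc by simp_all
        from trivial_fibration_fill[OF p B.zero_closed this] show ?thesis by blast
      qed
      then obtain l0 l1 where l: "l0 \<in> elts A m" "gdiff A m l0 = k g 0" "p m l0 = \<zero>\<^bsub>gr B m\<^esub>"
        "l1 \<in> elts A m" "gdiff A m l1 = k g' 1" "p m l1 = \<zero>\<^bsub>gr B m\<^esub>" using k0 k1 by meson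
      obtain \<gamma> where \<gamma>: "\<gamma> \<in> elts (path A) m" "path_eval 0 m \<gamma> = l0" "path_eval 1 m \<gamma> = l1"
        "path_map p m \<gamma> = \<zero>\<^bsub>gr (path B) m\<^esub>"
        using path_interpolation[OF A l(1,4)] B pm l(3,6) by metis
      have "gdiff (path A) m \<gamma> \<in> cocycles (path A) n" using \<gamma>(1) Suc by (simp add: cocycles_def PA.diff_diff)
      thus ?thesis using \<gamma> l Suc dga_mapD(6)[OF em \<gamma>(1)] dga_mapD(6)[OF mm \<gamma>(1)]
        by (intro bexI[of _ "gdiff (path A) m \<gamma>"]) simp_all
    qed
    then obtain \<delta> where \<delta>: "\<delta> \<in> cocycles (path A) n" "path_eval 0 n \<delta> = k g 0" "path_eval 1 n \<delta> = k g' 1"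
      "path_map p n \<delta> = \<zero>\<^bsub>gr (path B) n\<^esub>" by blast
    define \<alpha> where "\<alpha> = \<alpha>0 \<oplus>\<^bsub>gr (path A) n\<^esub> \<delta>"
    have \<delta>e: "\<delta> \<in> elts (path A) n" "gdiff (path A) n \<delta> = \<zero>\<^bsub>gr (path A) (Suc n)\<^esub>"
      using \<delta>(1) by (simp_all add: cocycles_def)
    have e: "path_eval s n \<alpha>0 \<in> elts A n" for s using \<alpha>0 dga_mapD(1)[OF em] by blast
    have end': "path_eval s n \<alpha> = f n q" if "path_eval s n \<delta> = k f s" "f n q \<in> elts A n" for f s
      using that e[of s] \<alpha>0(1) \<delta>e(1) by (simp add: \<alpha>_def dga_mapD(2)[OF em] k_def)
    have "path_map p n \<alpha> = K n q"
      using \<alpha>0 \<delta>e \<delta>(4) dga_mapD(1)[OF K q] by (simp add: \<alpha>_def dga_mapD(2)[OF mm])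
    hence "T n q \<alpha>" unfolding T_def
      using q end'[of 0 g] end'[of 1 g'] \<delta>(2,3) \<alpha>0(1) \<delta>e dga_mapD(1)[OF g q] dga_mapD(1)[OF g' q]
      by (simp add: \<alpha>_def)
    moreover have "gdiff (path A) n \<alpha> = \<beta>" using \<alpha>0 \<delta>e PA.cocyclesD[OF \<beta>] by (simp add: \<alpha>_def PA.diff_add)
    ultimately show ?thesis by blast
  qed
  moreover have "z = \<zero>\<^bsub>gr (path A) 0\<^esub>" if "T 0 \<zero>\<^bsub>gr Q 0\<^esub> z" "z \<in> cocycles (path A) 0" for z
    using that pT dga_map_zero[OF K Q B.cdga_path] unfolding T_def trivial_fibration_def by simp
  ultimately have "acyclic_correspondence Q (path A) T" unfolding acyclic_correspondence_def by blast
  then obtain L where L: "dga_map Q (path A) L" "\<And>n q. q \<in> elts Q n \<Longrightarrow> T n q (L n q)"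
    using cof A.cdga_path unfolding cofibrant_def by blast
  thus ?thesis unfolding homotopy_step_def T_def by blast
qed

text \<open>
  An equivalence through elementary homotopies is lifted step by step; the maps in between lift because \<open>Q\<close> is cofibrant.
\<close>

lemma homotopic_cancel_trivial_fibration:
  assumes cof: "cofibrant TYPE('a forms) Q" "cofibrant TYPE('a) Q"
    and Q: "cdga Q" and A: "cdga (A :: 'a cdga)" and B: "cdga B"
    and p: "trivial_fibration A B p" and g: "dga_map Q A g" and g': "dga_map Q A g'"
    and h: "homotopic Q B (\<lambda>n q. p n (g n q)) (\<lambda>n q. p n (g' n q))"
  shows "homotopic Q A g g'"
proof -
  note pm = trivial_fibration_dga_map[OF p] and c = path_const_dga_map[OF B]
  have "\<forall>l. dga_map Q A l \<longrightarrow> (\<forall>n. \<forall>q\<in>elts Q n. p n (l n q) = k n q) \<longrightarrow> homotopic Q A g l"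
    if "homotopic Q B (\<lambda>n q. p n (g n q)) k" for k using that
  proof (induction rule: equivclp_induct)
    case base
    show ?case
    proof (intro allI impI r_into_equivclp)
      fix l assume "dga_map Q A l" "\<forall>n. \<forall>q\<in>elts Q n. p n (l n q) = p n (g n q)"
      thus "homotopy_step Q A g l"
        by (intro lift_homotopy_step[OF cof(1) Q A B p g _ dga_map_comp[OF dga_map_comp[OF g pm] c]]) simp_all
    qed
  next
    case (step k k')
    have km: "dga_map Q B k" using step(2) homotopy_step_dga_map[OF Q B] by blast
    obtain l where l: "dga_map Q A l" "\<And>n q. q \<in> elts Q n \<Longrightarrow> p n (l n q) = k n q"
      by (rule cofibrant_lift[OF cof(2) Q A B p km]) blast
    show ?case
    proof (intro allI impI)
      fix l' assume l': "dga_map Q A l'" "\<forall>n. \<forall>q\<in>elts Q n. p n (l' n q) = k' n q"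
      from step(2) have "homotopy_step Q A l l' \<or> homotopy_step Q A l' l"
      proof
        assume "homotopy_step Q B k k'"
        then obtain K where "dga_map Q (path B) K"
          "\<forall>n. \<forall>q\<in>elts Q n. path_eval 0 n (K n q) = k n q \<and> path_eval 1 n (K n q) = k' n q"
          unfolding homotopy_step_def by blast
        thus ?thesis using lift_homotopy_step[OF cof(1) Q A B p l(1) l'(1)] l(2) l'(2) by simp
      next
        assume "homotopy_step Q B k' k"
        then obtain K where "dga_map Q (path B) K"
          "\<forall>n. \<forall>q\<in>elts Q n. path_eval 0 n (K n q) = k' n q \<and> path_eval 1 n (K n q) = k n q"
          unfolding homotopy_step_def by blast
        thus ?thesis using lift_homotopy_step[OF cof(1) Q A B p l'(1) l(1)] l(2) l'(2) by simp
      qed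
      hence "homotopic Q A l l'" by (meson converse_r_into_equivclp r_into_equivclp)
      moreover have "homotopic Q A g l" using step.IH l by blast
      ultimately show "homotopic Q A g l'" using homotopic_trans by blast
    qed
  qed
  thus ?thesis using h g' by blast
qed

text \<open>
  A weak equivalence \<open>w : A \<rightarrow> B\<close> factors through \<open>E = A \<times>\<^sub>B path B\<close> as a section of a trivial
  fibration to \<open>A\<close>, followed by a trivial fibration to \<open>B\<close>. The latter is surjective because over \<open>0\<close>
  there are straight paths from \<open>0\<close> to any element of \<open>B\<close>.
\<close>

lemma weak_equivalence_factorisation:
  assumes A: "cdga (A :: 'a cdga)" and B: "cdga (B :: 'b cdga)" and w: "weak_equivalence A B w"
  obtains E :: "('a \<times> 'b forms) cdga" and j r p
  where "cdga E" "dga_map A E j" "trivial_fibration E A r" "trivial_fibration E B p"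
    "\<And>n a. r n (j n a) = a" "\<And>n a. p n (j n a) = w n a"
proof -
  interpret A: cdga A by fact
  interpret B: cdga B by fact
  note wm = weak_equivalence_dga_map[OF w] and PB = B.cdga_path and c = path_const_dga_map[OF B]
  define T where "T n a \<beta> \<longleftrightarrow> a \<in> elts A n \<and> \<beta> \<in> elts (path B) n \<and> path_eval 0 n \<beta> = w n a" for n a \<beta>
  have T: "acyclic_correspondence A (path B) T"
    unfolding T_def by (rule trivial_fibration_correspondence[OF path_eval_trivial_fibration[OF B] wm A PB B])
  hence C: "correspondence A (path B) T" by (simp add: acyclic_correspondence_def)
  define E where "E = corr_cdga A (path B) T"
  have E: "cdga E" unfolding E_def by (rule cdga_corr_cdga[OF A PB C])
  define r :: "nat \<Rightarrow> 'a \<times> 'b forms \<Rightarrow> 'a" where "r = (\<lambda>n. fst)"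
  define p :: "nat \<Rightarrow> 'a \<times> 'b forms \<Rightarrow> 'b" where "p = (\<lambda>n x. path_eval 1 n (snd x))"
  define j where "j = (\<lambda>n a. (a, path_const B n (w n a)))"
  have r: "trivial_fibration E A r" unfolding r_def E_def by (rule acyclic_correspondence_fst[OF T A PB])
  note cw = dga_mapD[OF dga_map_comp[OF wm c]]
  have j: "dga_map A E j" unfolding dga_map_def j_def E_def
    using cw by (simp add: T_def)
  have pm: "dga_map E B p" unfolding p_def E_def
    by (rule dga_map_comp[OF corr_cdga_projections(2)[OF C] path_eval_dga_map[OF B]])
  have jw: "weak_equivalence A E j"
  proof (rule weak_equivalence_cancel_left[OF A E A j trivial_fibration_weak_equivalence[OF r E A]])
    show "weak_equivalence A A (\<lambda>n x. r n (j n x))"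
      unfolding r_def j_def by (rule bijective_weak_equivalence[OF A A, of _ "\<lambda>n x. x"]) (simp_all add: dga_map_id)
  qed
  have pw: "weak_equivalence E B p"
    by (rule weak_equivalence_cancel_right[OF A E B jw pm]) (simp add: p_def j_def w)
  have "\<exists>x\<in>elts E n. p n x = b" if b: "b \<in> elts B n" for n b
  proof -
    obtain \<gamma> where \<gamma>: "\<gamma> \<in> elts (path B) n" "path_eval 0 n \<gamma> = \<zero>\<^bsub>gr B n\<^esub>" "path_eval 1 n \<gamma> = b"
      using path_interpolation[OF B B.zero_closed b] by metis
    thus ?thesis using dga_map_zero[OF wm A B]
      by (intro bexI[of _ "(\<zero>\<^bsub>gr A n\<^esub>, \<gamma>)"]) (simp_all add: p_def E_def T_def)
  qed
  hence p: "trivial_fibration E B p" by (rule surjective_weak_equivalence[OF pw E B])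
  show thesis by (rule that[OF E j r p]) (simp_all add: r_def p_def j_def)
qed

text \<open>
  The instances of the lifting property that the study of maps to algebras with elements in \<open>'a\<close> requires: the
  algebra \<open>E\<close> of the factorisation and its path algebra.
\<close>

definition cofibrant_object :: "'a itself \<Rightarrow> 'u cdga \<Rightarrow> bool" where
  "cofibrant_object (_ :: 'a itself) Q \<longleftrightarrow> cdga Q \<and> cofibrant TYPE('a \<times> 'a forms) Q \<and> cofibrant TYPE(('a \<times> 'a forms) forms) Q"

text \<open>
  With the factorisation \<open>w = p j\<close> and the retraction \<open>r\<close> of \<open>j\<close>, lift \<open>f\<close> along \<open>p\<close> to \<open>e\<close> and take \<open>g = r e\<close>. Then
  \<open>j g\<close> is homotopic to \<open>e\<close> because both have the image \<open>g\<close> under the trivial fibration \<open>r\<close>.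
\<close>

lemma homotopic_lift_weak_equivalence:
  assumes cof: "cofibrant_object TYPE('a) Q"
    and A: "cdga (A :: 'a cdga)" and B: "cdga (B :: 'a cdga)" and w: "weak_equivalence A B w" and f: "dga_map Q B f"
  obtains g where "dga_map Q A g" "homotopic Q B (\<lambda>n q. w n (g n q)) f"
proof -
  have Q: "cdga Q" and c: "cofibrant TYPE('a \<times> 'a forms) Q" "cofibrant TYPE(('a \<times> 'a forms) forms) Q"
    using cof by (auto simp: cofibrant_object_def)
  obtain E :: "('a \<times> 'a forms) cdga" and j r p
    where E: "cdga E" "dga_map A E j" "trivial_fibration E A r" "trivial_fibration E B p"
      "\<And>n a. r n (j n a) = a" "\<And>n a. p n (j n a) = w n a"
    using weak_equivalence_factorisation[OF A B w] by blast
  note rm = trivial_fibration_dga_map[OF E(3)] and pm = trivial_fibration_dga_map[OF E(4)]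
  obtain e where e: "dga_map Q E e" "\<And>n q. q \<in> elts Q n \<Longrightarrow> p n (e n q) = f n q"
    by (rule cofibrant_lift[OF c(1) Q E(1) B E(4) f]) blast
  define g where "g n q = r n (e n q)" for n q
  have g: "dga_map Q A g" unfolding g_def by (rule dga_map_comp[OF e(1) rm])
  have "homotopic Q A (\<lambda>n q. r n (j n (g n q))) (\<lambda>n q. r n (e n q))"
    unfolding E(5) by (rule homotopic_cong[OF A g]) (simp add: g_def)
  from homotopic_cancel_trivial_fibration[OF c(2,1) Q E(1) A E(3) dga_map_comp[OF g E(2)] e(1) this]
  have "homotopic Q E (\<lambda>n q. j n (g n q)) e" .
  from homotopic_post[OF E(1) B pm this] have "homotopic Q B (\<lambda>n q. w n (g n q)) (\<lambda>n q. p n (e n q))"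
    unfolding E(6) .
  moreover have "homotopic Q B (\<lambda>n q. p n (e n q)) f"
    by (rule homotopic_cong[OF B dga_map_comp[OF e(1) pm]]) (rule e(2))
  ultimately show thesis using that[OF g] homotopic_trans by blast
qed

lemma homotopic_cancel_weak_equivalence:
  assumes cof: "cofibrant_object TYPE('a) Q"
    and A: "cdga (A :: 'a cdga)" and B: "cdga (B :: 'a cdga)" and w: "weak_equivalence A B w"
    and g: "dga_map Q A g" and g': "dga_map Q A g'"
    and h: "homotopic Q B (\<lambda>n q. w n (g n q)) (\<lambda>n q. w n (g' n q))"
  shows "homotopic Q A g g'"
proof -
  have Q: "cdga Q" and c: "cofibrant TYPE('a \<times> 'a forms) Q" "cofibrant TYPE(('a \<times> 'a forms) forms) Q"
    using cof by (auto simp: cofibrant_object_def)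
  obtain E :: "('a \<times> 'a forms) cdga" and j r p
    where E: "cdga E" "dga_map A E j" "trivial_fibration E A r" "trivial_fibration E B p"
      "\<And>n a. r n (j n a) = a" "\<And>n a. p n (j n a) = w n a"
    using weak_equivalence_factorisation[OF A B w] by blast
  have "homotopic Q B (\<lambda>n q. p n (j n (g n q))) (\<lambda>n q. p n (j n (g' n q)))" unfolding E(6) by (rule h)
  from homotopic_cancel_trivial_fibration[OF c(2,1) Q E(1) B E(4) dga_map_comp[OF g E(2)] dga_map_comp[OF g' E(2)] this]
  have "homotopic Q E (\<lambda>n q. j n (g n q)) (\<lambda>n q. j n (g' n q))" .
  from homotopic_post[OF E(1) A trivial_fibration_dga_map[OF E(3)] this] show ?thesis unfolding E(5) .
qed

section \<open>Zigzags act on homotopy invariant functors\<close>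

lemma CDGA_simps [simp]:
  "A \<in> Obj CDGA \<longleftrightarrow> cdga A" "Hom CDGA = cdga_hom"
  "Idm CDGA A = (\<lambda>n. \<lambda>x\<in>elts A n. x)" "Comp CDGA A B C g f = (\<lambda>n. compose (elts A n) (g n) (f n))"
  by (simp_all add: CDGA_def)

lemma quasi_iso_hom: "w \<in> quasi_iso A B \<Longrightarrow> w \<in> cdga_hom A B"
  by (simp add: quasi_iso_def)

lemma cdga_hom_dga_map: "f \<in> cdga_hom A B \<Longrightarrow> dga_map A B f"
  by (simp add: cdga_hom_iff)

primrec step_target :: "('o, 'm) step \<Rightarrow> 'o" where
  "step_target (Fwd X f Y) = Y"
| "step_target (Bwd Y w X) = X"

text \<open>
  A functor with values in sets is given by representatives: \<open>S A\<close> is the set of representatives at \<open>A\<close>, and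
  \<open>R A\<close> is equality of the represented elements. A formal inverse acts as the converse relation.
\<close>

primrec step_rel :: "('o \<Rightarrow> 's set) \<Rightarrow> ('o \<Rightarrow> 's \<Rightarrow> 's \<Rightarrow> bool) \<Rightarrow> ('m \<Rightarrow> 's \<Rightarrow> 's) \<Rightarrow> ('o, 'm) step \<Rightarrow> 's \<Rightarrow> 's \<Rightarrow> bool" where
  "step_rel S R act (Fwd X f Y) s t \<longleftrightarrow> s \<in> S X \<and> t \<in> S Y \<and> R Y (act f s) t"
| "step_rel S R act (Bwd Y w X) s t \<longleftrightarrow> s \<in> S Y \<and> t \<in> S X \<and> R Y (act w t) s"

primrec word_rel :: "('o \<Rightarrow> 's set) \<Rightarrow> ('o \<Rightarrow> 's \<Rightarrow> 's \<Rightarrow> bool) \<Rightarrow> ('m \<Rightarrow> 's \<Rightarrow> 's) \<Rightarrow>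
    ('o, 'm) step list \<Rightarrow> 'o \<Rightarrow> 's \<Rightarrow> 's \<Rightarrow> bool" where
  "word_rel S R act [] X s t \<longleftrightarrow> s \<in> S X \<and> t \<in> S X \<and> R X s t"
| "word_rel S R act (st # p) X s t \<longleftrightarrow> (\<exists>k. step_rel S R act st s k \<and> word_rel S R act p (step_target st) k t)"

text \<open>
  The conditions \<open>cancel\<close> and \<open>lift\<close> say that quasi-isomorphisms become bijections. Hence the functor
  factors through the localisation: words act on it by relations that are functions on the
  represented elements, and equal words act in the same way (\<open>word_eq_rel\<close>).
\<close>

locale homotopy_functor =
  fixes S :: "'u cdga \<Rightarrow> 's set" and R :: "'u cdga \<Rightarrow> 's \<Rightarrow> 's \<Rightarrow> bool" and act :: "'u cdga_map \<Rightarrow> 's \<Rightarrow> 's"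
  assumes R_refl: "cdga A \<Longrightarrow> s \<in> S A \<Longrightarrow> R A s s"
    and R_sym: "cdga A \<Longrightarrow> s \<in> S A \<Longrightarrow> t \<in> S A \<Longrightarrow> R A s t \<Longrightarrow> R A t s"
    and R_trans: "cdga A \<Longrightarrow> r \<in> S A \<Longrightarrow> s \<in> S A \<Longrightarrow> t \<in> S A \<Longrightarrow> R A r s \<Longrightarrow> R A s t \<Longrightarrow> R A r t"
    and act_closed: "cdga A \<Longrightarrow> cdga B \<Longrightarrow> f \<in> cdga_hom A B \<Longrightarrow> s \<in> S A \<Longrightarrow> act f s \<in> S B"
    and act_cong: "cdga A \<Longrightarrow> cdga B \<Longrightarrow> f \<in> cdga_hom A B \<Longrightarrow> s \<in> S A \<Longrightarrow> t \<in> S A \<Longrightarrow> R A s t \<Longrightarrow> R B (act f s) (act f t)"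
    and act_id: "cdga A \<Longrightarrow> s \<in> S A \<Longrightarrow> R A (act (Idm CDGA A) s) s"
    and act_comp: "cdga A \<Longrightarrow> cdga B \<Longrightarrow> cdga C \<Longrightarrow> f \<in> cdga_hom A B \<Longrightarrow> g \<in> cdga_hom B C \<Longrightarrow> s \<in> S A \<Longrightarrow>
      R C (act (Comp CDGA A B C g f) s) (act g (act f s))"
    and cancel: "cdga A \<Longrightarrow> cdga B \<Longrightarrow> w \<in> quasi_iso A B \<Longrightarrow> s \<in> S A \<Longrightarrow> t \<in> S A \<Longrightarrow>
      R B (act w s) (act w t) \<Longrightarrow> R A s t"
    and lift: "cdga A \<Longrightarrow> cdga B \<Longrightarrow> w \<in> quasi_iso A B \<Longrightarrow> t \<in> S B \<Longrightarrow> \<exists>s\<in>S A. R B (act w s) t"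
begin

abbreviation "srel \<equiv> step_rel S R act"
abbreviation "wrel \<equiv> word_rel S R act"

lemma step_facts:
  assumes "is_step CDGA quasi_iso A st B"
  shows "step_target st = B" "cdga A" "cdga B" "srel st s t \<Longrightarrow> s \<in> S A" "srel st s t \<Longrightarrow> t \<in> S B"
  using assms by (cases st; auto)+

lemma step_closed:
  assumes st: "is_step CDGA quasi_iso A st B" and "srel st s t" "s' \<in> S A" "t' \<in> S B" "R A s s'" "R B t t'"
  shows "srel st s' t'"
proof (cases st)
  case (Fwd X f Y)
  have f: "cdga A" "cdga B" "f \<in> cdga_hom A B" "X = A" "Y = B" using st Fwd by auto
  have m: "s \<in> S A" "t \<in> S B" "R B (act f s) t" using assms(2) Fwd f by auto
  have "R B (act f s') (act f s)" using act_cong[OF f(1,2,3) assms(3) m(1)] R_sym[OF f(1) m(1) assms(3,5)] by blast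
  hence "R B (act f s') t'" using R_trans[OF f(2)] act_closed[OF f(1,2,3)] m assms(3,4,6) by meson
  thus ?thesis using Fwd f assms by simp
next
  case (Bwd Y w X)
  have f: "cdga A" "cdga B" "w \<in> quasi_iso B A" "X = B" "Y = A" using st Bwd by auto
  note w = quasi_iso_hom[OF f(3)]
  have m: "s \<in> S A" "t \<in> S B" "R A (act w t) s" using assms(2) Bwd f by auto
  have "R A (act w t') (act w t)" using act_cong[OF f(2,1) w assms(4) m(2)] R_sym[OF f(2) m(2) assms(4,6)] by blast
  hence "R A (act w t') s'" using R_trans[OF f(1)] act_closed[OF f(2,1) w] m assms(3,4,5) by meson
  thus ?thesis using Bwd f assms by simp
qed

lemma step_total:
  assumes st: "is_step CDGA quasi_iso A st B" and "s \<in> S A" shows "\<exists>t. srel st s t"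
proof (cases st)
  case (Fwd X f Y)
  thus ?thesis using assms act_closed[of A B f s] R_refl[of B "act f s"] by auto
next
  case (Bwd Y w X)
  thus ?thesis using assms lift[of B A w s] by auto
qed

lemma step_functional:
  assumes st: "is_step CDGA quasi_iso A st B" and "srel st s t" "srel st s' t'" "R A s s'" shows "R B t t'"
proof (cases st)
  case (Fwd X f Y)
  have f: "cdga A" "cdga B" "f \<in> cdga_hom A B" "X = A" "Y = B" using st Fwd by auto
  have m: "s \<in> S A" "t \<in> S B" "R B (act f s) t" "s' \<in> S A" "t' \<in> S B" "R B (act f s') t'" using assms(2,3) Fwd f by auto
  note c = act_closed[OF f(1-3) m(1)] act_closed[OF f(1-3) m(4)]
  have "R B t (act f s)" by (rule R_sym[OF f(2) c(1) m(2,3)])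
  moreover have "R B (act f s) (act f s')" by (rule act_cong[OF f(1-3) m(1,4) assms(4)])
  ultimately have "R B t (act f s')" by (rule R_trans[OF f(2) m(2) c])
  thus ?thesis using m(6) by (rule R_trans[OF f(2) m(2) c(2) m(5)])
next
  case (Bwd Y w X)
  have f: "cdga A" "cdga B" "w \<in> quasi_iso B A" "X = B" "Y = A" using st Bwd by auto
  note w = quasi_iso_hom[OF f(3)]
  have m: "s \<in> S A" "t \<in> S B" "R A (act w t) s" "s' \<in> S A" "t' \<in> S B" "R A (act w t') s'" using assms(2,3) Bwd f by auto
  note c = act_closed[OF f(2,1) w m(2)] act_closed[OF f(2,1) w m(5)]
  have "R A (act w t) s'" by (rule R_trans[OF f(1) c(1) m(1,4) m(3) assms(4)])
  moreover have "R A s' (act w t')" by (rule R_sym[OF f(1) c(2) m(4,6)])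
  ultimately have "R A (act w t) (act w t')" by (rule R_trans[OF f(1) c(1) m(4) c(2)])
  thus ?thesis by (rule cancel[OF f(2,1,3) m(2,5)])
qed

lemma word_objects: "is_word CDGA quasi_iso A p B \<Longrightarrow> cdga A \<and> cdga B" for A B :: "'u cdga"
proof (induction p arbitrary: A)
  case (Cons st p)
  then obtain Y where Y: "is_step CDGA quasi_iso A st Y" "is_word CDGA quasi_iso Y p B" by auto
  show ?case using step_facts(2)[OF Y(1)] Cons.IH[OF Y(2)] by blast
qed simp

lemma word_mem: "is_word CDGA quasi_iso A p B \<Longrightarrow> wrel p A s t \<Longrightarrow> s \<in> S A \<and> t \<in> S B"
proof (induction p arbitrary: A s)
  case (Cons st p)
  from Cons.prems obtain Y k where Y: "is_step CDGA quasi_iso A st Y" "is_word CDGA quasi_iso Y p B"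
    "srel st s k" "wrel p (step_target st) k t" by auto
  show ?case using step_facts(4)[OF Y(1,3)] Cons.IH[OF Y(2) Y(4)[unfolded step_facts(1)[OF Y(1)]]] by blast
qed auto

lemma word_closed:
  "is_word CDGA quasi_iso A p B \<Longrightarrow> wrel p A s t \<Longrightarrow> s' \<in> S A \<Longrightarrow> t' \<in> S B \<Longrightarrow> R A s s' \<Longrightarrow> R B t t' \<Longrightarrow> wrel p A s' t'"
proof (induction p arbitrary: A s s')
  case Nil
  hence m: "cdga A" "A = B" "s \<in> S A" "t \<in> S A" "R A s t" by auto
  note e = Nil(3) Nil(4)[folded m(2)] Nil(5) Nil(6)[folded m(2)]
  have "R A s' s" by (rule R_sym[OF m(1,3) e(1,3)])
  hence "R A s' t" by (rule R_trans[OF m(1) e(1) m(3,4) _ m(5)])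
  hence "R A s' t'" by (rule R_trans[OF m(1) e(1) m(4) e(2) _ e(4)])
  thus ?case using e(1,2) by simp
next
  case (Cons st p)
  from Cons.prems(1,2) obtain Y k where Y: "is_step CDGA quasi_iso A st Y" "is_word CDGA quasi_iso Y p B"
    "srel st s k" "wrel p Y k t" using step_facts(1) by fastforce
  note f = step_facts[OF Y(1)]
  have k: "k \<in> S Y" by (rule f(5)[OF Y(3)])
  hence kk: "R Y k k" by (rule R_refl[OF f(3)])
  have "srel st s' k" by (rule step_closed[OF Y(1,3) Cons.prems(3) k Cons.prems(5) kk])
  moreover have "wrel p Y k t'" by (rule Cons.IH[OF Y(2,4) k Cons.prems(4) kk Cons.prems(6)])
  ultimately show ?case using f(1) by auto
qed

lemma word_total: "is_word CDGA quasi_iso A p B \<Longrightarrow> s \<in> S A \<Longrightarrow> \<exists>t. wrel p A s t"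
proof (induction p arbitrary: A s)
  case Nil thus ?case using R_refl by auto
next
  case (Cons st p)
  from Cons.prems(1) obtain Y where Y: "is_step CDGA quasi_iso A st Y" "is_word CDGA quasi_iso Y p B" by auto
  obtain k where k: "srel st s k" using step_total[OF Y(1) Cons.prems(2)] by blast
  obtain t where "wrel p Y k t" using Cons.IH[OF Y(2)] step_facts(5)[OF Y(1) k] by blast
  thus ?case using k step_facts(1)[OF Y(1)] by auto
qed

lemma word_functional:
  "is_word CDGA quasi_iso A p B \<Longrightarrow> wrel p A s t \<Longrightarrow> wrel p A s' t' \<Longrightarrow> R A s s' \<Longrightarrow> R B t t'"
proof (induction p arbitrary: A s s')
  case Nil
  hence m: "cdga A" "A = B" "s \<in> S A" "t \<in> S A" "R A s t" "s' \<in> S A" "t' \<in> S A" "R A s' t'" by auto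
  have "R A t s" by (rule R_sym[OF m(1,3,4,5)])
  hence "R A t s'" by (rule R_trans[OF m(1,4,3,6) _ Nil(4)])
  hence "R A t t'" by (rule R_trans[OF m(1,4,6,7) _ m(8)])
  thus ?case using m(2) by simp
next
  case (Cons st p)
  from Cons.prems(1,2,3) obtain Y k k' where Y: "is_step CDGA quasi_iso A st Y" "is_word CDGA quasi_iso Y p B"
    "srel st s k" "wrel p (step_target st) k t" "srel st s' k'" "wrel p (step_target st) k' t'" by auto
  from step_functional[OF Y(1,3,5) Cons.prems(4)] show ?case
    using Cons.IH[OF Y(2)] Y(4,6) unfolding step_facts(1)[OF Y(1)] by blast
qed

lemma word_append:
  "is_word CDGA quasi_iso A p B \<Longrightarrow> is_word CDGA quasi_iso B q C \<Longrightarrow>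
   wrel (p @ q) A s t \<longleftrightarrow> (\<exists>k. wrel p A s k \<and> wrel q B k t)"
proof (induction p arbitrary: A s)
  case Nil
  hence A: "A = B" "cdga B" by auto
  have "wrel q B s t" if "wrel [] B s k" "wrel q B k t" for k
    using that word_closed[OF Nil(2) that(2), of s t] word_mem[OF Nil(2) that(2)] R_sym[OF A(2)] R_refl
      word_objects[OF Nil(2)] by auto
  moreover have "wrel [] B s s" if "wrel q B s t" using word_mem[OF Nil(2) that] R_refl[OF A(2)] by simp
  ultimately show ?case using A by auto
next
  case (Cons st p)
  from Cons.prems(1) obtain Y where Y: "is_step CDGA quasi_iso A st Y" "is_word CDGA quasi_iso Y p B" by auto
  show ?case using Cons.IH[OF Y(2) Cons.prems(2)] step_facts(1)[OF Y(1)] by auto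
qed

end

lemma is_word_append: "is_word C W X p Y \<Longrightarrow> is_word C W Y q Z \<Longrightarrow> is_word C W X (p @ q) Z"
  by (induction p arbitrary: X) auto

lemma word_eq_words:
  assumes "\<And>X. X \<in> Obj C \<Longrightarrow> Idm C X \<in> Hom C X X"
    and "\<And>X Y Z f g. X \<in> Obj C \<Longrightarrow> Y \<in> Obj C \<Longrightarrow> Z \<in> Obj C \<Longrightarrow> f \<in> Hom C X Y \<Longrightarrow> g \<in> Hom C Y Z \<Longrightarrow> Comp C X Y Z g f \<in> Hom C X Z"
    and "\<And>X Y w. w \<in> W X Y \<Longrightarrow> w \<in> Hom C X Y"
    and "word_eq C W X Y p q"
  shows "is_word C W X p Y \<and> is_word C W X q Y"
  using assms(4) by (induction rule: word_eq.induct) (use assms(1-3) in \<open>auto intro: is_word_append\<close>)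

lemma cdga_hom_Idm: "Idm CDGA A \<in> cdga_hom A A" if "cdga A"
proof -
  interpret cdga A by fact
  show ?thesis using one_closed by (simp add: cdga_hom_iff dga_map_def)
qed

lemma cdga_hom_Comp:
  assumes "cdga A" "cdga B" "f \<in> cdga_hom A B" "g \<in> cdga_hom B C" shows "Comp CDGA A B C g f \<in> cdga_hom A C"
proof -
  interpret cdga A by fact
  have "dga_map A C (\<lambda>n. compose (elts A n) (g n) (f n))"
    by (rule dga_map_cong[OF assms(1) dga_map_comp[OF cdga_hom_dga_map[OF assms(3)] cdga_hom_dga_map[OF assms(4)]]])
      (simp add: compose_def)
  thus ?thesis by (simp add: cdga_hom_iff)
qed

lemma CDGA_word_eq_words: "word_eq CDGA quasi_iso X Y p q \<Longrightarrow> is_word CDGA quasi_iso X p Y \<and> is_word CDGA quasi_iso X q Y"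
  by (rule word_eq_words[rotated 3]) (use cdga_hom_Idm cdga_hom_Comp quasi_iso_hom in auto)

lemma (in homotopy_functor) word_eq_rel:
  "word_eq CDGA quasi_iso A B p q \<Longrightarrow> wrel p A s t \<longleftrightarrow> wrel q A s t"
proof (induction arbitrary: s t rule: word_eq.induct)
  case (cong X' p X Y q q' r Y')
  have w: "is_word CDGA quasi_iso X q Y" "is_word CDGA quasi_iso X q' Y"
    using CDGA_word_eq_words[OF cong.hyps(2)] by blast+
  note qr = word_append[OF w(1) cong.hyps(3)] word_append[OF w(2) cong.hyps(3)]
  have "is_word CDGA quasi_iso X (q @ r) Y'" "is_word CDGA quasi_iso X (q' @ r) Y'"
    using is_word_append[OF w(1) cong.hyps(3)] is_word_append[OF w(2) cong.hyps(3)] .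
  from this[THEN word_append[OF cong.hyps(1)]] show ?case using qr cong.IH by simp
next
  case (ident X)
  hence X: "cdga X" by simp
  note c = act_closed[OF X X cdga_hom_Idm[OF X]] act_id[OF X]
  have "s \<in> S X \<Longrightarrow> t \<in> S X \<Longrightarrow> R X (act (Idm CDGA X) s) t \<longleftrightarrow> R X s t"
    using c R_sym[OF X] R_trans[OF X] by meson
  moreover have "wrel [Fwd X (Idm CDGA X) X] X s t \<longleftrightarrow> s \<in> S X \<and> t \<in> S X \<and> R X (act (Idm CDGA X) s) t"
    using R_refl[OF X] R_trans[OF X] c(1) by (simp del: CDGA_simps) blast
  ultimately show ?case by auto
next
  case (comp X Y Z f g)
  hence o: "cdga X" "cdga Y" "cdga Z" "f \<in> cdga_hom X Y" "g \<in> cdga_hom Y Z" by auto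
  let ?h = "Comp CDGA X Y Z g f"
  have h: "?h \<in> cdga_hom X Z" by (rule cdga_hom_Comp[OF o(1,2,4,5)])
  have w: "is_word CDGA quasi_iso X [Fwd X f Y, Fwd Y g Z] Z" "is_word CDGA quasi_iso X [Fwd X ?h Z] Z"
    using o h by auto
  have base: "wrel [Fwd X f Y, Fwd Y g Z] X s (act g (act f s))" "wrel [Fwd X ?h Z] X s (act g (act f s))" if s: "s \<in> S X" for s
  proof -
    note c = act_closed[OF o(1,2,4) s] act_closed[OF o(2,3,5) act_closed[OF o(1,2,4) s]] act_closed[OF o(1,3) h s]
    show "wrel [Fwd X f Y, Fwd Y g Z] X s (act g (act f s))" using s c R_refl o by auto
    show "wrel [Fwd X ?h Z] X s (act g (act f s))"
      using s c R_refl[OF o(3) c(2)] act_comp[OF o s] by (auto simp del: CDGA_simps)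
  qed
  have eq: "wrel p X s t \<longleftrightarrow> s \<in> S X \<and> t \<in> S Z \<and> R Z (act g (act f s)) t"
    if p: "is_word CDGA quasi_iso X p Z" "\<And>s. s \<in> S X \<Longrightarrow> wrel p X s (act g (act f s))" for p
  proof
    assume a: "wrel p X s t"
    hence m: "s \<in> S X" "t \<in> S Z" using word_mem[OF p(1)] by blast+
    thus "s \<in> S X \<and> t \<in> S Z \<and> R Z (act g (act f s)) t"
      using word_functional[OF p(1) p(2)[OF m(1)] a R_refl[OF o(1) m(1)]] by blast
  next
    assume a: "s \<in> S X \<and> t \<in> S Z \<and> R Z (act g (act f s)) t"
    thus "wrel p X s t" using word_closed[OF p(1) p(2)] R_refl[OF o(1)] by blast
  qed
  show ?case using eq[OF w(1) base(1)] eq[OF w(2) base(2)] by blast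
next
  case (inv_left X Y w)
  hence o: "cdga X" "cdga Y" "w \<in> quasi_iso X Y" by auto
  note h = quasi_iso_hom[OF o(3)]
  have w: "is_word CDGA quasi_iso X [Fwd X w Y, Bwd Y w X] X" using o h by auto
  have base: "wrel [Fwd X w Y, Bwd Y w X] X s s" if s: "s \<in> S X" for s
    using s o act_closed[OF o(1,2) h s] R_refl by auto
  show ?case
  proof
    assume a: "wrel [Fwd X w Y, Bwd Y w X] X s t"
    hence m: "s \<in> S X" "t \<in> S X" using word_mem[OF w] by blast+
    thus "wrel [] X s t" using word_functional[OF w base[OF m(1)] a R_refl[OF o(1) m(1)]] by simp
  next
    assume "wrel [] X s t"
    hence m: "s \<in> S X" "t \<in> S X" "R X s t" by simp_all
    show "wrel [Fwd X w Y, Bwd Y w X] X s t"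
      by (rule word_closed[OF w base[OF m(1)] m(1,2) R_refl[OF o(1) m(1)] m(3)])
  qed
next
  case (inv_right X Y w)
  hence o: "cdga X" "cdga Y" "w \<in> quasi_iso X Y" by auto
  note h = quasi_iso_hom[OF o(3)]
  have w: "is_word CDGA quasi_iso Y [Bwd Y w X, Fwd X w Y] Y" using o h by auto
  have base: "wrel [Bwd Y w X, Fwd X w Y] Y s s" if s: "s \<in> S Y" for s
  proof -
    obtain k where k: "k \<in> S X" "R Y (act w k) s" using lift[OF o s] by blast
    thus ?thesis using s R_refl[OF o(2) s] by auto
  qed
  show ?case
  proof
    assume a: "wrel [Bwd Y w X, Fwd X w Y] Y s t"
    hence m: "s \<in> S Y" "t \<in> S Y" using word_mem[OF w] by blast+
    thus "wrel [] Y s t" using word_functional[OF w base[OF m(1)] a R_refl[OF o(2) m(1)]] by simp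
  next
    assume "wrel [] Y s t"
    hence m: "s \<in> S Y" "t \<in> S Y" "R Y s t" by simp_all
    show "wrel [Bwd Y w X, Fwd X w Y] Y s t"
      by (rule word_closed[OF w base[OF m(1)] m(1,2) R_refl[OF o(2) m(1)] m(3)])
  qed
qed auto

text \<open>
  This compares the action on maps with the action on their restrictions along a map, and on their
  values at a cocycle.
\<close>

lemma word_rel_natural:
  assumes "is_word CDGA quasi_iso A p B" "word_rel S R act p A s t"
    and "\<And>A s. cdga A \<Longrightarrow> s \<in> S A \<Longrightarrow> \<tau> s \<in> S' A"
    and "\<And>A s t. cdga A \<Longrightarrow> t \<in> S A \<Longrightarrow> R A s t \<Longrightarrow> R' A (\<tau> s) (\<tau> t)"
    and "\<And>f s. \<tau> (act f s) = act' f (\<tau> s)"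
  shows "word_rel S' R' act' p A (\<tau> s) (\<tau> t)"
  using assms(1,2)
proof (induction p arbitrary: A s)
  case Nil thus ?case using assms(3,4) by auto
next
  case (Cons st p)
  from Cons.prems obtain Y k where Y: "is_step CDGA quasi_iso A st Y" "is_word CDGA quasi_iso Y p B"
    "step_rel S R act st s k" "word_rel S R act p (step_target st) k t" by auto
  have "step_target st = Y" using Y(1) by (cases st) auto
  moreover have "step_rel S' R' act' st (\<tau> s) (\<tau> k)"
    using Y(1,3) assms(3,4) by (cases st) (auto simp: assms(5)[symmetric])
  ultimately show ?case using Cons.IH[OF Y(2)] Y(4) by auto
qed

section \<open>Strictification of sequences\<close>

text \<open>
  Cofibrancy of \<open>Q\<close> makes homotopy classes of maps out of \<open>Q\<close> invariant under weak equivalences of the target.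
\<close>

lemma homotopy_functor_maps:
  assumes cof: "cofibrant_object TYPE('u) Q"
  shows "homotopy_functor (\<lambda>A :: 'u cdga. {f. dga_map Q A f}) (homotopic Q) (\<lambda>f s n q. f n (s n q))"
proof -
  have Q: "cdga Q" using cof by (simp add: cofibrant_object_def)
  show ?thesis
  proof
    fix A B :: "'u cdga" and w t assume "cdga A" "cdga B" "w \<in> quasi_iso A B" "t \<in> {f. dga_map Q B f}"
    thus "\<exists>s\<in>{f. dga_map Q A f}. homotopic Q B (\<lambda>n q. w n (s n q)) t"
      using homotopic_lift_weak_equivalence[OF cof, of A B w t] by (auto simp: quasi_iso_iff)
  next
    fix A B :: "'u cdga" and w s t
    assume "cdga A" "cdga B" "w \<in> quasi_iso A B" "s \<in> {f. dga_map Q A f}" "t \<in> {f. dga_map Q A f}"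
      "homotopic Q B (\<lambda>n q. w n (s n q)) (\<lambda>n q. w n (t n q))"
    thus "homotopic Q A s t"
      using homotopic_cancel_weak_equivalence[OF cof, of A B w s t] by (auto simp: quasi_iso_iff)
  next
    fix A :: "'u cdga" and s assume A: "cdga A" and s: "s \<in> {f. dga_map Q A f}"
    show "homotopic Q A (\<lambda>n q. Idm CDGA A n (s n q)) s"
      using s dga_mapD(1)[of Q A s] by (intro homotopic_sym[OF homotopic_cong[OF A]]) auto
  next
    fix A B C :: "'u cdga" and f g s
    assume o: "cdga A" "cdga B" "cdga C" "f \<in> cdga_hom A B" "g \<in> cdga_hom B C" "s \<in> {f. dga_map Q A f}"
    have "dga_map Q C (\<lambda>n q. g n (f n (s n q)))"
      using dga_map_comp[OF dga_map_comp[OF _ cdga_hom_dga_map[OF o(4)]] cdga_hom_dga_map[OF o(5)], of Q s] o(6) by simp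
    thus "homotopic Q C (\<lambda>n q. Comp CDGA A B C g f n (s n q)) (\<lambda>n q. g n (f n (s n q)))"
      using o(6) dga_mapD(1)[of Q A s] by (intro homotopic_sym[OF homotopic_cong[OF o(3)]]) (auto simp: compose_def)
  next
    fix A B :: "'u cdga" and f s assume o: "cdga A" "cdga B" "f \<in> cdga_hom A B" "s \<in> {f. dga_map Q A f}"
    show "(\<lambda>n q. f n (s n q)) \<in> {f. dga_map Q B f}"
      using dga_map_comp[OF _ cdga_hom_dga_map[OF o(3)], of Q s] o(4) by simp
  next
    fix A B :: "'u cdga" and f s t assume o: "cdga A" "cdga B" "f \<in> cdga_hom A B" "homotopic Q A s t"
    show "homotopic Q B (\<lambda>n q. f n (s n q)) (\<lambda>n q. f n (t n q))"
      by (rule homotopic_post[OF o(1,2) cdga_hom_dga_map[OF o(3)] o(4)])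
  qed (auto intro: homotopic_sym homotopic_trans)
qed

lemma homotopy_functor_cocycles:
  "homotopy_functor (\<lambda>A :: 'u cdga. cocycles A n) (\<lambda>A. cohomologous A n) (\<lambda>f. f n)"
proof
  fix A B :: "'u cdga" and w t assume "cdga A" "cdga B" "w \<in> quasi_iso A B" "t \<in> cocycles B n"
  thus "\<exists>s\<in>cocycles A n. cohomologous B n (w n s) t" by (simp add: quasi_iso_iff weak_equivalence_def)
next
  fix A B :: "'u cdga" and w s t
  assume "cdga A" "cdga B" "w \<in> quasi_iso A B" "s \<in> cocycles A n" "t \<in> cocycles A n" "cohomologous B n (w n s) (w n t)"
  thus "cohomologous A n s t" by (simp add: quasi_iso_iff weak_equivalence_def)
next
  fix A :: "'u cdga" and s assume "cdga A" "s \<in> cocycles A n"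
  thus "cohomologous A n (Idm CDGA A n s) s" by (simp add: cdga.cocyclesD cdga.cohomologous_refl)
next
  fix A B C :: "'u cdga" and f g s
  assume o: "cdga A" "cdga B" "cdga C" "f \<in> cdga_hom A B" "g \<in> cdga_hom B C" "s \<in> cocycles A n"
  note m = dga_mapD(1)[OF cdga_hom_dga_map[OF o(4)] cdga.cocyclesD[OF o(1,6)]]
  show "cohomologous C n (Comp CDGA A B C g f n s) (g n (f n s))"
    using cdga.cohomologous_refl[OF o(3) dga_mapD(1)[OF cdga_hom_dga_map[OF o(5)] m]] cdga.cocyclesD[OF o(1,6)]
    by (simp add: compose_def)
next
  fix A B :: "'u cdga" and f s assume o: "cdga A" "cdga B" "f \<in> cdga_hom A B" "s \<in> cocycles A n"
  show "f n s \<in> cocycles B n" by (rule dga_map_cocycles[OF cdga_hom_dga_map[OF o(3)] o(1,2,4)])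
next
  fix A B :: "'u cdga" and f s t assume o: "cdga A" "cdga B" "f \<in> cdga_hom A B" "cohomologous A n s t" "t \<in> cocycles A n"
  show "cohomologous B n (f n s) (f n t)"
    by (rule dga_map_cohomologous[OF cdga_hom_dga_map[OF o(3)] o(1,2,4) cdga.cocyclesD[OF o(1,5)]])
qed (auto intro: cdga.cohomologous_refl cdga.cohomologous_sym cdga.cohomologous_trans cdga.cocyclesD)

abbreviation map_rel :: "'u cdga \<Rightarrow> ('u cdga, 'u cdga_map) step list \<Rightarrow> 'u cdga \<Rightarrow> 'u cdga_map \<Rightarrow> 'u cdga_map \<Rightarrow> bool" where
  "map_rel Q \<equiv> word_rel (\<lambda>A. {f. dga_map Q A f}) (homotopic Q) (\<lambda>f s n q. f n (s n q))"

abbreviation coh_rel :: "nat \<Rightarrow> ('u cdga, 'u cdga_map) step list \<Rightarrow> 'u cdga \<Rightarrow> 'u \<Rightarrow> 'u \<Rightarrow> bool" where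
  "coh_rel n \<equiv> word_rel (\<lambda>A. cocycles A n) (\<lambda>A. cohomologous A n) (\<lambda>f. f n)"

definition coh_bijective :: "('u cdga, 'u cdga_map) step list \<Rightarrow> 'u cdga \<Rightarrow> 'u cdga \<Rightarrow> bool" where
  "coh_bijective p A B \<longleftrightarrow>
     (\<forall>n. \<forall>z\<in>cocycles B n. \<exists>y. coh_rel n p A y z) \<and>
     (\<forall>n y y' z. coh_rel n p A y z \<longrightarrow> coh_rel n p A y' z \<longrightarrow> cohomologous A n y y')"

text \<open>
  On cohomology, \<open>h\<close> is \<open>q\<close> followed by the action of the zigzag \<open>p\<close>, by naturality in the homotopy functor.
\<close>

lemma map_rel_weak_equivalence:
  assumes p: "is_word CDGA quasi_iso A p B" and Q: "cdga Q" and q: "weak_equivalence Q A q"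
    and rel: "map_rel Q p A q h" and bij: "coh_bijective p A B" and h: "dga_map Q B h"
  shows "weak_equivalence Q B h"
proof -
  have rel': "coh_rel n p A (q n z) (h n z)" if z: "z \<in> cocycles Q n" for n z
  proof (rule word_rel_natural[OF p rel])
    show "f n z \<in> cocycles A n" if "cdga A" "f \<in> {f. dga_map Q A f}" for A :: "'a cdga" and f
      using dga_map_cocycles[OF _ Q that(1) z] that(2) by simp
    show "cohomologous A n (f n z) (g n z)" if A: "cdga A" and g: "g \<in> {f. dga_map Q A f}" and fg: "homotopic Q A f g" for A :: "'a cdga" and f g
    proof -
      have g: "dga_map Q A g" using g by simp
      have "cohomologous A n (g n z) (f n z)"
        by (rule homotopic_cohomologous[OF Q A homotopic_sym[OF fg] g z])
      moreover have "f n z \<in> elts A n"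
        by (rule dga_mapD(1)[OF homotopic_dga_map[OF Q A homotopic_sym[OF fg] g] cdga.cocyclesD[OF Q z]])
      ultimately show ?thesis by (rule cdga.cohomologous_sym[OF A])
    qed
  qed simp
  interpret A: cdga A using homotopy_functor.word_objects[OF homotopy_functor_cocycles p] by blast
  interpret B: cdga B using homotopy_functor.word_objects[OF homotopy_functor_cocycles p] by blast
  have qc: "q n z \<in> cocycles A n" if "z \<in> cocycles Q n" for n z
    using dga_map_cocycles[OF weak_equivalence_dga_map[OF q] Q A.cdga_axioms that] .
  show ?thesis unfolding weak_equivalence_def
  proof (intro conjI allI ballI impI)
    show "dga_map Q B h" by (rule h)
    fix n
    interpret C: homotopy_functor "\<lambda>A :: 'a cdga. cocycles A n" "\<lambda>A. cohomologous A n" "\<lambda>f. f n"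
      by (rule homotopy_functor_cocycles)
    show "\<exists>y\<in>cocycles Q n. cohomologous B n (h n y) z" if z: "z \<in> cocycles B n" for z
    proof -
      obtain y where y: "coh_rel n p A y z" using bij z unfolding coh_bijective_def by blast
      hence "y \<in> cocycles A n" using C.word_mem[OF p] by blast
      then obtain x where x: "x \<in> cocycles Q n" "cohomologous A n (q n x) y"
        using q unfolding weak_equivalence_def by blast
      thus ?thesis using C.word_functional[OF p rel'[OF x(1)] y] by blast
    qed
    fix x x' assume x: "x \<in> cocycles Q n" "x' \<in> cocycles Q n" "cohomologous B n (h n x) (h n x')"
    have hc: "h n x \<in> cocycles B n" "h n x' \<in> cocycles B n"
      using dga_map_cocycles[OF h Q B.cdga_axioms] x by blast+
    have "coh_rel n p A (q n x) (h n x')"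
      using C.word_closed[OF p rel'[OF x(1)] qc[OF x(1)] hc(2) A.cohomologous_refl x(3)] qc[OF x(1)] A.cocyclesD by blast
    hence "cohomologous A n (q n x) (q n x')"
      using bij rel'[OF x(2)] unfolding coh_bijective_def by blast
    thus "cohomologous Q n x x'" using q x unfolding weak_equivalence_def by blast
  qed
qed

text \<open>
  Besides the types that occur in \<open>cofibrant_object\<close>, homotopies of maps to an algebra with elements in \<open>'u\<close> have to be extended.
\<close>

definition free_cofibration :: "'u cdga \<Rightarrow> 'u cdga \<Rightarrow> (nat \<Rightarrow> 'u \<Rightarrow> 'u) \<Rightarrow> bool" where
  "free_cofibration P Q i \<longleftrightarrow> dga_map P Q i \<and> cofibration TYPE('u forms) P Q i \<and>
     cofibration TYPE('u \<times> 'u forms) P Q i \<and> cofibration TYPE(('u \<times> 'u forms) forms) P Q i"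

lemma free_extension_cofibrant:
  assumes F: "free_extension P B v enc"
  shows "cofibrant TYPE('v) (free_extension.Ext False P B v enc)"
  unfolding cofibrant_def
proof (intro allI impI)
  fix X :: "'v cdga" and T
  assume X: "cdga X" "acyclic_correspondence (free_extension.Ext False P B v enc) X T"
  from free_extension.lifting[OF F X, of "\<lambda>n x. undefined"]
  show "\<exists>L. dga_map (free_extension.Ext False P B v enc) X L \<and>
    (\<forall>n. \<forall>q\<in>elts (free_extension.Ext False P B v enc) n. T n q (L n q))" by blast
qed

lemma free_extension_cofibration:
  assumes F: "free_extension P B v enc"
  shows "cofibration TYPE('v) P (free_extension.Ext True P B v enc) (free_extension.incl True P B v enc)"
  unfolding cofibration_def
proof (intro allI impI)
  fix X :: "'v cdga" and T u
  assume X: "cdga X" "acyclic_correspondence (free_extension.Ext True P B v enc) X T" and u: "dga_map P X u"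
    and base: "\<forall>n. \<forall>a\<in>elts P n. T n (free_extension.incl True P B v enc n a) (u n a)"
  from free_extension.lifting[OF F X u] base
  show "\<exists>L. dga_map (free_extension.Ext True P B v enc) X L \<and>
    (\<forall>n. \<forall>q\<in>elts (free_extension.Ext True P B v enc) n. T n q (L n q)) \<and>
    (\<forall>n. \<forall>a\<in>elts P n. L n (free_extension.incl True P B v enc n a) = u n a)" by blast
qed

lemma cofibrant_replacement:
  assumes inf: "infinite (UNIV :: 'u set)" and B: "cdga (B :: 'u cdga)"
  obtains Q :: "'u cdga" and q where "cofibrant_object TYPE('u) Q" "trivial_fibration Q B q"
proof -
  obtain enc :: "'u tm \<Rightarrow> 'u" where "inj enc" using inj_tm_encoding[OF inf] by blast
  hence F: "free_extension B B (\<lambda>n x. x) enc"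
    by (rule free_extension.intro[OF B B dga_map_id])
  have "cofibrant_object TYPE('u) (free_extension.Ext False B B (\<lambda>n x. x) enc)"
    unfolding cofibrant_object_def
    by (intro conjI free_extension.cdga_Ext[OF F] free_extension_cofibrant[OF F])
  thus ?thesis using free_extension.proj_trivial_fibration[OF F] by (rule that)
qed

lemma cofibration_factorisation:
  assumes inf: "infinite (UNIV :: 'u set)" and P: "cofibrant_object TYPE('u) (P :: 'u cdga)" and B: "cdga (B :: 'u cdga)"
    and v: "dga_map P B v"
  obtains Q :: "'u cdga" and i q where "cofibrant_object TYPE('u) Q" "free_cofibration P Q i" "trivial_fibration Q B q"
    "\<And>n x. x \<in> elts P n \<Longrightarrow> q n (i n x) = v n x"
proof -
  have PC: "cdga P" using P by (simp add: cofibrant_object_def)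
  obtain enc :: "'u tm \<Rightarrow> 'u" where "inj enc" using inj_tm_encoding[OF inf] by blast
  hence F: "free_extension P B v enc"
    by (rule free_extension.intro[OF PC B v])
  let ?Q = "free_extension.Ext True P B v enc" and ?i = "free_extension.incl True P B v enc"
  note im = free_extension.incl_dga_map[OF F, of True, OF TrueI] and QC = free_extension.cdga_Ext[OF F, of True]
  have i: "free_cofibration P ?Q ?i"
    unfolding free_cofibration_def by (intro conjI im free_extension_cofibration[OF F])
  have c: "cofibrant_object TYPE('u) ?Q"
    using P i unfolding free_cofibration_def cofibrant_object_def
    by (intro conjI QC; elim conjE) (rule cofibrant_comp[OF PC QC im]; assumption)+
  show ?thesis
    by (rule that[OF c i free_extension.proj_trivial_fibration[OF F] free_extension.proj_incl[OF F, of True, OF TrueI]])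
qed

text \<open>
  Factoring the maps \<open>Q n \<rightarrow> A n \<rightarrow> A (n + 1)\<close> through cofibrations gives a sequence \<open>Q\<close> of cofibrant algebras over \<open>A\<close>.
  Maps \<open>h n : Q n \<rightarrow> B n\<close> that represent the zigzags \<open>\<theta> n\<close> are chosen one after the other. Any representative
  of \<open>\<theta> (n + 1)\<close> extends \<open>h n\<close> up to homotopy, since the zigzags commute with the structure maps in the
  homotopy category, and it extends \<open>h n\<close> strictly after a change within its homotopy class.
\<close>

theorem sequence_strictification:
  fixes A B :: "nat \<Rightarrow> 'u cdga"
  assumes inf: "infinite (UNIV :: 'u set)"
    and A: "\<And>n. cdga (A n)" and B: "\<And>n. cdga (B n)"
    and a: "\<And>n. a n \<in> cdga_hom (A n) (A (Suc n))" and b: "\<And>n. b n \<in> cdga_hom (B n) (B (Suc n))"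
    and \<theta>: "\<And>n. is_word CDGA quasi_iso (A n) (\<theta> n) (B n)"
    and comm: "\<And>n. word_eq CDGA quasi_iso (A n) (B (Suc n))
      ([Fwd (A n) (a n) (A (Suc n))] @ \<theta> (Suc n)) (\<theta> n @ [Fwd (B n) (b n) (B (Suc n))])"
    and bij: "\<And>n. coh_bijective (\<theta> n) (A n) (B n)"
  shows "\<exists>(Q :: nat \<Rightarrow> 'u cdga) i q h. (\<forall>n. cdga (Q n)) \<and> (\<forall>n. dga_map (Q n) (Q (Suc n)) (i n)) \<and>
    (\<forall>n. weak_equivalence (Q n) (A n) (q n)) \<and> (\<forall>n. weak_equivalence (Q n) (B n) (h n)) \<and>
    (\<forall>n k. \<forall>x\<in>elts (Q n) k. q (Suc n) k (i n k x) = a n k (q n k x) \<and> h (Suc n) k (i n k x) = b n k (h n k x))"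
proof -
  define good :: "nat \<Rightarrow> 'u cdga \<times> 'u cdga_map \<times> 'u cdga_map \<Rightarrow> bool" where
    "good n s \<longleftrightarrow> (case s of (Q, q, h) \<Rightarrow> cofibrant_object TYPE('u) Q \<and> trivial_fibration Q (A n) q \<and>
       dga_map Q (B n) h \<and> map_rel Q (\<theta> n) (A n) q h)" for n s
  define succ :: "nat \<Rightarrow> 'u cdga \<times> 'u cdga_map \<times> 'u cdga_map \<Rightarrow> 'u cdga \<times> 'u cdga_map \<times> 'u cdga_map \<Rightarrow> bool" where
    "succ n s s' \<longleftrightarrow> (case s of (Q, q, h) \<Rightarrow> case s' of (Q', q', h') \<Rightarrow> \<exists>i. dga_map Q Q' i \<and>
       (\<forall>k. \<forall>x\<in>elts Q k. q' k (i k x) = a n k (q k x) \<and> h' k (i k x) = b n k (h k x)))" for n s s'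
  have "\<exists>s. good 0 s"
  proof -
    obtain Q :: "'u cdga" and q where Q: "cofibrant_object TYPE('u) Q" "trivial_fibration Q (A 0) q"
      using cofibrant_replacement[OF inf A] by blast
    interpret M: homotopy_functor "\<lambda>A :: 'u cdga. {f. dga_map Q A f}" "homotopic Q" "\<lambda>f s n q. f n (s n q)"
      by (rule homotopy_functor_maps[OF Q(1)])
    obtain h where "map_rel Q (\<theta> 0) (A 0) q h"
      using M.word_total[OF \<theta>[of 0], of q] trivial_fibration_dga_map[OF Q(2)] by auto
    thus ?thesis using Q M.word_mem[OF \<theta>[of 0]] unfolding good_def by blast
  qed
  moreover have "\<exists>s'. good (Suc n) s' \<and> succ n s s'" if good: "good n s" for n s
  proof -
    obtain P q h where s: "s = (P, q, h)" by (cases s)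
    have P: "cofibrant_object TYPE('u) P" and q: "trivial_fibration P (A n) q" and h: "dga_map P (B n) h"
      and rel: "map_rel P (\<theta> n) (A n) q h" using good by (simp_all add: good_def s)
    note am = cdga_hom_dga_map[OF a[of n]] and bm = cdga_hom_dga_map[OF b[of n]]
    note qm = trivial_fibration_dga_map[OF q]
    obtain Q :: "'u cdga" and i q' where Q: "cofibrant_object TYPE('u) Q" and i: "free_cofibration P Q i"
      and q': "trivial_fibration Q (A (Suc n)) q'" "\<And>k x. x \<in> elts P k \<Longrightarrow> q' k (i k x) = a n k (q k x)"
      using cofibration_factorisation[OF inf P A dga_map_comp[OF qm am]] by metis
    have im: "dga_map P Q i" using i by (simp add: free_cofibration_def)
    have PC: "cdga P" and QC: "cdga Q" using P Q by (simp_all add: cofibrant_object_def)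
    interpret MP: homotopy_functor "\<lambda>A :: 'u cdga. {f. dga_map P A f}" "homotopic P" "\<lambda>f s n q. f n (s n q)"
      by (rule homotopy_functor_maps[OF P])
    interpret MQ: homotopy_functor "\<lambda>A :: 'u cdga. {f. dga_map Q A f}" "homotopic Q" "\<lambda>f s n q. f n (s n q)"
      by (rule homotopy_functor_maps[OF Q])
    note q'm = trivial_fibration_dga_map[OF q'(1)]
    obtain k where k: "map_rel Q (\<theta> (Suc n)) (A (Suc n)) q' k"
      using MQ.word_total[OF \<theta>[of "Suc n"], of q'] q'm by auto
    hence km: "dga_map Q (B (Suc n)) k" using MQ.word_mem[OF \<theta>[of "Suc n"]] by blast
    \<comment> \<open>Restricted to \<open>P\<close>, both \<open>k\<close> and \<open>h\<close> represent the same composite in the homotopy category.\<close>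
    have "map_rel P (\<theta> (Suc n)) (A (Suc n)) (\<lambda>m x. q' m (i m x)) (\<lambda>m x. k m (i m x))"
      by (rule word_rel_natural[OF \<theta>[of "Suc n"] k]) (auto intro: dga_map_comp[OF im] homotopic_pre[OF im])
    moreover have "step_rel (\<lambda>A :: 'u cdga. {f. dga_map P A f}) (homotopic P) (\<lambda>f s n q. f n (s n q))
        (Fwd (A n) (a n) (A (Suc n))) q (\<lambda>m x. q' m (i m x))"
      using qm dga_map_comp[OF im q'm] homotopic_cong[OF A dga_map_comp[OF im q'm], of "\<lambda>m x. a n m (q m x)"] q'(2)
      by (auto intro: homotopic_sym)
    ultimately have "map_rel P ([Fwd (A n) (a n) (A (Suc n))] @ \<theta> (Suc n)) (A n) q (\<lambda>m x. k m (i m x))" by auto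
    hence "map_rel P (\<theta> n @ [Fwd (B n) (b n) (B (Suc n))]) (A n) q (\<lambda>m x. k m (i m x))"
      using MP.word_eq_rel[OF comm] by blast
    then obtain l where l: "map_rel P (\<theta> n) (A n) q l" "map_rel P [Fwd (B n) (b n) (B (Suc n))] (B n) l (\<lambda>m x. k m (i m x))"
      using MP.word_append[OF \<theta>, of n "[Fwd (B n) (b n) (B (Suc n))]" "B (Suc n)"] A B b by auto
    have "homotopic P (B n) h l"
      using MP.word_functional[OF \<theta> rel l(1)] MP.R_refl[OF A, of q] qm by blast
    hence "homotopic P (B (Suc n)) (\<lambda>m x. b n m (h m x)) (\<lambda>m x. b n m (l m x))"
      by (rule homotopic_post[OF B B bm])
    moreover have "homotopic P (B (Suc n)) (\<lambda>m x. b n m (l m x)) (\<lambda>m x. k m (i m x))"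
      using l(2) homotopic_trans by fastforce
    ultimately have "homotopic P (B (Suc n)) (\<lambda>m x. k m (i m x)) (\<lambda>m x. b n m (h m x))"
      using homotopic_trans homotopic_sym by blast
    then obtain h' where h': "homotopic Q (B (Suc n)) k h'" "dga_map Q (B (Suc n)) h'"
      "\<And>m x. x \<in> elts P m \<Longrightarrow> h' m (i m x) = b n m (h m x)"
      using homotopy_extension[OF _ im PC QC B km] i unfolding free_cofibration_def by blast
    have "map_rel Q (\<theta> (Suc n)) (A (Suc n)) q' h'"
      using MQ.word_closed[OF \<theta> k] MQ.R_refl[OF A, of q'] q'm h'(1,2) by blast
    hence "good (Suc n) (Q, q', h')" using Q q' h' by (simp add: good_def)
    moreover have "succ n s (Q, q', h')" using im q'(2) h'(3) by (auto simp: succ_def s)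
    ultimately show ?thesis by blast
  qed
  ultimately obtain f where f: "\<And>n. good n (f n)" "\<And>n. succ n (f n) (f (Suc n))"
    using dependent_nat_choice[of good succ] by blast
  define Q where "Q n = fst (f n)" for n
  define q where "q n = fst (snd (f n))" for n
  define h where "h n = snd (snd (f n))" for n
  have fn: "f n = (Q n, q n, h n)" for n by (simp add: Q_def q_def h_def)
  have g: "cofibrant_object TYPE('u) (Q n)" "trivial_fibration (Q n) (A n) (q n)" "dga_map (Q n) (B n) (h n)"
    "map_rel (Q n) (\<theta> n) (A n) (q n) (h n)" for n
    using f(1)[of n] by (simp_all add: good_def fn)
  have QC: "cdga (Q n)" for n using g(1) by (simp add: cofibrant_object_def)
  have qw: "weak_equivalence (Q n) (A n) (q n)" for n by (rule trivial_fibration_weak_equivalence[OF g(2) QC A])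
  have "\<forall>n. \<exists>i. dga_map (Q n) (Q (Suc n)) i \<and>
    (\<forall>k. \<forall>x\<in>elts (Q n) k. q (Suc n) k (i k x) = a n k (q n k x) \<and> h (Suc n) k (i k x) = b n k (h n k x))"
    using f(2) by (simp add: succ_def fn)
  then obtain i where "\<forall>n. dga_map (Q n) (Q (Suc n)) (i n) \<and>
    (\<forall>k. \<forall>x\<in>elts (Q n) k. q (Suc n) k (i n k x) = a n k (q n k x) \<and> h (Suc n) k (i n k x) = b n k (h n k x))"
    by (rule choice[THEN exE])
  moreover have "weak_equivalence (Q n) (B n) (h n)" for n
    by (rule map_rel_weak_equivalence[OF \<theta> QC qw g(4) bij g(3)])
  ultimately show ?thesis using QC qw
    by (intro exI[of _ Q] exI[of _ i] exI[of _ q] exI[of _ h]) simp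
qed

section \<open>Words in the homotopy category\<close>

primrec apply_step :: "('o \<Rightarrow> 'o2) \<Rightarrow> ('o \<Rightarrow> 'o \<Rightarrow> 'm \<Rightarrow> 'm2) \<Rightarrow> ('o, 'm) step \<Rightarrow> ('o2, 'm2) step" where
  "apply_step fo fm (Fwd X f Y) = Fwd (fo X) (fm X Y f) (fo Y)"
| "apply_step fo fm (Bwd Y w X) = Bwd (fo Y) (fm X Y w) (fo X)"

lemma shift_step_apply_step: "shift_step C \<epsilon> = apply_step (shift_ob C \<epsilon>) (shift_map C \<epsilon>)"
proof
  fix s show "shift_step C \<epsilon> s = apply_step (shift_ob C \<epsilon>) (shift_map C \<epsilon>) s" by (cases s) auto
qed

locale weq_category =
  fixes C :: "('o, 'm, 'z) category_scheme" and W :: "'o \<Rightarrow> 'o \<Rightarrow> 'm set"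
  assumes Idm_Hom: "X \<in> Obj C \<Longrightarrow> Idm C X \<in> Hom C X X"
    and Comp_Hom: "X \<in> Obj C \<Longrightarrow> Y \<in> Obj C \<Longrightarrow> Z \<in> Obj C \<Longrightarrow> f \<in> Hom C X Y \<Longrightarrow> g \<in> Hom C Y Z \<Longrightarrow>
      Comp C X Y Z g f \<in> Hom C X Z"
    and W_Hom: "w \<in> W X Y \<Longrightarrow> w \<in> Hom C X Y"
begin

abbreviation "word \<equiv> is_word C W"
abbreviation "weql \<equiv> word_eq C W"
abbreviation "cl \<equiv> word_class C W"

lemma words: "weql X Y p q \<Longrightarrow> word X p Y \<and> word X q Y"
  by (rule word_eq_words[OF Idm_Hom Comp_Hom W_Hom])

lemma word_Obj: "word X p Y \<Longrightarrow> X \<in> Obj C \<and> Y \<in> Obj C"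
proof (induction p arbitrary: X)
  case (Cons s p)
  then obtain Z where "is_step C W X s Z" "word Z p Y" by auto
  thus ?case using Cons.IH by (cases s) auto
qed simp

lemma append_cong:
  assumes "weql X Y p p'" "weql Y Z q q'" shows "weql X Z (p @ q) (p' @ q')"
proof -
  note w = words[OF assms(1)] words[OF assms(2)] word_Obj
  have "weql X Z ([] @ p @ q) ([] @ p' @ q)" using assms(1) w by (intro word_eq.cong) auto
  moreover have "weql X Z (p' @ q @ []) (p' @ q' @ [])" using assms(2) w by (intro word_eq.cong) auto
  ultimately show ?thesis using word_eq.trans by fastforce
qed

lemma word_eq_refl: "word X p Y \<Longrightarrow> weql X Y p p"
  by (rule word_eq.refl)

lemma class_mem: "word X p Y \<Longrightarrow> p \<in> cl X Y p"
  by (simp add: word_class_def word_eq_refl)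

lemma class_eq_iff: "word X p Y \<Longrightarrow> cl X Y p = cl X Y q \<longleftrightarrow> weql X Y p q"
proof
  assume "word X p Y" "cl X Y p = cl X Y q"
  hence "p \<in> cl X Y q" using class_mem by blast
  thus "weql X Y p q" by (simp add: word_class_def word_eq.sym)
next
  assume "weql X Y p q"
  thus "cl X Y p = cl X Y q" unfolding word_class_def by (blast intro: word_eq.sym word_eq.trans)
qed

lemma class_eqI: "weql X Y p q \<Longrightarrow> cl X Y p = cl X Y q"
  using class_eq_iff words by blast

lemma Hom_Ho_iff: "P \<in> Hom (Ho C W) X Y \<longleftrightarrow> (\<exists>p. word X p Y \<and> P = cl X Y p)"
  by (auto simp: Ho_def)

text \<open>The union over all representatives in the definition of composition has equal members.\<close>

lemma Ho_Comp:
  assumes p: "word X p Y" and q: "word Y q Z"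
  shows "Comp (Ho C W) X Y Z (cl Y Z q) (cl X Y p) = cl X Z (p @ q)"
proof -
  have "cl X Z (p' @ q') = cl X Z (p @ q)" if "p' \<in> cl X Y p" "q' \<in> cl Y Z q" for p' q'
  proof -
    have "weql X Y p p'" "weql Y Z q q'" using that by (simp_all add: word_class_def)
    thus ?thesis by (rule class_eqI[OF append_cong, symmetric])
  qed
  hence "(\<Union>p'\<in>cl X Y p. \<Union>q'\<in>cl Y Z q. cl X Z (p' @ q')) = (\<Union>p'\<in>cl X Y p. \<Union>q'\<in>cl Y Z q. cl X Z (p @ q))"
    by (intro SUP_cong HOL.refl)
  also have "\<dots> = cl X Z (p @ q)" using class_mem[OF p] class_mem[OF q] by blast
  finally show ?thesis by (simp add: Ho_def)
qed

text \<open>Every step of a zigzag of weak equivalences is invertible in the localisation.\<close>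

lemma weakly_equivalent_words:
  assumes "weakly_equivalent C W X Y"
  shows "\<exists>p q. word X p Y \<and> word Y q X \<and> weql X X (p @ q) [] \<and> weql Y Y (q @ p) []"
proof -
  have X: "X \<in> Obj C" and "equivclp (\<lambda>A B. A \<in> Obj C \<and> B \<in> Obj C \<and> W A B \<noteq> {}) X Y"
    using assms by (auto simp: weakly_equivalent_def)
  from this(2) show ?thesis
  proof (induction rule: equivclp_induct)
    case base
    have "word X [] X" using X by simp
    thus ?case using word_eq_refl[of X "[]" X] by (intro exI[of _ "[]"]) auto
  next
    case (step Y Z)
    then obtain p q where pq: "word X p Y" "word Y q X" "weql X X (p @ q) []" "weql Y Y (q @ p) []" by blast
    have o: "Y \<in> Obj C" "Z \<in> Obj C" using step(2) by auto
    have "\<exists>u v. word Y u Z \<and> word Z v Y \<and> weql Y Y (u @ v) [] \<and> weql Z Z (v @ u) []"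
      using step(2)
    proof
      assume "Y \<in> Obj C \<and> Z \<in> Obj C \<and> W Y Z \<noteq> {}"
      then obtain w where w: "w \<in> W Y Z" by blast
      show ?thesis using o w W_Hom[OF w] word_eq.inv_left[of Y C Z w W] word_eq.inv_right[of Y C Z w W]
        by (intro exI[of _ "[Fwd Y w Z]"] exI[of _ "[Bwd Z w Y]"]) auto
    next
      assume "Z \<in> Obj C \<and> Y \<in> Obj C \<and> W Z Y \<noteq> {}"
      then obtain w where w: "w \<in> W Z Y" by blast
      show ?thesis using o w W_Hom[OF w] word_eq.inv_left[of Z C Y w W] word_eq.inv_right[of Z C Y w W]
        by (intro exI[of _ "[Bwd Y w Z]"] exI[of _ "[Fwd Z w Y]"]) auto
    qed
    then obtain u v where uv: "word Y u Z" "word Z v Y" "weql Y Y (u @ v) []" "weql Z Z (v @ u) []" by blast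
    have "weql X X (p @ (u @ v) @ q) (p @ [] @ q)" by (rule word_eq.cong[OF pq(1) uv(3) pq(2)])
    hence "weql X X (p @ (u @ v) @ q) []" using pq(3) word_eq.trans by fastforce
    moreover have "weql Z Z (v @ (q @ p) @ u) (v @ [] @ u)" by (rule word_eq.cong[OF uv(2) pq(4) uv(1)])
    hence "weql Z Z (v @ (q @ p) @ u) []" using uv(4) word_eq.trans by fastforce
    ultimately show ?case using is_word_append[OF pq(1) uv(1)] is_word_append[OF uv(2) pq(2)]
      by (intro exI[of _ "p @ u"] exI[of _ "v @ q"]) simp
  qed
qed

end

locale weq_functor = C: weq_category C W + D: weq_category D V
  for C :: "('o, 'm, 'z) category_scheme" and W and D :: "('o2, 'm2, 'z2) category_scheme" and V +
  fixes fo :: "'o \<Rightarrow> 'o2" and fm :: "'o \<Rightarrow> 'o \<Rightarrow> 'm \<Rightarrow> 'm2"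
  assumes fo: "X \<in> Obj C \<Longrightarrow> fo X \<in> Obj D"
    and fm: "X \<in> Obj C \<Longrightarrow> Y \<in> Obj C \<Longrightarrow> f \<in> Hom C X Y \<Longrightarrow> fm X Y f \<in> Hom D (fo X) (fo Y)"
    and fm_id: "X \<in> Obj C \<Longrightarrow> fm X X (Idm C X) = Idm D (fo X)"
    and fm_comp: "X \<in> Obj C \<Longrightarrow> Y \<in> Obj C \<Longrightarrow> Z \<in> Obj C \<Longrightarrow> f \<in> Hom C X Y \<Longrightarrow> g \<in> Hom C Y Z \<Longrightarrow>
      fm X Z (Comp C X Y Z g f) = Comp D (fo X) (fo Y) (fo Z) (fm Y Z g) (fm X Y f)"
    and fm_W: "X \<in> Obj C \<Longrightarrow> Y \<in> Obj C \<Longrightarrow> w \<in> W X Y \<Longrightarrow> fm X Y w \<in> V (fo X) (fo Y)"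
begin

lemma step_map: "is_step C W X s Y \<Longrightarrow> is_step D V (fo X) (apply_step fo fm s) (fo Y)"
  using fo fm fm_W by (cases s) auto

lemma word_map: "is_word C W X p Y \<Longrightarrow> is_word D V (fo X) (map (apply_step fo fm) p) (fo Y)"
proof (induction p arbitrary: X)
  case (Cons s p)
  then obtain Z where Z: "is_step C W X s Z" "is_word C W Z p Y" by auto
  show ?case unfolding list.map is_word.simps
    by (rule exI[of _ "fo Z"]) (intro conjI step_map[OF Z(1)] Cons.IH[OF Z(2)])
qed (simp add: fo)

lemma word_eq_map: "word_eq C W X Y p q \<Longrightarrow> word_eq D V (fo X) (fo Y) (map (apply_step fo fm) p) (map (apply_step fo fm) q)"
proof (induction rule: word_eq.induct)
  case (cong X' p X Y q q' r Y')
  thus ?case using word_eq.cong[OF word_map[OF cong.hyps(1)] cong.IH word_map[OF cong.hyps(3)]] by simp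
next
  case (comp X Y Z f g)
  show ?case unfolding list.map apply_step.simps fm_comp[OF comp.hyps]
    by (rule word_eq.comp) (use fo fm comp.hyps in auto)
next
  case (trans X Y p q r) thus ?case by (blast intro: word_eq.trans)
qed (use word_map fo fm fm_W fm_id in \<open>auto intro: word_eq.intros\<close>)

end

text \<open>The squares of formal inverses are obtained from those of the arrows by cancellation.\<close>

lemma word_eq_natural:
  assumes F: "weq_functor C W D V fo fm" and G: "weq_functor C W D V go gm"
    and \<eta>: "\<And>X. X \<in> Obj C \<Longrightarrow> \<eta> X \<in> Hom D (fo X) (go X)"
    and nat: "\<And>X Y f. X \<in> Obj C \<Longrightarrow> Y \<in> Obj C \<Longrightarrow> f \<in> Hom C X Y \<Longrightarrow>
      Comp D (fo X) (fo Y) (go Y) (\<eta> Y) (fm X Y f) = Comp D (fo X) (go X) (go Y) (gm X Y f) (\<eta> X)"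
    and p: "is_word C W X p Y"
  shows "word_eq D V (fo X) (go Y) ([Fwd (fo X) (\<eta> X) (go X)] @ map (apply_step go gm) p)
    (map (apply_step fo fm) p @ [Fwd (fo Y) (\<eta> Y) (go Y)])"
  using p
proof (induction p arbitrary: X)
  case Nil
  interpret F: weq_functor C W D V fo fm by fact
  interpret G: weq_functor C W D V go gm by fact
  from Nil show ?case using \<eta> F.fo G.fo by (auto intro!: word_eq.refl)
next
  case (Cons s p)
  interpret F: weq_functor C W D V fo fm by fact
  interpret G: weq_functor C W D V go gm by fact
  obtain Z where Z: "is_step C W X s Z" "is_word C W Z p Y" using Cons.prems by auto
  have o: "X \<in> Obj C" "Z \<in> Obj C" using Z(1) by (cases s; auto)+
  let ?\<eta> = "\<lambda>X. Fwd (fo X) (\<eta> X) (go X)"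
  let ?f = "apply_step fo fm" and ?g = "apply_step go gm"
  have sq: "word_eq D V (fo X) (go Z) [Fwd (fo X) (\<eta> X) (go X), Fwd (go X) (gm X Z f) (go Z)]
     [Fwd (fo X) (fm X Z f) (fo Z), Fwd (fo Z) (\<eta> Z) (go Z)]" if "X \<in> Obj C" "Z \<in> Obj C" "f \<in> Hom C X Z" for X Z f
  proof -
    have "word_eq D V (fo X) (go Z) [Fwd (fo X) (\<eta> X) (go X), Fwd (go X) (gm X Z f) (go Z)]
       [Fwd (fo X) (Comp D (fo X) (go X) (go Z) (gm X Z f) (\<eta> X)) (go Z)]"
      using that \<eta> F.fo G.fo G.fm by (intro word_eq.comp) auto
    moreover have "word_eq D V (fo X) (go Z) [Fwd (fo X) (fm X Z f) (fo Z), Fwd (fo Z) (\<eta> Z) (go Z)]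
       [Fwd (fo X) (Comp D (fo X) (fo Z) (go Z) (\<eta> Z) (fm X Z f)) (go Z)]"
      using that \<eta> F.fo G.fo F.fm by (intro word_eq.comp) auto
    ultimately show ?thesis unfolding nat[OF that] by (rule word_eq.trans[OF _ word_eq.sym])
  qed
  have step: "word_eq D V (fo X) (go Z) [?\<eta> X, ?g s] [?f s, ?\<eta> Z]"
  proof (cases s)
    case (Fwd X' f Z')
    thus ?thesis using sq[OF o] Z(1) by auto
  next
    case (Bwd X' w Z')
    hence w: "w \<in> W Z X" "s = Bwd X w Z" using Z(1) by auto
    note fw = F.fm_W[OF o(2,1) w(1)] and gw = G.fm_W[OF o(2,1) w(1)]
    have fB: "is_word D V (fo X) [?f s] (fo Z)" and gB: "is_word D V (go X) [?g s] (go Z)"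
      using w fw gw o F.fo G.fo by auto
    have ir: "word_eq D V (fo X) (fo X) [?f s, Fwd (fo Z) (fm Z X w) (fo X)] []"
      using word_eq.inv_right[of "fo Z" D "fo X" "fm Z X w" V] F.fo o fw w by simp
    have il: "word_eq D V (go Z) (go Z) [Fwd (go Z) (gm Z X w) (go X), ?g s] []"
      using word_eq.inv_left[of "go Z" D "go X" "gm Z X w" V] G.fo o gw w by simp
    \<comment> \<open>Insert \<open>w\<^sup>-\<^sup>1 w\<close> in front of the square of \<open>w\<close> and cancel \<open>w w\<^sup>-\<^sup>1\<close> behind it.\<close>
    have 1: "word_eq D V (fo X) (go Z) ([] @ [] @ [?\<eta> X, ?g s]) ([] @ [?f s, Fwd (fo Z) (fm Z X w) (fo X)] @ [?\<eta> X, ?g s])"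
      by (rule word_eq.cong[OF _ word_eq.sym[OF ir]])
        (use o \<eta> F.fo G.fo gB w gw in auto)
    have 2: "word_eq D V (fo X) (go Z) ([?f s] @ [Fwd (fo Z) (fm Z X w) (fo X), ?\<eta> X] @ [?g s])
        ([?f s] @ [?\<eta> Z, Fwd (go Z) (gm Z X w) (go X)] @ [?g s])"
      by (rule word_eq.cong[OF fB word_eq.sym[OF sq[OF o(2,1) F.C.W_Hom[OF w(1)]]] gB])
    have 3: "word_eq D V (fo X) (go Z) ([?f s, ?\<eta> Z] @ [Fwd (go Z) (gm Z X w) (go X), ?g s] @ []) ([?f s, ?\<eta> Z] @ [] @ [])"
      by (rule word_eq.cong[OF _ il])
        (use o \<eta> F.fo G.fo fB w fw in auto)
    show ?thesis using word_eq.trans[OF word_eq.trans[OF 1[simplified] 2[simplified]] 3[simplified]] by simp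
  qed
  have "word_eq D V (fo X) (go Y) ([] @ [?\<eta> X, ?g s] @ map ?g p) ([] @ [?f s, ?\<eta> Z] @ map ?g p)"
    by (rule word_eq.cong[OF _ step G.word_map[OF Z(2)]]) (use o F.fo in auto)
  moreover have "word_eq D V (fo X) (go Y) ([?f s] @ ([?\<eta> Z] @ map ?g p) @ []) ([?f s] @ (map ?f p @ [?\<eta> Y]) @ [])"
    by (rule word_eq.cong[OF _ Cons.IH[OF Z(2)]]) (use F.step_map[OF Z(1)] F.C.word_Obj[OF Z(2)] F.fo G.fo o in auto)
  ultimately show ?case using word_eq.trans by fastforce
qed

section \<open>Extended tame persistence objects\<close>

lemma CDGA_Comp_id:
  assumes "f \<in> cdga_hom A B"
  shows "Comp CDGA A A B f (Idm CDGA A) = f" "Comp CDGA A B B (Idm CDGA B) f = f"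
proof -
  have e: "f n \<in> extensional (elts A n)" "\<And>x. x \<in> elts A n \<Longrightarrow> f n x \<in> elts B n" for n
    using assms dga_mapD(1) by (auto simp: cdga_hom_iff)
  show "Comp CDGA A A B f (Idm CDGA A) = f" "Comp CDGA A B B (Idm CDGA B) f = f"
    using e by (auto simp: compose_def fun_eq_iff extensional_def restrict_def)
qed

lemma CDGA_Comp_assoc:
  assumes "f \<in> cdga_hom A B"
  shows "Comp CDGA A C D h (Comp CDGA A B C g f) = Comp CDGA A B D (Comp CDGA B C D h g) f"
  using dga_mapD(1)[OF cdga_hom_dga_map[OF assms]] by (auto simp: compose_def fun_eq_iff restrict_def)

lemma CDGA_Comp_apply: "x \<in> elts A n \<Longrightarrow> Comp CDGA A B C g f n x = g n (f n x)"
  by (simp add: compose_def)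

lemma weq_category_CDGA: "weq_category CDGA quasi_iso"
  by unfold_locales (use cdga_hom_Idm cdga_hom_Comp quasi_iso_hom in auto)

lemma is_functorD:
  assumes "is_functor CDGA F"
  shows "0 \<le> t \<Longrightarrow> cdga (ob F t)" "0 \<le> s \<Longrightarrow> s \<le> t \<Longrightarrow> str F s t \<in> cdga_hom (ob F s) (ob F t)"
    "0 \<le> t \<Longrightarrow> str F t t = Idm CDGA (ob F t)"
    "0 \<le> r \<Longrightarrow> r \<le> s \<Longrightarrow> s \<le> t \<Longrightarrow> Comp CDGA (ob F r) (ob F s) (ob F t) (str F s t) (str F r s) = str F r t"
  using assms unfolding is_functor_def by (auto simp del: CDGA_simps(3,4))

lemma nat_transfD:
  assumes "\<alpha> \<in> nat_transf CDGA F G"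
  shows "0 \<le> t \<Longrightarrow> \<alpha> t \<in> cdga_hom (ob F t) (ob G t)"
    "0 \<le> s \<Longrightarrow> s \<le> t \<Longrightarrow> Comp CDGA (ob F s) (ob F t) (ob G t) (\<alpha> t) (str F s t) =
      Comp CDGA (ob F s) (ob G s) (ob G t) (str G s t) (\<alpha> s)"
    "\<alpha> \<in> extensional {0..}"
  using assms unfolding nat_transf_def by (auto simp del: CDGA_simps(3,4))

lemma et_simps:
  "F \<in> Obj (et CDGA) \<longleftrightarrow> is_functor CDGA F \<and> (\<exists>\<tau> N. discretises CDGA \<tau> N F)"
  "Hom (et CDGA) = nat_transf CDGA"
  "Idm (et CDGA) F = (\<lambda>t\<in>{0..}. Idm CDGA (ob F t))"
  "Comp (et CDGA) F G K \<beta> \<alpha> = (\<lambda>t\<in>{0..}. Comp CDGA (ob F t) (ob G t) (ob K t) (\<beta> t) (\<alpha> t))"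
  "shift_ob (et CDGA) = shift_pers"
  "shift_map (et CDGA) \<epsilon> F G \<alpha> = (\<lambda>t\<in>{0..}. \<alpha> (t + \<epsilon>))"
  "shift_unit (et CDGA) \<epsilon> F = (\<lambda>t\<in>{0..}. str F t (t + \<epsilon>))"
  by (simp_all add: et_def pers_cat_def del: CDGA_simps)

lemma shift_pers_simps [simp]:
  "ob (shift_pers \<epsilon> F) t = ob F (t + \<epsilon>)" "str (shift_pers \<epsilon> F) s t = str F (s + \<epsilon>) (t + \<epsilon>)"
  "shift_pers \<epsilon> (shift_pers \<delta> F) = shift_pers (\<delta> + \<epsilon>) F" "shift_pers 0 F = F"
  by (simp_all add: shift_pers_def add_ac)

lemma is_functor_shift: "is_functor CDGA F \<Longrightarrow> 0 \<le> \<epsilon> \<Longrightarrow> is_functor CDGA (shift_pers \<epsilon> F)"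
  unfolding is_functor_def by (simp del: CDGA_simps)

text \<open>The shifted functor is discretised by the shifted sequence, without its finitely many initial terms \<open>< \<epsilon>\<close>.\<close>

lemma discretises_shift:
  assumes d: "discretises C \<tau> N F" and \<epsilon>: "0 \<le> \<epsilon>"
  shows "\<exists>\<tau>' N'. discretises C \<tau>' N' (shift_pers \<epsilon> F)"
proof -
  have inc: "\<tau> a < \<tau> (Suc a)" if "enat (Suc a) < N" for a using d that by (simp add: discretises_def)
  have mono: "\<tau> a \<le> \<tau> b" if "a \<le> b" "enat b < N" for a b
    using that
  proof (induction b)
    case (Suc b)
    have "enat b < N" using Suc.prems(2) by (meson enat_ord_simps(2) lessI less_trans)
    thus ?case using Suc inc[OF Suc.prems(2)] by (cases "a = Suc b") auto
  qed simp
  have iso: "\<exists>a. enat a < N \<and> s + \<epsilon> < \<tau> a \<and> \<tau> a \<le> t + \<epsilon>"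
    if "0 \<le> s" "s \<le> t" "\<not> is_iso C (ob F (s + \<epsilon>)) (ob F (t + \<epsilon>)) (str F (s + \<epsilon>) (t + \<epsilon>))" for s t
    using d that \<epsilon> unfolding discretises_def by auto
  show ?thesis
  proof (cases "\<exists>a. enat a < N \<and> \<epsilon> \<le> \<tau> a")
    case False
    have "discretises C \<tau> 0 (shift_pers \<epsilon> F)" unfolding discretises_def
      using False iso by (force simp: zero_enat_def[symmetric])
    thus ?thesis by blast
  next
    case True
    define k where "k = (LEAST a. enat a < N \<and> \<epsilon> \<le> \<tau> a)"
    have k: "enat k < N" "\<epsilon> \<le> \<tau> k" using LeastI_ex[OF True] by (simp_all add: k_def)
    have low: "k \<le> a" if "enat a < N" "\<epsilon> \<le> \<tau> a" for a unfolding k_def using that by (intro Least_le) simp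
    have N: "enat a < N - enat k \<longleftrightarrow> enat (a + k) < N" for a by (cases N) auto
    have "discretises C (\<lambda>a. \<tau> (a + k) - \<epsilon>) (N - enat k) (shift_pers \<epsilon> F)"
      unfolding discretises_def
    proof (intro conjI allI impI)
      fix a assume "enat a < N - enat k"
      thus "0 \<le> \<tau> (a + k) - \<epsilon>" using mono[of k "a + k"] k(2) N by simp
    next
      fix a assume "enat (Suc a) < N - enat k"
      thus "\<tau> (a + k) - \<epsilon> < \<tau> (Suc a + k) - \<epsilon>" using inc[of "a + k"] N by simp
    next
      assume "N - enat k = \<infinity>"
      hence "N = \<infinity>" by (cases N) auto
      hence "filterlim \<tau> at_top sequentially" using d by (simp add: discretises_def)
      hence "eventually (\<lambda>a. Z + \<epsilon> \<le> \<tau> (a + k)) sequentially" for Z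
        using eventually_sequentially_seg[of "\<lambda>a. Z + \<epsilon> \<le> \<tau> a" k] unfolding filterlim_at_top by blast
      thus "filterlim (\<lambda>a. \<tau> (a + k) - \<epsilon>) at_top sequentially"
        unfolding filterlim_at_top by (simp add: algebra_simps)
    next
      fix s t assume st: "0 \<le> s \<and> s \<le> t \<and> \<not> is_iso C (ob (shift_pers \<epsilon> F) s) (ob (shift_pers \<epsilon> F) t) (str (shift_pers \<epsilon> F) s t)"
      then obtain a where a: "enat a < N" "s + \<epsilon> < \<tau> a" "\<tau> a \<le> t + \<epsilon>" using iso by auto
      hence "k \<le> a" using low st by auto
      thus "\<exists>a. enat a < N - enat k \<and> s < \<tau> (a + k) - \<epsilon> \<and> \<tau> (a + k) - \<epsilon> \<le> t"
        using a N by (intro exI[of _ "a - k"]) auto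
    qed
    thus ?thesis by blast
  qed
qed

lemma shift_et: "F \<in> Obj (et CDGA) \<Longrightarrow> 0 \<le> \<epsilon> \<Longrightarrow> shift_pers \<epsilon> F \<in> Obj (et CDGA)"
  using is_functor_shift discretises_shift unfolding et_simps by blast

lemma weq_category_et: "weq_category (et CDGA) weq"
proof
  fix F assume F: "F \<in> Obj (et CDGA)"
  note f = is_functorD[of F]
  have "is_functor CDGA F" using F by (simp add: et_simps)
  note f = is_functorD[OF this]
  show "Idm (et CDGA) F \<in> Hom (et CDGA) F F"
    unfolding et_simps nat_transf_def using f
    by (auto simp del: CDGA_simps(3,4) simp: CDGA_Comp_id cdga_hom_Idm)
next
  fix F G K :: "'a pers_cdga" and \<alpha> \<beta>
  assume o: "F \<in> Obj (et CDGA)" "G \<in> Obj (et CDGA)" "K \<in> Obj (et CDGA)"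
    and "\<alpha> \<in> Hom (et CDGA) F G" "\<beta> \<in> Hom (et CDGA) G K"
  hence \<alpha>: "\<alpha> \<in> nat_transf CDGA F G" and \<beta>: "\<beta> \<in> nat_transf CDGA G K" by (simp_all add: et_simps)
  note F = is_functorD[of F] and G = is_functorD[of G]
  have fF: "is_functor CDGA F" "is_functor CDGA G" "is_functor CDGA K" using o by (simp_all add: et_simps)
  note f = is_functorD[OF fF(1)] and g = is_functorD[OF fF(2)] and k = is_functorD[OF fF(3)]
  note a = nat_transfD[OF \<alpha>] and b = nat_transfD[OF \<beta>]
  have "Comp CDGA (ob F s) (ob F t) (ob K t) (Comp CDGA (ob F t) (ob G t) (ob K t) (\<beta> t) (\<alpha> t)) (str F s t) =
     Comp CDGA (ob F s) (ob K s) (ob K t) (str K s t) (Comp CDGA (ob F s) (ob G s) (ob K s) (\<beta> s) (\<alpha> s))"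
    if st: "0 \<le> s" "s \<le> t" for s t
  proof -
    have "Comp CDGA (ob F s) (ob F t) (ob K t) (Comp CDGA (ob F t) (ob G t) (ob K t) (\<beta> t) (\<alpha> t)) (str F s t) =
      Comp CDGA (ob F s) (ob G t) (ob K t) (\<beta> t) (Comp CDGA (ob F s) (ob F t) (ob G t) (\<alpha> t) (str F s t))"
      by (rule CDGA_Comp_assoc[OF f(2)[OF st], symmetric])
    also have "\<dots> = Comp CDGA (ob F s) (ob G t) (ob K t) (\<beta> t) (Comp CDGA (ob F s) (ob G s) (ob G t) (str G s t) (\<alpha> s))"
      by (simp only: a(2)[OF st])
    also have "\<dots> = Comp CDGA (ob F s) (ob G s) (ob K t) (Comp CDGA (ob G s) (ob G t) (ob K t) (\<beta> t) (str G s t)) (\<alpha> s)"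
      by (rule CDGA_Comp_assoc[OF a(1)[OF st(1)]])
    also have "\<dots> = Comp CDGA (ob F s) (ob G s) (ob K t) (Comp CDGA (ob G s) (ob K s) (ob K t) (str K s t) (\<beta> s)) (\<alpha> s)"
      by (simp only: b(2)[OF st])
    also have "\<dots> = Comp CDGA (ob F s) (ob K s) (ob K t) (str K s t) (Comp CDGA (ob F s) (ob G s) (ob K s) (\<beta> s) (\<alpha> s))"
      by (rule CDGA_Comp_assoc[OF a(1)[OF st(1)], symmetric])
    finally show ?thesis .
  qed
  thus "Comp (et CDGA) F G K \<beta> \<alpha> \<in> Hom (et CDGA) F K"
    unfolding et_simps nat_transf_def using cdga_hom_Comp[OF f(1) g(1) a(1) b(1)]
    by (auto simp del: CDGA_simps(3,4))
qed (simp add: weq_def)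

section \<open>The implications between the notions of formality that hold in general\<close>

lemma pers_cat_simps:
  "Hom (pers_cat C) = nat_transf C"
  "Comp (pers_cat C) F G K \<beta> \<alpha> = (\<lambda>t\<in>{0..}. Comp C (ob F t) (ob G t) (ob K t) (\<beta> t) (\<alpha> t))"
  "shift_ob (pers_cat C) = shift_pers"
  "shift_map (pers_cat C) \<epsilon> F G \<alpha> = (\<lambda>t\<in>{0..}. \<alpha> (t + \<epsilon>))"
  "shift_unit (pers_cat C) \<epsilon> F = (\<lambda>t\<in>{0..}. str F t (t + \<epsilon>))"
  by (simp_all add: pers_cat_def)

lemma nat_transf_shift:
  assumes "\<alpha> \<in> nat_transf CDGA F G" "0 \<le> \<epsilon>"
  shows "(\<lambda>t\<in>{0..}. \<alpha> (t + \<epsilon>)) \<in> nat_transf CDGA (shift_pers \<epsilon> F) (shift_pers \<epsilon> G)"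
  unfolding nat_transf_def using nat_transfD[OF assms(1)] assms(2) by (auto simp del: CDGA_simps(3,4))

lemma weq_functor_shift:
  assumes "0 \<le> \<epsilon>"
  shows "weq_functor (et CDGA) weq (et CDGA) weq (shift_ob (et CDGA) \<epsilon>) (shift_map (et CDGA) \<epsilon>)"
proof (intro weq_functor.intro weq_category_et weq_functor_axioms.intro)
  fix X Y :: "'a pers_cdga" and f g
  show "X \<in> Obj (et CDGA) \<Longrightarrow> shift_ob (et CDGA) \<epsilon> X \<in> Obj (et CDGA)"
    using shift_et assms by (simp add: et_simps(5))
  show "f \<in> Hom (et CDGA) X Y \<Longrightarrow>
    shift_map (et CDGA) \<epsilon> X Y f \<in> Hom (et CDGA) (shift_ob (et CDGA) \<epsilon> X) (shift_ob (et CDGA) \<epsilon> Y)"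
    using nat_transf_shift assms by (simp add: et_simps(2,5,6))
  show "shift_map (et CDGA) \<epsilon> X X (Idm (et CDGA) X) = Idm (et CDGA) (shift_ob (et CDGA) \<epsilon> X)"
    using assms by (auto simp: et_simps simp del: CDGA_simps)
  show "shift_map (et CDGA) \<epsilon> X Z (Comp (et CDGA) X Y Z g f) =
    Comp (et CDGA) (shift_ob (et CDGA) \<epsilon> X) (shift_ob (et CDGA) \<epsilon> Y) (shift_ob (et CDGA) \<epsilon> Z)
      (shift_map (et CDGA) \<epsilon> Y Z g) (shift_map (et CDGA) \<epsilon> X Y f)" for Z :: "'a pers_cdga"
    using assms by (auto simp: et_simps simp del: CDGA_simps)
  show "w \<in> weq X Y \<Longrightarrow> shift_map (et CDGA) \<epsilon> X Y w \<in> weq (shift_ob (et CDGA) \<epsilon> X) (shift_ob (et CDGA) \<epsilon> Y)" for w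
    using nat_transf_shift[of w X Y \<epsilon>] assms by (simp add: weq_def et_simps(2,5,6))
qed

lemma weq_functor_eval:
  assumes "0 \<le> t" shows "weq_functor (et CDGA) weq CDGA quasi_iso (\<lambda>X. ob X t) (\<lambda>X Y f. f t)"
proof (intro weq_functor.intro weq_category_et weq_category_CDGA weq_functor_axioms.intro)
  fix X Y :: "'a pers_cdga" and f g
  show "X \<in> Obj (et CDGA) \<Longrightarrow> ob X t \<in> Obj CDGA"
    using is_functorD(1) assms by (auto simp: et_simps)
  show "f \<in> Hom (et CDGA) X Y \<Longrightarrow> f t \<in> Hom CDGA (ob X t) (ob Y t)"
    using nat_transfD(1) assms by (simp add: et_simps)
  show "Idm (et CDGA) X t = Idm CDGA (ob X t)" using assms by (simp add: et_simps)
  show "Comp (et CDGA) X Y Z g f t = Comp CDGA (ob X t) (ob Y t) (ob Z t) (g t) (f t)" for Z :: "'a pers_cdga"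
    using assms by (simp add: et_simps)
  show "w \<in> weq X Y \<Longrightarrow> w t \<in> quasi_iso (ob X t) (ob Y t)" for w using assms by (simp add: weq_def)
qed

lemma weq_functor_id: "weq_functor (et CDGA) weq (et CDGA) weq (\<lambda>X. X) (\<lambda>X Y f. f)"
  by (intro weq_functor.intro weq_category_et weq_functor_axioms.intro) (assumption | rule HOL.refl)+

lemma apply_step_id: "map (apply_step (\<lambda>X. X) (\<lambda>X Y f. f)) p = p"
proof (induction p)
  case (Cons s p) thus ?case by (cases s) auto
qed simp

interpretation et: weq_category "et CDGA :: ('u pers_cdga, real \<Rightarrow> 'u cdga_map) shift_category" weq
  by (rule weq_category_et)

interpretation CDGA: weq_category "CDGA :: ('u cdga, 'u cdga_map) category" quasi_iso
  by (rule weq_category_CDGA)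

lemma shift_unit_nat_transf:
  assumes "is_functor CDGA F" "0 \<le> \<epsilon>" shows "shift_unit (et CDGA) \<epsilon> F \<in> nat_transf CDGA F (shift_pers \<epsilon> F)"
  using is_functorD[OF assms(1)] assms(2) unfolding nat_transf_def et_simps by (auto simp del: CDGA_simps(3,4))

text \<open>
  The structure maps \<open>F \<rightarrow> F\<^sup>\<epsilon>\<close> remain natural in the homotopy category.
\<close>

lemma shift_unit_word:
  assumes p: "et.word F p G" and \<epsilon>: "0 \<le> \<epsilon>"
  shows "et.weql F (shift_pers \<epsilon> G)
    ([Fwd F (shift_unit (et CDGA) \<epsilon> F) (shift_pers \<epsilon> F)] @ map (shift_step (et CDGA) \<epsilon>) p)
    (p @ [Fwd G (shift_unit (et CDGA) \<epsilon> G) (shift_pers \<epsilon> G)])"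
proof -
  have "word_eq (et CDGA) weq F (shift_ob (et CDGA) \<epsilon> G)
    ([Fwd F (shift_unit (et CDGA) \<epsilon> F) (shift_ob (et CDGA) \<epsilon> F)] @
       map (apply_step (shift_ob (et CDGA) \<epsilon>) (shift_map (et CDGA) \<epsilon>)) p)
    (map (apply_step (\<lambda>X. X) (\<lambda>X Y f. f)) p @ [Fwd G (shift_unit (et CDGA) \<epsilon> G) (shift_ob (et CDGA) \<epsilon> G)])"
  proof (rule word_eq_natural[OF weq_functor_id weq_functor_shift[OF \<epsilon>] _ _ p])
    fix X Y :: "'a pers_cdga" and f
    show "X \<in> Obj (et CDGA) \<Longrightarrow> shift_unit (et CDGA) \<epsilon> X \<in> Hom (et CDGA) X (shift_ob (et CDGA) \<epsilon> X)"
      using shift_unit_nat_transf[OF _ \<epsilon>] unfolding et_simps(1,2,5) by blast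
    assume "f \<in> Hom (et CDGA) X Y"
    hence f: "f \<in> nat_transf CDGA X Y" by (simp add: et_simps)
    show "Comp (et CDGA) X Y (shift_ob (et CDGA) \<epsilon> Y) (shift_unit (et CDGA) \<epsilon> Y) f =
      Comp (et CDGA) X (shift_ob (et CDGA) \<epsilon> X) (shift_ob (et CDGA) \<epsilon> Y) (shift_map (et CDGA) \<epsilon> X Y f) (shift_unit (et CDGA) \<epsilon> X)"
      using nat_transfD(2)[OF f, of _ "_ + \<epsilon>"] \<epsilon> by (auto simp: et_simps simp del: CDGA_simps)
  qed
  thus ?thesis by (simp add: apply_step_id shift_step_apply_step et_simps(5))
qed

lemma shift_Ho_simps:
  "Hom (shift_Ho C W) = Hom (Ho C W)" "Comp (shift_Ho C W) = Comp (Ho C W)" "shift_ob (shift_Ho C W) = shift_ob C"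
  "shift_map (shift_Ho C W) \<epsilon> X Y P =
    (\<Union>p\<in>P. word_class C W (shift_ob C \<epsilon> X) (shift_ob C \<epsilon> Y) (map (shift_step C \<epsilon>) p))"
  "shift_unit (shift_Ho C W) \<epsilon> X = word_class C W X (shift_ob C \<epsilon> X) [Fwd X (shift_unit C \<epsilon> X) (shift_ob C \<epsilon> X)]"
  by (simp_all add: shift_Ho_def category.defs shift_category.defs)

lemma shift_word:
  assumes "0 \<le> \<epsilon>" "et.word F p G"
  shows "et.word (shift_pers \<epsilon> F) (map (shift_step (et CDGA) \<epsilon>) p) (shift_pers \<epsilon> G)"
  using weq_functor.word_map[OF weq_functor_shift[OF assms(1)] assms(2)]
  by (simp add: shift_step_apply_step et_simps(5))

lemma shift_word_eq:
  assumes "0 \<le> \<epsilon>" "et.weql F G p q"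
  shows "et.weql (shift_pers \<epsilon> F) (shift_pers \<epsilon> G) (map (shift_step (et CDGA) \<epsilon>) p) (map (shift_step (et CDGA) \<epsilon>) q)"
  using weq_functor.word_eq_map[OF weq_functor_shift[OF assms(1)] assms(2)]
  by (simp add: shift_step_apply_step et_simps(5))

lemma shift_map_Ho:
  assumes \<epsilon>: "0 \<le> \<epsilon>" and p: "et.word F p G"
  shows "shift_map (shift_Ho (et CDGA) weq) \<epsilon> F G (et.cl F G p) =
    et.cl (shift_pers \<epsilon> F) (shift_pers \<epsilon> G) (map (shift_step (et CDGA) \<epsilon>) p)"
proof -
  have "et.cl (shift_pers \<epsilon> F) (shift_pers \<epsilon> G) (map (shift_step (et CDGA) \<epsilon>) p') =
      et.cl (shift_pers \<epsilon> F) (shift_pers \<epsilon> G) (map (shift_step (et CDGA) \<epsilon>) p)" if "p' \<in> et.cl F G p" for p'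
  proof -
    have "et.weql F G p p'" using that by (simp add: word_class_def)
    thus ?thesis by (rule et.class_eqI[OF shift_word_eq[OF \<epsilon>], symmetric])
  qed
  thus ?thesis using et.class_mem[OF p] unfolding shift_Ho_simps et_simps(5) by blast
qed

abbreviation unit_step :: "real \<Rightarrow> 'u pers_cdga \<Rightarrow> ('u pers_cdga, real \<Rightarrow> 'u cdga_map) step" where
  "unit_step \<epsilon> F \<equiv> Fwd F (shift_unit (et CDGA) \<epsilon> F) (shift_pers \<epsilon> F)"

lemma unit_step_word:
  assumes "F \<in> Obj (et CDGA)" "0 \<le> \<epsilon>" shows "et.word F [unit_step \<epsilon> F] (shift_pers \<epsilon> F)"
proof -
  have "is_functor CDGA F" using assms(1) by (simp add: et_simps(1))
  thus ?thesis using assms(1) shift_et[OF assms] shift_unit_nat_transf[OF _ assms(2)] by (simp add: et_simps(2))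
qed

lemma Ho_interleaved_iff:
  assumes F: "F \<in> Obj (et CDGA)" and G: "G \<in> Obj (et CDGA)" and \<epsilon>: "0 \<le> \<epsilon>"
  shows "Ho_interleaved \<epsilon> F G \<longleftrightarrow> (\<exists>p q. et.word F p (shift_pers \<epsilon> G) \<and> et.word G q (shift_pers \<epsilon> F) \<and>
    et.weql F (shift_pers (2 * \<epsilon>) F) (p @ map (shift_step (et CDGA) \<epsilon>) q) [unit_step (2 * \<epsilon>) F] \<and>
    et.weql G (shift_pers (2 * \<epsilon>) G) (q @ map (shift_step (et CDGA) \<epsilon>) p) [unit_step (2 * \<epsilon>) G])"
proof -
  have half: "Comp (Ho (et CDGA) weq) F (shift_pers \<epsilon> G) (shift_pers (2 * \<epsilon>) F)
      (shift_map (shift_Ho (et CDGA) weq) \<epsilon> G (shift_pers \<epsilon> F) (et.cl G (shift_pers \<epsilon> F) q)) (et.cl F (shift_pers \<epsilon> G) p) =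
      shift_unit (shift_Ho (et CDGA) weq) (2 * \<epsilon>) F \<longleftrightarrow>
    et.weql F (shift_pers (2 * \<epsilon>) F) (p @ map (shift_step (et CDGA) \<epsilon>) q) [unit_step (2 * \<epsilon>) F]"
    if p: "et.word F p (shift_pers \<epsilon> G)" and q: "et.word G q (shift_pers \<epsilon> F)" for F G p q
  proof -
    have 2: "shift_pers \<epsilon> (shift_pers \<epsilon> F) = shift_pers (2 * \<epsilon>) F" by simp
    note q' = shift_word[OF \<epsilon> q, unfolded 2]
    show ?thesis
      by (simp only: shift_map_Ho[OF \<epsilon> q] 2 et.Ho_Comp[OF p q'] shift_Ho_simps(5) et_simps(5)
          et.class_eq_iff[OF is_word_append[OF p q']])
  qed
  show ?thesis
    unfolding Ho_interleaved_def interleaved_def shift_Ho_simps(1,2,3) et_simps(5)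
  proof (intro iffI; elim bexE exE conjE)
    fix \<phi> \<psi> assume "\<phi> \<in> Hom (Ho (et CDGA) weq) F (shift_pers \<epsilon> G)" "\<psi> \<in> Hom (Ho (et CDGA) weq) G (shift_pers \<epsilon> F)"
      and eq: "Comp (Ho (et CDGA) weq) F (shift_pers \<epsilon> G) (shift_pers (2 * \<epsilon>) F)
        (shift_map (shift_Ho (et CDGA) weq) \<epsilon> G (shift_pers \<epsilon> F) \<psi>) \<phi> = shift_unit (shift_Ho (et CDGA) weq) (2 * \<epsilon>) F"
        "Comp (Ho (et CDGA) weq) G (shift_pers \<epsilon> F) (shift_pers (2 * \<epsilon>) G)
        (shift_map (shift_Ho (et CDGA) weq) \<epsilon> F (shift_pers \<epsilon> G) \<phi>) \<psi> = shift_unit (shift_Ho (et CDGA) weq) (2 * \<epsilon>) G"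
    then obtain p q where "et.word F p (shift_pers \<epsilon> G)" "\<phi> = et.cl F (shift_pers \<epsilon> G) p"
      "et.word G q (shift_pers \<epsilon> F)" "\<psi> = et.cl G (shift_pers \<epsilon> F) q" by (auto simp: et.Hom_Ho_iff)
    thus "\<exists>p q. et.word F p (shift_pers \<epsilon> G) \<and> et.word G q (shift_pers \<epsilon> F) \<and>
      et.weql F (shift_pers (2 * \<epsilon>) F) (p @ map (shift_step (et CDGA) \<epsilon>) q) [unit_step (2 * \<epsilon>) F] \<and>
      et.weql G (shift_pers (2 * \<epsilon>) G) (q @ map (shift_step (et CDGA) \<epsilon>) p) [unit_step (2 * \<epsilon>) G]"
      using eq half by blast
  next
    fix p q assume w: "et.word F p (shift_pers \<epsilon> G)" "et.word G q (shift_pers \<epsilon> F)"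
      and eq: "et.weql F (shift_pers (2 * \<epsilon>) F) (p @ map (shift_step (et CDGA) \<epsilon>) q) [unit_step (2 * \<epsilon>) F]"
       "et.weql G (shift_pers (2 * \<epsilon>) G) (q @ map (shift_step (et CDGA) \<epsilon>) p) [unit_step (2 * \<epsilon>) G]"
    show "\<exists>\<phi>\<in>Hom (Ho (et CDGA) weq) F (shift_pers \<epsilon> G). \<exists>\<psi>\<in>Hom (Ho (et CDGA) weq) G (shift_pers \<epsilon> F).
       Comp (Ho (et CDGA) weq) F (shift_pers \<epsilon> G) (shift_pers (2 * \<epsilon>) F)
        (shift_map (shift_Ho (et CDGA) weq) \<epsilon> G (shift_pers \<epsilon> F) \<psi>) \<phi> = shift_unit (shift_Ho (et CDGA) weq) (2 * \<epsilon>) F \<and>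
       Comp (Ho (et CDGA) weq) G (shift_pers \<epsilon> F) (shift_pers (2 * \<epsilon>) G)
        (shift_map (shift_Ho (et CDGA) weq) \<epsilon> F (shift_pers \<epsilon> G) \<phi>) \<psi> = shift_unit (shift_Ho (et CDGA) weq) (2 * \<epsilon>) G"
      using half[OF w] half[OF w(2,1)] eq w
      by (intro bexI[of _ "et.cl F (shift_pers \<epsilon> G) p"] bexI[of _ "et.cl G (shift_pers \<epsilon> F) q"])
        (auto simp: et.Hom_Ho_iff)
  qed
qed

text \<open>
  Conjugating an interleaving of \<open>F'\<close> and \<open>G'\<close> with isomorphisms \<open>F \<cong> F'\<close> and \<open>G \<cong> G'\<close> of the homotopy
  category gives one of \<open>F\<close> and \<open>G\<close>, by naturality of the structure maps.
\<close>

lemma interleaved_conjugate: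
  assumes \<epsilon>: "0 \<le> \<epsilon>"
    and a: "et.word F a F'" "et.word F' a' F" "et.weql F F (a @ a') []"
    and b: "et.word G b G'" "et.word G' b' G" "et.weql G' G' (b' @ b) []"
    and p: "et.word F' p (shift_pers \<epsilon> G')" and q: "et.word G' q (shift_pers \<epsilon> F')"
    and eq: "et.weql F' (shift_pers (2 * \<epsilon>) F') (p @ map (shift_step (et CDGA) \<epsilon>) q) [unit_step (2 * \<epsilon>) F']"
  shows "et.weql F (shift_pers (2 * \<epsilon>) F)
    ((a @ p @ map (shift_step (et CDGA) \<epsilon>) b') @ map (shift_step (et CDGA) \<epsilon>) (b @ q @ map (shift_step (et CDGA) \<epsilon>) a'))
    [unit_step (2 * \<epsilon>) F]"
proof -
  let ?S = "map (shift_step (et CDGA) \<epsilon>)" and ?S2 = "map (shift_step (et CDGA) (2 * \<epsilon>))"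
  have F: "F \<in> Obj (et CDGA)" using et.word_Obj[OF a(1)] by blast
  have 2: "shift_pers \<epsilon> (shift_pers \<epsilon> X) = shift_pers (2 * \<epsilon>) X" for X :: "'a pers_cdga" by simp
  have \<epsilon>2: "0 \<le> 2 * \<epsilon>" using \<epsilon> by simp
  have SS: "?S (?S w) = ?S2 w" for w
  proof (induction w)
    case (Cons s w)
    have "shift_step (et CDGA) \<epsilon> (shift_step (et CDGA) \<epsilon> s) = shift_step (et CDGA) (2 * \<epsilon>) s"
      using \<epsilon> by (cases s) (auto simp: et_simps(5,6) algebra_simps)
    with Cons show ?case by simp
  qed simp
  note wS = shift_word[OF \<epsilon>] and wS2 = shift_word[OF \<epsilon>2]
  have Sa': "et.word (shift_pers (2 * \<epsilon>) F') (?S2 a') (shift_pers (2 * \<epsilon>) F)" by (rule wS2[OF a(2)])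
  have Sq: "et.word (shift_pers \<epsilon> G') (?S q) (shift_pers (2 * \<epsilon>) F')" using wS[OF q] unfolding 2 .
  have "et.weql (shift_pers \<epsilon> G') (shift_pers \<epsilon> G') (?S b' @ ?S b) []"
    using shift_word_eq[OF \<epsilon> b(3)] by simp
  from word_eq.cong[OF is_word_append[OF a(1) p] this is_word_append[OF Sq Sa']]
  have "et.weql F (shift_pers (2 * \<epsilon>) F) ((a @ p) @ (?S b' @ ?S b) @ (?S q @ ?S2 a')) ((a @ p) @ [] @ (?S q @ ?S2 a'))" .
  moreover have "et.weql F (shift_pers (2 * \<epsilon>) F) (a @ (p @ ?S q) @ ?S2 a') (a @ [unit_step (2 * \<epsilon>) F'] @ ?S2 a')"
    by (rule word_eq.cong[OF a(1) eq Sa'])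
  moreover have "et.weql F (shift_pers (2 * \<epsilon>) F) ([] @ (a @ [unit_step (2 * \<epsilon>) F']) @ ?S2 a') ([] @ ([unit_step (2 * \<epsilon>) F] @ ?S2 a) @ ?S2 a')"
    by (rule word_eq.cong[OF _ word_eq.sym[OF shift_unit_word[OF a(1) \<epsilon>2]] Sa']) (simp add: F)
  moreover have "et.weql F (shift_pers (2 * \<epsilon>) F) ([unit_step (2 * \<epsilon>) F] @ (?S2 a @ ?S2 a') @ []) ([unit_step (2 * \<epsilon>) F] @ [] @ [])"
    using shift_word_eq[OF \<epsilon>2 a(3)] by (intro word_eq.cong[OF unit_step_word[OF F \<epsilon>2]]) (auto simp: shift_et[OF F \<epsilon>2])
  ultimately have "et.weql F (shift_pers (2 * \<epsilon>) F) (a @ p @ ?S b' @ ?S b @ ?S q @ ?S2 a') [unit_step (2 * \<epsilon>) F]"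
    by (simp del: is_word.simps) (meson word_eq.trans)
  thus ?thesis by (simp add: SS del: map_map)
qed

lemma homotopy_interleaved_imp_Ho_interleaved:
  assumes "homotopy_interleaved \<epsilon> F G" "0 \<le> \<epsilon>" shows "Ho_interleaved \<epsilon> F G"
proof -
  note \<epsilon> = assms(2)
  obtain F' G' where w: "weakly_equivalent (et CDGA) weq F' F" "weakly_equivalent (et CDGA) weq G' G"
    and i: "interleaved (pers_cat CDGA) \<epsilon> F' G'" using assms(1) unfolding homotopy_interleaved_def by blast
  have o: "F \<in> Obj (et CDGA)" "F' \<in> Obj (et CDGA)" "G \<in> Obj (et CDGA)" "G' \<in> Obj (et CDGA)"
    using w by (simp_all add: weakly_equivalent_def)
  obtain a' a where a: "et.word F' a' F" "et.word F a F'" "et.weql F' F' (a' @ a) []" "et.weql F F (a @ a') []"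
    using et.weakly_equivalent_words[OF w(1)] by blast
  obtain b' b where b: "et.word G' b' G" "et.word G b G'" "et.weql G' G' (b' @ b) []" "et.weql G G (b @ b') []"
    using et.weakly_equivalent_words[OF w(2)] by blast
  obtain \<phi> \<psi> where \<phi>: "\<phi> \<in> Hom (et CDGA) F' (shift_pers \<epsilon> G')" and \<psi>: "\<psi> \<in> Hom (et CDGA) G' (shift_pers \<epsilon> F')"
    and eq: "Comp (et CDGA) F' (shift_pers \<epsilon> G') (shift_pers (2 * \<epsilon>) F') (shift_map (et CDGA) \<epsilon> G' (shift_pers \<epsilon> F') \<psi>) \<phi> = shift_unit (et CDGA) (2 * \<epsilon>) F'"
      "Comp (et CDGA) G' (shift_pers \<epsilon> F') (shift_pers (2 * \<epsilon>) G') (shift_map (et CDGA) \<epsilon> F' (shift_pers \<epsilon> G') \<phi>) \<psi> = shift_unit (et CDGA) (2 * \<epsilon>) G'"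
    using i unfolding interleaved_def pers_cat_simps et_simps by blast
  have e: "et.weql X (shift_pers (2 * \<epsilon>) X) ([Fwd X \<phi> (shift_pers \<epsilon> Y)] @ map (shift_step (et CDGA) \<epsilon>) [Fwd Y \<psi> (shift_pers \<epsilon> X)])
      [unit_step (2 * \<epsilon>) X]"
    if "X \<in> Obj (et CDGA)" "Y \<in> Obj (et CDGA)" "\<phi> \<in> Hom (et CDGA) X (shift_pers \<epsilon> Y)" "\<psi> \<in> Hom (et CDGA) Y (shift_pers \<epsilon> X)"
      "Comp (et CDGA) X (shift_pers \<epsilon> Y) (shift_pers (2 * \<epsilon>) X) (shift_map (et CDGA) \<epsilon> Y (shift_pers \<epsilon> X) \<psi>) \<phi> = shift_unit (et CDGA) (2 * \<epsilon>) X"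
    for X Y :: "'a pers_cdga" and \<phi> \<psi>
  proof -
    have "shift_map (et CDGA) \<epsilon> Y (shift_pers \<epsilon> X) \<psi> \<in> Hom (et CDGA) (shift_pers \<epsilon> Y) (shift_pers (2 * \<epsilon>) X)"
      using nat_transf_shift[of \<psi> Y "shift_pers \<epsilon> X" \<epsilon>] that(4) \<epsilon> by (simp add: et_simps(2,6))
    from word_eq.comp[OF that(1) shift_et[OF that(2) \<epsilon>] shift_et[OF that(1)] that(3) this, of weq]
    show ?thesis using \<epsilon> that(5) by (simp add: et_simps(5))
  qed
  let ?p = "[Fwd F' \<phi> (shift_pers \<epsilon> G')]" and ?q = "[Fwd G' \<psi> (shift_pers \<epsilon> F')]"
  let ?S = "map (shift_step (et CDGA) \<epsilon>)"
  have pq: "et.word F' ?p (shift_pers \<epsilon> G')" "et.word G' ?q (shift_pers \<epsilon> F')"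
    using \<phi> \<psi> o shift_et[OF _ \<epsilon>] by simp_all
  note c = interleaved_conjugate[OF \<epsilon> a(2,1,4) b(2,1,3) pq e[OF o(2,4) \<phi> \<psi> eq(1)]]
    interleaved_conjugate[OF \<epsilon> b(2,1,4) a(2,1,3) pq(2,1) e[OF o(4,2) \<psi> \<phi> eq(2)]]
  have "et.word F (a @ ?p @ ?S b') (shift_pers \<epsilon> G)" "et.word G (b @ ?q @ ?S a') (shift_pers \<epsilon> F)"
    by (intro is_word_append[OF a(2) is_word_append[OF pq(1) shift_word[OF \<epsilon> b(1)]]]
      is_word_append[OF b(2) is_word_append[OF pq(2) shift_word[OF \<epsilon> a(1)]]])+
  thus ?thesis unfolding Ho_interleaved_iff[OF o(1,3) \<epsilon>] using c by blast
qed

lemma Ho_image_simps [simp]: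
  "ob (Ho_image F) = ob F" "shift_pers \<epsilon> (Ho_image F) = Ho_image (shift_pers \<epsilon> F)"
  "str (Ho_image F) s t = CDGA.cl (ob F s) (ob F t) [Fwd (ob F s) (str F s t) (ob F t)]"
  by (simp_all add: Ho_image_def shift_pers_def)

abbreviation eval_word :: "real \<Rightarrow> ('u pers_cdga, real \<Rightarrow> 'u cdga_map) step list \<Rightarrow> ('u cdga, 'u cdga_map) step list" where
  "eval_word t \<equiv> map (apply_step (\<lambda>X. ob X t) (\<lambda>X Y f. f t))"

text \<open>The value of a zigzag at \<open>t\<close> is natural in \<open>t\<close> because the structure maps are natural in the functor.\<close>

lemma eval_word_nat_transf:
  assumes p: "et.word F p G"
  shows "(\<lambda>t\<in>{0..}. CDGA.cl (ob F t) (ob G t) (eval_word t p)) \<in> nat_transf (Ho CDGA quasi_iso) (Ho_image F) (Ho_image G)"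
proof -
  have fo: "is_functor CDGA F" "is_functor CDGA G" using et.word_Obj[OF p] by (simp_all add: et_simps)
  have w: "CDGA.word (ob F t) (eval_word t p) (ob G t)" if "0 \<le> t" for t
    by (rule weq_functor.word_map[OF weq_functor_eval[OF that] p])
  have "Comp (Ho CDGA quasi_iso) (ob F s) (ob F t) (ob G t) (CDGA.cl (ob F t) (ob G t) (eval_word t p)) (str (Ho_image F) s t) =
     Comp (Ho CDGA quasi_iso) (ob F s) (ob G s) (ob G t) (str (Ho_image G) s t) (CDGA.cl (ob F s) (ob G s) (eval_word s p))"
    if st: "0 \<le> s" "s \<le> t" for s t
  proof -
    have t: "0 \<le> t" using st by simp
    have sw: "CDGA.word (ob X s) [Fwd (ob X s) (str X s t) (ob X t)] (ob X t)" if "is_functor CDGA X" for X :: "'a pers_cdga"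
      using is_functorD[OF that] st by simp
    have "CDGA.weql (ob F s) (ob G t) ([Fwd (ob F s) (str F s t) (ob F t)] @ eval_word t p)
       (eval_word s p @ [Fwd (ob G s) (str G s t) (ob G t)])"
    proof (rule word_eq_natural[OF weq_functor_eval[OF st(1)] weq_functor_eval[OF t] _ _ p])
      show "str X s t \<in> Hom CDGA (ob X s) (ob X t)" if "X \<in> Obj (et CDGA)" for X
        using that is_functorD(2) st by (auto simp: et_simps)
      show "Comp CDGA (ob X s) (ob Y s) (ob Y t) (str Y s t) (f s) = Comp CDGA (ob X s) (ob X t) (ob Y t) (f t) (str X s t)"
        if "f \<in> Hom (et CDGA) X Y" for X Y f
        using that nat_transfD(2) st unfolding et_simps by metis
    qed
    from CDGA.class_eqI[OF this] show ?thesis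
      using CDGA.Ho_Comp[OF sw[OF fo(1)] w[OF t]] CDGA.Ho_Comp[OF w[OF st(1)] sw[OF fo(2)]] by simp
  qed
  moreover have "CDGA.cl (ob F t) (ob G t) (eval_word t p) \<in> Hom (Ho CDGA quasi_iso) (ob F t) (ob G t)" if "0 \<le> t" for t
    unfolding CDGA.Hom_Ho_iff using w[OF that] by blast
  ultimately show ?thesis by (auto simp: nat_transf_def)
qed

lemma Ho_interleaved_imp_homotopy_comm_interleaved:
  assumes F: "F \<in> Obj (et CDGA)" and G: "G \<in> Obj (et CDGA)" and \<epsilon>: "0 \<le> \<epsilon>" and i: "Ho_interleaved \<epsilon> F G"
  shows "homotopy_comm_interleaved \<epsilon> F G"
proof -
  obtain p q where p: "et.word F p (shift_pers \<epsilon> G)" and q: "et.word G q (shift_pers \<epsilon> F)"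
    and e: "et.weql F (shift_pers (2 * \<epsilon>) F) (p @ map (shift_step (et CDGA) \<epsilon>) q) [unit_step (2 * \<epsilon>) F]"
      "et.weql G (shift_pers (2 * \<epsilon>) G) (q @ map (shift_step (et CDGA) \<epsilon>) p) [unit_step (2 * \<epsilon>) G]"
    using i unfolding Ho_interleaved_iff[OF F G \<epsilon>] by blast
  have half: "(\<lambda>t\<in>{0..}. Comp (Ho CDGA quasi_iso) (ob F t) (ob (shift_pers \<epsilon> G) t) (ob (shift_pers (2 * \<epsilon>) F) t)
        ((\<lambda>t\<in>{0..}. (\<lambda>t\<in>{0..}. CDGA.cl (ob G t) (ob (shift_pers \<epsilon> F) t) (eval_word t q)) (t + \<epsilon>)) t)
        ((\<lambda>t\<in>{0..}. CDGA.cl (ob F t) (ob (shift_pers \<epsilon> G) t) (eval_word t p)) t)) =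
      (\<lambda>t\<in>{0..}. str (Ho_image F) t (t + 2 * \<epsilon>))"
    if p: "et.word F p (shift_pers \<epsilon> G)" and q: "et.word G q (shift_pers \<epsilon> F)"
      and e: "et.weql F (shift_pers (2 * \<epsilon>) F) (p @ map (shift_step (et CDGA) \<epsilon>) q) [unit_step (2 * \<epsilon>) F]" for F G p q
  proof (rule restrict_ext)
    fix t :: real assume "t \<in> {0..}"
    hence t: "0 \<le> t" "0 \<le> t + \<epsilon>" using \<epsilon> by auto
    have ev: "eval_word t (map (shift_step (et CDGA) \<epsilon>) w) = eval_word (t + \<epsilon>) w" for w :: "('b pers_cdga, real \<Rightarrow> 'b cdga_map) step list"
    proof (induction w)
      case (Cons s w) thus ?case using t by (cases s) (auto simp: et_simps(5,6))
    qed simp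
    have wp: "CDGA.word (ob F t) (eval_word t p) (ob G (t + \<epsilon>))"
      using weq_functor.word_map[OF weq_functor_eval[OF t(1)] p] by simp
    have wq: "CDGA.word (ob G (t + \<epsilon>)) (eval_word (t + \<epsilon>) q) (ob F (t + 2 * \<epsilon>))"
      using weq_functor.word_map[OF weq_functor_eval[OF t(2)] q] by (simp add: algebra_simps)
    have "CDGA.weql (ob F t) (ob F (t + 2 * \<epsilon>)) (eval_word t p @ eval_word (t + \<epsilon>) q) [Fwd (ob F t) (str F t (t + 2 * \<epsilon>)) (ob F (t + 2 * \<epsilon>))]"
      using weq_functor.word_eq_map[OF weq_functor_eval[OF t(1)] e] t(1) by (simp add: ev et_simps(7) del: map_map)
    from CDGA.class_eqI[OF this] CDGA.Ho_Comp[OF wp wq]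
    show "Comp (Ho CDGA quasi_iso) (ob F t) (ob (shift_pers \<epsilon> G) t) (ob (shift_pers (2 * \<epsilon>) F) t)
        ((\<lambda>t\<in>{0..}. (\<lambda>t\<in>{0..}. CDGA.cl (ob G t) (ob (shift_pers \<epsilon> F) t) (eval_word t q)) (t + \<epsilon>)) t)
        ((\<lambda>t\<in>{0..}. CDGA.cl (ob F t) (ob (shift_pers \<epsilon> G) t) (eval_word t p)) t) = str (Ho_image F) t (t + 2 * \<epsilon>)"
      using t by (simp add: algebra_simps)
  qed
  show ?thesis
    unfolding homotopy_comm_interleaved_def interleaved_def pers_cat_simps Ho_image_simps(1,2)
    using half[OF p q e(1)] half[OF q p e(2)] eval_word_nat_transf[OF p] eval_word_nat_transf[OF q] by blast
qed

lemma Inf_distance_mono: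
  assumes "\<And>\<epsilon>. 0 \<le> \<epsilon> \<Longrightarrow> P \<epsilon> \<Longrightarrow> P' \<epsilon>" "Inf (ereal ` {\<epsilon>. 0 \<le> \<epsilon> \<and> P \<epsilon>}) = 0"
  shows "Inf (ereal ` {\<epsilon>. 0 \<le> \<epsilon> \<and> P' \<epsilon>}) = 0"
proof (rule antisym)
  have "Inf (ereal ` {\<epsilon>. 0 \<le> \<epsilon> \<and> P' \<epsilon>}) \<le> Inf (ereal ` {\<epsilon>. 0 \<le> \<epsilon> \<and> P \<epsilon>})"
    by (rule Inf_superset_mono) (use assms(1) in blast)
  thus "Inf (ereal ` {\<epsilon>. 0 \<le> \<epsilon> \<and> P' \<epsilon>}) \<le> 0" using assms(2) by simp
  show "0 \<le> Inf (ereal ` {\<epsilon>. 0 \<le> \<epsilon> \<and> P' \<epsilon>})" by (rule Inf_greatest) auto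
qed

lemma Inf_distance_zeroI: "P 0 \<Longrightarrow> Inf (ereal ` {\<epsilon>. 0 \<le> \<epsilon> \<and> P \<epsilon>}) = 0"
  by (rule antisym) (auto intro!: Inf_lower2[of "ereal 0"] Inf_greatest simp: zero_ereal_def)

lemma formal_HI_imp_IHC: "formal_wrt d_HI F \<Longrightarrow> formal_wrt d_IHC F"
  unfolding formal_wrt_def d_HI_def d_IHC_def
  by (rule Inf_distance_mono[of "\<lambda>\<epsilon>. homotopy_interleaved \<epsilon> F (H F)"])
    (rule homotopy_interleaved_imp_Ho_interleaved)

lemma H_formal_imp_HI: "H_formal F \<Longrightarrow> formal_wrt d_HI F"
proof -
  assume h: "H_formal F"
  hence F: "F \<in> Obj (et CDGA)" and e: "weakly_equivalent (et CDGA) weq F F"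
    by (auto simp: H_formal_def weakly_equivalent_def)
  note f = is_functorD[of F]
  have fF: "is_functor CDGA F" using F by (simp add: et_simps)
  have u: "shift_unit (et CDGA) 0 F \<in> nat_transf CDGA F F" using shift_unit_nat_transf[OF fF, of 0] by simp
  have "interleaved (pers_cat CDGA) 0 F F" unfolding interleaved_def pers_cat_simps
    using u is_functorD[OF fF]
    by (intro bexI[of _ "shift_unit (et CDGA) 0 F"])
      (auto simp: et_simps CDGA_Comp_id cdga_hom_Idm simp del: CDGA_simps(3,4) intro!: restrict_ext)
  hence "homotopy_interleaved 0 F (H F)" unfolding homotopy_interleaved_def
    using e h unfolding H_formal_def by blast
  thus ?thesis unfolding formal_wrt_def d_HI_def by (rule Inf_distance_zeroI)
qed

section \<open>The cohomology of an extended tame functor\<close>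

lemma cdga_hom_eqI:
  assumes "f \<in> cdga_hom A B" "g \<in> cdga_hom A B'" "\<And>n x. x \<in> elts A n \<Longrightarrow> f n x = g n x" shows "f = g"
proof
  fix n show "f n = g n"
    using assms by (intro extensionalityI[of _ "elts A n"]) (simp_all add: cdga_hom_iff)
qed

lemma iso_quasi_iso:
  assumes A: "cdga A" and B: "cdga B" and f: "is_iso CDGA A B f" shows "f \<in> quasi_iso A B"
proof -
  obtain g where h: "f \<in> cdga_hom A B" "g \<in> cdga_hom B A"
    and "Comp CDGA A B A g f = Idm CDGA A" "Comp CDGA B A B f g = Idm CDGA B"
    using f unfolding is_iso_def by auto
  hence e: "Comp CDGA A B A g f n x = Idm CDGA A n x" "Comp CDGA B A B f g n x = Idm CDGA B n x" for n x by auto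
  have "weak_equivalence A B f"
    by (rule bijective_weak_equivalence[OF A B cdga_hom_dga_map[OF h(1)] cdga_hom_dga_map[OF h(2)]])
      (use e in \<open>simp_all add: compose_def fun_eq_iff split: if_splits, metis+\<close>)
  thus ?thesis using h(1) by (simp add: quasi_iso_iff A B)
qed

lemma cohomology_map_Idm:
  assumes "cdga A" shows "cohomology_map A A (Idm CDGA A) = Idm CDGA (cohomology A)"
proof -
  interpret cdga A by fact
  show ?thesis by (auto simp: cohomology_map_def cohomology_simps coh_rep_closed coh_rep_idem cocyclesD intro!: ext)
qed

lemma cohomology_map_Comp:
  assumes A: "cdga A" and B: "cdga B" and C: "cdga C" and f: "f \<in> cdga_hom A B" and g: "g \<in> cdga_hom B C"
  shows "cohomology_map A C (Comp CDGA A B C g f) =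
    Comp CDGA (cohomology A) (cohomology B) (cohomology C) (cohomology_map B C g) (cohomology_map A B f)"
proof (rule cdga_hom_eqI)
  note fm = cdga_hom_dga_map[OF f] and gm = cdga_hom_dga_map[OF g]
  note gf = cdga_hom_Comp[OF A B f g]
  show "cohomology_map A C (Comp CDGA A B C g f) \<in> cdga_hom (cohomology A) (cohomology C)"
    by (rule cohomology_map_hom[OF cdga_hom_dga_map[OF gf] A C])
  show "Comp CDGA (cohomology A) (cohomology B) (cohomology C) (cohomology_map B C g) (cohomology_map A B f)
    \<in> cdga_hom (cohomology A) (cohomology C)"
    by (rule cdga_hom_Comp[OF cdga.cdga_cohomology[OF A] cdga.cdga_cohomology[OF B]
          cohomology_map_hom[OF fm A B] cohomology_map_hom[OF gm B C]])
  fix n x assume x: "x \<in> elts (cohomology A) n"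
  then obtain z where z: "z \<in> cocycles A n" "x = coh_rep A n z" by (auto simp: cdga.cohomology_simps[OF A])
  have e: "z \<in> elts A n" by (rule cdga.cocyclesD(1)[OF A z(1)])
  show "cohomology_map A C (Comp CDGA A B C g f) n x =
    Comp CDGA (cohomology A) (cohomology B) (cohomology C) (cohomology_map B C g) (cohomology_map A B f) n x"
    unfolding CDGA_Comp_apply[OF x] unfolding z(2) cohomology_map_rep[OF cdga_hom_dga_map[OF gf] A C z(1)]
      cohomology_map_rep[OF fm A B z(1)] cohomology_map_rep[OF gm B C dga_map_cocycles[OF fm A B z(1)]]
      CDGA_Comp_apply[OF e] ..
qed

lemma cohomology_map_iso:
  assumes A: "cdga A" and B: "cdga B" and f: "is_iso CDGA A B f"
  shows "is_iso CDGA (cohomology A) (cohomology B) (cohomology_map A B f)"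
proof -
  obtain g where h: "f \<in> cdga_hom A B" "g \<in> cdga_hom B A"
    and e: "Comp CDGA A B A g f = Idm CDGA A" "Comp CDGA B A B f g = Idm CDGA B"
    using f unfolding is_iso_def by auto
  show ?thesis unfolding is_iso_def CDGA_simps(2)
    using cohomology_map_hom[OF cdga_hom_dga_map[OF h(1)] A B] cohomology_map_hom[OF cdga_hom_dga_map[OF h(2)] B A]
      cohomology_map_Comp[OF A B A h] cohomology_map_Comp[OF B A B h(2,1)]
      cohomology_map_Idm[OF A] cohomology_map_Idm[OF B] unfolding e by metis
qed

lemma H_simps [simp]:
  "ob (H F) t = cohomology (ob F t)" "str (H F) s t = cohomology_map (ob F s) (ob F t) (str F s t)"
  by (simp_all add: H_def)

lemma is_functor_H:
  assumes "is_functor CDGA F" shows "is_functor CDGA (H F)"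
proof -
  note f = is_functorD[OF assms]
  have "Comp CDGA (cohomology (ob F r)) (cohomology (ob F s)) (cohomology (ob F t))
      (cohomology_map (ob F s) (ob F t) (str F s t)) (cohomology_map (ob F r) (ob F s) (str F r s)) =
      cohomology_map (ob F r) (ob F t) (str F r t)"
    if "0 \<le> r" "r \<le> s" "s \<le> t" for r s t
    unfolding f(4)[OF that, symmetric] using that by (intro cohomology_map_Comp[symmetric] f) auto
  moreover have "cohomology_map (ob F s) (ob F t) (str F s t) \<in> cdga_hom (cohomology (ob F s)) (cohomology (ob F t))"
    if "0 \<le> s" "s \<le> t" for s t using that by (intro cohomology_map_hom cdga_hom_dga_map f) auto
  moreover have "cohomology_map (ob F t) (ob F t) (str F t t) = Idm CDGA (cohomology (ob F t))" if "0 \<le> t" for t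
    unfolding f(3)[OF that] using f(1)[OF that] by (rule cohomology_map_Idm)
  moreover have "cdga (cohomology (ob F t))" if "0 \<le> t" for t
    using f(1)[OF that] by (rule cdga.cdga_cohomology)
  ultimately show ?thesis unfolding is_functor_def
    by (simp del: CDGA_simps(3,4))
qed

lemma discretises_H:
  assumes "is_functor CDGA F" "discretises CDGA \<tau> N F" shows "discretises CDGA \<tau> N (H F)"
proof -
  have "is_iso CDGA (ob (H F) s) (ob (H F) t) (str (H F) s t)"
    if "0 \<le> s" "s \<le> t" "is_iso CDGA (ob F s) (ob F t) (str F s t)" for s t
    unfolding H_simps using that by (intro cohomology_map_iso is_functorD(1)[OF assms(1)]) auto
  thus ?thesis using assms(2) unfolding discretises_def by blast
qed

lemma H_et: "F \<in> Obj (et CDGA) \<Longrightarrow> H F \<in> Obj (et CDGA)"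
  using is_functor_H discretises_H unfolding et_simps by blast

lemma formal_IHC_imp_HC:
  assumes F: "F \<in> Obj (et CDGA)" and f: "formal_wrt d_IHC F" shows "formal_wrt d_HC F"
  using f unfolding formal_wrt_def d_IHC_def d_HC_def
  by (rule Inf_distance_mono[rotated]) (rule Ho_interleaved_imp_homotopy_comm_interleaved[OF F H_et[OF F]])


section \<open>Grids of the half line\<close>

locale grid =
  fixes \<sigma> :: "nat \<Rightarrow> real" and \<beta> :: real
  assumes start: "\<sigma> 0 = 0" and gap_pos: "0 < \<beta>" and gap: "\<sigma> k + \<beta> \<le> \<sigma> (Suc k)"
begin

lemma mono: "j \<le> k \<Longrightarrow> \<sigma> j \<le> \<sigma> k"
  by (rule lift_Suc_mono_le[of \<sigma>]) (use gap gap_pos in \<open>force intro: order_trans[OF _ gap]\<close>)+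

lemma nonneg: "0 \<le> \<sigma> k" using mono[of 0 k] start by simp

lemma unbounded: "real k * \<beta> \<le> \<sigma> k"
proof (induction k)
  case (Suc k) thus ?case using gap[of k] by (simp add: algebra_simps)
qed (simp add: start)

definition cell :: "real \<Rightarrow> nat" where "cell t = (LEAST k. t < \<sigma> (Suc k))"

lemma cell_bounds:
  assumes "0 \<le> t" shows "\<sigma> (cell t) \<le> t" "t < \<sigma> (Suc (cell t))"
proof -
  obtain k where "t < real k * \<beta>" using gap_pos reals_Archimedean3 by blast
  also have "\<dots> \<le> real (Suc k) * \<beta>" using gap_pos by (simp add: algebra_simps)
  finally have "t < \<sigma> (Suc k)" using unbounded[of "Suc k"] by linarith
  thus 1: "t < \<sigma> (Suc (cell t))" unfolding cell_def by (rule LeastI)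
  show "\<sigma> (cell t) \<le> t"
  proof (cases "cell t")
    case (Suc k)
    hence "\<not> t < \<sigma> (Suc k)" unfolding cell_def by (intro not_less_Least) simp
    thus ?thesis using Suc by simp
  qed (use start assms in simp)
qed

lemma cell_mono:
  assumes "0 \<le> s" "s \<le> t" shows "cell s \<le> cell t"
  unfolding cell_def[of s] by (rule Least_le) (use cell_bounds(2)[of t] assms in linarith)

lemma cell_eqI:
  assumes "\<sigma> k \<le> t" "t < \<sigma> (Suc k)" shows "cell t = k"
proof (rule antisym)
  show "cell t \<le> k" unfolding cell_def by (rule Least_le) fact
  have "\<not> cell t < k"
    using mono[of "Suc (cell t)" k] cell_bounds(2)[of t] assms(1) nonneg[of k] by fastforce
  thus "k \<le> cell t" by simp
qed

lemma cell_grid: "cell (\<sigma> k) = k"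
  by (rule cell_eqI) (use gap[of k] gap_pos in linarith)+

lemma divergent: "filterlim \<sigma> at_top sequentially"
proof -
  have "filterlim (\<lambda>k. real k * \<beta>) at_top sequentially"
    using filterlim_tendsto_pos_mult_at_top[OF tendsto_const gap_pos filterlim_real_sequentially] by (simp add: mult.commute)
  thus ?thesis by (rule filterlim_at_top_mono) (use unbounded in simp)
qed

text \<open>Discretisation by a grid means constancy up to isomorphism on its cells.\<close>

lemma discretises_iff:
  "discretises C \<sigma> \<infinity> F \<longleftrightarrow>
   (\<forall>s t. 0 \<le> s \<longrightarrow> s \<le> t \<longrightarrow> cell s = cell t \<longrightarrow> is_iso C (ob F s) (ob F t) (str F s t))"
proof -
  have "\<sigma> a < \<sigma> (Suc a)" for a using gap[of a] gap_pos by linarith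
  moreover have "(\<exists>a. s < \<sigma> a \<and> \<sigma> a \<le> t) \<longleftrightarrow> cell s \<noteq> cell t" if st: "0 \<le> s" "s \<le> t" for s t
  proof
    assume "\<exists>a. s < \<sigma> a \<and> \<sigma> a \<le> t"
    then obtain a where a: "s < \<sigma> a" "\<sigma> a \<le> t" by blast
    have "\<not> a \<le> cell s" using mono[of a "cell s"] a cell_bounds(1)[OF st(1)] by linarith
    moreover have "a \<le> cell t" using cell_mono[OF nonneg a(2)] by (simp add: cell_grid)
    ultimately show "cell s \<noteq> cell t" by linarith
  next
    assume "cell s \<noteq> cell t"
    hence "Suc (cell s) \<le> cell t" using cell_mono[OF st] by simp
    thus "\<exists>a. s < \<sigma> a \<and> \<sigma> a \<le> t" using mono[of "Suc (cell s)" "cell t"] cell_bounds[of s] cell_bounds[of t] st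
      by (intro exI[of _ "cell t"]) force
  qed
  ultimately show ?thesis unfolding discretises_def using nonneg divergent by simp blast
qed

end

text \<open>
  A finite sequence is continued with steps \<open>\<alpha>\<close>, and \<open>0\<close> is put in front if necessary. Additional terms weaken
  the condition on the structure maps.
\<close>

lemma grid_exists:
  assumes d: "discretises C \<tau> N F" and \<alpha>: "0 < \<alpha>"
    and gap: "\<And>n. enat (Suc n) < N \<Longrightarrow> \<alpha> \<le> \<tau> (Suc n) - \<tau> n"
  shows "\<exists>\<sigma> \<beta>. grid \<sigma> \<beta> \<and> discretises C \<sigma> \<infinity> F"
proof -
  define \<tau>' where "\<tau>' = rec_nat (if 0 < N then \<tau> 0 else 0) (\<lambda>n x. if enat (Suc n) < N then \<tau> (Suc n) else x + \<alpha>)"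
  have s: "\<tau>' 0 = (if 0 < N then \<tau> 0 else 0)" "\<tau>' (Suc n) = (if enat (Suc n) < N then \<tau> (Suc n) else \<tau>' n + \<alpha>)" for n
    by (simp_all add: \<tau>'_def)
  have ext: "\<tau>' n = \<tau> n" if "enat n < N" for n
    using that by (cases n) (auto simp: s zero_enat_def[symmetric])
  have step: "\<tau>' n + \<alpha> \<le> \<tau>' (Suc n)" for n
  proof (cases "enat (Suc n) < N")
    case True
    hence "enat n < N" by (rule le_less_trans[rotated]) simp
    thus ?thesis using gap[OF True] ext True by (simp add: s)
  qed (simp add: s)
  have pos: "0 \<le> \<tau>' 0" using d unfolding s discretises_def by (auto simp: zero_enat_def)
  have iso: "\<exists>a. s < \<tau>' a \<and> \<tau>' a \<le> t" if "0 \<le> s" "s \<le> t" "\<not> is_iso C (ob F s) (ob F t) (str F s t)" for s t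
    using d that ext unfolding discretises_def by metis
  have "\<exists>\<sigma> \<beta>. grid \<sigma> \<beta> \<and> range \<tau>' \<subseteq> range \<sigma>"
  proof (cases "\<tau>' 0 = 0")
    case True
    hence "grid \<tau>' \<alpha>" using step \<alpha> by unfold_locales auto
    thus ?thesis by blast
  next
    case False
    have "case_nat 0 \<tau>' k + min \<alpha> (\<tau>' 0) \<le> case_nat 0 \<tau>' (Suc k)" for k
      using step[of "k - 1"] by (cases k) auto
    hence "grid (case_nat 0 \<tau>') (min \<alpha> (\<tau>' 0))" using False pos \<alpha> by unfold_locales auto
    moreover have "\<tau>' n \<in> range (case_nat 0 \<tau>')" for n by (rule range_eqI[of _ _ "Suc n"]) simp
    ultimately show ?thesis by blast
  qed
  then obtain \<sigma> \<beta> where \<sigma>: "grid \<sigma> \<beta>" "range \<tau>' \<subseteq> range \<sigma>" by blast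
  interpret grid \<sigma> \<beta> by fact
  have "\<exists>a. s < \<sigma> a \<and> \<sigma> a \<le> t" if "0 \<le> s \<and> s \<le> t \<and> \<not> is_iso C (ob F s) (ob F t) (str F s t)" for s t
    using iso[of s t] that \<sigma>(2) by (metis (no_types, lifting) rangeE rangeI subsetD)
  moreover have "\<sigma> a < \<sigma> (Suc a)" for a using gap[of a] gap_pos grid.gap[OF \<sigma>(1), of a] by linarith
  ultimately have "discretises C \<sigma> \<infinity> F" unfolding discretises_def using nonneg divergent by simp
  thus ?thesis using \<sigma>(1) by blast
qed

lemma weakly_equivalentI:
  assumes "F \<in> Obj (et CDGA)" "G \<in> Obj (et CDGA)" "w \<in> weq F G" shows "weakly_equivalent (et CDGA) weq F G"
  using assms unfolding weakly_equivalent_def by (auto intro!: r_into_equivclp)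

lemma weakly_equivalent_trans:
  "weakly_equivalent C W X Y \<Longrightarrow> weakly_equivalent C W Y Z \<Longrightarrow> weakly_equivalent C W X Z"
  unfolding weakly_equivalent_def by (auto intro: equivclp_trans)

lemma weakly_equivalent_sym: "weakly_equivalent C W X Y \<Longrightarrow> weakly_equivalent C W Y X"
  unfolding weakly_equivalent_def by (auto intro: equivclp_sym)

section \<open>Step functors\<close>

primrec seq_map :: "(nat \<Rightarrow> 'u cdga) \<Rightarrow> (nat \<Rightarrow> 'u cdga_map) \<Rightarrow> nat \<Rightarrow> nat \<Rightarrow> 'u cdga_map" where
  "seq_map Q i j 0 = Idm CDGA (Q j)"
| "seq_map Q i j (Suc k) = (if j \<le> k then Comp CDGA (Q j) (Q k) (Q (Suc k)) (i k) (seq_map Q i j k) else Idm CDGA (Q j))"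

locale cdga_sequence =
  fixes Q :: "nat \<Rightarrow> 'u cdga" and i :: "nat \<Rightarrow> 'u cdga_map"
  assumes Q: "cdga (Q n)" and i: "i n \<in> cdga_hom (Q n) (Q (Suc n))"
begin

lemma seq_map_id: "seq_map Q i j j = Idm CDGA (Q j)"
  by (cases j) (simp_all del: CDGA_simps)

lemma seq_map_hom: "j \<le> k \<Longrightarrow> seq_map Q i j k \<in> cdga_hom (Q j) (Q k)"
proof (induction k)
  case (Suc k)
  show ?case
  proof (cases "j \<le> k")
    case True thus ?thesis using cdga_hom_Comp[OF Q Q Suc.IH[OF True] i] by (simp del: CDGA_simps)
  next
    case False
    hence "j = Suc k" using Suc.prems by simp
    thus ?thesis using cdga_hom_Idm[OF Q] by (simp del: CDGA_simps)
  qed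
qed (use cdga_hom_Idm[OF Q] in \<open>simp del: CDGA_simps\<close>)

lemma seq_map_comp:
  "j \<le> k \<Longrightarrow> k \<le> l \<Longrightarrow> Comp CDGA (Q j) (Q k) (Q l) (seq_map Q i k l) (seq_map Q i j k) = seq_map Q i j l"
proof (induction l)
  case 0 thus ?case using CDGA_Comp_id(2)[OF seq_map_hom[of 0 0]] by (simp del: CDGA_simps)
next
  case (Suc l)
  show ?case
  proof (cases "k \<le> l")
    case True
    thus ?thesis using Suc.IH[OF Suc.prems(1) True] Suc.prems(1)
      CDGA_Comp_assoc[OF seq_map_hom[OF Suc.prems(1)], of "Q l" "Q (Suc l)" "i l" "seq_map Q i k l"]
      by (simp del: CDGA_simps)
  next
    case False
    hence "k = Suc l" using Suc.prems by simp
    thus ?thesis using CDGA_Comp_id(2)[OF seq_map_hom[OF Suc.prems(1)]] by (simp only: seq_map_id)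
  qed
qed

lemma seq_map_natural:
  assumes K: "\<And>j k l. j \<le> k \<Longrightarrow> k \<le> l \<Longrightarrow> Comp CDGA (K j) (K k) (K l) (c k l) (c j k) = c j l"
    and c: "\<And>j k. j \<le> k \<Longrightarrow> c j k \<in> cdga_hom (K j) (K k)" and c_id: "\<And>k. c k k = Idm CDGA (K k)"
    and r: "\<And>n. r n \<in> cdga_hom (Q n) (K n)"
    and nat: "\<And>n. Comp CDGA (Q n) (Q (Suc n)) (K (Suc n)) (r (Suc n)) (i n) = Comp CDGA (Q n) (K n) (K (Suc n)) (c n (Suc n)) (r n)"
  shows "j \<le> k \<Longrightarrow> Comp CDGA (Q j) (Q k) (K k) (r k) (seq_map Q i j k) = Comp CDGA (Q j) (K j) (K k) (c j k) (r j)"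
proof (induction k)
  case 0 thus ?case using CDGA_Comp_id[OF r] c_id by (simp del: CDGA_simps)
next
  case (Suc k)
  show ?case
  proof (cases "j \<le> k")
    case True
    note h = seq_map_hom[OF True]
    have "Comp CDGA (Q j) (Q (Suc k)) (K (Suc k)) (r (Suc k)) (seq_map Q i j (Suc k)) =
      Comp CDGA (Q j) (Q k) (K (Suc k)) (Comp CDGA (Q k) (Q (Suc k)) (K (Suc k)) (r (Suc k)) (i k)) (seq_map Q i j k)"
      using True CDGA_Comp_assoc[OF h] by (simp del: CDGA_simps)
    also have "\<dots> = Comp CDGA (Q j) (K k) (K (Suc k)) (c k (Suc k)) (Comp CDGA (Q j) (Q k) (K k) (r k) (seq_map Q i j k))"
      unfolding nat CDGA_Comp_assoc[OF h] ..
    also have "\<dots> = Comp CDGA (Q j) (K j) (K (Suc k)) (Comp CDGA (K j) (K k) (K (Suc k)) (c k (Suc k)) (c j k)) (r j)"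
      unfolding Suc.IH[OF True] CDGA_Comp_assoc[OF r] ..
    also have "\<dots> = Comp CDGA (Q j) (K j) (K (Suc k)) (c j (Suc k)) (r j)" using K[OF True, of "Suc k"] by simp
    finally show ?thesis .
  next
    case False
    hence "j = Suc k" using Suc.prems by simp
    thus ?thesis using CDGA_Comp_id[OF r] c_id by (simp add: seq_map_id del: CDGA_simps seq_map.simps)
  qed
qed

end

locale cdga_step_functor = grid \<sigma> \<beta> + cdga_sequence Q i
  for \<sigma> \<beta> and Q :: "nat \<Rightarrow> 'u cdga" and i
begin

definition step_functor :: "'u pers_cdga" where
  "step_functor = \<lparr> ob = (\<lambda>t. Q (cell t)), str = (\<lambda>s t. seq_map Q i (cell s) (cell t)) \<rparr>"

lemma step_functor_simps [simp]:
  "ob step_functor t = Q (cell t)" "str step_functor s t = seq_map Q i (cell s) (cell t)"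
  by (simp_all add: step_functor_def)

lemma step_functor_et: "step_functor \<in> Obj (et CDGA)"
proof -
  have "is_functor CDGA step_functor" unfolding is_functor_def
    using Q seq_map_hom seq_map_id seq_map_comp cell_mono by (simp del: CDGA_simps(3,4))
  moreover have "is_iso CDGA (Q k) (Q k) (Idm CDGA (Q k))" for k
    using cdga_hom_Idm[OF Q, of k] CDGA_Comp_id(1)[OF cdga_hom_Idm[OF Q, of k]]
    unfolding is_iso_def CDGA_simps(2) by blast
  hence "discretises CDGA \<sigma> \<infinity> step_functor" unfolding discretises_iff by (simp add: seq_map_id del: CDGA_simps)
  ultimately show ?thesis unfolding et_simps by blast
qed

text \<open>
  If \<open>K\<close> is constant on the cells of the grid, it is determined up to isomorphism by its values on
  the grid, so a sequence of quasi-isomorphisms extends to the half line: on the cell of \<open>\<sigma> n\<close>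
  compose with the isomorphisms \<open>K (\<sigma> n \<le> t)\<close>.
\<close>

lemma step_functor_weq:
  assumes K: "K \<in> Obj (et CDGA)" and d: "discretises CDGA \<sigma> \<infinity> K"
    and r: "\<And>n. r n \<in> quasi_iso (Q n) (ob K (\<sigma> n))"
    and nat: "\<And>n. Comp CDGA (Q n) (Q (Suc n)) (ob K (\<sigma> (Suc n))) (r (Suc n)) (i n) =
      Comp CDGA (Q n) (ob K (\<sigma> n)) (ob K (\<sigma> (Suc n))) (str K (\<sigma> n) (\<sigma> (Suc n))) (r n)"
  shows "weakly_equivalent (et CDGA) weq step_functor K"
proof -
  have fK: "is_functor CDGA K" using K by (simp add: et_simps)
  note k = is_functorD[OF fK]
  note rh = quasi_iso_hom[OF r]
  define w where "w = (\<lambda>t\<in>{0..}. Comp CDGA (Q (cell t)) (ob K (\<sigma> (cell t))) (ob K t) (str K (\<sigma> (cell t)) t) (r (cell t)))"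
  have w: "w t = Comp CDGA (Q (cell t)) (ob K (\<sigma> (cell t))) (ob K t) (str K (\<sigma> (cell t)) t) (r (cell t))" if "0 \<le> t" for t
    using that by (simp add: w_def del: CDGA_simps)
  note b = cell_bounds nonneg mono
  have wh: "w t \<in> cdga_hom (Q (cell t)) (ob K t)" if "0 \<le> t" for t
    unfolding w[OF that] by (rule cdga_hom_Comp[OF Q k(1)[OF nonneg] rh k(2)[OF nonneg b(1)[OF that]]])
  have we: "w t \<in> quasi_iso (Q (cell t)) (ob K t)" if t: "0 \<le> t" for t
  proof -
    have "is_iso CDGA (ob K (\<sigma> (cell t))) (ob K t) (str K (\<sigma> (cell t)) t)"
      using d nonneg b(1)[OF t] unfolding discretises_iff by (simp add: cell_grid)
    hence "str K (\<sigma> (cell t)) t \<in> quasi_iso (ob K (\<sigma> (cell t))) (ob K t)"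
      using iso_quasi_iso k(1) nonneg t by blast
    hence "weak_equivalence (ob K (\<sigma> (cell t))) (ob K t) (str K (\<sigma> (cell t)) t)"
      using quasi_iso_iff[OF k(1)[OF nonneg] k(1)[OF t]] by blast
    moreover have "weak_equivalence (Q (cell t)) (ob K (\<sigma> (cell t))) (r (cell t))"
      using r quasi_iso_iff[OF Q k(1)[OF nonneg]] by blast
    ultimately have "weak_equivalence (Q (cell t)) (ob K t) (\<lambda>n x. str K (\<sigma> (cell t)) t n (r (cell t) n x))"
      by (intro weak_equivalence_comp[OF Q k(1)[OF nonneg] k(1)[OF t]])
    hence "weak_equivalence (Q (cell t)) (ob K t) (w t)"
      by (rule weak_equivalence_cong[OF Q]) (simp add: w[OF t] CDGA_Comp_apply del: CDGA_simps)
    thus ?thesis using wh[OF t] Q k(1)[OF t] by (simp add: quasi_iso_iff)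
  qed
  have sq: "Comp CDGA (Q j) (Q l) (ob K (\<sigma> l)) (r l) (seq_map Q i j l) =
    Comp CDGA (Q j) (ob K (\<sigma> j)) (ob K (\<sigma> l)) (str K (\<sigma> j) (\<sigma> l)) (r j)" if "j \<le> l" for j l
    using that k(2)[OF nonneg mono] k(3)[OF nonneg] k(4)[OF nonneg mono mono] rh nat
    by (intro seq_map_natural[of "\<lambda>n. ob K (\<sigma> n)" "\<lambda>j l. str K (\<sigma> j) (\<sigma> l)"])
  have "Comp CDGA (Q (cell s)) (Q (cell t)) (ob K t) (w t) (seq_map Q i (cell s) (cell t)) =
    Comp CDGA (Q (cell s)) (ob K s) (ob K t) (str K s t) (w s)" if st: "0 \<le> s" "s \<le> t" for s t
  proof -
    note c = cell_mono[OF st] and t = order_trans[OF st]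
    let ?j = "cell s" and ?l = "cell t"
    have "Comp CDGA (Q ?j) (Q ?l) (ob K t) (w t) (seq_map Q i ?j ?l) =
      Comp CDGA (Q ?j) (ob K (\<sigma> ?l)) (ob K t) (str K (\<sigma> ?l) t) (Comp CDGA (Q ?j) (Q ?l) (ob K (\<sigma> ?l)) (r ?l) (seq_map Q i ?j ?l))"
      unfolding w[OF t] CDGA_Comp_assoc[OF seq_map_hom[OF c]] ..
    also have "\<dots> = Comp CDGA (Q ?j) (ob K (\<sigma> ?j)) (ob K t)
        (Comp CDGA (ob K (\<sigma> ?j)) (ob K (\<sigma> ?l)) (ob K t) (str K (\<sigma> ?l) t) (str K (\<sigma> ?j) (\<sigma> ?l))) (r ?j)"
      unfolding sq[OF c] CDGA_Comp_assoc[OF rh] ..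
    also have "Comp CDGA (ob K (\<sigma> ?j)) (ob K (\<sigma> ?l)) (ob K t) (str K (\<sigma> ?l) t) (str K (\<sigma> ?j) (\<sigma> ?l)) =
        Comp CDGA (ob K (\<sigma> ?j)) (ob K s) (ob K t) (str K s t) (str K (\<sigma> ?j) s)"
      unfolding k(4)[OF nonneg mono[OF c] b(1)[OF t]] k(4)[OF nonneg b(1)[OF st(1)] st(2)] ..
    also have "Comp CDGA (Q ?j) (ob K (\<sigma> ?j)) (ob K t) \<dots> (r ?j) = Comp CDGA (Q ?j) (ob K s) (ob K t) (str K s t) (w s)"
      unfolding w[OF st(1)] CDGA_Comp_assoc[OF rh] ..
    finally show ?thesis .
  qed
  hence "w \<in> nat_transf CDGA step_functor K" unfolding nat_transf_def using wh by (simp add: w_def del: CDGA_simps(3,4))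
  hence "w \<in> weq step_functor K" unfolding weq_def et_simps using we by simp
  thus ?thesis by (rule weakly_equivalentI[OF step_functor_et K])
qed

end

text \<open>Moving every point to the right within its cell does not change a functor that is constant on the cells.\<close>

lemma (in grid) reparametrisation_weq:
  fixes G :: "'u pers_cdga"
  assumes G: "is_functor CDGA G" and d: "discretises CDGA \<sigma> \<infinity> G"
    and m: "\<And>s t. 0 \<le> s \<Longrightarrow> s \<le> t \<Longrightarrow> m s \<le> m t" "\<And>t. 0 \<le> t \<Longrightarrow> t \<le> m t" "\<And>t. 0 \<le> t \<Longrightarrow> cell (m t) = cell t"
  defines "K \<equiv> \<lparr> ob = (\<lambda>t. ob G (m t)), str = (\<lambda>s t. str G (m s) (m t)) \<rparr>"
  shows "discretises CDGA \<sigma> \<infinity> K" "K \<in> Obj (et CDGA)" "weakly_equivalent (et CDGA) weq G K"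
proof -
  have [simp]: "ob K t = ob G (m t)" "str K s t = str G (m s) (m t)" for s t by (simp_all add: K_def)
  note g = is_functorD[OF G]
  have m0: "0 \<le> m t" if "0 \<le> t" for t using m(2)[OF that] that by linarith
  show dK: "discretises CDGA \<sigma> \<infinity> K" using d m m0 unfolding discretises_iff by (auto simp del: CDGA_simps)
  have "is_functor CDGA K" unfolding is_functor_def using g m m0 by (auto simp del: CDGA_simps(3,4))
  thus K: "K \<in> Obj (et CDGA)" using dK unfolding et_simps by blast
  have "str G t (m t) \<in> quasi_iso (ob G t) (ob G (m t))" if "0 \<le> t" for t
    using d m(2,3)[OF that] that m0[OF that] g(1) unfolding discretises_iff by (auto intro!: iso_quasi_iso)
  moreover have "(\<lambda>t\<in>{0..}. str G t (m t)) \<in> nat_transf CDGA G K"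
    unfolding nat_transf_def using g m m0 by (auto simp del: CDGA_simps(3,4) intro: order_trans)
  ultimately have "(\<lambda>t\<in>{0..}. str G t (m t)) \<in> weq G K" unfolding weq_def et_simps by simp
  moreover have "G \<in> Obj (et CDGA)" using G d unfolding et_simps by blast
  ultimately show "weakly_equivalent (et CDGA) weq G K" using weakly_equivalentI K by blast
qed

section \<open>Formality of functors with a gap\<close>

text \<open>
  Representatives of the components of an interleaving. The triangles and the naturality squares, which commute in the
  homotopy category, become equalities of words.
\<close>

lemma homotopy_comm_interleaved_words:
  assumes F: "is_functor CDGA F" and G: "is_functor CDGA G" and \<epsilon>: "0 \<le> \<epsilon>" and int: "homotopy_comm_interleaved \<epsilon> F G"
  obtains u v where
    "\<And>t. 0 \<le> t \<Longrightarrow> CDGA.word (ob F t) (u t) (ob G (t + \<epsilon>))" "\<And>t. 0 \<le> t \<Longrightarrow> CDGA.word (ob G t) (v t) (ob F (t + \<epsilon>))"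
    "\<And>t. 0 \<le> t \<Longrightarrow> CDGA.weql (ob F t) (ob F (t + 2 * \<epsilon>)) (u t @ v (t + \<epsilon>)) [Fwd (ob F t) (str F t (t + 2 * \<epsilon>)) (ob F (t + 2 * \<epsilon>))]"
    "\<And>t. 0 \<le> t \<Longrightarrow> CDGA.weql (ob G t) (ob G (t + 2 * \<epsilon>)) (v t @ u (t + \<epsilon>)) [Fwd (ob G t) (str G t (t + 2 * \<epsilon>)) (ob G (t + 2 * \<epsilon>))]"
    "\<And>s t. 0 \<le> s \<Longrightarrow> s \<le> t \<Longrightarrow> CDGA.weql (ob F s) (ob G (t + \<epsilon>)) ([Fwd (ob F s) (str F s t) (ob F t)] @ u t)
      (u s @ [Fwd (ob G (s + \<epsilon>)) (str G (s + \<epsilon>) (t + \<epsilon>)) (ob G (t + \<epsilon>))])"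
proof -
  let ?D = "Ho CDGA quasi_iso"
  obtain \<phi> \<psi> where \<phi>: "\<phi> \<in> nat_transf ?D (Ho_image F) (shift_pers \<epsilon> (Ho_image G))"
    and \<psi>: "\<psi> \<in> nat_transf ?D (Ho_image G) (shift_pers \<epsilon> (Ho_image F))"
    and e1: "(\<lambda>t\<in>{0..}. Comp ?D (ob (Ho_image F) t) (ob (shift_pers \<epsilon> (Ho_image G)) t) (ob (shift_pers (2 * \<epsilon>) (Ho_image F)) t)
      ((\<lambda>t\<in>{0..}. \<psi> (t + \<epsilon>)) t) (\<phi> t)) = (\<lambda>t\<in>{0..}. str (Ho_image F) t (t + 2 * \<epsilon>))"
    and e2: "(\<lambda>t\<in>{0..}. Comp ?D (ob (Ho_image G) t) (ob (shift_pers \<epsilon> (Ho_image F)) t) (ob (shift_pers (2 * \<epsilon>) (Ho_image G)) t)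
      ((\<lambda>t\<in>{0..}. \<phi> (t + \<epsilon>)) t) (\<psi> t)) = (\<lambda>t\<in>{0..}. str (Ho_image G) t (t + 2 * \<epsilon>))"
    using int unfolding homotopy_comm_interleaved_def interleaved_def pers_cat_simps by blast
  have ex: "\<exists>w. \<forall>t\<ge>0. CDGA.word (ob X t) (w t) (ob Y (t + \<epsilon>)) \<and> \<chi> t = CDGA.cl (ob X t) (ob Y (t + \<epsilon>)) (w t)"
    if "\<chi> \<in> nat_transf ?D (Ho_image X) (shift_pers \<epsilon> (Ho_image Y))" for \<chi> and X Y :: "'a pers_cdga"
  proof -
    have "\<forall>t\<in>{0..}. \<exists>w. CDGA.word (ob X t) w (ob Y (t + \<epsilon>)) \<and> \<chi> t = CDGA.cl (ob X t) (ob Y (t + \<epsilon>)) w"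
      using that by (simp add: nat_transf_def CDGA.Hom_Ho_iff)
    from bchoice[OF this] show ?thesis by auto
  qed
  obtain u where u: "\<And>t. 0 \<le> t \<Longrightarrow> CDGA.word (ob F t) (u t) (ob G (t + \<epsilon>))"
    "\<And>t. 0 \<le> t \<Longrightarrow> \<phi> t = CDGA.cl (ob F t) (ob G (t + \<epsilon>)) (u t)" using ex[OF \<phi>] by blast
  obtain v where v: "\<And>t. 0 \<le> t \<Longrightarrow> CDGA.word (ob G t) (v t) (ob F (t + \<epsilon>))"
    "\<And>t. 0 \<le> t \<Longrightarrow> \<psi> t = CDGA.cl (ob G t) (ob F (t + \<epsilon>)) (v t)" using ex[OF \<psi>] by blast
  have half: "CDGA.weql (ob X t) (ob X (t + 2 * \<epsilon>)) (p t @ q (t + \<epsilon>)) [Fwd (ob X t) (str X t (t + 2 * \<epsilon>)) (ob X (t + 2 * \<epsilon>))]"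
    if t: "0 \<le> t" and p: "\<And>t. 0 \<le> t \<Longrightarrow> CDGA.word (ob X t) (p t) (ob Y (t + \<epsilon>))"
        "\<And>t. 0 \<le> t \<Longrightarrow> \<alpha> t = CDGA.cl (ob X t) (ob Y (t + \<epsilon>)) (p t)"
      and q: "\<And>t. 0 \<le> t \<Longrightarrow> CDGA.word (ob Y t) (q t) (ob X (t + \<epsilon>))"
        "\<And>t. 0 \<le> t \<Longrightarrow> \<gamma> t = CDGA.cl (ob Y t) (ob X (t + \<epsilon>)) (q t)"
      and e: "(\<lambda>t\<in>{0..}. Comp ?D (ob (Ho_image X) t) (ob (shift_pers \<epsilon> (Ho_image Y)) t) (ob (shift_pers (2 * \<epsilon>) (Ho_image X)) t)
        ((\<lambda>t\<in>{0..}. \<gamma> (t + \<epsilon>)) t) (\<alpha> t)) = (\<lambda>t\<in>{0..}. str (Ho_image X) t (t + 2 * \<epsilon>))"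
    for t \<alpha> \<gamma> p q and X Y :: "'a pers_cdga"
  proof -
    have t': "0 \<le> t + \<epsilon>" "t + \<epsilon> + \<epsilon> = t + 2 * \<epsilon>" using t \<epsilon> by simp_all
    note q' = q[OF t'(1), unfolded t'(2)]
    have "Comp ?D (ob X t) (ob Y (t + \<epsilon>)) (ob X (t + 2 * \<epsilon>)) (\<gamma> (t + \<epsilon>)) (\<alpha> t) =
      CDGA.cl (ob X t) (ob X (t + 2 * \<epsilon>)) [Fwd (ob X t) (str X t (t + 2 * \<epsilon>)) (ob X (t + 2 * \<epsilon>))]"
      using fun_cong[OF e, of t] t by simp
    thus ?thesis unfolding p(2)[OF t] q'(2) CDGA.Ho_Comp[OF p(1)[OF t] q'(1)]
      using CDGA.class_eq_iff[OF is_word_append[OF p(1)[OF t] q'(1)]] by blast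
  qed
  have nat: "CDGA.weql (ob F s) (ob G (t + \<epsilon>)) ([Fwd (ob F s) (str F s t) (ob F t)] @ u t)
      (u s @ [Fwd (ob G (s + \<epsilon>)) (str G (s + \<epsilon>) (t + \<epsilon>)) (ob G (t + \<epsilon>))])" if st: "0 \<le> s" "s \<le> t" for s t
  proof -
    have t: "0 \<le> t" "0 \<le> s + \<epsilon>" "0 \<le> t + \<epsilon>" "s + \<epsilon> \<le> t + \<epsilon>" using st \<epsilon> by linarith+
    have w: "CDGA.word (ob F s) [Fwd (ob F s) (str F s t) (ob F t)] (ob F t)"
      "CDGA.word (ob G (s + \<epsilon>)) [Fwd (ob G (s + \<epsilon>)) (str G (s + \<epsilon>) (t + \<epsilon>)) (ob G (t + \<epsilon>))] (ob G (t + \<epsilon>))"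
      using is_functorD(1,2)[OF F] is_functorD(1,2)[OF G] st t by simp_all
    have "Comp ?D (ob F s) (ob F t) (ob G (t + \<epsilon>)) (\<phi> t) (CDGA.cl (ob F s) (ob F t) [Fwd (ob F s) (str F s t) (ob F t)]) =
      Comp ?D (ob F s) (ob G (s + \<epsilon>)) (ob G (t + \<epsilon>))
        (CDGA.cl (ob G (s + \<epsilon>)) (ob G (t + \<epsilon>)) [Fwd (ob G (s + \<epsilon>)) (str G (s + \<epsilon>) (t + \<epsilon>)) (ob G (t + \<epsilon>))]) (\<phi> s)"
      using \<phi> st by (simp add: nat_transf_def)
    thus ?thesis unfolding u(2)[OF st(1)] u(2)[OF t(1)] CDGA.Ho_Comp[OF w(1) u(1)[OF t(1)]] CDGA.Ho_Comp[OF u(1)[OF st(1)] w(2)]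
      using CDGA.class_eq_iff[OF is_word_append[OF w(1) u(1)[OF t(1)]]] by blast
  qed
  show thesis by (rule that[OF u(1) v(1) half[OF _ u v e1] half[OF _ v u e2] nat])
qed

text \<open>
  Two out of six: if \<open>q \<circ> p\<close> and \<open>p' \<circ> q\<close> act as bijections, then \<open>p\<close> is injective because
  \<open>q \<circ> p\<close> is, and surjective because \<open>q \<circ> p\<close> is and \<open>q\<close> is injective.
\<close>

lemma (in homotopy_functor) word_injective:
  assumes p: "is_word CDGA quasi_iso A p B" and q: "is_word CDGA quasi_iso B q C" and f: "f \<in> quasi_iso A C"
    and pq: "word_eq CDGA quasi_iso A C (p @ q) [Fwd A f C]"
    and rel: "wrel p A s t" "wrel p A s' t'" "R B t t'"
  shows "R A s s'"
proof -
  note o = word_objects[OF p] word_objects[OF q]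
  note m = word_mem[OF p rel(1)] word_mem[OF p rel(2)]
  obtain r where r: "wrel q B t r" using word_total[OF q] m(1) by blast
  note rC = conjunct2[OF word_mem[OF q r]]
  have "wrel q B t' r" by (rule word_closed[OF q r]) (use m rC rel(3) R_refl o in auto)
  hence "wrel [Fwd A f C] A s r" "wrel [Fwd A f C] A s' r"
    using rel(1,2) r word_append[OF p q] word_eq_rel[OF pq] by blast+
  then obtain k k' where k: "k \<in> S C" "R C (act f s) k" "R C k r" "k' \<in> S C" "R C (act f s') k'" "R C k' r" by auto
  note c = act_closed[OF _ _ quasi_iso_hom[OF f]]
  have a: "act f s \<in> S C" "act f s' \<in> S C" using c o m by auto
  have "R C (act f s) r" using k R_trans[of C "act f s" k r] a rC o by blast
  moreover have "R C r (act f s')"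
    using k R_trans[of C "act f s'" k' r] R_sym[of C "act f s'" r] a rC o by blast
  ultimately have "R C (act f s) (act f s')" using R_trans[of C "act f s" r "act f s'"] a rC o by blast
  thus ?thesis using cancel[OF _ _ f] o m by blast
qed

lemma (in homotopy_functor) word_surjective:
  assumes p: "is_word CDGA quasi_iso A p B" and q: "is_word CDGA quasi_iso B q C" and p': "is_word CDGA quasi_iso C p' D"
    and f: "f \<in> quasi_iso A C" and g: "g \<in> quasi_iso B D"
    and pq: "word_eq CDGA quasi_iso A C (p @ q) [Fwd A f C]" and qp: "word_eq CDGA quasi_iso B D (q @ p') [Fwd B g D]"
    and t: "t \<in> S B"
  shows "\<exists>s. wrel p A s t"
proof -
  note o = word_objects[OF p] word_objects[OF q]
  obtain r where r: "wrel q B t r" using word_total[OF q t] by blast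
  note rC = conjunct2[OF word_mem[OF q r]]
  obtain s where s: "s \<in> S A" "R C (act f s) r" using lift[OF _ _ f rC] o by blast
  have "wrel [Fwd A f C] A s r"
    using s rC R_refl[of C r] o by auto
  then obtain k where k: "wrel p A s k" "wrel q B k r" using word_append[OF p q] word_eq_rel[OF pq] by blast
  have "R C r r" using R_refl o rC by blast
  hence "R B k t" by (rule word_injective[OF q p' g qp k(2) r])
  hence "wrel p A s t" using word_closed[OF p k(1) s(1) t] R_refl[of A s] o s(1) by blast
  thus ?thesis ..
qed

lemma coh_bijective_two_of_six:
  assumes w: "is_word CDGA quasi_iso A p B" "is_word CDGA quasi_iso B q C" "is_word CDGA quasi_iso C p' D"
    and fg: "f \<in> quasi_iso A C" "g \<in> quasi_iso B D"
    and e: "word_eq CDGA quasi_iso A C (p @ q) [Fwd A f C]" "word_eq CDGA quasi_iso B D (q @ p') [Fwd B g D]"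
  shows "coh_bijective p A B"
proof -
  have B: "cdga B" using homotopy_functor.word_objects[OF homotopy_functor_cocycles w(2)] by blast
  have refl: "cohomologous B n z z" if "z \<in> cocycles B n" for n z
    by (rule cdga.cohomologous_refl[OF B cdga.cocyclesD(1)[OF B that]])
  show ?thesis unfolding coh_bijective_def
  proof (intro conjI allI ballI impI)
    fix n z assume "z \<in> cocycles B n"
    thus "\<exists>y. coh_rel n p A y z" by (rule homotopy_functor.word_surjective[OF homotopy_functor_cocycles w fg e])
  next
    fix n y y' z assume y: "coh_rel n p A y z" "coh_rel n p A y' z"
    hence "z \<in> cocycles B n" using homotopy_functor.word_mem[OF homotopy_functor_cocycles w(1)] by blast
    thus "cohomologous A n y y'"
      by (intro homotopy_functor.word_injective[OF homotopy_functor_cocycles w(1,2) fg(1) e(1) y] refl)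
  qed
qed

text \<open>
  An element \<open>x \<noteq> 0\<close> of a rational vector space has infinitely many multiples, so over a finite
  universe all algebras vanish and all functors are weakly equivalent.
\<close>

lemma finite_universe_elts:
  assumes fin: "finite (UNIV :: 'u set)" and A: "cdga (A :: 'u cdga)" shows "elts A n = {\<zero>\<^bsub>gr A n\<^esub>}"
proof -
  interpret cdga A by fact
  have "x = \<zero>\<^bsub>gr A n\<^esub>" if x: "x \<in> elts A n" for x
  proof (rule ccontr)
    assume nz: "x \<noteq> \<zero>\<^bsub>gr A n\<^esub>"
    have "inj (\<lambda>c :: rat. c \<odot>\<^bsub>gr A n\<^esub> x)"
    proof (rule injI)
      fix c d :: rat assume "c \<odot>\<^bsub>gr A n\<^esub> x = d \<odot>\<^bsub>gr A n\<^esub> x"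
      hence "(c - d) \<odot>\<^bsub>gr A n\<^esub> x = (d + - d) \<odot>\<^bsub>gr A n\<^esub> x"
        using smult_add_left[OF x, of c "- d"] smult_add_left[OF x, of d "- d"] by simp
      hence "(c - d) \<odot>\<^bsub>gr A n\<^esub> x = \<zero>\<^bsub>gr A n\<^esub>" using x by simp
      thus "c = d" using smult_eq_zero[OF x, of "c - d"] nz by auto
    qed
    hence "finite (UNIV :: rat set)" using fin by (meson finite_imageD finite_subset subset_UNIV)
    thus False using infinite_UNIV_char_0 by blast
  qed
  thus ?thesis by auto
qed

lemma finite_universe_weakly_equivalent:
  fixes F G :: "'u pers_cdga"
  assumes fin: "finite (UNIV :: 'u set)" and F: "F \<in> Obj (et CDGA)" and G: "G \<in> Obj (et CDGA)"
  shows "weakly_equivalent (et CDGA) weq F G"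
proof -
  note e = finite_universe_elts[OF fin]
  define z where "z A B = (\<lambda>n. \<lambda>x\<in>elts A n. \<zero>\<^bsub>gr B n\<^esub>)" for A B :: "'u cdga"
  have z: "z A B \<in> cdga_hom A B" if A: "cdga A" and B: "cdga B" for A B
  proof -
    interpret A: cdga A by fact
    interpret B: cdga B by fact
    have m: "y = \<zero>\<^bsub>gr B n\<^esub>" if "y \<in> elts B n" for y n using that e[OF B] by simp
    have "gone B = \<zero>\<^bsub>gr B 0\<^esub>" by (rule m[OF B.one_closed])
    moreover have "gmult B p q \<zero>\<^bsub>gr B p\<^esub> \<zero>\<^bsub>gr B q\<^esub> = \<zero>\<^bsub>gr B (p + q)\<^esub>" for p q by simp
    ultimately show ?thesis by (auto simp: cdga_hom_iff dga_map_def z_def A.one_closed)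
  qed
  have q: "z A B \<in> quasi_iso A B" if A: "cdga A" and B: "cdga B" for A B
  proof -
    have "weak_equivalence A B (z A B)"
      by (rule bijective_weak_equivalence[OF A B cdga_hom_dga_map[OF z[OF A B]] cdga_hom_dga_map[OF z[OF B A]]])
        (simp_all add: z_def e[OF A] e[OF B])
    thus ?thesis using z[OF A B] by (simp add: quasi_iso_iff A B)
  qed
  have uniq: "f = g" if "cdga B" "f \<in> cdga_hom A B" "g \<in> cdga_hom A B" for f g and A B :: "'u cdga"
    using dga_mapD(1)[OF cdga_hom_dga_map[OF that(2)]] dga_mapD(1)[OF cdga_hom_dga_map[OF that(3)]]
    by (intro cdga_hom_eqI[OF that(2,3)]) (simp add: e[OF that(1)])
  have fF: "is_functor CDGA F" and fG: "is_functor CDGA G" using F G by (simp_all add: et_simps)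
  note f = is_functorD[OF fF] and g = is_functorD[OF fG]
  have "Comp CDGA (ob F s) (ob F t) (ob G t) (z (ob F t) (ob G t)) (str F s t) =
    Comp CDGA (ob F s) (ob G s) (ob G t) (str G s t) (z (ob F s) (ob G s))" if "0 \<le> s" "s \<le> t" for s t
  proof (rule uniq[of "ob G t" _ "ob F s"])
    have t: "0 \<le> t" using that by simp
    show "cdga (ob G t)" by (rule g(1)[OF t])
    show "Comp CDGA (ob F s) (ob F t) (ob G t) (z (ob F t) (ob G t)) (str F s t) \<in> cdga_hom (ob F s) (ob G t)"
      using that t by (intro cdga_hom_Comp[OF f(1) f(1) f(2) z[OF f(1) g(1)]])
    show "Comp CDGA (ob F s) (ob G s) (ob G t) (str G s t) (z (ob F s) (ob G s)) \<in> cdga_hom (ob F s) (ob G t)"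
      using that t by (intro cdga_hom_Comp[OF f(1) g(1) z[OF f(1) g(1)] g(2)])
  qed
  hence "(\<lambda>t\<in>{0..}. z (ob F t) (ob G t)) \<in> weq F G"
    using z q f(1) g(1) by (simp add: weq_def et_simps nat_transf_def del: CDGA_simps(3,4))
  thus ?thesis by (rule weakly_equivalentI[OF F G])
qed

text \<open>
  As \<open>3 * \<epsilon> < \<beta>\<close>, the points \<open>\<sigma> n, \<sigma> n + \<epsilon>, \<sigma> n + 2 \<epsilon>, \<sigma> n + 3 \<epsilon>\<close> lie in the same cell, where the structure
  maps of \<open>F\<close> and \<open>G\<close> are isomorphisms. Two out of six shows that the zigzag \<open>F (\<sigma> n) \<rightarrow> G (\<sigma> n + \<epsilon>)\<close> is bijective
  on cohomology, so the sequences \<open>F (\<sigma> n)\<close> and \<open>G (\<sigma> n + \<epsilon>)\<close> receive compatible quasi-isomorphisms from one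
  strict sequence \<open>Q\<close>.
\<close>

theorem (in grid) homotopy_comm_interleaved_imp_weakly_equivalent:
  fixes F G :: "'u pers_cdga"
  assumes F: "F \<in> Obj (et CDGA)" "discretises CDGA \<sigma> \<infinity> F" and G: "G \<in> Obj (et CDGA)" "discretises CDGA \<sigma> \<infinity> G"
    and \<epsilon>: "0 \<le> \<epsilon>" "3 * \<epsilon> < \<beta>" and int: "homotopy_comm_interleaved \<epsilon> F G"
  shows "weakly_equivalent (et CDGA) weq F G"
proof (cases "finite (UNIV :: 'u set)")
  case True
  thus ?thesis by (rule finite_universe_weakly_equivalent[OF _ F(1) G(1)])
next
  case False
  have fF: "is_functor CDGA F" and fG: "is_functor CDGA G" using F G by (simp_all add: et_simps)
  note f = is_functorD[OF fF] and g = is_functorD[OF fG]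
  obtain u v where u: "\<And>t. 0 \<le> t \<Longrightarrow> CDGA.word (ob F t) (u t) (ob G (t + \<epsilon>))"
    and v: "\<And>t. 0 \<le> t \<Longrightarrow> CDGA.word (ob G t) (v t) (ob F (t + \<epsilon>))"
    and uv: "\<And>t. 0 \<le> t \<Longrightarrow> CDGA.weql (ob F t) (ob F (t + 2 * \<epsilon>)) (u t @ v (t + \<epsilon>)) [Fwd (ob F t) (str F t (t + 2 * \<epsilon>)) (ob F (t + 2 * \<epsilon>))]"
    and vu: "\<And>t. 0 \<le> t \<Longrightarrow> CDGA.weql (ob G t) (ob G (t + 2 * \<epsilon>)) (v t @ u (t + \<epsilon>)) [Fwd (ob G t) (str G t (t + 2 * \<epsilon>)) (ob G (t + 2 * \<epsilon>))]"
    and nat: "\<And>s t. 0 \<le> s \<Longrightarrow> s \<le> t \<Longrightarrow> CDGA.weql (ob F s) (ob G (t + \<epsilon>)) ([Fwd (ob F s) (str F s t) (ob F t)] @ u t)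
      (u s @ [Fwd (ob G (s + \<epsilon>)) (str G (s + \<epsilon>) (t + \<epsilon>)) (ob G (t + \<epsilon>))])"
    using homotopy_comm_interleaved_words[OF fF fG \<epsilon>(1) int] by blast
  have near: "cell (\<sigma> n + \<delta>) = n" if "0 \<le> \<delta>" "\<delta> \<le> 3 * \<epsilon>" for n \<delta>
    by (rule cell_eqI) (use that gap[of n] \<epsilon> in linarith)+
  have pos: "0 \<le> \<sigma> n + \<delta>" if "0 \<le> \<delta>" for n \<delta> using that nonneg[of n] by simp
  have bij: "coh_bijective (u (\<sigma> n)) (ob F (\<sigma> n)) (ob G (\<sigma> n + \<epsilon>))" for n
  proof (rule coh_bijective_two_of_six)
    have e: "\<sigma> n + \<epsilon> + \<epsilon> = \<sigma> n + 2 * \<epsilon>" "\<sigma> n + 2 * \<epsilon> + \<epsilon> = \<sigma> n + 3 * \<epsilon>" "\<sigma> n + \<epsilon> + 2 * \<epsilon> = \<sigma> n + 3 * \<epsilon>" by simp_all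
    show "CDGA.word (ob F (\<sigma> n)) (u (\<sigma> n)) (ob G (\<sigma> n + \<epsilon>))" by (rule u[OF nonneg])
    show "CDGA.word (ob G (\<sigma> n + \<epsilon>)) (v (\<sigma> n + \<epsilon>)) (ob F (\<sigma> n + 2 * \<epsilon>))" using v[of "\<sigma> n + \<epsilon>"] pos[of \<epsilon> n] \<epsilon> e by simp
    show "CDGA.word (ob F (\<sigma> n + 2 * \<epsilon>)) (u (\<sigma> n + 2 * \<epsilon>)) (ob G (\<sigma> n + 3 * \<epsilon>))" using u[of "\<sigma> n + 2 * \<epsilon>"] pos[of "2 * \<epsilon>" n] \<epsilon> e by simp
    show "CDGA.weql (ob F (\<sigma> n)) (ob F (\<sigma> n + 2 * \<epsilon>)) (u (\<sigma> n) @ v (\<sigma> n + \<epsilon>)) [Fwd (ob F (\<sigma> n)) (str F (\<sigma> n) (\<sigma> n + 2 * \<epsilon>)) (ob F (\<sigma> n + 2 * \<epsilon>))]"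
      by (rule uv[OF nonneg])
    show "CDGA.weql (ob G (\<sigma> n + \<epsilon>)) (ob G (\<sigma> n + 3 * \<epsilon>)) (v (\<sigma> n + \<epsilon>) @ u (\<sigma> n + 2 * \<epsilon>))
        [Fwd (ob G (\<sigma> n + \<epsilon>)) (str G (\<sigma> n + \<epsilon>) (\<sigma> n + 3 * \<epsilon>)) (ob G (\<sigma> n + 3 * \<epsilon>))]"
      using vu[OF pos[OF \<epsilon>(1), of n]] unfolding e .
    have "is_iso CDGA (ob F (\<sigma> n)) (ob F (\<sigma> n + 2 * \<epsilon>)) (str F (\<sigma> n) (\<sigma> n + 2 * \<epsilon>))"
      using F(2) nonneg[of n] \<epsilon> near[of "2 * \<epsilon>" n] unfolding discretises_iff by (simp add: cell_grid)
    thus "str F (\<sigma> n) (\<sigma> n + 2 * \<epsilon>) \<in> quasi_iso (ob F (\<sigma> n)) (ob F (\<sigma> n + 2 * \<epsilon>))"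
      using f(1) nonneg pos \<epsilon> by (intro iso_quasi_iso) auto
    have "is_iso CDGA (ob G (\<sigma> n + \<epsilon>)) (ob G (\<sigma> n + 3 * \<epsilon>)) (str G (\<sigma> n + \<epsilon>) (\<sigma> n + 3 * \<epsilon>))"
      using G(2) pos[of \<epsilon> n] \<epsilon> near[of \<epsilon> n] near[of "3 * \<epsilon>" n] unfolding discretises_iff by simp
    thus "str G (\<sigma> n + \<epsilon>) (\<sigma> n + 3 * \<epsilon>) \<in> quasi_iso (ob G (\<sigma> n + \<epsilon>)) (ob G (\<sigma> n + 3 * \<epsilon>))"
      using g(1) pos \<epsilon> by (intro iso_quasi_iso) auto
  qed
  \<comment> \<open>The grid only meets \<open>G\<close> at the points \<open>\<sigma> n + \<epsilon>\<close>. The functor \<open>K = G \<circ> m\<close> is weakly equivalent to \<open>G\<close> and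
    has the value \<open>G (\<sigma> n + \<epsilon>)\<close> at \<open>\<sigma> n\<close>.\<close>
  define m where "m t = max t (\<sigma> (cell t) + \<epsilon>)" for t
  define K where "K = \<lparr> ob = (\<lambda>t. ob G (m t)), str = (\<lambda>s t. str G (m s) (m t)) \<rparr>"
  have m: "m s \<le> m t" if "0 \<le> s" "s \<le> t" for s t
    using that mono[OF cell_mono[OF that]] unfolding m_def by auto
  have m_cell: "cell (m t) = cell t" if "0 \<le> t" for t
    by (rule cell_eqI) (use cell_bounds[OF that] gap[of "cell t"] \<epsilon> in \<open>auto simp: m_def\<close>)
  have m_grid: "m (\<sigma> n) = \<sigma> n + \<epsilon>" for n using \<epsilon>(1) by (simp add: m_def cell_grid)
  note K = reparametrisation_weq[OF fG G(2) m _ m_cell, folded K_def]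
  have tm: "t \<le> m t" for t by (simp add: m_def)
  have K': "ob K (\<sigma> n) = ob G (\<sigma> n + \<epsilon>)" "str K (\<sigma> n) (\<sigma> (Suc n)) = str G (\<sigma> n + \<epsilon>) (\<sigma> (Suc n) + \<epsilon>)" for n
    by (simp_all add: K_def m_grid)
  have "\<exists>(Q :: nat \<Rightarrow> 'u cdga) i q h. (\<forall>n. cdga (Q n)) \<and> (\<forall>n. dga_map (Q n) (Q (Suc n)) (i n)) \<and>
    (\<forall>n. weak_equivalence (Q n) (ob F (\<sigma> n)) (q n)) \<and> (\<forall>n. weak_equivalence (Q n) (ob G (\<sigma> n + \<epsilon>)) (h n)) \<and>
    (\<forall>n k. \<forall>x\<in>elts (Q n) k. q (Suc n) k (i n k x) = str F (\<sigma> n) (\<sigma> (Suc n)) k (q n k x) \<and>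
      h (Suc n) k (i n k x) = str G (\<sigma> n + \<epsilon>) (\<sigma> (Suc n) + \<epsilon>) k (h n k x))"
    using False f(1,2) g(1,2) u nat bij nonneg mono \<epsilon>(1)
    by (intro sequence_strictification[where \<theta> = "\<lambda>n. u (\<sigma> n)"]) auto
  then obtain Q :: "nat \<Rightarrow> 'u cdga" and i q h where Q: "\<And>n. cdga (Q n)" and im: "\<And>n. dga_map (Q n) (Q (Suc n)) (i n)"
    and q: "\<And>n. weak_equivalence (Q n) (ob F (\<sigma> n)) (q n)" and h: "\<And>n. weak_equivalence (Q n) (ob G (\<sigma> n + \<epsilon>)) (h n)"
    and sq: "\<And>n k x. x \<in> elts (Q n) k \<Longrightarrow> q (Suc n) k (i n k x) = str F (\<sigma> n) (\<sigma> (Suc n)) k (q n k x)"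
      "\<And>n k x. x \<in> elts (Q n) k \<Longrightarrow> h (Suc n) k (i n k x) = str G (\<sigma> n + \<epsilon>) (\<sigma> (Suc n) + \<epsilon>) k (h n k x)" by blast
  define r where "r f = (\<lambda>n k. \<lambda>x\<in>elts (Q n) k. f n k x)" for f :: "nat \<Rightarrow> 'u cdga_map"
  have r: "r f n k x = f n k x" if "x \<in> elts (Q n) k" for f n k x using that by (simp add: r_def)
  have r_hom: "r f n \<in> cdga_hom (Q n) B" if "dga_map (Q n) B (f n)" for f n B
    using dga_map_cong[OF Q that, of "r f n"] by (simp add: cdga_hom_iff r_def)
  have r_weq: "r f n \<in> quasi_iso (Q n) B" if "weak_equivalence (Q n) B (f n)" "cdga B" for f n B
    using weak_equivalence_cong[OF Q that(1), of "r f n"] r_hom[where f = f, OF weak_equivalence_dga_map[OF that(1)]]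
    by (simp add: quasi_iso_iff[OF Q that(2)] r_def)
  interpret cdga_step_functor \<sigma> \<beta> Q "r i" 
    by (intro cdga_step_functor.intro grid_axioms cdga_sequence.intro Q r_hom[where f = i, OF im])
  have sq': "Comp CDGA (Q n) (Q (Suc n)) Y (r p (Suc n)) (r i n) = Comp CDGA (Q n) X Y a (r p n)"
    if "\<And>k x. x \<in> elts (Q n) k \<Longrightarrow> p (Suc n) k (i n k x) = a k (p n k x)" for n p X Y a
    using that dga_mapD(1)[OF im] by (auto simp: compose_def r intro!: ext restrict_ext)
  have "weakly_equivalent (et CDGA) weq step_functor F"
    by (rule step_functor_weq[OF F, where r = "r q"]) (rule r_weq[where f = q, OF q f(1)[OF nonneg]] sq'[where p = q, OF sq(1)]; assumption)+
  moreover have "weakly_equivalent (et CDGA) weq step_functor K"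
    by (rule step_functor_weq[OF K(2,1), where r = "r h"])
      (use r_weq[where f = h, OF h] g(1) nonneg \<epsilon>(1) sq'[where p = h, OF sq(2)] tm in \<open>simp_all add: K' del: CDGA_simps(3,4)\<close>)
  moreover have "weakly_equivalent (et CDGA) weq G K" using K(3) tm by blast
  ultimately show ?thesis by (blast intro: weakly_equivalent_sym weakly_equivalent_trans)
qed

lemma formal_HC_imp_H_formal:
  assumes F: "F \<in> Obj (et CDGA)" and d: "discretises CDGA \<tau> N F" and \<alpha>: "0 < \<alpha>"
    and gap: "\<And>n. enat (Suc n) < N \<Longrightarrow> \<alpha> \<le> \<tau> (Suc n) - \<tau> n" and f: "formal_wrt d_HC F"
  shows "H_formal F"
proof -
  obtain \<sigma> \<beta> where \<sigma>: "grid \<sigma> \<beta>" and dF: "discretises CDGA \<sigma> \<infinity> F" using grid_exists[OF d \<alpha> gap] by blast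
  have fF: "is_functor CDGA F" using F by (simp add: et_simps)
  have "Inf (ereal ` {\<epsilon>. 0 \<le> \<epsilon> \<and> homotopy_comm_interleaved \<epsilon> F (H F)}) < ereal (\<beta> / 3)"
    using f grid.gap_pos[OF \<sigma>] unfolding formal_wrt_def d_HC_def by simp
  then obtain \<epsilon> where "0 \<le> \<epsilon>" "\<epsilon> < \<beta> / 3" "homotopy_comm_interleaved \<epsilon> F (H F)" unfolding Inf_less_iff by auto
  thus ?thesis unfolding H_formal_def
    by (intro grid.homotopy_comm_interleaved_imp_weakly_equivalent[OF \<sigma> F dF H_et[OF F] discretises_H[OF fF dF]]) auto
qed

theorem proposition7p5:
  fixes F :: "'u pers_cdga"
  assumes "F \<in> Obj (et CDGA)"
  shows "((H_formal F \<longrightarrow> formal_wrt d_HI F) \<and>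
          (formal_wrt d_HI F \<longrightarrow> formal_wrt d_IHC F) \<and>
          (formal_wrt d_IHC F \<longrightarrow> formal_wrt d_HC F)) \<and>
         (\<forall>\<tau> N \<alpha>. discretises CDGA \<tau> N F \<and> 0 < \<alpha> \<and>
             (\<forall>n. enat (Suc n) < N \<longrightarrow> \<alpha> \<le> \<tau> (Suc n) - \<tau> n) \<longrightarrow>
           (formal_wrt d_HC F \<longrightarrow> formal_wrt d_IHC F) \<and>
           (formal_wrt d_IHC F \<longrightarrow> H_formal F))"
  using H_formal_imp_HI formal_HI_imp_IHC formal_IHC_imp_HC[OF assms] formal_HC_imp_H_formal[OF assms] by blast

end
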